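(* Let $E$ be a reflexive Banach space and let $K\subset H^{1}(\mu,E)$. The following are equivalent. (1) $K$ is relatively weakly compact in $H^{1}(\mu,E)$. (2) $K^{\ast}$ is uniformly integrable.
   Context: Stochastic basis: $(X,\mathscr{F},\mu)$ is a complete probability space with a filtration $\{\mathscr{F}_{t}:t\geq0\}$ of sub-$\sigma$-algebras of $\mathscr{F}$ such that $\mathscr{F}_{0}$ is the $\sigma$-algebra generated by the $\mu$-null sets and $\mathscr{F}_{t}=\bigcap_{s>t}\mathscr{F}_{s}$ for all $t\geq0$. All processes are indexed by $[0,\infty)$ and identified when they agree outside an evanescent set, i.e. a set $A\subset[0,\infty)\times X$ whose projection onto $X$ is $\mu$-null. Banach spaces are real. For an $E$-valued process $M$, $M^{\ast}_{t}=\sup_{s\leq t}\Vert M_{s}\Vert_{E}$ and $M^{\ast}_{\infty}=\sup_{t>0}M^{\ast}_{t}$. $H^{1}(\mu,E)$ is the Banach space of càdlàg $E$-valued martingales $M$ such that $M^{\ast}_{\infty}\in L^{1}(\mu)$ and such that there is a terminal value $M_{\infty}\in L^{1}(\mu,E)$ (Bochner space) with $M_{t}=\mathbb{E}[M_{\infty}\mid\mathscr{F}_{t}]$ for all $t\in[0,\infty)$; its norm is $M\mapsto\Vert M^{\ast}_{\infty}\Vert_{L^{1}}$. For $K\subset H^{1}(\mu,E)$, $K^{\ast}=\{M^{\ast}_{\infty}:M\in K\}\subset L^{1}(\mu)$. A subset of $L^{1}(\mu)$ is uniformly integrable if it is $L^{1}$-bounded and for each $\varepsilon>0$ there is $\delta>0$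 such that $\int_{A}|\xi|\,d\mu\leq\varepsilon$ for all $\xi$ in the subset and all $A\in\mathscr{F}$ with $\mu(A)\leq\delta$. *)

theory Defs
  imports "HOL-Probability.Probability"
begin

section \<open>Reflexive Banach spaces\<close>

definition bidual_embedding ::
    "'e::real_normed_vector \<Rightarrow> (('e \<Rightarrow>\<^sub>L real) \<Rightarrow>\<^sub>L real)" where
  "bidual_embedding x = Blinfun (\<lambda>\<phi>. blinfun_apply \<phi> x)"

lemma blinfun_apply_bidual_embedding:
  "blinfun_apply (bidual_embedding x) \<phi> = blinfun_apply \<phi> x"
  unfolding bidual_embedding_def
  by (simp add: bounded_linear_Blinfun_apply blinfun.bounded_linear_left)

definition reflexive_space :: "'e::real_normed_vector itself \<Rightarrow> bool" where
  "reflexive_space _ \<longleftrightarrow> surj (bidual_embedding :: 'e \<Rightarrow> _)"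


section \<open>The Bochner integral without separability of the range space\<close>

text \<open>
  The library integral \<open>has_bochner_integral\<close> is restricted to second countable (separable)
  range spaces. The definitions below drop this restriction by replacing Borel measurability by
  strong measurability; the two notions agree on separable spaces, see
  \<open>has_Bochner_integral_iff_library\<close>.
\<close>

definition strongly_measurable ::
    "'x measure \<Rightarrow> ('x \<Rightarrow> 'e::real_normed_vector) \<Rightarrow> bool" where
  "strongly_measurable M f \<longleftrightarrow>
     (\<exists>s. (\<forall>i::nat. simple_function M (s i)) \<and> (\<forall>x\<in>space M. (\<lambda>i. s i x) \<longlonglongrightarrow> f x))"

definition has_Bochner_integral ::
    "'x measure \<Rightarrow> ('x \<Rightarrow> 'e::real_normed_vector) \<Rightarrow> 'e \<Rightarrow> bool" where
  "has_Bochner_integral M f v \<longleftrightarrow>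
     strongly_measurable M f \<and>
     (\<exists>s. (\<forall>i::nat. Bochner_Integration.simple_bochner_integrable M (s i)) \<and>
          (\<lambda>i. \<integral>\<^sup>+x. norm (f x - s i x) \<partial>M) \<longlonglongrightarrow> 0 \<and>
          (\<lambda>i. Bochner_Integration.simple_bochner_integral M (s i)) \<longlonglongrightarrow> v)"

definition Bochner_integrable ::
    "'x measure \<Rightarrow> ('x \<Rightarrow> 'e::real_normed_vector) \<Rightarrow> bool" where
  "Bochner_integrable M f \<longleftrightarrow> (\<exists>v. has_Bochner_integral M f v)"

lemma strongly_measurable_imp_borel_measurable:
  assumes "strongly_measurable M f"
  shows "f \<in> borel_measurable M"
  using assms unfolding strongly_measurable_def
  by (metis borel_measurable_LIMSEQ_metric borel_measurable_simple_function)

lemma strongly_measurable_iff_borel_measurable: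
  fixes f :: "'x \<Rightarrow> 'e::{real_normed_vector, second_countable_topology}"
  shows "strongly_measurable M f \<longleftrightarrow> f \<in> borel_measurable M"
  using strongly_measurable_imp_borel_measurable borel_measurable_implies_sequence_metric[of f M 0]
  unfolding strongly_measurable_def by blast

lemma has_Bochner_integral_iff_library:
  fixes f :: "'x \<Rightarrow> 'e::{real_normed_vector, second_countable_topology}"
  shows "has_Bochner_integral M f v \<longleftrightarrow> has_bochner_integral M f v"
  unfolding has_Bochner_integral_def strongly_measurable_iff_borel_measurable
    has_bochner_integral.simps by blast

lemma has_Bochner_integral_unique:
  assumes "has_Bochner_integral M f v" "has_Bochner_integral M f w"
  shows "v = w"
proof -
  obtain s where s: "\<And>i::nat. Bochner_Integration.simple_bochner_integrable M (s i)"
      "(\<lambda>i. \<integral>\<^sup>+x. norm (f x - s i x) \<partial>M) \<longlonglongrightarrow> 0"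
      "(\<lambda>i. Bochner_Integration.simple_bochner_integral M (s i)) \<longlonglongrightarrow> v"
    using assms(1) unfolding has_Bochner_integral_def by blast
  obtain t where t: "\<And>i::nat. Bochner_Integration.simple_bochner_integrable M (t i)"
      "(\<lambda>i. \<integral>\<^sup>+x. norm (f x - t i x) \<partial>M) \<longlonglongrightarrow> 0"
      "(\<lambda>i. Bochner_Integration.simple_bochner_integral M (t i)) \<longlonglongrightarrow> w"
    using assms(2) unfolding has_Bochner_integral_def by blast
  obtain a where a: "\<And>i::nat. simple_function M (a i)" "\<And>x. x \<in> space M \<Longrightarrow> (\<lambda>i. a i x) \<longlonglongrightarrow> f x"
    using assms(1) unfolding has_Bochner_integral_def strongly_measurable_def by blast
  have meas: "(\<lambda>x. norm (f x - u x)) \<in> borel_measurable M" if u: "simple_function M u" for u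
  proof (rule borel_measurable_LIMSEQ_real)
    show "(\<lambda>i. norm (a i x - u x)) \<longlonglongrightarrow> norm (f x - u x)" if "x \<in> space M" for x
      by (intro tendsto_intros a that)
    show "(\<lambda>x. norm (a i x - u x)) \<in> borel_measurable M" for i
      by (intro borel_measurable_simple_function simple_function_compose2[OF a(1) u])
  qed
  have bound: "ennreal (norm (Bochner_Integration.simple_bochner_integral M (s i) - Bochner_Integration.simple_bochner_integral M (t i)))
      \<le> (\<integral>\<^sup>+x. norm (f x - s i x) \<partial>M) + (\<integral>\<^sup>+x. norm (f x - t i x) \<partial>M)" for i
  proof -
    have sf: "simple_function M (s i)" "simple_function M (t i)"
      using s(1)[of i] t(1)[of i] by (auto elim: simple_bochner_integrable.cases)
    have st: "Bochner_Integration.simple_bochner_integrable M (\<lambda>x. s i x - t i x)"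
      by (intro simple_bochner_integrable_compose2[where p="(-)"] s t) simp
    have "norm (Bochner_Integration.simple_bochner_integral M (s i) - Bochner_Integration.simple_bochner_integral M (t i))
        \<le> Bochner_Integration.simple_bochner_integral M (\<lambda>x. norm (s i x - t i x))"
      using simple_bochner_integral_norm_bound[OF st] simple_bochner_integral_diff[OF s(1) t(1)]
      by simp
    also have "ennreal (Bochner_Integration.simple_bochner_integral M (\<lambda>x. norm (s i x - t i x)))
        = (\<integral>\<^sup>+x. norm (s i x - t i x) \<partial>M)"
      by (intro simple_bochner_integral_eq_nn_integral
            simple_bochner_integrable_compose2[where p="\<lambda>x y. norm (x - y)"] s t) auto
    also have "\<dots> \<le> (\<integral>\<^sup>+x. ennreal (norm (f x - s i x)) + ennreal (norm (f x - t i x)) \<partial>M)"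
      by (intro nn_integral_mono, simp flip: ennreal_plus)
         (metis add.commute dist_commute dist_norm dist_triangle)
    also have "\<dots> = (\<integral>\<^sup>+x. norm (f x - s i x) \<partial>M) + (\<integral>\<^sup>+x. norm (f x - t i x) \<partial>M)"
      using meas sf by (intro nn_integral_add) auto
    finally show ?thesis by (simp add: ennreal_leI)
  qed
  have "(\<lambda>i. ennreal (norm (Bochner_Integration.simple_bochner_integral M (s i) - Bochner_Integration.simple_bochner_integral M (t i))))
      \<longlonglongrightarrow> 0"
    by (rule tendsto_sandwich[OF _ _ tendsto_const])
       (use bound tendsto_add[OF s(2) t(2)] in auto)
  moreover have "(\<lambda>i. ennreal (norm (Bochner_Integration.simple_bochner_integral M (s i) - Bochner_Integration.simple_bochner_integral M (t i))))
      \<longlonglongrightarrow> ennreal (norm (v - w))"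
    by (intro tendsto_intros s t)
  ultimately have "ennreal (norm (v - w)) = 0"
    using LIMSEQ_unique by blast
  then show ?thesis by simp
qed

definition is_cond_exp ::
    "'x measure \<Rightarrow> 'x measure \<Rightarrow> ('x \<Rightarrow> 'e::real_normed_vector) \<Rightarrow> ('x \<Rightarrow> 'e) \<Rightarrow> bool" where
  \<comment> \<open>\<open>g\<close> is a version of the conditional expectation of \<open>f\<close> given \<open>sets G\<close>\<close>
  "is_cond_exp M G f g \<longleftrightarrow>
     Bochner_integrable M f \<and> Bochner_integrable M g \<and> strongly_measurable G g \<and>
     (\<forall>A\<in>sets G. \<exists>v. has_Bochner_integral M (\<lambda>x. indicator A x *\<^sub>R f x) v \<and>
                     has_Bochner_integral M (\<lambda>x. indicator A x *\<^sub>R g x) v)"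


section \<open>Stochastic basis, processes and martingales\<close>

text \<open>
  The filtration is a family of measures of which only the \<open>\<sigma>\<close>-algebras matter. Time is
  \<open>[0,\<infinity>)\<close>; nothing is required of, and nothing depends on, negative indices.
\<close>

locale stochastic_basis = prob_space M + complete_measure M
  for M :: "'x measure" +
  fixes F :: "real \<Rightarrow> 'x measure"
  assumes subalgebra_F: "0 \<le> t \<Longrightarrow> subalgebra M (F t)"
    and F_mono: "0 \<le> s \<Longrightarrow> s \<le> t \<Longrightarrow> sets (F s) \<subseteq> sets (F t)"
    and F_zero: "sets (F 0) = sigma_sets (space M) (null_sets M)"
    and F_right_continuous: "0 \<le> t \<Longrightarrow> sets (F t) = (\<Inter>s\<in>{t<..}. sets (F s))"

type_synonym ('x, 'e) process = "real \<Rightarrow> 'x \<Rightarrow> 'e"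

definition evanescent :: "'x measure \<Rightarrow> (real \<times> 'x) set \<Rightarrow> bool" where
  "evanescent M A \<longleftrightarrow> A \<subseteq> {0..} \<times> space M \<and> snd ` A \<in> null_sets M"

definition indistinguishable ::
    "'x measure \<Rightarrow> ('x, 'e) process \<Rightarrow> ('x, 'e) process \<Rightarrow> bool" where
  "indistinguishable M Y Z \<longleftrightarrow> evanescent M {(t, x). 0 \<le> t \<and> x \<in> space M \<and> Y t x \<noteq> Z t x}"

definition cadlag :: "'x measure \<Rightarrow> ('x, 'e::real_normed_vector) process \<Rightarrow> bool" where
  "cadlag M Y \<longleftrightarrow>
     (\<forall>x\<in>space M. (\<forall>t\<ge>0. ((\<lambda>s. Y s x) \<longlongrightarrow> Y t x) (at_right t)) \<and>
                  (\<forall>t>0. \<exists>l. ((\<lambda>s. Y s x) \<longlongrightarrow> l) (at_left t)))"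

definition martingale ::
    "'x measure \<Rightarrow> (real \<Rightarrow> 'x measure) \<Rightarrow> ('x, 'e::real_normed_vector) process \<Rightarrow> bool" where
  "martingale M F Y \<longleftrightarrow>
     (\<forall>t\<ge>0. strongly_measurable (F t) (Y t) \<and> Bochner_integrable M (Y t)) \<and>
     (\<forall>s\<ge>0. \<forall>t\<ge>s. is_cond_exp M (F s) (Y t) (Y s))"

definition running_sup :: "('x, 'e::real_normed_vector) process \<Rightarrow> real \<Rightarrow> 'x \<Rightarrow> ennreal" where
  "running_sup Y t x = (SUP s\<in>{0..t}. ennreal (norm (Y s x)))"

definition maximal_function :: "('x, 'e::real_normed_vector) process \<Rightarrow> 'x \<Rightarrow> ennreal" where
  "maximal_function Y x = (SUP t\<in>{0<..}. running_sup Y t x)"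


section \<open>The Banach space of martingales with integrable maximal function\<close>

definition H1_processes ::
    "'x measure \<Rightarrow> (real \<Rightarrow> 'x measure) \<Rightarrow> ('x, 'e::real_normed_vector) process set" where
  "H1_processes M F =
     {Y. cadlag M Y \<and> martingale M F Y \<and>
         maximal_function Y \<in> borel_measurable M \<and> (\<integral>\<^sup>+x. maximal_function Y x \<partial>M) < \<infinity> \<and>
         (\<exists>Y_inf. Bochner_integrable M Y_inf \<and> (\<forall>t\<ge>0. is_cond_exp M (F t) Y_inf (Y t)))}"

definition H1_rel ::
    "'x measure \<Rightarrow> (real \<Rightarrow> 'x measure) \<Rightarrow> ('x, 'e::real_normed_vector) process rel" where
  "H1_rel M F = {(Y, Z). Y \<in> H1_processes M F \<and> Z \<in> H1_processes M F \<and> indistinguishable M Y Z}"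

definition H1 ::
    "'x measure \<Rightarrow> (real \<Rightarrow> 'x measure) \<Rightarrow> ('x, 'e::real_normed_vector) process set set" where
  "H1 M F = H1_processes M F // H1_rel M F"

definition H1_add ::
    "'x measure \<Rightarrow> (real \<Rightarrow> 'x measure) \<Rightarrow> ('x, 'e::real_normed_vector) process set \<Rightarrow>
     ('x, 'e) process set \<Rightarrow> ('x, 'e) process set" where
  "H1_add M F C D = (\<Union>Y\<in>C. \<Union>Z\<in>D. H1_rel M F `` {\<lambda>t x. Y t x + Z t x})"

definition H1_scale ::
    "'x measure \<Rightarrow> (real \<Rightarrow> 'x measure) \<Rightarrow> real \<Rightarrow> ('x, 'e::real_normed_vector) process set \<Rightarrow>
     ('x, 'e) process set" where
  "H1_scale M F c C = (\<Union>Y\<in>C. H1_rel M F `` {\<lambda>t x. c *\<^sub>R Y t x})"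

definition H1_norm :: "'x measure \<Rightarrow> ('x, 'e::real_normed_vector) process set \<Rightarrow> real" where
  \<comment> \<open>the common value over all representatives, see \<open>H1_norm_class\<close>\<close>
  "H1_norm M C = the_elem ((\<lambda>Y. enn2real (\<integral>\<^sup>+x. maximal_function Y x \<partial>M)) ` C)"

lemma indistinguishable_iff:
  "indistinguishable M Y Z \<longleftrightarrow> {x \<in> space M. \<exists>t\<ge>0. Y t x \<noteq> Z t x} \<in> null_sets M"
proof -
  have "snd ` {(t, x). 0 \<le> t \<and> x \<in> space M \<and> Y t x \<noteq> Z t x} = {x \<in> space M. \<exists>t\<ge>0. Y t x \<noteq> Z t x}"
    by force
  then show ?thesis
    unfolding indistinguishable_def evanescent_def by auto
qed

lemma (in stochastic_basis) equiv_H1_rel: "equiv (H1_processes M F) (H1_rel M F)"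
proof (rule equivI)
  show "H1_rel M F \<subseteq> H1_processes M F \<times> H1_processes M F"
    unfolding H1_rel_def by auto
  show "refl_on (H1_processes M F) (H1_rel M F)"
    by (rule refl_onI) (auto simp: H1_rel_def indistinguishable_iff)
  show "sym (H1_rel M F)"
    by (rule symI) (auto simp: H1_rel_def indistinguishable_iff eq_commute)
  show "trans (H1_rel M F)"
  proof (rule transI)
    fix Y Z W assume "(Y, Z) \<in> H1_rel M F" "(Z, W) \<in> H1_rel M F"
    moreover from this have
      "{x \<in> space M. \<exists>t\<ge>0. Y t x \<noteq> Z t x} \<union> {x \<in> space M. \<exists>t\<ge>0. Z t x \<noteq> W t x} \<in> null_sets M"
      unfolding H1_rel_def indistinguishable_iff by blast
    then have "{x \<in> space M. \<exists>t\<ge>0. Y t x \<noteq> W t x} \<in> null_sets M"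
      by (rule complete2[rotated]) auto
    ultimately show "(Y, W) \<in> H1_rel M F"
      unfolding H1_rel_def indistinguishable_iff by blast
  qed
qed

lemma maximal_function_AE_cong:
  assumes "indistinguishable M Y Z"
  shows "AE x in M. maximal_function Y x = maximal_function Z x"
proof (rule AE_I'[of "{x \<in> space M. \<exists>t\<ge>0. Y t x \<noteq> Z t x}"])
  show "{x \<in> space M. \<exists>t\<ge>0. Y t x \<noteq> Z t x} \<in> null_sets M"
    using assms by (simp add: indistinguishable_iff)
  show "{x \<in> space M. maximal_function Y x \<noteq> maximal_function Z x}
      \<subseteq> {x \<in> space M. \<exists>t\<ge>0. Y t x \<noteq> Z t x}"
  proof (clarify, rule ccontr)
    fix x assume neq: "maximal_function Y x \<noteq> maximal_function Z x"
      and "\<not> (\<exists>t\<ge>0. Y t x \<noteq> Z t x)"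
    then have "Y t x = Z t x" if "0 \<le> t" for t using that by blast
    then have "running_sup Y t x = running_sup Z t x" for t
      unfolding running_sup_def by (intro SUP_cong) auto
    then show False using neq by (simp add: maximal_function_def)
  qed
qed

lemma (in stochastic_basis) H1_norm_class:
  assumes "Y \<in> C" "C \<in> H1 M F"
  shows "H1_norm M C = enn2real (\<integral>\<^sup>+x. maximal_function Y x \<partial>M)"
proof -
  have "enn2real (\<integral>\<^sup>+x. maximal_function Z x \<partial>M) = enn2real (\<integral>\<^sup>+x. maximal_function Y x \<partial>M)"
    if "Z \<in> C" for Z
  proof -
    have "(Z, Y) \<in> H1_rel M F"
      using quotient_eq_iff[OF equiv_H1_rel] assms that unfolding H1_def by blast
    then have "AE x in M. maximal_function Z x = maximal_function Y x"
      by (intro maximal_function_AE_cong) (auto simp: H1_rel_def)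
    then show ?thesis by (simp cong: nn_integral_cong_AE)
  qed
  then have "(\<lambda>Y. enn2real (\<integral>\<^sup>+x. maximal_function Y x \<partial>M)) ` C
      = {enn2real (\<integral>\<^sup>+x. maximal_function Y x \<partial>M)}"
    unfolding image_def using assms(1) by blast
  then show ?thesis by (simp add: H1_norm_def)
qed


section \<open>Weak topology and relative weak compactness\<close>

definition H1_dual ::
    "'x measure \<Rightarrow> (real \<Rightarrow> 'x measure) \<Rightarrow> (('x, 'e::real_normed_vector) process set \<Rightarrow> real) set" where
  "H1_dual M F =
     {\<phi>. (\<forall>C\<in>H1 M F. \<forall>D\<in>H1 M F. \<phi> (H1_add M F C D) = \<phi> C + \<phi> D) \<and>
         (\<forall>c. \<forall>C\<in>H1 M F. \<phi> (H1_scale M F c C) = c * \<phi> C) \<and>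
         (\<exists>B. \<forall>C\<in>H1 M F. \<bar>\<phi> C\<bar> \<le> B * H1_norm M C)}"

definition H1_weak_topology ::
    "'x measure \<Rightarrow> (real \<Rightarrow> 'x measure) \<Rightarrow> ('x, 'e::real_normed_vector) process set topology" where
  "H1_weak_topology M F =
     topology_generated_by {{C \<in> H1 M F. \<phi> C \<in> U} |\<phi> U. \<phi> \<in> H1_dual M F \<and> open U}"

lemma topspace_H1_weak_topology: "topspace (H1_weak_topology M F) = H1 M F"
proof -
  have "(\<lambda>_. 0) \<in> H1_dual M F"
    unfolding H1_dual_def by (auto intro: exI[of _ 0])
  then have "{C \<in> H1 M F. (0::real) \<in> UNIV}
      \<in> {{C \<in> H1 M F. \<phi> C \<in> U} |\<phi> U. \<phi> \<in> H1_dual M F \<and> open U}"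
    by blast
  then show ?thesis
    unfolding H1_weak_topology_def topology_generated_by_topspace by auto
qed

definition relatively_weakly_compact_H1 ::
    "'x measure \<Rightarrow> (real \<Rightarrow> 'x measure) \<Rightarrow> ('x, 'e::real_normed_vector) process set set \<Rightarrow> bool" where
  "relatively_weakly_compact_H1 M F K \<longleftrightarrow>
     compactin (H1_weak_topology M F) (H1_weak_topology M F closure_of K)"


section \<open>Uniform integrability\<close>

definition maximal_functions ::
    "('x, 'e::real_normed_vector) process set set \<Rightarrow> ('x \<Rightarrow> real) set" where
  \<comment> \<open>all representatives are taken; for processes in \<open>H1_processes\<close> the maximal function is
     finite almost everywhere, so \<open>enn2real\<close> changes it only on a null set\<close>
  "maximal_functions K = {\<lambda>x. enn2real (maximal_function Y x) |Y. Y \<in> \<Union>K}"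

definition uniformly_integrable :: "'x measure \<Rightarrow> ('x \<Rightarrow> real) set \<Rightarrow> bool" where
  "uniformly_integrable M S \<longleftrightarrow>
     (\<forall>\<xi>\<in>S. integrable M \<xi>) \<and>
     (\<exists>B. \<forall>\<xi>\<in>S. (\<integral>x. \<bar>\<xi> x\<bar> \<partial>M) \<le> B) \<and>
     (\<forall>\<epsilon>>0. \<exists>\<delta>>0. \<forall>\<xi>\<in>S. \<forall>A\<in>sets M. measure M A \<le> \<delta> \<longrightarrow> (LINT x:A|M. \<bar>\<xi> x\<bar>) \<le> \<epsilon>)"

end

theory Submission
  imports Defs "HOL-Library.Function_Algebras"
begin

text \<open>
  Uniform integrability gives weak compactness. Consider the closed convex set \<open>C\<close> of all
  martingales whose maximal functions obey the given bounds (\<open>ui_ball\<close>). In \<open>C\<close>, tails of a sequence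
  have convex combinations whose terminal values converge in mean: a Komlos type argument makes them
  converge weakly in \<open>E\<close> almost everywhere, and a functional separating the limit from the convex
  hull of a tail would, once represented by an operator valued density, contradict Vitali's theorem.
  Doob's maximal inequality and uniform integrability lift the convergence to the martingale space, so
  that closed convex hulls of tails in \<open>C\<close> intersect, and by Whitley's construction \<open>C\<close> is weakly
  compact. It is weakly closed by the Hahn--Banach theorem.

  Conversely, a sequence in a relatively weakly compact set has a weak cluster point. If uniform
  integrability fails, there are martingales \<open>Y\<^sub>n\<close> in the set whose maximal functions have mass bounded
  below on disjoint sets \<open>B\<^sub>n\<close>. Take functionals \<open>l\<^sub>n\<close> dominated by the integral of the maximal function
  over \<open>B\<^sub>n\<close> and norming \<open>Y\<^sub>n\<close>. Along a subsequence that makes the off-diagonal terms small, the sum of the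
  \<open>l\<^sub>n\<close> separates the \<open>Y\<^sub>n\<close> from each of their cluster points.
\<close>

section \<open>The Hahn--Banach theorem and weak compactness by convex combinations\<close>

text \<open>\<open>H1\<close> is a set of classes inside a type that carries no norm, whereas linear
  functionals and convex hulls need a vector space. Everything is therefore done with
  representatives in the full function type: \<open>H1_processes\<close> is a subspace, an algebraic
  projection \<open>P\<close> onto it makes \<open>pnorm (P Y)\<close> a seminorm on all processes,
  and functionals bounded by a multiple of \<open>pnorm\<close> do not see indistinguishability.

  No description of the dual of the martingale space is used. A functional on it is known only
  through the seminorm that dominates it, and a functional on Bochner integrable functions is
  represented only along a prescribed sequence of simple functions. The range space may be
  nonseparable, so weak limits of values are confined to a closed separable subspace normed by
  countably many functionals.

  Reflexivity enters only pointwise: it turns convergence of countably many scalar functions into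
  weak convergence of the values. Convex combinations replace subsequences because they give
  convergence almost everywhere from boundedness in mean, and separation of convex sets turns weak
  information into convergence in mean.\<close>

instantiation "fun" :: (type, scaleR) scaleR
begin
definition "c *\<^sub>R f = (\<lambda>x. c *\<^sub>R f x)"
instance ..
end

lemma scaleR_fun_apply [simp]: "(c *\<^sub>R f) x = c *\<^sub>R f x"
  by (simp add: scaleR_fun_def)

instance "fun" :: (type, real_vector) real_vector
proof
  fix a b :: real and f g :: "'a \<Rightarrow> 'b"
  show "a *\<^sub>R (f + g) = a *\<^sub>R f + a *\<^sub>R g" by (rule ext) (simp add: scaleR_add_right)
  show "(a + b) *\<^sub>R f = a *\<^sub>R f + b *\<^sub>R f" by (rule ext) (simp add: scaleR_add_left)
  show "a *\<^sub>R b *\<^sub>R f = (a * b) *\<^sub>R f" by (rule ext) simp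
  show "1 *\<^sub>R f = f" by (rule ext) simp
qed

section \<open>Sublinear functionals, seminorms and the Hahn-Banach theorem\<close>

definition sublinear :: "('w::real_vector \<Rightarrow> real) \<Rightarrow> bool" where
  "sublinear p \<longleftrightarrow> (\<forall>x y. p (x + y) \<le> p x + p y) \<and> (\<forall>t>0. \<forall>x. p (t *\<^sub>R x) = t * p x)"

definition seminorm :: "('w::real_vector \<Rightarrow> real) \<Rightarrow> bool" where
  "seminorm p \<longleftrightarrow> (\<forall>x y. p (x + y) \<le> p x + p y) \<and> (\<forall>t x. p (t *\<^sub>R x) = \<bar>t\<bar> * p x)"

lemma sublinear_zero: "sublinear p \<Longrightarrow> p 0 = 0"
  unfolding sublinear_def by (drule conjunct2, drule spec[of _ 2], drule mp, simp, drule spec[of _ 0]) simp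

lemma sublinear_neg_le:
  assumes "sublinear p"
  shows "- p (- x) \<le> p x"
proof -
  have "p (x + - x) \<le> p x + p (- x)"
    using assms unfolding sublinear_def by blast
  then show ?thesis using sublinear_zero[OF assms] by simp
qed

lemma seminorm_triangle: "seminorm p \<Longrightarrow> p (x + y) \<le> p x + p y"
  by (simp add: seminorm_def)

lemma seminorm_scale: "seminorm p \<Longrightarrow> p (t *\<^sub>R x) = \<bar>t\<bar> * p x"
  by (simp add: seminorm_def)

lemma seminorm_minus: "seminorm p \<Longrightarrow> p (- x) = p x"
  using seminorm_scale[of p "-1" x] by simp

lemma seminorm_minus_commute: "seminorm p \<Longrightarrow> p (x - y) = p (y - x)"
  using seminorm_minus[of p "y - x"] by simp

lemma seminorm_zero: "seminorm p \<Longrightarrow> p 0 = 0"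
  using seminorm_scale[of p 0 0] by simp

lemma seminorm_nonneg: "seminorm p \<Longrightarrow> 0 \<le> p x"
  using seminorm_triangle[of p x "-x"] seminorm_minus[of p x] seminorm_zero[of p] by simp

lemma seminorm_diff_triangle: "seminorm p \<Longrightarrow> p (x - z) \<le> p (x - y) + p (y - z)"
  using seminorm_triangle[of p "x - y" "y - z"] by simp

lemma seminorm_sublinear: "seminorm p \<Longrightarrow> sublinear p"
  unfolding seminorm_def sublinear_def by simp

lemma seminorm_sum: "seminorm p \<Longrightarrow> p (sum f A) \<le> (\<Sum>i\<in>A. p (f i))"
proof (induction A rule: infinite_finite_induct)
  case (insert x F)
  then show ?case using seminorm_triangle[of p "f x" "sum f F"] by simp
qed (simp_all add: seminorm_zero)

text \<open>Serves for quantities such as the integral of a norm, which are subadditive only on the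
  subspace of integrable functions; composed with a projection onto it they become seminorms on the
  whole type.\<close>

lemma seminorm_comp_linear:
  assumes "linear P" "\<And>x y. x \<in> range P \<Longrightarrow> y \<in> range P \<Longrightarrow> p (x + y) \<le> p x + p y"
    "\<And>t x. x \<in> range P \<Longrightarrow> p (t *\<^sub>R x) = \<bar>t\<bar> * p x"
  shows "seminorm (\<lambda>x. p (P x))"
  using assms by (simp add: seminorm_def linear_add linear_scale)

text \<open>A purely algebraic projection, namely a linear left inverse of the identity on
  \<open>V\<close>; no continuity is claimed.\<close>

lemma subspace_projection:
  assumes "subspace V"
  obtains P where "linear P" "range P \<subseteq> V" "\<And>v. v \<in> V \<Longrightarrow> P v = v"
  using linear_exists_left_inverse_on[OF linear_id assms] by auto

text \<open>Every sublinear modification needed below is an infimal convolution with a convex cone.\<close>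

lemma sublinear_inf_cone:
  fixes K :: "('w::real_vector \<times> real) set"
  assumes p: "sublinear p"
    and zero: "(0, 0) \<in> K"
    and add: "\<And>x y. x \<in> K \<Longrightarrow> y \<in> K \<Longrightarrow> x + y \<in> K"
    and scale: "\<And>t x. 0 < t \<Longrightarrow> x \<in> K \<Longrightarrow> t *\<^sub>R x \<in> K"
    and le: "\<And>z r. (z, r) \<in> K \<Longrightarrow> r \<le> p z"
  defines "q \<equiv> \<lambda>x. INF k\<in>K. p (x + fst k) - snd k"
  shows "sublinear q" and "q x \<le> p x" and "(z, r) \<in> K \<Longrightarrow> q x \<le> p (x + z) - r"
proof -
  \<comment> \<open>By \<open>le\<close>, no competitor drops below \<open>- p (- x)\<close>, so the
    infimum defining \<open>q\<close> is finite.\<close>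
  have lower: "- p (- x) \<le> p (x + fst k) - snd k" if "k \<in> K" for k x
  proof -
    have "p (fst k) \<le> p (- x) + p (x + fst k)"
      using p[unfolded sublinear_def, THEN conjunct1, rule_format, of "- x" "x + fst k"] by simp
    then show ?thesis using le[of "fst k" "snd k"] that by simp
  qed
  have bdd: "bdd_below ((\<lambda>k. p (x + fst k) - snd k) ` K)" for x
    by (rule bdd_belowI2[of _ "- p (- x)"]) (rule lower)
  have ne: "K \<noteq> {}" using zero by auto
  have qx: "q x = (INF k\<in>K. p (x + fst k) - snd k)" for x by (simp add: q_def)
  have upper: "q x \<le> p (x + fst k) - snd k" if "k \<in> K" for k x
    unfolding q_def by (rule cINF_lower[OF bdd that])
  show "q x \<le> p x" using upper[OF zero] by simp
  show "(z, r) \<in> K \<Longrightarrow> q x \<le> p (x + z) - r" using upper[of "(z, r)" x] by simp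
  have add: "q (x + y) \<le> q x + q y" for x y
  proof -
    \<comment> \<open>The difference form allows the two infima on the right to be taken one after
      the other, over \<open>k\<close> and then over \<open>l\<close>.\<close>
    have "q (x + y) - (p (y + fst l) - snd l) \<le> q x" if l: "l \<in> K" for l
    proof -
      have "q (x + y) - (p (y + fst l) - snd l) \<le> p (x + fst k) - snd k" if k: "k \<in> K" for k
      proof -
        have "q (x + y) \<le> p (x + y + fst (k + l)) - snd (k + l)"
          by (rule upper[OF add[OF k l]])
        moreover have "p ((x + fst k) + (y + fst l)) \<le> p (x + fst k) + p (y + fst l)"
          using p by (simp add: sublinear_def)
        ultimately show ?thesis by (simp add: add_ac)
      qed
      then show ?thesis unfolding qx[of x] by (rule cINF_greatest[OF ne])
    qed
    then have "q (x + y) - q x \<le> p (y + fst l) - snd l" if "l \<in> K" for l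
      using that by (simp add: diff_le_eq add.commute)
    then have "q (x + y) - q x \<le> q y" unfolding qx[of y] by (rule cINF_greatest[OF ne])
    then show ?thesis by simp
  qed
  have scale_le: "q (t *\<^sub>R x) \<le> t * q x" if t: "0 < t" for t x
  proof -
    have "q (t *\<^sub>R x) / t \<le> p (x + fst k) - snd k" if k: "k \<in> K" for k
    proof -
      have "q (t *\<^sub>R x) \<le> p (t *\<^sub>R x + fst (t *\<^sub>R k)) - snd (t *\<^sub>R k)"
        by (rule upper[OF scale[OF t k]])
      also have "\<dots> = t * (p (x + fst k) - snd k)"
        using p t by (simp add: sublinear_def right_diff_distrib flip: scaleR_add_right)
      finally show ?thesis using t by (simp add: pos_divide_le_eq mult.commute)
    qed
    then have "q (t *\<^sub>R x) / t \<le> q x" unfolding qx[of x] by (rule cINF_greatest[OF ne])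
    then show ?thesis using t by (simp add: pos_divide_le_eq mult.commute)
  qed
  have "q (t *\<^sub>R x) = t * q x" if t: "0 < t" for t x
  proof (rule antisym[OF scale_le[OF t]])
    have "q (inverse t *\<^sub>R (t *\<^sub>R x)) \<le> inverse t * q (t *\<^sub>R x)"
      using t by (intro scale_le) simp
    then show "t * q x \<le> q (t *\<^sub>R x)" using t by (simp add: field_simps)
  qed
  then show "sublinear q" using add by (simp add: sublinear_def)
qed

text \<open>Zorn's lemma yields a minimal sublinear functional \<open>q\<close> below
  \<open>p\<close>. The infimal convolution of \<open>q\<close> with the ray through
  \<open>(y, q y)\<close> is again sublinear and below \<open>q\<close>, hence equal to
  \<open>q\<close>; this is superadditivity, and together with sublinearity it makes
  \<open>q\<close> linear.\<close>

lemma hahn_banach_sublinear: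
  fixes p :: "'w::real_vector \<Rightarrow> real"
  assumes p: "sublinear p"
  obtains f where "linear f" "\<And>x. f x \<le> p x"
proof -
  define A where "A = {q. sublinear q \<and> q \<le> p}"
  have ex: "\<exists>m\<in>A. \<forall>a\<in>A. m \<ge> a \<longrightarrow> a = m"
  proof (rule predicate_Zorn)
    show "partial_order_on A (relation_of (\<ge>) A)"
      by (rule partial_order_on_relation_ofI) auto
    fix C assume C: "C \<in> Chains (relation_of (\<ge>) A)"
    have CA: "C \<subseteq> A" using C by (auto simp: Chains_def relation_of_def)
    have tot: "a \<le> b \<or> b \<le> a" if "a \<in> C" "b \<in> C" for a b
      using C that by (auto simp: Chains_def relation_of_def)
    show "\<exists>u\<in>A. \<forall>a\<in>C. a \<ge> u"
    proof (cases "C = {}")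
      case True then show ?thesis using p by (auto simp: A_def)
    next
      case False
      define u where "u x = (INF q\<in>C. q x)" for x
      have sub: "sublinear q" "q \<le> p" if "q \<in> C" for q using that CA by (auto simp: A_def)
      \<comment> \<open>The chain is bounded below pointwise, since \<open>q \<le> p\<close> gives
        \<open>q x \<ge> - q (- x) \<ge> - p (- x)\<close>.\<close>
      have bdd: "bdd_below ((\<lambda>q. q x) ` C)" for x
      proof (rule bdd_belowI2[of _ "- p (- x)"])
        fix q assume "q \<in> C"
        then show "- p (- x) \<le> q x"
          using sublinear_neg_le[OF sub(1), of q x] sub(2)[of q, THEN le_funD, of "- x"] by simp
      qed
      have upper: "u x \<le> q x" if "q \<in> C" for q x
        unfolding u_def by (rule cINF_lower[OF bdd that])
      have greatest: "c \<le> u x" if "\<And>q. q \<in> C \<Longrightarrow> c \<le> q x" for c x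
        unfolding u_def by (rule cINF_greatest[OF False that])
      have "u (x + y) \<le> u x + u y" for x y
      proof -
        \<comment> \<open>In a chain one member \<open>s\<close> lies below both \<open>q\<close>
          and \<open>r\<close>, so different near minimisers at \<open>x\<close> and at
          \<open>y\<close> can be replaced by a single one.\<close>
        have *: "u (x + y) \<le> q x + r y" if "q \<in> C" "r \<in> C" for q r
        proof -
          obtain s where s: "s \<in> C" "s \<le> q" "s \<le> r"
            using tot[OF \<open>q \<in> C\<close> \<open>r \<in> C\<close>] \<open>q \<in> C\<close> \<open>r \<in> C\<close> by (meson order_refl)
          have "u (x + y) \<le> s x + s y"
            using upper[OF s(1), of "x + y"] sub(1)[OF s(1), unfolded sublinear_def, THEN conjunct1, rule_format, of x y]
            by linarith
          also have "\<dots> \<le> q x + r y" by (intro add_mono le_funD[OF s(2)] le_funD[OF s(3)])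
          finally show ?thesis .
        qed
        have "u (x + y) - r y \<le> u x" if "r \<in> C" for r
          using * that by (intro greatest) (simp add: diff_le_eq)
        then have "u (x + y) - u x \<le> u y" by (intro greatest) (simp add: diff_le_eq add.commute)
        then show ?thesis by simp
      qed
      moreover have "u (t *\<^sub>R x) = t * u x" if t: "t > 0" for t x
      proof (rule antisym)
        have "u (t *\<^sub>R x) / t \<le> u x"
        proof (rule greatest)
          fix q assume q: "q \<in> C"
          have "u (t *\<^sub>R x) \<le> t * q x"
            using upper[OF q, of "t *\<^sub>R x"] sub(1)[OF q] t by (simp add: sublinear_def)
          then show "u (t *\<^sub>R x) / t \<le> q x" using t by (simp add: pos_divide_le_eq mult.commute)
        qed
        then show "u (t *\<^sub>R x) \<le> t * u x" using t by (simp add: pos_divide_le_eq mult.commute)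
        show "t * u x \<le> u (t *\<^sub>R x)"
        proof (rule greatest)
          fix q assume q: "q \<in> C"
          show "t * u x \<le> q (t *\<^sub>R x)"
            using upper[OF q, of x] sub(1)[OF q] t by (simp add: sublinear_def)
        qed
      qed
      ultimately have "sublinear u" by (simp add: sublinear_def)
      moreover obtain q where "q \<in> C" using False by auto
      then have "u \<le> p" using upper[of q] sub(2)[of q] by (auto simp: le_fun_def intro: order_trans)
      ultimately show ?thesis using upper by (intro bexI[of _ u]) (auto simp: A_def le_fun_def)
    qed
  qed
  then obtain q where q: "sublinear q" "q \<le> p" and min: "\<And>r. sublinear r \<Longrightarrow> r \<le> q \<Longrightarrow> r = q"
  proof -
    assume that: "\<And>q. sublinear q \<Longrightarrow> q \<le> p \<Longrightarrow> (\<And>r. sublinear r \<Longrightarrow> r \<le> q \<Longrightarrow> r = q) \<Longrightarrow> thesis"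
    obtain m where m: "m \<in> A" "\<And>a. a \<in> A \<Longrightarrow> a \<le> m \<Longrightarrow> a = m" using ex by blast
    show thesis
    proof (rule that)
      show "sublinear m" "m \<le> p" using m(1) by (auto simp: A_def)
      show "r = m" if "sublinear r" "r \<le> m" for r
        using m that order_trans[of r m p] by (auto simp: A_def)
    qed
  qed
  have super: "q x + q y \<le> q (x + y)" for x y
  proof -
    define K where "K = (\<lambda>t. (t *\<^sub>R y, t * q y)) ` {0..}"
    have K0: "(0, 0) \<in> K" unfolding K_def by (auto intro!: image_eqI[of _ _ 0])
    have Kadd: "a + b \<in> K" if ab: "a \<in> K" "b \<in> K" for a b
    proof -
      obtain s t where "s \<ge> 0" "a = (s *\<^sub>R y, s * q y)" "t \<ge> 0" "b = (t *\<^sub>R y, t * q y)"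
        using ab unfolding K_def by auto
      then show ?thesis unfolding K_def
        by (intro image_eqI[of _ _ "s + t"]) (simp_all add: scaleR_add_left distrib_right)
    qed
    have Kscale: "t *\<^sub>R a \<in> K" if ta: "0 < t" "a \<in> K" for t a
    proof -
      obtain s where s: "s \<ge> 0" "a = (s *\<^sub>R y, s * q y)" using ta(2) unfolding K_def by auto
      then show ?thesis using ta(1) unfolding K_def by (auto intro!: image_eqI[of _ _ "t * s"])
    qed
    have Kle: "r \<le> q z" if zr: "(z, r) \<in> K" for z r
    proof -
      obtain s where s: "s \<ge> 0" "z = s *\<^sub>R y" "r = s * q y" using zr unfolding K_def by auto
      then show ?thesis using q(1) sublinear_zero[OF q(1)]
        by (cases "s = 0") (auto simp: sublinear_def)
    qed
    note cone = sublinear_inf_cone[OF q(1) K0 Kadd Kscale Kle, simplified]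
    \<comment> \<open>Minimality forces the convolution to be \<open>q\<close> itself; evaluated at
      the point of the ray with parameter \<open>1\<close> it gives superadditivity.\<close>
    have eq: "(\<lambda>x. INF k\<in>K. q (x + fst k) - snd k) = q"
      using cone(1,2) by (intro min) (auto simp: le_fun_def)
    have "(y, q y) \<in> K" unfolding K_def by (auto intro!: image_eqI[of _ _ 1])
    then have "q x \<le> q (x + y) - q y"
      using cone(3)[of y "q y" x] fun_cong[OF eq, of x] by simp
    then show ?thesis by simp
  qed
  have add: "q (x + y) = q x + q y" for x y
    using super[of x y] q(1)[unfolded sublinear_def, THEN conjunct1, rule_format, of x y] by (rule antisym[rotated])
  have neg: "q (- x) = - q x" for x
    using add[of x "- x"] sublinear_zero[OF q(1)] by simp
  have "q (t *\<^sub>R x) = t *\<^sub>R q x" for t x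
  proof (cases t "0::real" rule: linorder_cases)
    case less
    then have "q ((- t) *\<^sub>R x) = (- t) * q x"
      using q(1)[unfolded sublinear_def, THEN conjunct2, rule_format, of "- t" x] by simp
    then show ?thesis using neg[of "t *\<^sub>R x"] by simp
  qed (use q(1) sublinear_zero[OF q(1)] in \<open>auto simp: sublinear_def\<close>)
  then have "linear q" using add by (intro linearI)
  then show thesis using that q(2) by (auto simp: le_fun_def)
qed

text \<open>The cone is spanned by \<open>Q \<times> {e}\<close>: a linear \<open>f\<close> below
  the convolution satisfies \<open>f (- x) \<le> p 0 - e\<close> for \<open>x \<in> Q\<close>, that
  is \<open>e \<le> f x\<close>. A point is separated from a convex set by applying this to the
  translated set.\<close>

lemma hahn_banach_convex:
  fixes p :: "'w::real_vector \<Rightarrow> real"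
  assumes p: "seminorm p" and Q: "convex Q" "Q \<noteq> {}" and e: "\<And>x. x \<in> Q \<Longrightarrow> e \<le> p x"
  obtains f where "linear f" "\<And>x. \<bar>f x\<bar> \<le> p x" "\<And>x. x \<in> Q \<Longrightarrow> e \<le> f x"
proof -
  define K where "K = {(t *\<^sub>R x, t * e) |t x. 0 \<le> t \<and> x \<in> Q}"
  have K0: "(0, 0) \<in> K"
  proof -
    obtain x where "x \<in> Q" using Q(2) by blast
    then show ?thesis unfolding K_def by (auto intro!: exI[of _ 0] exI[of _ x])
  qed
  have Kadd: "a + b \<in> K" if ab: "a \<in> K" "b \<in> K" for a b
  proof -
    obtain s x t y where a: "a = (s *\<^sub>R x, s * e)" "0 \<le> s" "x \<in> Q" and b: "b = (t *\<^sub>R y, t * e)" "0 \<le> t" "y \<in> Q"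
      using ab unfolding K_def by blast
    show ?thesis
    proof (cases "s + t = 0")
      case True
      then have "s = 0" "t = 0" using a b by auto
      then show ?thesis using K0 a b by (simp add: zero_prod_def)
    next
      case False
      define z where "z = (s / (s + t)) *\<^sub>R x + (t / (s + t)) *\<^sub>R y"
      have "z \<in> Q" unfolding z_def using a b False
        by (intro convexD[OF Q(1)]) (auto simp: add_divide_distrib[symmetric])
      moreover have "a + b = ((s + t) *\<^sub>R z, (s + t) * e)"
        unfolding a(1) b(1) using False by (simp add: z_def scaleR_add_right) (simp add: distrib_right)
      ultimately show ?thesis using a b unfolding K_def by (auto intro!: exI[of _ "s + t"])
    qed
  qed
  have Kscale: "t *\<^sub>R a \<in> K" if ta: "0 < t" "a \<in> K" for t a
  proof -
    obtain s x where a: "a = (s *\<^sub>R x, s * e)" "0 \<le> s" "x \<in> Q" using ta(2) unfolding K_def by blast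
    then show ?thesis using ta(1) unfolding K_def by (auto intro!: exI[of _ "t * s"])
  qed
  have Kle: "r \<le> p z" if "(z, r) \<in> K" for z r
    using that e unfolding K_def by (auto simp: seminorm_scale[OF p] intro!: mult_left_mono)
  note cone = sublinear_inf_cone[OF seminorm_sublinear[OF p] K0 Kadd Kscale Kle, simplified]
  obtain f where f: "linear f" "\<And>x. f x \<le> (INF k\<in>K. p (x + fst k) - snd k)"
    using hahn_banach_sublinear[OF cone(1)] by blast
  have le: "f x \<le> p x" for x using f(2) cone(2) order_trans by blast
  have "\<bar>f x\<bar> \<le> p x" for x
    using le[of x] le[of "- x"] by (simp add: linear_neg[OF f(1)] seminorm_minus[OF p] abs_le_iff)
  moreover have "e \<le> f x" if "x \<in> Q" for x
  proof -
    have "(x, e) \<in> K" using that unfolding K_def by (auto intro!: exI[of _ 1])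
    then have "f (- x) \<le> p (- x + x) - e" using f(2) cone(3) order_trans by blast
    then show ?thesis by (simp add: linear_neg[OF f(1)] seminorm_zero[OF p])
  qed
  ultimately show thesis using that f(1) by blast
qed

lemma hahn_banach_norming:
  fixes p :: "'w::real_vector \<Rightarrow> real"
  assumes p: "seminorm p"
  obtains f where "linear f" "\<And>x. \<bar>f x\<bar> \<le> p x" "f z = p z"
proof -
  obtain f where f: "linear f" "\<And>x. \<bar>f x\<bar> \<le> p x" "p z \<le> f z"
    using hahn_banach_convex[OF p, of "{z}" "p z"] by auto
  moreover have "f z = p z" using f(2)[of z] f(3) by simp
  ultimately show thesis using that by blast
qed

text \<open>Tychonoff's theorem for a product of compact intervals. The index set may be
  uncountable, for instance all functionals, so a finer filter takes the place of a
  subsequence.\<close>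

lemma simultaneous_filter_limit:
  fixes h :: "'n \<Rightarrow> 'i \<Rightarrow> real"
  assumes F: "F \<noteq> bot" and bound: "\<And>i. eventually (\<lambda>n. \<bar>h n i\<bar> \<le> B i) F"
  obtains F' L where "F' \<le> F" "F' \<noteq> bot" "\<And>i. ((\<lambda>n. h n i) \<longlongrightarrow> L i) F'"
proof -
  \<comment> \<open>Clipping puts every \<open>g n\<close> into the compact box, although for each
    \<open>i\<close> the bound on \<open>h\<close> holds only eventually, with no uniformity in
    \<open>i\<close>.\<close>
  define g where "g n i = max (- \<bar>B i\<bar>) (min \<bar>B i\<bar> (h n i))" for n i
  define S where "S = Pi\<^sub>E UNIV (\<lambda>i. {- \<bar>B i\<bar>..\<bar>B i\<bar>})"
  have "compactin (product_topology (\<lambda>_. euclidean) UNIV) S"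
    unfolding S_def by (subst compactin_PiE) (auto simp: compact_Icc)
  then have "compact S" by (simp add: euclidean_product_topology)
  moreover have "g n \<in> S" for n unfolding S_def g_def by auto
  then have "eventually (\<lambda>x. x \<in> S) (filtermap g F)" by (simp add: eventually_filtermap)
  moreover have "filtermap g F \<noteq> bot" using F by (simp add: filtermap_bot_iff)
  ultimately obtain L where L: "inf (nhds L) (filtermap g F) \<noteq> bot"
    using compact_filter by metis
  \<comment> \<open>The trace of \<open>F\<close> on the preimages of the neighbourhoods of the
    cluster point \<open>L\<close>.\<close>
  define F' where "F' = inf F (filtercomap g (nhds L))"
  have "F' \<noteq> bot"
  proof
    assume "F' = bot"
    then have "eventually (\<lambda>_. False) F'" by simp
    then obtain P Q where PQ: "eventually P F" "eventually Q (filtercomap g (nhds L))" "\<And>x. P x \<and> Q x \<Longrightarrow> False"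
      unfolding F'_def eventually_inf by blast
    from PQ(2) obtain R where R: "eventually R (nhds L)" "\<And>x. R (g x) \<Longrightarrow> Q x"
      unfolding eventually_filtercomap by blast
    have "eventually (\<lambda>y. \<not> R y) (filtermap g F)"
      unfolding eventually_filtermap using PQ(1) by eventually_elim (use PQ(3) R(2) in blast)
    with R(1) have "eventually (\<lambda>_. False) (inf (nhds L) (filtermap g F))"
      unfolding eventually_inf by blast
    then show False using L by (simp add: trivial_limit_def)
  qed
  moreover have "F' \<le> F" unfolding F'_def by simp
  moreover have "((\<lambda>n. h n i) \<longlongrightarrow> L i) F'" for i
  proof -
    have "(g \<longlongrightarrow> L) F'"
      unfolding F'_def by (rule filterlim_mono[OF filterlim_filtercomap]) auto
    then have "((\<lambda>n. g n i) \<longlongrightarrow> L i) F'"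
      by (rule continuous_on_tendsto_compose[OF continuous_on_product_coordinates[of i]]) auto
    moreover have "eventually (\<lambda>n. g n i = h n i) F'"
      using bound[of i] \<open>F' \<le> F\<close> by (auto simp: g_def elim!: filter_leD eventually_mono)
    ultimately show ?thesis using tendsto_cong by force
  qed
  ultimately show thesis by (intro that[of F' L])
qed

section \<open>Rational linear combinations as a countable dense family\<close>

definition rat_combination :: "(nat \<Rightarrow> 'w::real_vector) \<Rightarrow> rat list \<Rightarrow> 'w" where
  "rat_combination a l = (\<Sum>i<length l. of_rat (l ! i) *\<^sub>R a i)"

lemma span_range_nat_obtain:
  fixes a :: "nat \<Rightarrow> 'w::real_vector"
  assumes "y \<in> span (range a)"
  obtains n c where "y = (\<Sum>i<n. c i *\<^sub>R a i)"
proof -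
  have "\<exists>n c. y = (\<Sum>i<n. c i *\<^sub>R a i)"
    using assms
  proof (induction rule: span_induct_alt)
    case base
    show ?case by (rule exI[of _ 0]) simp
  next
    case (step c x y)
    then obtain n d j where y: "y = (\<Sum>i<n. d i *\<^sub>R a i)" and x: "x = a j" by auto
    define N where "N = max n (Suc j)"
    have "y = (\<Sum>i<N. (if i < n then d i else 0) *\<^sub>R a i)"
      unfolding y by (rule sum.mono_neutral_cong_left) (auto simp: N_def)
    moreover have "c *\<^sub>R x = (\<Sum>i<N. (if i = j then c else 0) *\<^sub>R a i)"
    proof -
      have "(\<Sum>i<N. (if i = j then c else 0) *\<^sub>R a i) = (\<Sum>i<N. if i = j then c *\<^sub>R a i else 0)"
        by (rule sum.cong) auto
      also have "\<dots> = c *\<^sub>R x" by (simp add: N_def x less_max_iff_disj)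
      finally show ?thesis ..
    qed
    ultimately have "c *\<^sub>R x + y = (\<Sum>i<N. ((if i = j then c else 0) + (if i < n then d i else 0)) *\<^sub>R a i)"
      by (simp only: scaleR_add_left sum.distrib)
    then show ?case by (intro exI)
  qed
  then show thesis using that by blast
qed

lemma rat_combination_dense:
  fixes a :: "nat \<Rightarrow> 'w::real_vector"
  assumes p: "seminorm p" and y: "y \<in> span (range a)" and e: "0 < e"
  obtains l where "p (y - rat_combination a l) < e"
proof -
  obtain n c where yc: "y = (\<Sum>i<n. c i *\<^sub>R a i)" using span_range_nat_obtain[OF y] .
  have "\<exists>q. \<bar>c i - of_rat q\<bar> * p (a i) < e / (n + 1)" for i
  proof -
    have p0: "0 \<le> p (a i)" by (rule seminorm_nonneg[OF p])
    \<comment> \<open>Coefficient \<open>i\<close> may cost at most \<open>e / (n + 1)\<close>; the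
      summand \<open>1\<close> keeps the denominator positive when
      \<open>p (a i) = 0\<close>.\<close>
    define d where "d = e / (n + 1) / (p (a i) + 1)"
    have d: "0 < d" using e p0 by (simp add: d_def)
    obtain q where q: "c i - d < of_rat q" "of_rat q < c i"
      using of_rat_dense[of "c i - d" "c i"] d by auto
    have "\<bar>c i - of_rat q\<bar> * p (a i) \<le> d * p (a i)"
      using q p0 by (intro mult_right_mono) auto
    also have "\<dots> < d * (p (a i) + 1)" using d by simp
    also have "\<dots> = e / (n + 1)" using p0 by (simp add: d_def)
    finally show ?thesis by blast
  qed
  then obtain q where q: "\<And>i. \<bar>c i - of_rat (q i)\<bar> * p (a i) < e / (n + 1)" by metis
  have "y - rat_combination a (map q [0..<n]) = (\<Sum>i<n. (c i - of_rat (q i)) *\<^sub>R a i)"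
    by (simp add: yc rat_combination_def scaleR_diff_left sum_subtractf)
  then have "p (y - rat_combination a (map q [0..<n])) \<le> (\<Sum>i<n. p ((c i - of_rat (q i)) *\<^sub>R a i))"
    by (simp only: seminorm_sum[OF p])
  also have "\<dots> \<le> (\<Sum>i<n. e / (n + 1))"
    by (rule sum_mono) (simp only: seminorm_scale[OF p] less_imp_le[OF q])
  also have "\<dots> < e" using e by (simp add: field_simps)
  finally show thesis by (rule that)
qed

text \<open>Whitley's construction: the limit \<open>L\<close> of a filter on \<open>C\<close>, an element of the bidual, is almost
  normed on the span of itself and of the points chosen so far by countably many functionals; the next
  point is chosen close to \<open>L\<close> on finitely many of these, so that any point in all closed convex hulls
  of the tails agrees with \<open>L\<close>.\<close>

lemma weak_limit_in_set:
  fixes p :: "'w::real_vector \<Rightarrow> real"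
  assumes p: "seminorm p" and B: "\<And>x. x \<in> C \<Longrightarrow> p x \<le> B"
    and F: "F \<noteq> bot" "eventually (\<lambda>x. x \<in> C) F"
    and tails: "\<And>a::nat \<Rightarrow> 'w. range a \<subseteq> C \<Longrightarrow>
      \<exists>x\<in>C. \<forall>n. \<forall>e>0. \<exists>y\<in>convex hull (a ` {n..}). p (x - y) < e"
  obtains x F' where "x \<in> C" "F' \<le> F" "F' \<noteq> bot"
    "\<And>f. linear f \<Longrightarrow> (\<And>w. \<bar>f w\<bar> \<le> p w) \<Longrightarrow> (f \<longlongrightarrow> f x) F'"
proof -
  define D where "D = {f. linear f \<and> (\<forall>w. \<bar>f w\<bar> \<le> p w)}"
  \<comment> \<open>Extended by \<open>0\<close> outside \<open>D\<close>, the evaluations are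
    indexed by the whole function type, as the simultaneous limit requires.\<close>
  define h where "h w f = (if f \<in> D then f w else 0)" for w f
  have "eventually (\<lambda>w. \<bar>h w f\<bar> \<le> \<bar>B\<bar>) F" for f
    using F(2)
  proof eventually_elim
    case (elim w)
    have "\<bar>h w f\<bar> \<le> p w" unfolding h_def D_def using seminorm_nonneg[OF p] by auto
    then show ?case using B[OF elim] by linarith
  qed
  then obtain F' L where F': "F' \<le> F" "F' \<noteq> bot" and lim: "\<And>f. ((\<lambda>w. h w f) \<longlongrightarrow> L f) F'"
    using simultaneous_filter_limit[OF F(1), where h = h and B = "\<lambda>_. \<bar>B\<bar>"] by blast
  have C': "eventually (\<lambda>x. x \<in> C) F'" using F'(1) F(2) by (rule filter_leD)
  have lim: "(f \<longlongrightarrow> L f) F'" if "f \<in> D" for f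
    using lim[of f] that by (simp add: h_def)
  have Dlin: "linear f" and Dle: "\<bar>f w\<bar> \<le> p w" if "f \<in> D" for f w
    using that by (auto simp: D_def)
  have Lle: "\<bar>L f\<bar> \<le> \<bar>B\<bar>" if f: "f \<in> D" for f
  proof (rule tendsto_upperbound[OF tendsto_rabs[OF lim[OF f]] _ F'(2)])
    show "eventually (\<lambda>w. \<bar>f w\<bar> \<le> \<bar>B\<bar>) F'"
      using C'
    proof eventually_elim
      case (elim w)
      show ?case using Dle[OF f, of w] B[OF elim] by linarith
    qed
  qed
  have zero: "(\<lambda>_. 0) \<in> D"
    unfolding D_def using seminorm_nonneg[OF p] by (auto intro: linearI)
  \<comment> \<open>The distance from \<open>L\<close> to \<open>v\<close>, tested on
    \<open>D\<close>, is realised up to the factor \<open>2\<close>; its supremum \<open>N\<close>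
    need not be attained.\<close>
  have "\<exists>f\<in>D. \<forall>g\<in>D. \<bar>L g - g v\<bar> \<le> 2 * \<bar>L f - f v\<bar>" for v
  proof -
    define N where "N = (SUP g\<in>D. \<bar>L g - g v\<bar>)"
    have bdd: "bdd_above ((\<lambda>g. \<bar>L g - g v\<bar>) ` D)"
    proof (rule bdd_aboveI2)
      fix g assume g: "g \<in> D"
      show "\<bar>L g - g v\<bar> \<le> \<bar>B\<bar> + p v" using Lle[OF g] Dle[OF g, of v] by linarith
    qed
    have up: "\<bar>L g - g v\<bar> \<le> N" if "g \<in> D" for g
      unfolding N_def by (rule cSUP_upper[OF that bdd])
    show ?thesis
    proof (cases "N \<le> 0")
      case True
      show ?thesis
      proof (rule bexI[OF _ zero], rule ballI)
        fix g assume "g \<in> D"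
        from up[OF this] True have "\<bar>L g - g v\<bar> \<le> 0" by (rule order_trans)
        then show "\<bar>L g - g v\<bar> \<le> 2 * \<bar>L (\<lambda>_. 0) - 0\<bar>" by (rule order_trans) simp
      qed
    next
      case False
      then have "N / 2 < (SUP g\<in>D. \<bar>L g - g v\<bar>)" by (simp add: N_def)
      then obtain f where f: "f \<in> D" "N / 2 < \<bar>L f - f v\<bar>"
        using less_cSUP_iff[OF _ bdd] zero by blast
      show ?thesis
      proof (rule bexI[OF _ f(1)], rule ballI)
        fix g assume "g \<in> D"
        from up[OF this] show "\<bar>L g - g v\<bar> \<le> 2 * \<bar>L f - f v\<bar>"
          by (rule order_trans) (use f(2) in simp)
      qed
    qed
  qed
  then obtain \<phi> where \<phi>D: "\<And>v. \<phi> v \<in> D"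
    and \<phi>: "\<And>v g. g \<in> D \<Longrightarrow> \<bar>L g - g v\<bar> \<le> 2 * \<bar>L (\<phi> v) - \<phi> v v\<bar>"
    by metis
  \<comment> \<open>An enumeration of all rational lists with \<open>length (l m) \<le> m\<close>:
    then \<open>y m a\<close> involves only \<open>a i\<close> with \<open>i < m\<close>, so the
    choice of \<open>a n\<close> may refer to every \<open>y m\<close> with
    \<open>m \<le> n\<close>. Pairing the code of a list with its length ensures that each list does
    occur untruncated.\<close>
  define l where "l m = take m (from_nat (fst (prod_decode m)) :: rat list)" for m
  have l_len: "length (l m) \<le> m" for m by (simp add: l_def)
  have l_surj: "\<exists>m. l m = l'" for l'
  proof
    have "length l' \<le> prod_encode (to_nat l', length l')" by (rule le_prod_encode_2)
    then show "l (prod_encode (to_nat l', length l')) = l'" by (simp add: l_def)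
  qed
  define y where "y m a = rat_combination a (l m)" for m and a :: "nat \<Rightarrow> 'w"
  have y_cong: "y m a = y m b" if "\<And>i. i < m \<Longrightarrow> a i = b i" for m a b
    unfolding y_def rat_combination_def using l_len[of m] that by (intro sum.cong) auto
  define P where "P a n r \<longleftrightarrow> r \<in> C \<and> (\<forall>m\<le>n. \<bar>\<phi> (y m a) r - L (\<phi> (y m a))\<bar> < 1 / (real n + 1))" for a n r
  have "\<exists>a. \<forall>n. P a n (a n)"
  proof (rule dependent_wellorder_choice)
    show "P f x r = P g x r" if "\<And>y. y < x \<Longrightarrow> f y = g y" for f g x r
    proof -
      have "y m f = y m g" if "m \<le> x" for m
        by (rule y_cong) (use \<open>\<And>y. y < x \<Longrightarrow> f y = g y\<close> \<open>m \<le> x\<close> in auto)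
      then show ?thesis by (simp add: P_def)
    qed
    show "\<exists>r. P f x r" for x f
    proof -
      have "eventually (\<lambda>r. \<bar>\<phi> (y m f) r - L (\<phi> (y m f))\<bar> < 1 / (real x + 1)) F'" for m
        using tendstoD[OF lim[OF \<phi>D[of "y m f"]], of "1 / (real x + 1)"] by (simp add: dist_real_def)
      then have "eventually (\<lambda>r. \<forall>m\<in>{..x}. \<bar>\<phi> (y m f) r - L (\<phi> (y m f))\<bar> < 1 / (real x + 1)) F'"
        by (intro eventually_ball_finite) auto
      then have "eventually (P f x) F'"
        using C' by eventually_elim (auto simp: P_def)
      then show ?thesis using F'(2) eventually_happens' by blast
    qed
  qed
  then obtain a where aC: "\<And>n. a n \<in> C"
    and a: "\<And>m n. m \<le> n \<Longrightarrow> \<bar>\<phi> (y m a) (a n) - L (\<phi> (y m a))\<bar> < 1 / (real n + 1)"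
    unfolding P_def by blast
  obtain x where x: "x \<in> C" "\<And>n e. e > 0 \<Longrightarrow> \<exists>y\<in>convex hull (a ` {n..}). p (x - y) < e"
    using tails[of a] aC by blast
  \<comment> \<open>On the hull of a late tail the functional \<open>\<phi> (y m a)\<close> is
    within \<open>e / 2\<close> of its limit, and \<open>x\<close> is approximated by points of that
    hull, so \<open>x\<close> and \<open>L\<close> agree on all the functionals chosen.\<close>
  have \<psi>x: "\<phi> (y m a) x = L (\<phi> (y m a))" for m
  proof -
    define \<psi> where "\<psi> = \<phi> (y m a)"
    have \<psi>: "linear \<psi>" "\<And>w. \<bar>\<psi> w\<bar> \<le> p w" using Dlin[OF \<phi>D] Dle[OF \<phi>D] by (auto simp: \<psi>_def)
    have "\<bar>\<psi> x - L \<psi>\<bar> \<le> e" if e: "e > 0" for e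
    proof -
      obtain n0 where n0: "1 / (real n0 + 1) < e / 2" using e
        by (metis half_gt_zero reals_Archimedean inverse_eq_divide of_nat_Suc add.commute)
      define n where "n = max m n0"
      have n: "1 / (real k + 1) < e / 2" if "k \<ge> n" for k
      proof -
        have "1 / (real k + 1) \<le> 1 / (real n0 + 1)" using that by (intro divide_left_mono) (auto simp: n_def)
        then show ?thesis using n0 by linarith
      qed
      obtain z where z: "z \<in> convex hull (a ` {n..})" "p (x - z) < e / 2" using x(2)[of "e / 2" n] e by auto
      have "convex (\<psi> -` cball (L \<psi>) (e / 2))"
        by (rule convex_linear_vimage[OF \<psi>(1) convex_cball])
      moreover have "a ` {n..} \<subseteq> \<psi> -` cball (L \<psi>) (e / 2)"
      proof (rule image_subsetI)
        fix k assume k: "k \<in> {n..}"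
        have "\<bar>\<psi> (a k) - L \<psi>\<bar> < e / 2"
          using a[of m k] n[of k] k unfolding \<psi>_def by (auto simp: n_def)
        then show "a k \<in> \<psi> -` cball (L \<psi>) (e / 2)"
          by (simp add: dist_real_def abs_minus_commute)
      qed
      ultimately have "z \<in> \<psi> -` cball (L \<psi>) (e / 2)" using z(1) hull_minimal by blast
      then have "\<bar>\<psi> z - L \<psi>\<bar> \<le> e / 2" by (simp add: dist_real_def abs_minus_commute)
      moreover have "\<bar>\<psi> x - \<psi> z\<bar> < e / 2"
        using \<psi>(2)[of "x - z"] z(2) linear_diff[OF \<psi>(1)] by simp
      ultimately show ?thesis by linarith
    qed
    then have "\<bar>\<psi> x - L \<psi>\<bar> \<le> 0" using field_le_epsilon[of "\<bar>\<psi> x - L \<psi>\<bar>" 0] by auto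
    then show ?thesis by (simp add: \<psi>_def)
  qed
  \<comment> \<open>With respect to \<open>p\<close>, the point \<open>x\<close> is a limit of
    combinations of the \<open>a n\<close>, so some \<open>y m a\<close> is within
    \<open>2 * e\<close> of it. The distance of \<open>L\<close> from \<open>y m a\<close> is at
    most twice the one seen by \<open>\<psi>\<close>, and there \<open>L\<close> may be replaced by
    \<open>x\<close>; this costs \<open>4 * e\<close>, and the return from \<open>y m a\<close> to
    \<open>x\<close> costs \<open>2 * e\<close>.\<close>
  have Lx: "g x = L g" if g: "g \<in> D" for g
  proof -
    have "\<bar>L g - g x\<bar> \<le> 6 * e" if e: "e > 0" for e
    proof -
      obtain z where z: "z \<in> convex hull (a ` {0..})" "p (x - z) < e" using x(2)[of e 0] e by auto
      have "z \<in> span (range a)" using z(1) convex_hull_subset_span by fastforce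
      then obtain l' where l': "p (z - rat_combination a l') < e" using rat_combination_dense[OF p _ e] by blast
      obtain m where "l m = l'" using l_surj by blast
      then have m: "y m a = rat_combination a l'" by (simp add: y_def)
      define \<psi> where "\<psi> = \<phi> (y m a)"
      have \<psi>D: "\<psi> \<in> D" using \<phi>D by (simp add: \<psi>_def)
      have xy: "p (x - y m a) \<le> 2 * e"
        using seminorm_diff_triangle[OF p, of x "y m a" z] z(2) l' m by simp
      have "\<bar>L g - g (y m a)\<bar> \<le> 2 * \<bar>\<psi> x - \<psi> (y m a)\<bar>"
        using \<phi>[OF g, of "y m a"] \<psi>x[of m] by (simp add: \<psi>_def)
      also have "\<dots> \<le> 2 * (2 * e)"
        using Dle[OF \<psi>D, of "x - y m a"] xy linear_diff[OF Dlin[OF \<psi>D]] by simp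
      finally have "\<bar>L g - g (y m a)\<bar> \<le> 4 * e" by simp
      moreover have "\<bar>g x - g (y m a)\<bar> \<le> 2 * e"
        using Dle[OF g, of "x - y m a"] xy linear_diff[OF Dlin[OF g]] by simp
      ultimately show ?thesis by linarith
    qed
    from this[of "_ / 6"] have "\<bar>L g - g x\<bar> \<le> 0 + e" if "e > 0" for e using that by force
    then have "\<bar>L g - g x\<bar> \<le> 0" by (rule field_le_epsilon)
    then show ?thesis by simp
  qed
  show thesis
  proof (rule that[OF x(1) F'])
    fix f assume "linear f" "\<And>w. \<bar>f w\<bar> \<le> p w"
    then have "f \<in> D" by (simp add: D_def)
    then show "(f \<longlongrightarrow> f x) F'" using lim Lx by simp
  qed
qed

section \<open>Bochner integrable functions\<close>

lemma norming_functional: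
  fixes e :: "'e::real_normed_vector"
  obtains \<phi> :: "'e \<Rightarrow>\<^sub>L real" where "norm \<phi> \<le> 1" "\<phi> e = norm e"
proof -
  have "seminorm (norm :: 'e \<Rightarrow> real)" by (simp add: seminorm_def norm_triangle_ineq)
  then obtain f where f: "linear f" "\<And>x. \<bar>f x\<bar> \<le> norm x" "f e = norm e"
    using hahn_banach_norming[of norm e] by blast
  have bl: "bounded_linear f"
    using f(1,2) by (auto simp: bounded_linear_def bounded_linear_axioms_def intro!: exI[of _ 1])
  have "norm (Blinfun f) \<le> 1"
    by (rule norm_blinfun_bound) (use f(2) in \<open>auto simp: bounded_linear_Blinfun_apply[OF bl]\<close>)
  then show thesis by (rule that) (simp add: bounded_linear_Blinfun_apply[OF bl] f(3))
qed

lemma blinfun_le_norm: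
  fixes \<phi> :: "'e::real_normed_vector \<Rightarrow>\<^sub>L real"
  assumes "norm \<phi> \<le> 1"
  shows "\<bar>\<phi> e\<bar> \<le> norm e"
  using norm_blinfun[of \<phi> e] mult_right_mono[OF assms norm_ge_zero[of e]] by simp

lemma functionals_separate:
  fixes v w :: "'e::real_normed_vector"
  assumes "\<And>\<phi> :: 'e \<Rightarrow>\<^sub>L real. \<phi> v = \<phi> w"
  shows "v = w"
proof -
  obtain \<phi> :: "'e \<Rightarrow>\<^sub>L real" where "\<phi> (v - w) = norm (v - w)" using norming_functional by blast
  then show ?thesis using assms[of \<phi>] by (simp add: blinfun.diff_right)
qed

section \<open>Strong measurability: criteria and permanence\<close>

lemma strongly_measurable_simple: "simple_function M f \<Longrightarrow> strongly_measurable M f"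
  unfolding strongly_measurable_def by (intro exI[of _ "\<lambda>_. f"]) auto

text \<open>The approximation step in Pettis' theorem: among \<open>d 0, ..., d i\<close> pick the
  point nearest to \<open>f x\<close>. The choice depends measurably on \<open>x\<close> because
  only distances enter, and it takes finitely many values.\<close>

lemma strongly_measurableI_dist:
  fixes f :: "'x \<Rightarrow> 'e::real_normed_vector" and d :: "nat \<Rightarrow> 'e"
  assumes meas [measurable]: "\<And>j. (\<lambda>x. dist (f x) (d j)) \<in> borel_measurable M"
    and cl: "\<And>x. x \<in> space M \<Longrightarrow> f x \<in> closure (range d)"
  shows "strongly_measurable M f"
proof -
  define P where "P i x j \<longleftrightarrow> j \<le> i \<and> (\<forall>k\<in>{..i}. dist (f x) (d j) \<le> dist (f x) (d k))" for i x j
  \<comment> \<open>\<open>LEAST\<close> breaks ties, so the index of a nearest point becomes a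
    measurable function.\<close>
  define J where "J i x = (LEAST j. P i x j)" for i x
  have ex: "\<exists>j. P i x j" for i x
  proof -
    have "finite ((\<lambda>j. dist (f x) (d j)) ` {..i})" "(\<lambda>j. dist (f x) (d j)) ` {..i} \<noteq> {}" by auto
    from Min_in[OF this] obtain j where "j \<in> {..i}" "Min ((\<lambda>j. dist (f x) (d j)) ` {..i}) = dist (f x) (d j)"
      by (elim imageE)
    moreover have "Min ((\<lambda>j. dist (f x) (d j)) ` {..i}) \<le> dist (f x) (d k)" if "k \<in> {..i}" for k
      using that by (intro Min_le) auto
    ultimately show ?thesis unfolding P_def by auto
  qed
  have PJ: "P i x (J i x)" for i x unfolding J_def by (rule LeastI_ex[OF ex])
  have [measurable]: "Measurable.pred M (\<lambda>x. P i x j)" for i j unfolding P_def by measurable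
  have J_meas: "J i \<in> measurable M (count_space UNIV)" for i unfolding J_def by measurable
  have "simple_function M (J i)" for i
    unfolding simple_function_def
  proof (intro conjI ballI)
    have "J i ` space M \<subseteq> {..i}" using PJ by (auto simp: P_def)
    then show "finite (J i ` space M)" by (rule finite_subset) simp
    show "J i -` {x} \<inter> space M \<in> sets M" for x by (rule measurable_sets[OF J_meas]) simp
  qed
  then have "simple_function M (\<lambda>x. d (J i x))" for i by (rule simple_function_compose1)
  moreover have "(\<lambda>i. d (J i x)) \<longlonglongrightarrow> f x" if x: "x \<in> space M" for x
  proof (rule metric_LIMSEQ_I)
    fix e :: real assume "e > 0"
    then obtain j where j: "dist (d j) (f x) < e" using cl[OF x] by (auto simp: closure_approachable)
    have "dist (d (J i x)) (f x) < e" if "i \<ge> j" for i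
    proof -
      have "dist (f x) (d (J i x)) \<le> dist (f x) (d j)" using PJ[of i x] that by (auto simp: P_def)
      then show ?thesis using j by (simp add: dist_commute)
    qed
    then show "\<exists>no. \<forall>n\<ge>no. dist (d (J n x)) (f x) < e" by blast
  qed
  ultimately show ?thesis unfolding strongly_measurable_def
    by (intro exI[of _ "\<lambda>i x. d (J i x)"]) blast
qed

lemma strongly_measurable_separable_range:
  fixes f :: "'x \<Rightarrow> 'e::real_normed_vector"
  assumes "strongly_measurable M f"
  obtains d :: "nat \<Rightarrow> 'e" where "\<And>x. x \<in> space M \<Longrightarrow> f x \<in> closure (range d)"
proof -
  obtain s where s: "\<And>i::nat. simple_function M (s i)" "\<And>x. x \<in> space M \<Longrightarrow> (\<lambda>i. s i x) \<longlonglongrightarrow> f x"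
    using assms unfolding strongly_measurable_def by blast
  \<comment> \<open>The inserted \<open>0\<close> keeps \<open>D\<close> nonempty, so
    \<open>from_nat_into\<close> enumerates exactly \<open>D\<close>; the same device recurs
    below.\<close>
  define D where "D = insert 0 (\<Union>i. s i ` space M)"
  have "countable D" unfolding D_def using s(1)
    by (simp add: simple_function_def countable_finite)
  then have D: "range (from_nat_into D) = D" by (intro range_from_nat_into) (auto simp: D_def)
  have "f x \<in> closure D" if "x \<in> space M" for x
    by (rule closed_sequentially[OF closed_closure _ s(2)[OF that]]) (use that in \<open>auto simp: D_def intro!: closure_subset[THEN subsetD]\<close>)
  then show thesis using that[of "from_nat_into D"] D by simp
qed

lemma borel_measurable_compose_continuous:
  fixes h :: "'a::topological_space \<Rightarrow> 'b::topological_space"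
  assumes "f \<in> borel_measurable M" "continuous_on UNIV h"
  shows "(\<lambda>x. h (f x)) \<in> borel_measurable M"
  by (rule measurable_compose[OF assms(1) borel_measurable_continuous_onI[OF assms(2)]])

text \<open>The distance criterion replaces a diagonal argument: the separable ranges are joined
  into a single one, and the distance to a fixed point passes to the limit.\<close>

lemma strongly_measurable_LIMSEQ:
  fixes f :: "'x \<Rightarrow> 'e::real_normed_vector"
  assumes g: "\<And>i::nat. strongly_measurable M (g i)"
    and lim: "\<And>x. x \<in> space M \<Longrightarrow> (\<lambda>i. g i x) \<longlonglongrightarrow> f x"
  shows "strongly_measurable M f"
proof -
  have "\<exists>d :: nat \<Rightarrow> 'e. \<forall>x\<in>space M. g i x \<in> closure (range d)" for i
    using strongly_measurable_separable_range[OF g] by metis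
  then obtain d :: "nat \<Rightarrow> nat \<Rightarrow> 'e" where d: "\<And>i x. x \<in> space M \<Longrightarrow> g i x \<in> closure (range (d i))"
    by metis
  define c where "c n = (case prod_decode n of (i, j) \<Rightarrow> d i j)" for n
  have sub: "range (d i) \<subseteq> range c" for i
  proof
    fix y assume "y \<in> range (d i)"
    then obtain j where "y = d i j" by auto
    then have "y = c (prod_encode (i, j))" by (simp add: c_def)
    then show "y \<in> range c" by blast
  qed
  show ?thesis
  proof (rule strongly_measurableI_dist[where d = c])
    fix x assume x: "x \<in> space M"
    show "f x \<in> closure (range c)"
      by (rule closed_sequentially[OF closed_closure _ lim[OF x]])
         (use d[OF x] closure_mono[OF sub] in blast)
  next
    fix j
    show "(\<lambda>x. dist (f x) (c j)) \<in> borel_measurable M"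
    proof (rule borel_measurable_LIMSEQ_real)
      show "(\<lambda>i. dist (g i x) (c j)) \<longlonglongrightarrow> dist (f x) (c j)" if "x \<in> space M" for x
        by (intro tendsto_intros lim that)
      show "(\<lambda>x. dist (g i x) (c j)) \<in> borel_measurable M" for i
        by (rule borel_measurable_compose_continuous[OF strongly_measurable_imp_borel_measurable[OF g]])
           (intro continuous_intros)
    qed
  qed
qed

lemma strongly_measurable_compose:
  fixes f :: "'x \<Rightarrow> 'e::real_normed_vector" and h :: "'e \<Rightarrow> 'g::real_normed_vector"
  assumes "strongly_measurable M f" "continuous_on UNIV h"
  shows "strongly_measurable M (\<lambda>x. h (f x))"
proof -
  obtain s where s: "\<And>i::nat. simple_function M (s i)" "\<And>x. x \<in> space M \<Longrightarrow> (\<lambda>i. s i x) \<longlonglongrightarrow> f x"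
    using assms(1) unfolding strongly_measurable_def by blast
  have "(\<lambda>i. h (s i x)) \<longlonglongrightarrow> h (f x)" if "x \<in> space M" for x
    by (rule continuous_on_tendsto_compose[OF assms(2) s(2)[OF that]]) auto
  then show ?thesis unfolding strongly_measurable_def
    by (intro exI[of _ "\<lambda>i x. h (s i x)"]) (auto intro: simple_function_compose1[OF s(1)])
qed

lemma strongly_measurable_compose2:
  fixes f :: "'x \<Rightarrow> 'e::real_normed_vector" and g :: "'x \<Rightarrow> 'f::real_normed_vector"
    and h :: "'e \<Rightarrow> 'f \<Rightarrow> 'g::real_normed_vector"
  assumes "strongly_measurable M f" "strongly_measurable M g" "continuous_on UNIV (\<lambda>z. h (fst z) (snd z))"
  shows "strongly_measurable M (\<lambda>x. h (f x) (g x))"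
proof -
  obtain s where s: "\<And>i::nat. simple_function M (s i)" "\<And>x. x \<in> space M \<Longrightarrow> (\<lambda>i. s i x) \<longlonglongrightarrow> f x"
    using assms(1) unfolding strongly_measurable_def by blast
  obtain t where t: "\<And>i::nat. simple_function M (t i)" "\<And>x. x \<in> space M \<Longrightarrow> (\<lambda>i. t i x) \<longlonglongrightarrow> g x"
    using assms(2) unfolding strongly_measurable_def by blast
  have "(\<lambda>i. h (s i x) (t i x)) \<longlonglongrightarrow> h (f x) (g x)" if x: "x \<in> space M" for x
    using continuous_on_tendsto_compose[OF assms(3) tendsto_Pair[OF s(2)[OF x] t(2)[OF x]]] by simp
  then show ?thesis unfolding strongly_measurable_def
    by (intro exI[of _ "\<lambda>i x. h (s i x) (t i x)"]) (auto intro: simple_function_compose2[OF s(1) t(1)])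
qed

lemma strongly_measurable_add:
  "strongly_measurable M f \<Longrightarrow> strongly_measurable M g \<Longrightarrow> strongly_measurable M (\<lambda>x. f x + g x)"
  by (rule strongly_measurable_compose2[where h = "(+)"]) (assumption | intro continuous_intros)+

lemma strongly_measurable_diff:
  "strongly_measurable M f \<Longrightarrow> strongly_measurable M g \<Longrightarrow> strongly_measurable M (\<lambda>x. f x - g x)"
  by (rule strongly_measurable_compose2[where h = "(-)"]) (assumption | intro continuous_intros)+

lemma strongly_measurable_scaleR_const:
  "strongly_measurable M f \<Longrightarrow> strongly_measurable M (\<lambda>x. c *\<^sub>R f x)"
  by (rule strongly_measurable_compose[where h = "\<lambda>v. c *\<^sub>R v"]) (assumption | intro continuous_intros)+

lemma strongly_measurable_indicator:
  assumes "strongly_measurable M f" "A \<in> sets M"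
  shows "strongly_measurable M (\<lambda>x. indicat_real A x *\<^sub>R f x)"
  by (rule strongly_measurable_compose2[where h = "\<lambda>c v. c *\<^sub>R v"])
     (use assms in \<open>auto simp: strongly_measurable_iff_borel_measurable intro!: continuous_intros\<close>)

lemma strongly_measurable_norm:
  "strongly_measurable M f \<Longrightarrow> (\<lambda>x. norm (f x)) \<in> borel_measurable M"
  by (rule borel_measurable_compose_continuous[OF strongly_measurable_imp_borel_measurable])
     (auto intro: continuous_intros)

lemma strongly_measurable_blinfun:
  fixes \<phi> :: "'e::real_normed_vector \<Rightarrow>\<^sub>L real"
  shows "strongly_measurable M f \<Longrightarrow> (\<lambda>x. \<phi> (f x)) \<in> borel_measurable M"
  by (rule borel_measurable_compose_continuous[OF strongly_measurable_imp_borel_measurable])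
     (auto intro: continuous_intros)

lemma strongly_measurable_mono:
  assumes "strongly_measurable N f" "sets N \<subseteq> sets M" "space N = space M"
  shows "strongly_measurable M f"
  using assms unfolding strongly_measurable_def simple_function_def by (metis subsetD)

text \<open>Approximants are set to \<open>0\<close> where they exceed
  \<open>2 * norm (f x)\<close>. Where \<open>f x \<noteq> 0\<close> this eventually no longer
  happens, and where \<open>f x = 0\<close> it forces the value \<open>0\<close>. The bound makes
  dominated convergence available.\<close>

lemma strongly_measurable_dominated_simple:
  fixes f :: "'x \<Rightarrow> 'e::real_normed_vector"
  assumes "strongly_measurable M f"
  obtains s where "\<And>i::nat. simple_function M (s i)" "\<And>x. x \<in> space M \<Longrightarrow> (\<lambda>i. s i x) \<longlonglongrightarrow> f x"
    "\<And>i x. norm (s i x) \<le> 2 * norm (f x)"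
proof -
  obtain s where s: "\<And>i::nat. simple_function M (s i)" "\<And>x. x \<in> space M \<Longrightarrow> (\<lambda>i. s i x) \<longlonglongrightarrow> f x"
    using assms unfolding strongly_measurable_def by blast
  have [measurable]: "(\<lambda>x. norm (f x)) \<in> borel_measurable M" by (rule strongly_measurable_norm[OF assms])
  have [measurable]: "(\<lambda>x. norm (s i x)) \<in> borel_measurable M" for i
    by (rule strongly_measurable_norm[OF strongly_measurable_simple[OF s(1)]])
  define A where "A i = {x\<in>space M. norm (s i x) \<le> 2 * norm (f x)}" for i
  have A: "A i \<in> sets M" for i unfolding A_def by measurable
  define t where "t i x = (if x \<in> A i then s i x else 0)" for i x
  show thesis
  proof (rule that[of t])
    have "simple_function M (\<lambda>x. indicat_real (A i) x *\<^sub>R s i x)" for i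
      by (rule simple_function_compose2[where h = "\<lambda>c v. c *\<^sub>R v", OF simple_function_indicator[OF A] s(1)])
    moreover have "(\<lambda>x. indicat_real (A i) x *\<^sub>R s i x) = t i" for i by (auto simp: t_def)
    ultimately show "simple_function M (t i)" for i by metis
    show "norm (t i x) \<le> 2 * norm (f x)" for i x by (simp add: t_def A_def)
    show "(\<lambda>i. t i x) \<longlonglongrightarrow> f x" if x: "x \<in> space M" for x
    proof (cases "f x = 0")
      case True
      then have "t i x = 0" for i by (auto simp: t_def A_def)
      then show ?thesis using True by simp
    next
      case False
      have "eventually (\<lambda>i. norm (s i x) < 2 * norm (f x)) sequentially"
        using False by (intro order_tendstoD[OF tendsto_norm[OF s(2)[OF x]]]) simp
      then have "eventually (\<lambda>i. s i x = t i x) sequentially"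
        by eventually_elim (use x in \<open>simp add: t_def A_def\<close>)
      then show ?thesis using tendsto_cong s(2)[OF x] by force
    qed
  qed
qed

section \<open>Bochner integrability and conditional expectation on finite measure spaces\<close>

context finite_measure begin

lemma simple_bochner_integrable_iff_simple:
  "Bochner_Integration.simple_bochner_integrable M f \<longleftrightarrow> simple_function M f"
  by (auto simp: simple_bochner_integrable.simps)

text \<open>On a finite measure space every simple function is integrable. For the direction from
  right to left, dominated simple approximants converge in mean, and completeness of the range space
  supplies the limit of their integrals.\<close>

lemma Bochner_integrable_iff:
  fixes f :: "'a \<Rightarrow> 'e::banach"
  shows "Bochner_integrable M f \<longleftrightarrow> strongly_measurable M f \<and> integrable M (\<lambda>x. norm (f x))"
proof safe
  assume "Bochner_integrable M f"
  then obtain v s where f: "strongly_measurable M f" and s: "\<And>i::nat. simple_function M (s i)"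
    and lim: "(\<lambda>i. \<integral>\<^sup>+x. norm (f x - s i x) \<partial>M) \<longlonglongrightarrow> 0"
    unfolding Bochner_integrable_def has_Bochner_integral_def simple_bochner_integrable_iff_simple by blast
  show "strongly_measurable M f" by (rule f)
  have "eventually (\<lambda>i. (\<integral>\<^sup>+x. norm (f x - s i x) \<partial>M) < 1) sequentially"
    by (rule order_tendstoD(2)[OF lim]) simp
  then obtain i where i: "(\<integral>\<^sup>+x. norm (f x - s i x) \<partial>M) < 1" by (auto simp: eventually_sequentially)
  note si = strongly_measurable_simple[OF s[of i]]
  have "integrable M (\<lambda>x. norm (f x - s i x))"
  proof (rule integrableI_bounded)
    show "(\<lambda>x. norm (f x - s i x)) \<in> borel_measurable M"
      by (rule strongly_measurable_norm[OF strongly_measurable_diff[OF f si]])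
    show "(\<integral>\<^sup>+ x. ennreal (norm (norm (f x - s i x))) \<partial>M) < \<infinity>"
      using i by (simp add: order_less_trans)
  qed
  moreover have "integrable M (\<lambda>x. norm (s i x))"
  proof -
    have "finite (s i ` space M)" using s[of i] by (simp add: simple_function_def)
    then obtain b where "\<And>x. x \<in> space M \<Longrightarrow> norm (s i x) \<le> b"
      using finite_imp_bounded[of "s i ` space M"] by (auto simp: bounded_iff)
    then show ?thesis
      by (intro integrable_const_bound[of _ b] strongly_measurable_norm[OF si] AE_I2) auto
  qed
  ultimately have "integrable M (\<lambda>x. norm (f x - s i x) + norm (s i x))" by simp
  then show "integrable M (\<lambda>x. norm (f x))"
    by (rule Bochner_Integration.integrable_bound)
       (auto intro!: strongly_measurable_norm[OF f] AE_I2 simp: norm_triangle_sub add.commute)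
next
  assume f: "strongly_measurable M f" and int: "integrable M (\<lambda>x. norm (f x))"
  obtain s where s: "\<And>i::nat. simple_function M (s i)" "\<And>x. x \<in> space M \<Longrightarrow> (\<lambda>i. s i x) \<longlonglongrightarrow> f x"
    and sle: "\<And>i x. norm (s i x) \<le> 2 * norm (f x)"
    by (rule strongly_measurable_dominated_simple[OF f]) blast
  let ?S = "\<lambda>i. Bochner_Integration.simple_bochner_integral M (s i)"
  have meas: "(\<lambda>x. norm (f x - s i x)) \<in> borel_measurable M" for i
    by (rule strongly_measurable_norm[OF strongly_measurable_diff[OF f strongly_measurable_simple[OF s(1)]]])
  \<comment> \<open>\<open>3 = 1 + 2\<close>, the \<open>2\<close> being the domination of the
    approximants.\<close>
  have le: "norm (f x - s i x) \<le> 3 * norm (f x)" for i x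
    using norm_triangle_ineq4[of "f x" "s i x"] sle[of i x] by simp
  have int_diff: "integrable M (\<lambda>x. norm (f x - s i x))" for i
    by (rule Bochner_Integration.integrable_bound[of _ "\<lambda>x. 3 * norm (f x)"])
       (use int meas le in \<open>auto\<close>)
  have lim: "(\<lambda>i. \<integral>x. norm (f x - s i x) \<partial>M) \<longlonglongrightarrow> (\<integral>x. 0 \<partial>M)"
  proof (rule integral_dominated_convergence[where w = "\<lambda>x. 3 * norm (f x)"])
    show "AE x in M. (\<lambda>i. norm (f x - s i x)) \<longlonglongrightarrow> 0"
    proof (rule AE_I2)
      fix x assume "x \<in> space M"
      from tendsto_norm[OF tendsto_diff[OF tendsto_const s(2)[OF this], of "f x"]]
      show "(\<lambda>i. norm (f x - s i x)) \<longlonglongrightarrow> 0" by simp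
    qed
  qed (use int meas le in auto)
  have "norm (?S i - ?S j) \<le> (\<integral>x. norm (f x - s i x) \<partial>M) + (\<integral>x. norm (f x - s j x) \<partial>M)" for i j
  proof -
    have sb: "Bochner_Integration.simple_bochner_integrable M (s i)" for i
      using s(1) by (simp add: simple_bochner_integrable_iff_simple)
    have sd: "Bochner_Integration.simple_bochner_integrable M (\<lambda>x. s i x - s j x)"
      using simple_function_compose2[OF s(1) s(1), of "(-)"] by (simp add: simple_bochner_integrable_iff_simple)
    have "norm (?S i - ?S j) \<le> Bochner_Integration.simple_bochner_integral M (\<lambda>x. norm (s i x - s j x))"
      using simple_bochner_integral_norm_bound[OF sd] simple_bochner_integral_diff[OF sb sb] by simp
    also have "\<dots> = (\<integral>x. norm (s i x - s j x) \<partial>M)"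
    proof -
      have "Bochner_Integration.simple_bochner_integrable M (\<lambda>x. norm (s i x - s j x))"
        using simple_function_compose2[OF s(1) s(1), of "\<lambda>a b. norm (a - b)"]
        by (simp add: simple_bochner_integrable_iff_simple)
      from has_bochner_integral_simple_bochner_integrable[OF this]
      show ?thesis by (rule has_bochner_integral_integral_eq[symmetric])
    qed
    also have "\<dots> \<le> (\<integral>x. norm (f x - s i x) + norm (f x - s j x) \<partial>M)"
    proof (rule integral_mono')
      show "integrable M (\<lambda>x. norm (f x - s i x) + norm (f x - s j x))" using int_diff by simp
      show "norm (s i x - s j x) \<le> norm (f x - s i x) + norm (f x - s j x)" for x
        using norm_triangle_ineq4[of "f x - s j x" "f x - s i x"] by simp
    qed simp
    finally show ?thesis using int_diff by simp
  qed
  note S_diff = this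
  have "Cauchy ?S"
  proof (rule metric_CauchyI)
    fix e :: real assume "e > 0"
    then have "eventually (\<lambda>i. (\<integral>x. norm (f x - s i x) \<partial>M) < e / 2) sequentially"
      using lim by (intro order_tendstoD(2)[OF lim]) simp
    then obtain N where N: "\<And>i. i \<ge> N \<Longrightarrow> (\<integral>x. norm (f x - s i x) \<partial>M) < e / 2"
      by (auto simp: eventually_sequentially)
    have "dist (?S i) (?S j) < e" if "i \<ge> N" "j \<ge> N" for i j
      using S_diff[of i j] N[OF that(1)] N[OF that(2)] by (simp add: dist_norm)
    then show "\<exists>N. \<forall>i\<ge>N. \<forall>j\<ge>N. dist (?S i) (?S j) < e" by blast
  qed
  then obtain v where "?S \<longlonglongrightarrow> v" using Cauchy_convergent by (auto simp: convergent_def)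
  moreover have "(\<lambda>i. \<integral>\<^sup>+x. norm (f x - s i x) \<partial>M) \<longlonglongrightarrow> 0"
  proof -
    have "(\<integral>\<^sup>+x. norm (f x - s i x) \<partial>M) = ennreal (\<integral>x. norm (f x - s i x) \<partial>M)" for i
      by (rule nn_integral_eq_integral[OF int_diff]) simp
    then show ?thesis using tendsto_ennrealI[OF lim] by simp
  qed
  ultimately show "Bochner_integrable M f"
    unfolding Bochner_integrable_def has_Bochner_integral_def simple_bochner_integrable_iff_simple
    using f s(1) by blast
qed

lemma Bochner_integrableI_bound:
  fixes f :: "'a \<Rightarrow> 'e::banach"
  assumes "strongly_measurable M f" "integrable M g" "AE x in M. norm (f x) \<le> g x"
  shows "Bochner_integrable M f"
  unfolding Bochner_integrable_iff
  using assms by (auto intro!: Bochner_Integration.integrable_bound[OF assms(2) strongly_measurable_norm])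

lemma Bochner_integrable_scaleR:
  fixes f :: "'a \<Rightarrow> 'e::banach"
  shows "Bochner_integrable M f \<Longrightarrow> Bochner_integrable M (\<lambda>x. c *\<^sub>R f x)"
  by (auto simp: Bochner_integrable_iff intro: strongly_measurable_scaleR_const)

lemma Bochner_integrable_add:
  fixes f g :: "'a \<Rightarrow> 'e::banach"
  assumes "Bochner_integrable M f" "Bochner_integrable M g"
  shows "Bochner_integrable M (\<lambda>x. f x + g x)"
  by (rule Bochner_integrableI_bound[where g = "\<lambda>x. norm (f x) + norm (g x)"])
     (use assms in \<open>auto simp: Bochner_integrable_iff norm_triangle_ineq intro: strongly_measurable_add\<close>)

lemma Bochner_integrable_diff:
  fixes f g :: "'a \<Rightarrow> 'e::banach"
  assumes "Bochner_integrable M f" "Bochner_integrable M g"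
  shows "Bochner_integrable M (\<lambda>x. f x - g x)"
  using Bochner_integrable_add[OF assms(1) Bochner_integrable_scaleR[OF assms(2), of "-1"]] by simp

lemma Bochner_integrable_simple:
  fixes f :: "'a \<Rightarrow> 'e::banach"
  assumes "simple_function M f"
  shows "Bochner_integrable M f"
proof -
  have "finite (f ` space M)" using assms by (simp add: simple_function_def)
  then obtain b where "\<And>x. x \<in> space M \<Longrightarrow> norm (f x) \<le> b"
    using finite_imp_bounded[of "f ` space M"] by (auto simp: bounded_iff)
  then show ?thesis
    by (intro Bochner_integrableI_bound[where g = "\<lambda>_. b"] strongly_measurable_simple[OF assms]) auto
qed

lemma Bochner_integrable_indicator:
  fixes f :: "'a \<Rightarrow> 'e::banach"
  assumes "Bochner_integrable M f" "A \<in> sets M"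
  shows "Bochner_integrable M (\<lambda>x. indicat_real A x *\<^sub>R f x)"
  by (rule Bochner_integrableI_bound[where g = "\<lambda>x. norm (f x)"])
     (use assms strongly_measurable_indicator[of M f A] in \<open>auto simp: Bochner_integrable_iff intro!: AE_I2 mult_left_le_one_le\<close>)

lemma integrable_blinfun:
  fixes f :: "'a \<Rightarrow> 'e::banach" and \<phi> :: "'e \<Rightarrow>\<^sub>L real"
  assumes "Bochner_integrable M f"
  shows "integrable M (\<lambda>x. \<phi> (f x))"
  by (rule Bochner_Integration.integrable_bound[of _ "\<lambda>x. norm \<phi> * norm (f x)"])
     (use assms in \<open>auto simp: Bochner_integrable_iff strongly_measurable_blinfun intro!: AE_I2 norm_blinfun[of \<phi>, unfolded real_norm_def]\<close>)

lemma has_Bochner_integral_blinfun: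
  fixes f :: "'a \<Rightarrow> 'e::banach" and \<phi> :: "'e \<Rightarrow>\<^sub>L real"
  assumes "has_Bochner_integral M f v"
  shows "(\<integral>x. \<phi> (f x) \<partial>M) = \<phi> v"
proof -
  obtain s where f: "strongly_measurable M f" and s: "\<And>i::nat. simple_function M (s i)"
    and lim: "(\<lambda>i. \<integral>\<^sup>+x. norm (f x - s i x) \<partial>M) \<longlonglongrightarrow> 0"
    and lim_v: "(\<lambda>i. Bochner_Integration.simple_bochner_integral M (s i)) \<longlonglongrightarrow> v"
    using assms unfolding has_Bochner_integral_def simple_bochner_integrable_iff_simple by blast
  have "has_bochner_integral M (\<lambda>x. \<phi> (f x)) (\<phi> v)"
  proof (rule has_bochner_integral.intros[where s = "\<lambda>i x. \<phi> (s i x)"])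
    show "(\<lambda>x. \<phi> (f x)) \<in> borel_measurable M" by (rule strongly_measurable_blinfun[OF f])
    show "Bochner_Integration.simple_bochner_integrable M (\<lambda>x. \<phi> (s i x))" for i
      unfolding simple_bochner_integrable_iff_simple by (rule simple_function_compose1[OF s])
    have le: "ennreal (norm (\<phi> (f x) - \<phi> (s i x))) \<le> ennreal (norm \<phi>) * ennreal (norm (f x - s i x))" for i x
    proof -
      have "norm (\<phi> (f x) - \<phi> (s i x)) \<le> norm \<phi> * norm (f x - s i x)"
        using norm_blinfun[of \<phi> "f x - s i x"] by (simp only: blinfun.diff_right)
      then have "ennreal (norm (\<phi> (f x) - \<phi> (s i x))) \<le> ennreal (norm \<phi> * norm (f x - s i x))"
        by (rule ennreal_leI)
      also have "\<dots> = ennreal (norm \<phi>) * ennreal (norm (f x - s i x))"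
        by (rule ennreal_mult) simp_all
      finally show ?thesis .
    qed
    have upper: "(\<integral>\<^sup>+x. norm (\<phi> (f x) - \<phi> (s i x)) \<partial>M) \<le> ennreal (norm \<phi>) * (\<integral>\<^sup>+x. norm (f x - s i x) \<partial>M)" for i
    proof -
      have "(\<lambda>x. ennreal (norm (f x - s i x))) \<in> borel_measurable M"
        by (rule measurable_compose[OF strongly_measurable_norm[OF strongly_measurable_diff[OF f strongly_measurable_simple[OF s[of i]]]] measurable_ennreal])
      then have "ennreal (norm \<phi>) * (\<integral>\<^sup>+x. norm (f x - s i x) \<partial>M) = (\<integral>\<^sup>+x. ennreal (norm \<phi>) * norm (f x - s i x) \<partial>M)"
        by (rule nn_integral_cmult[symmetric])
      then show ?thesis by (simp only:) (rule nn_integral_mono, rule le)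
    qed
    have upper_lim: "(\<lambda>i. ennreal (norm \<phi>) * (\<integral>\<^sup>+x. norm (f x - s i x) \<partial>M)) \<longlonglongrightarrow> ennreal (norm \<phi>) * 0"
      by (rule ennreal_tendsto_cmult[OF ennreal_less_top lim])
    show "(\<lambda>i. \<integral>\<^sup>+x. norm (\<phi> (f x) - \<phi> (s i x)) \<partial>M) \<longlonglongrightarrow> 0"
    proof (rule tendsto_sandwich[OF _ _ tendsto_const])
      show "(\<lambda>i. ennreal (norm \<phi>) * (\<integral>\<^sup>+x. norm (f x - s i x) \<partial>M)) \<longlonglongrightarrow> 0"
        using upper_lim by (simp only: mult_zero_right)
    qed (use upper in \<open>auto intro!: always_eventually\<close>)
    have "Bochner_Integration.simple_bochner_integral M (\<lambda>x. \<phi> (s i x))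
        = \<phi> (Bochner_Integration.simple_bochner_integral M (s i))" for i
      by (rule simple_bochner_integral_linear)
         (auto simp: simple_bochner_integrable_iff_simple s blinfun.bounded_linear_right intro: bounded_linear.linear)
    then show "(\<lambda>i. Bochner_Integration.simple_bochner_integral M (\<lambda>x. \<phi> (s i x))) \<longlonglongrightarrow> \<phi> v"
      using blinfun.tendsto[OF tendsto_const lim_v, of \<phi>] by simp
  qed
  then show ?thesis by (rule has_bochner_integral_integral_eq)
qed

text \<open>Once integrability is known, functionals separate the candidates for the integral, so
  vector valued identities become scalar ones.\<close>

lemma has_Bochner_integral_iff_blinfun:
  fixes f :: "'a \<Rightarrow> 'e::banach"
  assumes "Bochner_integrable M f"
  shows "has_Bochner_integral M f v \<longleftrightarrow> (\<forall>\<phi> :: 'e \<Rightarrow>\<^sub>L real. (\<integral>x. \<phi> (f x) \<partial>M) = \<phi> v)"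
proof
  show "\<forall>\<phi> :: 'e \<Rightarrow>\<^sub>L real. (\<integral>x. \<phi> (f x) \<partial>M) = \<phi> v" if "has_Bochner_integral M f v"
    using has_Bochner_integral_blinfun[OF that] by blast
  assume *: "\<forall>\<phi> :: 'e \<Rightarrow>\<^sub>L real. (\<integral>x. \<phi> (f x) \<partial>M) = \<phi> v"
  obtain w where w: "has_Bochner_integral M f w" using assms by (auto simp: Bochner_integrable_def)
  have "w = v" by (rule functionals_separate) (simp add: *[rule_format, symmetric] has_Bochner_integral_blinfun[OF w])
  then show "has_Bochner_integral M f v" using w by simp
qed

text \<open>The working form of conditional expectations: only integrals of real functions occur,
  and vector valued integrals need not be handled afterwards.\<close>

lemma is_cond_exp_iff:
  fixes f g :: "'a \<Rightarrow> 'e::banach"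
  assumes "sets G \<subseteq> sets M"
  shows "is_cond_exp M G f g \<longleftrightarrow>
    Bochner_integrable M f \<and> Bochner_integrable M g \<and> strongly_measurable G g \<and>
    (\<forall>A\<in>sets G. \<forall>\<phi> :: 'e \<Rightarrow>\<^sub>L real. (LINT x:A|M. \<phi> (f x)) = (LINT x:A|M. \<phi> (g x)))"
proof -
  have "(\<exists>v. has_Bochner_integral M (\<lambda>x. indicator A x *\<^sub>R f x) v \<and> has_Bochner_integral M (\<lambda>x. indicator A x *\<^sub>R g x) v)
     \<longleftrightarrow> (\<forall>\<phi> :: 'e \<Rightarrow>\<^sub>L real. (LINT x:A|M. \<phi> (f x)) = (LINT x:A|M. \<phi> (g x)))"
    if fg: "Bochner_integrable M f" "Bochner_integrable M g" and A: "A \<in> sets G" for A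
  proof -
    have A: "A \<in> sets M" using A assms by auto
    note fA = Bochner_integrable_indicator[OF fg(1) A] and gA = Bochner_integrable_indicator[OF fg(2) A]
    obtain v where v: "has_Bochner_integral M (\<lambda>x. indicator A x *\<^sub>R f x) v"
      using fA unfolding Bochner_integrable_def by blast
    have "(\<exists>v. has_Bochner_integral M (\<lambda>x. indicator A x *\<^sub>R f x) v \<and> has_Bochner_integral M (\<lambda>x. indicator A x *\<^sub>R g x) v)
      \<longleftrightarrow> has_Bochner_integral M (\<lambda>x. indicator A x *\<^sub>R g x) v"
      using v has_Bochner_integral_unique by blast
    also have "\<dots> \<longleftrightarrow> (\<forall>\<phi> :: 'e \<Rightarrow>\<^sub>L real. (LINT x|M. \<phi> (indicator A x *\<^sub>R g x)) = (LINT x|M. \<phi> (indicator A x *\<^sub>R f x)))"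
      unfolding has_Bochner_integral_iff_blinfun[OF gA] has_Bochner_integral_blinfun[OF v] by simp
    also have "\<dots> \<longleftrightarrow> (\<forall>\<phi> :: 'e \<Rightarrow>\<^sub>L real. (LINT x:A|M. \<phi> (f x)) = (LINT x:A|M. \<phi> (g x)))"
      unfolding set_lebesgue_integral_def blinfun.scaleR_right by (auto simp: eq_commute)
    finally show ?thesis .
  qed
  then show ?thesis unfolding is_cond_exp_def by blast
qed

text \<open>Conditional contraction of the norm. On the level sets of a \<open>G\<close>-simple
  approximation \<open>s i\<close> of \<open>g\<close>, a functional norming the constant value can
  be moved from \<open>g\<close> to \<open>f\<close> by the conditional expectation property.
  Replacing \<open>g\<close> by \<open>s i\<close> costs the error in mean twice, hence the bound
  \<open>e / 2\<close> on it.\<close>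

lemma cond_exp_norm_le:
  fixes f g :: "'a \<Rightarrow> 'e::banach"
  assumes G: "sets G \<subseteq> sets M" "space G = space M" and ce: "is_cond_exp M G f g" and A: "A \<in> sets G"
  shows "(LINT x:A|M. norm (g x)) \<le> (LINT x:A|M. norm (f x))"
proof (rule field_le_epsilon)
  fix e :: real assume e: "e > 0"
  have f: "Bochner_integrable M f" and g: "Bochner_integrable M g" and gG: "strongly_measurable G g"
    and eq: "\<And>A (\<phi> :: 'e \<Rightarrow>\<^sub>L real). A \<in> sets G \<Longrightarrow> (LINT x:A|M. \<phi> (f x)) = (LINT x:A|M. \<phi> (g x))"
    using ce unfolding is_cond_exp_iff[OF G(1)] by blast+
  have AM [measurable]: "A \<in> sets M" using A G by auto
  obtain s where s: "\<And>i::nat. simple_function G (s i)" "\<And>x. x \<in> space G \<Longrightarrow> (\<lambda>i. s i x) \<longlonglongrightarrow> g x"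
    and sle: "\<And>i x. norm (s i x) \<le> 2 * norm (g x)"
    by (rule strongly_measurable_dominated_simple[OF gG]) blast
  have sM: "simple_function M (s i)" for i using s(1)[of i] G unfolding simple_function_def by auto
  have fn: "integrable M (\<lambda>x. norm (f x))" and gn: "integrable M (\<lambda>x. norm (g x))"
    and gsn: "integrable M (\<lambda>x. norm (g x - s i x))" and sn: "integrable M (\<lambda>x. norm (s i x))" for i
    using f g Bochner_integrable_diff[OF g Bochner_integrable_simple[OF sM[of i]]]
      Bochner_integrable_simple[OF sM[of i]] by (auto simp: Bochner_integrable_iff)
  have lim: "(\<lambda>i. \<integral>x. norm (g x - s i x) \<partial>M) \<longlonglongrightarrow> (\<integral>x. 0 \<partial>M)"
  proof (rule integral_dominated_convergence[where w = "\<lambda>x. 3 * norm (g x)"])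
    show "AE x in M. (\<lambda>i. norm (g x - s i x)) \<longlonglongrightarrow> 0"
    proof (rule AE_I2)
      fix x assume "x \<in> space M"
      then have "x \<in> space G" using G by simp
      from tendsto_norm[OF tendsto_diff[OF tendsto_const s(2)[OF this], of "g x"]]
      show "(\<lambda>i. norm (g x - s i x)) \<longlonglongrightarrow> 0" by simp
    qed
    show "AE x in M. norm (norm (g x - s i x)) \<le> 3 * norm (g x)" for i
    proof (rule AE_I2)
      fix x
      show "norm (norm (g x - s i x)) \<le> 3 * norm (g x)"
        using norm_triangle_ineq4[of "g x" "s i x"] sle[of i x] by simp
    qed
  qed (use gn gsn in auto)
  have "eventually (\<lambda>i. (\<integral>x. norm (g x - s i x) \<partial>M) < e / 2) sequentially"
    using e by (intro order_tendstoD(2)[OF lim]) simp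
  then obtain i where i: "(\<integral>x. norm (g x - s i x) \<partial>M) < e / 2" by (auto simp: eventually_sequentially)
  obtain N :: "'e \<Rightarrow> 'e \<Rightarrow>\<^sub>L real" where N: "\<And>v. norm (N v) \<le> 1" "\<And>v. N v v = norm v"
    using norming_functional by metis
  define R where "R = s i ` space M"
  define B where "B r = A \<inter> (s i -` {r} \<inter> space M)" for r
  have R: "finite R" using sM[of i] by (simp add: R_def simple_function_def)
  have BG: "B r \<in> sets G" for r
  proof -
    have "s i -` {r} \<inter> space G \<in> sets G"
      using simple_functionD(2)[OF s(1)] by blast
    then show ?thesis using A G by (auto simp: B_def)
  qed
  then have BM: "B r \<in> sets M" for r using G by auto
  \<comment> \<open>\<open>N (s i x)\<close> takes finitely many values, each on a set of
    \<open>G\<close> inside \<open>A\<close>, which reduces a functional depending on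
    \<open>x\<close> to fixed ones.\<close>
  have split: "(LINT x:A|M. N (s i x) (h x)) = (\<Sum>r\<in>R. LINT x:B r|M. N r (h x))"
    if h: "Bochner_integrable M h" for h
  proof -
    have "(LINT x:A|M. N (s i x) (h x)) = (LINT x|M. (\<Sum>r\<in>R. indicator (B r) x *\<^sub>R N r (h x)))"
      unfolding set_lebesgue_integral_def
    proof (rule Bochner_Integration.integral_cong[OF refl])
      fix x assume x: "x \<in> space M"
      have "(\<Sum>r\<in>R. indicator (B r) x *\<^sub>R N r (h x)) = (\<Sum>r\<in>R. if r = s i x then indicator A x *\<^sub>R N r (h x) else 0)"
        using x by (intro sum.cong) (auto simp: B_def indicator_def)
      then show "indicator A x *\<^sub>R N (s i x) (h x) = (\<Sum>r\<in>R. indicator (B r) x *\<^sub>R N r (h x))"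
        using R x by (simp add: R_def)
    qed
    also have "\<dots> = (\<Sum>r\<in>R. LINT x:B r|M. N r (h x))"
      unfolding set_lebesgue_integral_def
      by (intro Bochner_Integration.integral_sum integrable_mult_indicator integrable_blinfun h BM)
    finally show ?thesis .
  qed
  have meas: "integrable M (\<lambda>x. N (s i x) (h x))" if h: "Bochner_integrable M h" for h
  proof -
    have "integrable M (\<lambda>x. \<Sum>r\<in>R. indicator (s i -` {r} \<inter> space M) x *\<^sub>R N r (h x))"
      using simple_functionD(2)[OF sM[of i]]
      by (intro Bochner_Integration.integrable_sum integrable_mult_indicator integrable_blinfun h) auto
    moreover have "(\<Sum>r\<in>R. indicator (s i -` {r} \<inter> space M) x *\<^sub>R N r (h x)) = N (s i x) (h x)"
      if x: "x \<in> space M" for x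
    proof -
      have "(\<Sum>r\<in>R. indicator (s i -` {r} \<inter> space M) x *\<^sub>R N r (h x)) = (\<Sum>r\<in>R. if r = s i x then N r (h x) else 0)"
        using x by (intro sum.cong) (auto simp: indicator_def)
      then show ?thesis using R x by (simp add: R_def)
    qed
    ultimately show ?thesis
      by (subst (asm) Bochner_Integration.integrable_cong[OF refl])
  qed
  have setint: "set_integrable M A h" if "integrable M h" for h :: "'a \<Rightarrow> real"
    using that AM unfolding set_integrable_def by (rule integrable_mult_indicator[rotated])
  have "(LINT x:A|M. norm (g x)) \<le> (LINT x:A|M. norm (s i x) + norm (g x - s i x))"
    by (rule set_integral_mono)
       (use gn sn gsn in \<open>auto intro!: setint norm_triangle_sub\<close>)
  moreover have "\<dots> = (LINT x:A|M. norm (s i x)) + (LINT x:A|M. norm (g x - s i x))"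
    by (rule set_integral_add) (rule setint sn gsn)+
  moreover have "(LINT x:A|M. norm (s i x)) \<le> (LINT x:A|M. N (s i x) (g x) + norm (g x - s i x))"
  proof (rule set_integral_mono)
    show "set_integrable M A (\<lambda>x. norm (s i x))" by (rule setint[OF sn])
    show "set_integrable M A (\<lambda>x. N (s i x) (g x) + norm (g x - s i x))"
      by (rule setint[OF Bochner_Integration.integrable_add[OF meas[OF g] gsn]])
    fix x
    show "norm (s i x) \<le> N (s i x) (g x) + norm (g x - s i x)"
      using blinfun_le_norm[OF N(1), of "s i x" "g x - s i x"] N(2)[of "s i x"]
      by (simp add: blinfun.diff_right)
  qed
  moreover have "\<dots> = (LINT x:A|M. N (s i x) (g x)) + (LINT x:A|M. norm (g x - s i x))"
    by (rule set_integral_add[OF setint[OF meas[OF g]] setint[OF gsn]])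
  moreover have "(LINT x:A|M. N (s i x) (g x)) = (LINT x:A|M. N (s i x) (f x))"
    unfolding split[OF f] split[OF g] by (rule sum.cong[OF refl], rule eq[symmetric], rule BG)
  moreover have "\<dots> \<le> (LINT x:A|M. norm (f x))"
  proof (rule set_integral_mono[OF setint[OF meas[OF f]] setint[OF fn]])
    show "N (s i x) (f x) \<le> norm (f x)" for x
      using blinfun_le_norm[OF N(1), of "s i x" "f x"] by simp
  qed
  moreover have "(LINT x:A|M. norm (g x - s i x)) \<le> (\<integral>x. norm (g x - s i x) \<partial>M)"
    unfolding set_lebesgue_integral_def
    by (rule integral_mono'[OF gsn]) (auto simp: indicator_def)
  ultimately show "(LINT x:A|M. norm (g x)) \<le> (LINT x:A|M. norm (f x)) + e" using i by linarith
qed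

end

section \<open>Convergence in mean of convex combinations\<close>

lemma power2_diff_square_factor: "u\<^sup>2 - v\<^sup>2 = (u - v) * (u + v)" for u v :: real
  by (simp add: power2_eq_square algebra_simps)

text \<open>The function \<open>\<theta>\<close> grows linearly, so bounds in mean suffice to
  integrate it. Its second derivative is positive but decays like an inverse cube, which is the
  reason for the third power in the estimate.\<close>

lemma sqrt_convexity_gap:
  fixes a b :: real
  defines "\<theta> \<equiv> \<lambda>t::real. sqrt (1 + t\<^sup>2)"
  shows "0 \<le> (\<theta> a + \<theta> b) / 2 - \<theta> ((a + b) / 2)"
    and "(a - b)\<^sup>2 \<le> ((\<theta> a + \<theta> b) / 2 - \<theta> ((a + b) / 2)) * (\<theta> a + \<theta> b) ^ 3"
proof -
  define x y z where "x = \<theta> a" and "y = \<theta> b" and "z = 2 * \<theta> ((a + b) / 2)"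
  have x2: "x\<^sup>2 = 1 + a\<^sup>2" and y2: "y\<^sup>2 = 1 + b\<^sup>2" and z2: "z\<^sup>2 = 4 + (a + b)\<^sup>2"
    by (simp_all add: x_def y_def z_def \<theta>_def power_mult_distrib power_divide)
  have pos: "0 \<le> x" "0 \<le> y" "0 \<le> z" by (auto simp: x_def y_def z_def \<theta>_def)
  \<comment> \<open>Lagrange's identity for the vectors \<open>(1, a)\<close> and
    \<open>(1, b)\<close>; it yields the Cauchy-Schwarz bound \<open>cs\<close>.\<close>
  have lag: "(a - b)\<^sup>2 = (x * y)\<^sup>2 - (1 + a * b)\<^sup>2"
    unfolding power_mult_distrib x2 y2 by (simp add: power2_eq_square algebra_simps)
  then have "(1 + a * b)\<^sup>2 \<le> (x * y)\<^sup>2" using zero_le_power2[of "a - b"] by linarith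
  then have cs: "\<bar>1 + a * b\<bar> \<le> x * y"
    using abs_le_square_iff[of "1 + a * b" "x * y"] mult_nonneg_nonneg[OF pos(1,2)] by simp
  have S: "(x + y)\<^sup>2 - z\<^sup>2 = 2 * (x * y) - 2 * (1 + a * b)"
    using x2 y2 z2 power2_sum[of x y] power2_sum[of a b] by (simp only: mult.assoc) argo
  have zS: "z \<le> x + y"
  proof (rule power2_le_imp_le)
    show "z\<^sup>2 \<le> (x + y)\<^sup>2" using S cs by argo
  qed (use pos in simp)
  show "0 \<le> (\<theta> a + \<theta> b) / 2 - \<theta> ((a + b) / 2)" using zS unfolding x_def y_def z_def by argo
  define t where "t = 1 + a * b"
  have t: "\<bar>t\<bar> \<le> x * y" using cs by (simp add: t_def)
  \<comment> \<open>Two differences of squares: \<open>(a - b)\<^sup>2\<close> has the factor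
    \<open>x * y - t\<close>, and this in turn has the factor \<open>x + y - z\<close>, twice the
    gap.\<close>
  have 1: "(a - b)\<^sup>2 = (x * y - t) * (x * y + t)"
    unfolding lag t_def[symmetric] by (rule power2_diff_square_factor)
  have 2: "x * y - t = (x + y - z) / 2 * (x + y + z)"
    using S power2_diff_square_factor[of "x + y" z] unfolding t_def by simp
  have 3: "x * y + t \<le> (x + y)\<^sup>2 / 2"
  proof -
    have "0 \<le> (x - y)\<^sup>2" by simp
    then have "4 * (x * y) \<le> (x + y)\<^sup>2" unfolding power2_diff power2_sum by argo
    then show ?thesis using t by linarith
  qed
  have "(a - b)\<^sup>2 = (x + y - z) / 2 * ((x + y + z) * (x * y + t))"
    unfolding 1 2 by (rule mult.assoc)
  also have "\<dots> \<le> (x + y - z) / 2 * ((2 * (x + y)) * ((x + y)\<^sup>2 / 2))"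
  proof (rule mult_left_mono[OF mult_mono])
    show "x * y + t \<le> (x + y)\<^sup>2 / 2" by (rule 3)
    show "0 \<le> (x + y - z) / 2" "x + y + z \<le> 2 * (x + y)" "0 \<le> 2 * (x + y)" using zS pos by auto
    show "0 \<le> x * y + t" using t by linarith
  qed
  also have "(2 * (x + y)) * ((x + y)\<^sup>2 / 2) = (x + y) ^ 3"
    by (simp add: power3_eq_cube power2_eq_square)
  also have "(x + y - z) / 2 = (\<theta> a + \<theta> b) / 2 - \<theta> ((a + b) / 2)"
    unfolding x_def y_def z_def by argo
  finally show "(a - b)\<^sup>2 \<le> ((\<theta> a + \<theta> b) / 2 - \<theta> ((a + b) / 2)) * (\<theta> a + \<theta> b) ^ 3"
    by (simp only: x_def y_def)
qed

text \<open>By monotone convergence the sum has finite integral, hence it is finite almost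
  everywhere.\<close>

lemma AE_summable_of_integrals:
  fixes h :: "nat \<Rightarrow> 'a \<Rightarrow> real"
  assumes h: "\<And>i. integrable M (h i)" "\<And>i x. 0 \<le> h i x" and s: "summable (\<lambda>i. \<integral>x. h i x \<partial>M)"
  shows "AE x in M. summable (\<lambda>i. h i x)"
proof -
  have [measurable]: "h i \<in> borel_measurable M" for i using h(1) by auto
  have "(\<integral>\<^sup>+x. (\<Sum>i. ennreal (h i x)) \<partial>M) = (\<Sum>i. \<integral>\<^sup>+x. ennreal (h i x) \<partial>M)"
    by (rule nn_integral_suminf) simp
  also have "\<dots> = (\<Sum>i. ennreal (\<integral>x. h i x \<partial>M))"
    using h by (intro suminf_cong nn_integral_eq_integral) auto
  also have "\<dots> = ennreal (\<Sum>i. \<integral>x. h i x \<partial>M)"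
    using s h(2) by (intro suminf_ennreal2) auto
  also have "\<dots> \<noteq> \<infinity>" by simp
  finally have "AE x in M. (\<Sum>i. ennreal (h i x)) \<noteq> \<infinity>"
    by (intro nn_integral_PInf_AE) auto
  then show ?thesis by eventually_elim (use h(2) in \<open>auto intro!: summable_suminf_not_top\<close>)
qed

lemma convergent_of_summable_diff:
  fixes a :: "nat \<Rightarrow> real"
  assumes "summable (\<lambda>i. a i - a (Suc i))"
  shows "convergent a"
proof -
  have "a 0 - (\<Sum>i<n. a i - a (Suc i)) = a n" for n by (induction n) auto
  moreover have "convergent (\<lambda>n. a 0 - (\<Sum>i<n. a i - a (Suc i)))"
    using assms by (intro convergent_diff convergent_const) (simp add: summable_iff_convergent)
  ultimately show ?thesis by simp
qed

lemma convex_hull_image_atLeast_mono: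
  "m \<le> n \<Longrightarrow> convex hull (f ` {n..}) \<subseteq> convex hull (f ` {m::nat..})"
  by (intro hull_mono image_mono) auto

context finite_measure begin

text \<open>A Komlos type lemma: the convex combinations are almost minimisers of a strictly convex
  functional of linear growth, so that no more than boundedness in mean is needed.\<close>

lemma convex_combinations_AE_convergent:
  fixes f :: "nat \<Rightarrow> 'w::real_vector" and T :: "nat \<Rightarrow> 'w \<Rightarrow> 'a \<Rightarrow> real"
  assumes lin: "\<And>k. linear (T k)"
    and int: "\<And>k n. integrable M (T k (f n))"
    and bound: "\<And>k n. (\<integral>x. \<bar>T k (f n) x\<bar> \<partial>M) \<le> B k"
  obtains g where "\<And>n. g n \<in> convex hull (f ` {n..})"
    "\<And>k. AE x in M. convergent (\<lambda>n. T k (g n) x)"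
proof -
  define H where "H n = convex hull (f ` {n..})" for n
  define \<theta> where "\<theta> t = sqrt (1 + t\<^sup>2)" for t :: real
  define I where "I k g = (\<integral>x. \<theta> (T k g x) \<partial>M)" for k g
  \<comment> \<open>\<open>c k\<close> bounds the mean of \<open>\<theta> (T k g)\<close> for all
    \<open>g \<in> H 0\<close>; with the weights \<open>w k\<close> the functional
    \<open>\<Phi>\<close>, which sums over all \<open>k\<close>, is therefore at most
    \<open>2\<close>.\<close>
  define c where "c k = measure M (space M) + \<bar>B k\<bar> + 1" for k
  define w where "w k = (1 / 2) ^ k / c k" for k
  have c: "c k > 0" for k by (simp add: c_def add_nonneg_pos)
  then have w: "w k > 0" for k by (simp add: w_def)
  have Hmono: "m \<le> n \<Longrightarrow> H n \<subseteq> H m" for m n unfolding H_def by (rule convex_hull_image_atLeast_mono)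
  have Hconv: "convex (H n)" for n by (simp add: H_def)
  have T_add: "T k (u + v) x = T k u x + T k v x" and T_scale: "T k (r *\<^sub>R u) x = r * T k u x" for k u v x r
    using linear_add[OF lin[of k], of u v] linear_scale[OF lin[of k], of r u] by simp_all
  have Hint: "integrable M (T k g) \<and> (\<integral>x. \<bar>T k g x\<bar> \<partial>M) \<le> \<bar>B k\<bar>" if g: "g \<in> H 0" for g k
  proof -
    let ?A = "{g. integrable M (T k g) \<and> (\<integral>x. \<bar>T k g x\<bar> \<partial>M) \<le> \<bar>B k\<bar>}"
    have "convex ?A"
    proof (rule convexI)
      fix u v and r s :: real assume uv: "u \<in> ?A" "v \<in> ?A" and rs: "0 \<le> r" "0 \<le> s" "r + s = 1"
      have eq: "T k (r *\<^sub>R u + s *\<^sub>R v) = (\<lambda>x. r * T k u x + s * T k v x)"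
        by (rule ext) (simp add: T_add T_scale)
      have "(\<integral>x. \<bar>r * T k u x + s * T k v x\<bar> \<partial>M) \<le> (\<integral>x. r * \<bar>T k u x\<bar> + s * \<bar>T k v x\<bar> \<partial>M)"
        using uv rs by (intro integral_mono) (auto intro: order_trans[OF abs_triangle_ineq] simp: abs_mult)
      also have "\<dots> = r * (\<integral>x. \<bar>T k u x\<bar> \<partial>M) + s * (\<integral>x. \<bar>T k v x\<bar> \<partial>M)" using uv by simp
      also have "\<dots> \<le> r * \<bar>B k\<bar> + s * \<bar>B k\<bar>" using uv rs by (intro add_mono mult_left_mono) auto
      also have "\<dots> = \<bar>B k\<bar>" using rs(3) by (simp flip: distrib_right)
      finally show "r *\<^sub>R u + s *\<^sub>R v \<in> ?A" using uv by (simp add: eq)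
    qed
    moreover have "f ` {0..} \<subseteq> ?A" using int order_trans[OF bound abs_ge_self] by auto
    ultimately show ?thesis using g hull_minimal[of "f ` {0..}" ?A convex] unfolding H_def by blast
  qed
  have \<theta>_le: "\<theta> t \<le> 1 + \<bar>t\<bar>" and \<theta>0: "0 \<le> \<theta> t" for t
    unfolding \<theta>_def by (rule real_le_lsqrt) (auto simp: power2_eq_square algebra_simps)
  have \<theta>_meas [measurable]: "\<theta> \<in> borel_measurable borel" unfolding \<theta>_def by measurable
  have \<theta>int: "integrable M (\<lambda>x. \<theta> (T k g x))" if "g \<in> H 0" for g k
  proof (rule Bochner_Integration.integrable_bound[of _ "\<lambda>x. 1 + \<bar>T k g x\<bar>"])
    show "integrable M (\<lambda>x. 1 + \<bar>T k g x\<bar>)" using Hint[OF that, of k] by auto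
    show "(\<lambda>x. \<theta> (T k g x)) \<in> borel_measurable M"
      using Hint[OF that, of k] by (intro measurable_compose[OF _ \<theta>_meas]) auto
    show "AE x in M. norm (\<theta> (T k g x)) \<le> norm (1 + \<bar>T k g x\<bar>)"
    proof (rule AE_I2)
      fix x
      show "norm (\<theta> (T k g x)) \<le> norm (1 + \<bar>T k g x\<bar>)"
        using \<theta>_le[of "T k g x"] \<theta>0[of "T k g x"] by simp
    qed
  qed
  have I_le: "I k g \<le> c k" and I0: "0 \<le> I k g" if "g \<in> H 0" for g k
  proof -
    have "I k g \<le> (\<integral>x. 1 + \<bar>T k g x\<bar> \<partial>M)" unfolding I_def
      using Hint[OF that, of k] \<theta>int[OF that] \<theta>_le by (intro integral_mono) auto
    also have "\<dots> = measure M (space M) + (\<integral>x. \<bar>T k g x\<bar> \<partial>M)" using Hint[OF that, of k] by simp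
    also have "\<dots> \<le> c k" using Hint[OF that, of k] by (simp add: c_def)
    finally show "I k g \<le> c k" .
    show "0 \<le> I k g" unfolding I_def using \<theta>0 by simp
  qed
  define \<Phi> where "\<Phi> g = (\<Sum>k. w k * I k g)" for g
  have term_le: "w k * I k g \<le> (1 / 2) ^ k" if "g \<in> H 0" for k g
  proof -
    have "w k * I k g \<le> w k * c k" using I_le[OF that] w by (intro mult_left_mono) (auto intro: less_imp_le)
    also have "\<dots> = (1 / 2) ^ k" using c[of k] by (simp add: w_def)
    finally show ?thesis .
  qed
  have summ: "summable (\<lambda>k. w k * I k g)" if "g \<in> H 0" for g
    using term_le[OF that] I0[OF that] w
    by (intro summable_comparison_test'[OF summable_geometric[of "1/2::real"]]) (auto simp: abs_mult less_imp_le)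
  have \<Phi>0: "0 \<le> \<Phi> g" if "g \<in> H 0" for g
    unfolding \<Phi>_def using I0[OF that] w by (intro suminf_nonneg[OF summ[OF that]]) (auto simp: less_imp_le)
  have \<Phi>2: "\<Phi> g \<le> 2" if "g \<in> H 0" for g
    unfolding \<Phi>_def using suminf_le[OF term_le[OF that] summ[OF that] summable_geometric[of "1/2"]]
    by (simp add: suminf_geometric)
  define \<kappa> where "\<kappa> a b = (\<theta> a + \<theta> b) / 2 - \<theta> ((a + b) / 2)" for a b
  have \<kappa>0: "0 \<le> \<kappa> a b" and \<kappa>: "(a - b)\<^sup>2 \<le> \<kappa> a b * (\<theta> a + \<theta> b) ^ 3" for a b
    using sqrt_convexity_gap[of a b] by (simp_all add: \<kappa>_def \<theta>_def)
  have mid: "(1/2) *\<^sub>R g + (1/2) *\<^sub>R h \<in> H n" if "g \<in> H n" "h \<in> H n" for g h n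
    using convexD[OF Hconv that, of "1/2" "1/2"] by simp
  have H0: "g \<in> H 0" if "g \<in> H n" for g n using Hmono[of 0 n] that by auto
  \<comment> \<open>All coordinate gaps are nonnegative, so each one is controlled by the midpoint
    gap of the single functional \<open>\<Phi>\<close>.\<close>
  have \<kappa>int: "integrable M (\<lambda>x. \<kappa> (T k g x) (T k h x))"
    and gap: "w k * (\<integral>x. \<kappa> (T k g x) (T k h x) \<partial>M) \<le> (\<Phi> g + \<Phi> h) / 2 - \<Phi> ((1/2) *\<^sub>R g + (1/2) *\<^sub>R h)"
    if gh: "g \<in> H 0" "h \<in> H 0" for g h k
  proof -
    let ?m = "(1/2) *\<^sub>R g + (1/2) *\<^sub>R h"
    note m = mid[OF gh]
    have T_mid: "T k ?m x = (T k g x + T k h x) / 2" for k x by (simp add: T_add T_scale)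
    have eq: "\<kappa> (T k g x) (T k h x) = (\<theta> (T k g x) + \<theta> (T k h x)) / 2 - \<theta> (T k ?m x)" for k x
      by (simp add: \<kappa>_def T_mid)
    show "integrable M (\<lambda>x. \<kappa> (T k g x) (T k h x))" for k
      unfolding eq using \<theta>int[OF gh(1), of k] \<theta>int[OF gh(2), of k] \<theta>int[OF m, of k] by auto
    have int_eq: "(\<integral>x. \<kappa> (T k g x) (T k h x) \<partial>M) = (I k g + I k h) / 2 - I k ?m" for k
      unfolding eq I_def using \<theta>int[OF gh(1), of k] \<theta>int[OF gh(2), of k] \<theta>int[OF m, of k] by simp
    define d where "d k = (w k * I k g + w k * I k h) / 2 - w k * I k ?m" for k
    have d_eq: "d k = w k * (\<integral>x. \<kappa> (T k g x) (T k h x) \<partial>M)" for k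
      unfolding int_eq d_def by (simp add: algebra_simps add_divide_distrib)
    have d0: "0 \<le> d k" for k unfolding d_eq using w[of k] \<kappa>0 by (simp add: less_imp_le)
    have "(\<lambda>k. d k) sums ((\<Phi> g + \<Phi> h) / 2 - \<Phi> ?m)"
      unfolding d_def \<Phi>_def
      by (intro sums_diff sums_divide sums_add summable_sums summ gh m)
    then have "d k \<le> (\<Phi> g + \<Phi> h) / 2 - \<Phi> ?m"
      using sum_le_suminf[of d "{k}"] d0 by (auto simp: sums_iff)
    then show "w k * (\<integral>x. \<kappa> (T k g x) (T k h x) \<partial>M) \<le> (\<Phi> g + \<Phi> h) / 2 - \<Phi> ?m" by (simp add: d_eq)
  qed
  \<comment> \<open>The infima over the shrinking tails increase and are at most \<open>2\<close>.
    For \<open>n \<le> m\<close> the midpoint of the near minimisers \<open>g n\<close> and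
    \<open>g m\<close> still lies in \<open>H n\<close>, so \<open>\<Phi>\<close> is at least
    \<open>J n\<close> there; hence the midpoint gap is at most \<open>\<eta> n\<close>, which tends
    to \<open>0\<close>.\<close>
  define J where "J n = (INF g\<in>H n. \<Phi> g)" for n
  have Hne: "H n \<noteq> {}" for n by (simp add: H_def)
  have bdd: "bdd_below (\<Phi> ` H n)" for n using \<Phi>0 H0 by (intro bdd_belowI2[of _ 0]) auto
  have J_le: "J n \<le> \<Phi> g" if "g \<in> H n" for n g unfolding J_def by (rule cINF_lower[OF bdd that])
  have J_mono: "J m \<le> J n" if "m \<le> n" for m n
    unfolding J_def by (rule cINF_superset_mono[OF Hne bdd Hmono[OF that]]) simp
  have J2: "J n \<le> 2" for n
  proof -
    obtain g where "g \<in> H n" using Hne by blast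
    from J_le[OF this] \<Phi>2[OF H0[OF this]] show ?thesis by (rule order_trans)
  qed
  obtain L where L: "J \<longlonglongrightarrow> L" "\<And>i. J i \<le> L"
    using incseq_convergent[of J 2] J_mono J2 by (auto simp: incseq_def)
  have "\<exists>g. g \<in> H n \<and> \<Phi> g < J n + inverse (Suc n)" for n
  proof -
    have "(INF g\<in>H n. \<Phi> g) < J n + inverse (Suc n)" by (simp add: J_def)
    then show ?thesis using cINF_less_iff[OF Hne bdd] by blast
  qed
  then obtain g where g: "\<And>n. g n \<in> H n" and \<Phi>g: "\<And>n. \<Phi> (g n) < J n + inverse (Suc n)" by metis
  have g0: "g n \<in> H 0" for n by (rule H0[OF g])
  define \<eta> where "\<eta> n = (L - J n) + inverse (Suc n)" for n
  have \<eta>_lim: "\<eta> \<longlonglongrightarrow> 0"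
    unfolding \<eta>_def using tendsto_add[OF tendsto_diff[OF tendsto_const[of L] L(1)] LIMSEQ_inverse_real_of_nat] by simp
  have gap_g: "w k * (\<integral>x. \<kappa> (T k (g n) x) (T k (g m) x) \<partial>M) \<le> \<eta> n" if nm: "n \<le> m" for n m k
  proof -
    have gm: "g m \<in> H n" using g[of m] Hmono[OF nm] by blast
    have "w k * (\<integral>x. \<kappa> (T k (g n) x) (T k (g m) x) \<partial>M)
        \<le> (\<Phi> (g n) + \<Phi> (g m)) / 2 - \<Phi> ((1/2) *\<^sub>R g n + (1/2) *\<^sub>R g m)"
      by (rule gap[OF g0 g0])
    moreover have "J n \<le> \<Phi> ((1/2) *\<^sub>R g n + (1/2) *\<^sub>R g m)" by (rule J_le[OF mid[OF g gm]])
    moreover have "inverse (real (Suc m)) \<le> inverse (real (Suc n))" using nm by simp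
    ultimately show ?thesis
      using \<Phi>g[of n] \<Phi>g[of m] L(2)[of m] L(2)[of n] unfolding \<eta>_def by argo
  qed
  \<comment> \<open>The rate is \<open>128 = 2 * 64\<close>: multiplied by \<open>64 ^ i\<close> the
    gaps are still summable in mean, and \<open>64\<close> beats the factor \<open>8\<close> that
    comes from the cube of \<open>S i x \<le> h * 2 ^ i\<close>.\<close>
  have "\<exists>N. \<forall>n\<ge>N. \<eta> n < (1 / 128) ^ i" for i
    using order_tendstoD(2)[OF \<eta>_lim, of "(1 / 128) ^ i"] by (simp add: eventually_sequentially)
  then obtain N where N: "\<And>i n. n \<ge> N i \<Longrightarrow> \<eta> n < (1 / 128) ^ i" by metis
  \<comment> \<open>The summand \<open>i\<close> places \<open>g (r i)\<close> in the hull of the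
    tail from \<open>i\<close> on; the sum keeps \<open>r\<close> monotone and above each
    \<open>N i\<close>.\<close>
  define r where "r i = i + (\<Sum>j\<le>i. N j)" for i
  have r_ge: "i \<le> r i" "N i \<le> r i" "r i \<le> r (Suc i)" for i
    unfolding r_def by (auto intro: trans_le_add2 member_le_sum[of i "{..i}" N])
  show thesis
  proof (rule that[of "\<lambda>i. g (r i)"])
    show "g (r i) \<in> convex hull (f ` {i..})" for i
      using g[of "r i"] Hmono[OF r_ge(1)[of i]] unfolding H_def by blast
    fix k
    define a where "a i x = T k (g (r i)) x" for i x
    define S where "S i x = \<theta> (a i x) + \<theta> (a (Suc i) x)" for i x
    have S0: "0 \<le> S i x" for i x unfolding S_def using \<theta>0 by (simp add: add_nonneg_nonneg)
    have Sint: "integrable M (S i)" for i unfolding S_def a_def using \<theta>int[OF g0] by simp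
    have kint: "integrable M (\<lambda>x. \<kappa> (a i x) (a (Suc i) x))" for i
      unfolding a_def by (rule \<kappa>int[OF g0 g0])
    have S_le: "(\<integral>x. S i x \<partial>M) \<le> 2 * c k" for i
      using I_le[OF g0[of "r i"], of k] I_le[OF g0[of "r (Suc i)"], of k] \<theta>int[OF g0]
      unfolding S_def a_def I_def by simp
    have k_le: "(\<integral>x. \<kappa> (a i x) (a (Suc i) x) \<partial>M) \<le> (1 / 128) ^ i / w k" for i
      using gap_g[OF r_ge(3)[of i], of k] N[OF r_ge(2)[of i]] w[of k]
      unfolding a_def by (simp add: pos_le_divide_eq mult.commute)
    have "AE x in M. summable (\<lambda>i. (1 / 2) ^ i * S i x)"
    proof (rule AE_summable_of_integrals)
      show "summable (\<lambda>i. \<integral>x. (1 / 2) ^ i * S i x \<partial>M)"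
      proof (rule summable_comparison_test')
        show "summable (\<lambda>i. (1 / 2) ^ i * (2 * c k))" by (intro summable_mult2 summable_geometric) simp
        show "norm (\<integral>x. (1 / 2) ^ i * S i x \<partial>M) \<le> (1 / 2) ^ i * (2 * c k)" for i
          using S_le[of i] S0 by (simp add: abs_mult Bochner_Integration.integral_nonneg mult_left_mono)
      qed
      show "integrable M (\<lambda>x. (1 / 2) ^ i * S i x)" for i using Sint[of i] by simp
      show "0 \<le> (1 / 2) ^ i * S i x" for i x using S0[of i x] by simp
    qed
    moreover have "AE x in M. summable (\<lambda>i. 64 ^ i * \<kappa> (a i x) (a (Suc i) x))"
    proof (rule AE_summable_of_integrals)
      show "summable (\<lambda>i. \<integral>x. 64 ^ i * \<kappa> (a i x) (a (Suc i) x) \<partial>M)"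
      proof (rule summable_comparison_test')
        show "summable (\<lambda>i. (1 / 2) ^ i * inverse (w k))" by (intro summable_mult2 summable_geometric) simp
        show "norm (\<integral>x. 64 ^ i * \<kappa> (a i x) (a (Suc i) x) \<partial>M) \<le> (1 / 2) ^ i * inverse (w k)" for i
        proof -
          have "norm (\<integral>x. 64 ^ i * \<kappa> (a i x) (a (Suc i) x) \<partial>M) = 64 ^ i * (\<integral>x. \<kappa> (a i x) (a (Suc i) x) \<partial>M)"
            using \<kappa>0 by (simp add: abs_mult Bochner_Integration.integral_nonneg)
          also have "\<dots> \<le> 64 ^ i * ((1 / 128) ^ i / w k)" using k_le[of i] by (intro mult_left_mono) auto
          also have "\<dots> = (64 * (1 / 128)) ^ i * inverse (w k)" by (simp only: power_mult_distrib divide_inverse mult.assoc)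
          finally show ?thesis by simp
        qed
      qed
      show "integrable M (\<lambda>x. 64 ^ i * \<kappa> (a i x) (a (Suc i) x))" for i using kint[of i] by simp
      show "0 \<le> 64 ^ i * \<kappa> (a i x) (a (Suc i) x)" for i x using \<kappa>0[of "a i x" "a (Suc i) x"] by simp
    qed
    ultimately show "AE x in M. convergent (\<lambda>i. T k (g (r i)) x)"
    proof eventually_elim
      case (elim x)
      define h where "h = (\<Sum>i. (1 / 2) ^ i * S i x) + (\<Sum>i. 64 ^ i * \<kappa> (a i x) (a (Suc i) x))"
      have t_le: "(1 / 2) ^ i * S i x \<le> (\<Sum>i. (1 / 2) ^ i * S i x)" for i
        using sum_le_suminf[OF elim(1), of "{i}"] S0 by auto
      have u_le: "64 ^ i * \<kappa> (a i x) (a (Suc i) x) \<le> (\<Sum>i. 64 ^ i * \<kappa> (a i x) (a (Suc i) x))" for i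
        using sum_le_suminf[OF elim(2), of "{i}"] \<kappa>0 by auto
      have t0: "0 \<le> (\<Sum>i. (1 / 2) ^ i * S i x)" using S0 by (intro suminf_nonneg elim) auto
      have u0: "0 \<le> (\<Sum>i. 64 ^ i * \<kappa> (a i x) (a (Suc i) x))" using \<kappa>0 by (intro suminf_nonneg elim) auto
      have h0: "0 \<le> h" using t0 u0 by (simp add: h_def)
      have S_h: "S i x \<le> h * 2 ^ i" for i
      proof -
        have "(1 / 2) ^ i * S i x \<le> h" using t_le[of i] u0 unfolding h_def by linarith
        then show ?thesis by (simp add: power_one_over field_simps)
      qed
      have k_h: "\<kappa> (a i x) (a (Suc i) x) \<le> h / 64 ^ i" for i
      proof -
        have "64 ^ i * \<kappa> (a i x) (a (Suc i) x) \<le> h" using u_le[of i] t0 unfolding h_def by linarith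
        then show ?thesis by (simp add: field_simps)
      qed
      have diff_le: "\<bar>a i x - a (Suc i) x\<bar> \<le> h\<^sup>2 * (1 / 2) ^ i" for i
      proof -
        have "(a i x - a (Suc i) x)\<^sup>2 \<le> \<kappa> (a i x) (a (Suc i) x) * S i x ^ 3"
          unfolding S_def by (rule \<kappa>)
        also have "\<dots> \<le> (h / 64 ^ i) * (h * 2 ^ i) ^ 3"
          using k_h[of i] S_h[of i] S0[of i x] h0 \<kappa>0 by (intro mult_mono power_mono) auto
        also have "\<dots> = h ^ 4 * ((2 ^ 3) / 64) ^ i"
        proof -
          have "(2 ^ i) ^ 3 = ((2::real) ^ 3) ^ i" by (simp only: power_mult[symmetric] mult.commute)
          then have "(h / 64 ^ i) * (h * 2 ^ i) ^ 3 = h * h ^ 3 * ((2 ^ 3) ^ i / 64 ^ i)"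
            by (simp only: power_mult_distrib) simp
          also have "h * h ^ 3 = h ^ 4" by (simp add: numeral_eq_Suc)
          finally show ?thesis by (simp only: power_divide)
        qed
        \<comment> \<open>\<open>8 / 64\<close> is relaxed to \<open>1 / 4\<close>, whose powers are
          the squares of \<open>(1 / 2) ^ i\<close>, so that square roots can be taken.\<close>
        also have "\<dots> \<le> h ^ 4 * (1 / 4) ^ i"
          by (intro mult_left_mono power_mono) auto
        also have "\<dots> = (h\<^sup>2 * (1 / 2) ^ i)\<^sup>2"
        proof -
          have "((1 / 2) ^ i)\<^sup>2 = ((1 / 2 :: real)\<^sup>2) ^ i" by (simp only: power_mult[symmetric] mult.commute)
          moreover have "(1 / 2 :: real)\<^sup>2 = 1 / 4" by (simp add: power2_eq_square)
          moreover have "(h\<^sup>2)\<^sup>2 = h ^ 4" by (simp flip: power_mult)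
          ultimately show ?thesis by (simp only: power_mult_distrib)
        qed
        finally have "\<bar>a i x - a (Suc i) x\<bar> \<le> \<bar>h\<^sup>2 * (1 / 2) ^ i\<bar>" by (simp only: abs_le_square_iff)
        then show ?thesis by simp
      qed
      have "summable (\<lambda>i. a i x - a (Suc i) x)"
      proof (rule summable_comparison_test')
        show "summable (\<lambda>i. h\<^sup>2 * (1 / 2) ^ i)" by (intro summable_mult summable_geometric) simp
      qed (use diff_le in simp)
      then have "convergent (\<lambda>i. a i x)" by (rule convergent_of_summable_diff)
      then show ?case by (simp add: a_def)
    qed
  qed
qed

end

section \<open>Weak limits in a reflexive space and in its separable subspaces\<close>

lemma reflexive_weak_limit:
  fixes e :: "'n \<Rightarrow> 'e::banach"
  assumes refl: "reflexive_space TYPE('e)" and F: "F \<noteq> bot" and B: "eventually (\<lambda>n. norm (e n) \<le> B) F"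
  obtains F' v where "F' \<le> F" "F' \<noteq> bot" "\<And>\<phi> :: 'e \<Rightarrow>\<^sub>L real. ((\<lambda>n. \<phi> (e n)) \<longlongrightarrow> \<phi> v) F'"
proof -
  have "eventually (\<lambda>n. \<bar>\<phi> (e n)\<bar> \<le> norm \<phi> * B) F" for \<phi> :: "'e \<Rightarrow>\<^sub>L real"
    using B
  proof eventually_elim
    case (elim n)
    then show ?case
      using norm_blinfun[of \<phi> "e n"] mult_left_mono[OF elim norm_ge_zero[of \<phi>]] by simp
  qed
  then obtain F' and L :: "('e \<Rightarrow>\<^sub>L real) \<Rightarrow> real"
    where F': "F' \<le> F" "F' \<noteq> bot" and L: "\<And>\<phi> :: 'e \<Rightarrow>\<^sub>L real. ((\<lambda>n. blinfun_apply \<phi> (e n)) \<longlongrightarrow> L \<phi>) F'"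
    using simultaneous_filter_limit[OF F, where h = "\<lambda>n (\<phi> :: 'e \<Rightarrow>\<^sub>L real). \<phi> (e n)" and B = "\<lambda>\<phi>. norm \<phi> * B"] by blast
  have B': "eventually (\<lambda>n. norm (e n) \<le> B) F'" using F'(1) B by (rule filter_leD)
  \<comment> \<open>The limits along the filter form an element of the bidual, with norm controlled
    by the common bound \<open>B\<close>; reflexivity then names the vector behind it.\<close>
  have "bounded_linear L"
  proof (rule bounded_linear_intro[where K = B])
    fix \<phi> \<psi> :: "'e \<Rightarrow>\<^sub>L real" and r :: real
    show "L (\<phi> + \<psi>) = L \<phi> + L \<psi>"
      using tendsto_unique[OF F'(2) L[of "\<phi> + \<psi>"]] tendsto_add[OF L[of \<phi>] L[of \<psi>]]
      by (simp add: blinfun.add_left)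
    show "L (r *\<^sub>R \<phi>) = r *\<^sub>R L \<phi>"
      using tendsto_unique[OF F'(2) L[of "r *\<^sub>R \<phi>"]] tendsto_scaleR[OF tendsto_const[of r] L[of \<phi>]]
      by (simp add: blinfun.scaleR_left)
    show "norm (L \<phi>) \<le> norm \<phi> * B"
    proof (rule tendsto_upperbound[OF tendsto_norm[OF L] _ F'(2)])
      show "eventually (\<lambda>n. norm (\<phi> (e n)) \<le> norm \<phi> * B) F'"
        using B'
      proof eventually_elim
        case (elim n)
        then show ?case
          using norm_blinfun[of \<phi> "e n"] mult_left_mono[OF elim norm_ge_zero[of \<phi>]] by simp
      qed
    qed
  qed
  moreover obtain v :: 'e where "bidual_embedding v = Blinfun L"
    using refl unfolding reflexive_space_def by (metis surjD)
  ultimately have "L \<phi> = \<phi> v" for \<phi>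
    using blinfun_apply_bidual_embedding[of v \<phi>] by (simp add: bounded_linear_Blinfun_apply)
  then show thesis using that[OF F', of v] L by simp
qed

text \<open>Mazur's theorem: otherwise the translated set \<open>v - S\<close> has positive distance
  \<open>d\<close> from \<open>0\<close>, and a functional that is at least \<open>d\<close> on it
  contradicts weak convergence to \<open>v\<close>.\<close>

lemma closed_convex_weak_limit:
  fixes e :: "'n \<Rightarrow> 'e::real_normed_vector"
  assumes S: "closed S" "convex S" and F: "F \<noteq> bot" "eventually (\<lambda>n. e n \<in> S) F"
    and lim: "\<And>\<phi> :: 'e \<Rightarrow>\<^sub>L real. ((\<lambda>n. \<phi> (e n)) \<longlongrightarrow> \<phi> v) F"
  shows "v \<in> S"
proof (rule ccontr)
  assume "v \<notin> S"
  then obtain d where d: "d > 0" "\<And>x. x \<in> S \<Longrightarrow> d \<le> dist v x"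
    using S(1) by (metis closed_approachable dist_commute not_less)
  define Q where "Q = (\<lambda>x. v - x) ` S"
  have "S \<noteq> {}" using F eventually_happens'[OF F] by blast
  then have Q: "Q \<noteq> {}" "convex Q" using S(2) convex_translation[OF convex_negations[OF S(2)], of v]
    by (auto simp: Q_def image_image)
  have sn: "seminorm (norm :: 'e \<Rightarrow> real)" by (simp add: seminorm_def norm_triangle_ineq)
  obtain f where f: "linear f" "\<And>x. \<bar>f x\<bar> \<le> norm x" "\<And>x. x \<in> Q \<Longrightarrow> d \<le> f x"
    using hahn_banach_convex[OF sn Q(2,1), of d] d(2) by (auto simp: Q_def dist_norm)
  have bl: "bounded_linear f"
    using f(1,2) by (auto simp: bounded_linear_def bounded_linear_axioms_def intro!: exI[of _ 1])
  have "((\<lambda>n. f v - f (e n)) \<longlongrightarrow> f v - f v) F"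
    using lim[of "Blinfun f"] by (intro tendsto_intros) (simp add: bounded_linear_Blinfun_apply[OF bl])
  moreover have "eventually (\<lambda>n. d \<le> f v - f (e n)) F"
    using F(2) by eventually_elim (use f(3) in \<open>auto simp: Q_def linear_diff[OF f(1), symmetric]\<close>)
  ultimately have "d \<le> f v - f v" by (intro tendsto_lowerbound[OF _ _ F(1)])
  then show False using d(1) by simp
qed

lemma sum_fun_apply: "(\<Sum>a\<in>A. f a) x = (\<Sum>a\<in>A. f a x)"
  by (induction A rule: infinite_finite_induct) auto

lemma subspace_closure_normed:
  fixes S :: "'e::real_normed_vector set"
  assumes S: "subspace S"
  shows "subspace (closure S)"
  unfolding subspace_def
proof (intro conjI ballI allI)
  show "0 \<in> closure S" using subspace_0[OF S] closure_subset by blast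
  fix x assume "x \<in> closure S"
  then obtain u where u: "\<And>n. u n \<in> S" "u \<longlonglongrightarrow> x" unfolding closure_sequential by blast
  show "c *\<^sub>R x \<in> closure S" for c
    unfolding closure_sequential
    by (intro exI[of _ "\<lambda>n. c *\<^sub>R u n"] conjI allI subspace_scale[OF S] u tendsto_intros)
  fix y assume "y \<in> closure S"
  then obtain v where v: "\<And>n. v n \<in> S" "v \<longlonglongrightarrow> y" unfolding closure_sequential by blast
  show "x + y \<in> closure S"
    unfolding closure_sequential
    by (intro exI[of _ "\<lambda>n. u n + v n"] conjI allI subspace_add[OF S] u v tendsto_intros)
qed

text \<open>A sequence spans a closed separable subspace \<open>E\<^sub>0\<close>, and functionals
  norming a countable dense subset norm all of it. Countably many scalar conditions then determine a
  point of \<open>E\<^sub>0\<close>, while weak limits are still taken against all functionals on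
  the whole space.\<close>

locale separable_norming =
  fixes a :: "nat \<Rightarrow> 'e::banach"
begin

definition E\<^sub>0 :: "'e set" where "E\<^sub>0 = closure (span (range a))"

definition d :: "nat \<Rightarrow> 'e" where "d k = rat_combination a (from_nat k)"

definition N :: "nat \<Rightarrow> 'e \<Rightarrow>\<^sub>L real" where
  "N k = (SOME \<phi>. norm \<phi> \<le> 1 \<and> blinfun_apply \<phi> (d k) = norm (d k))"

lemma N: "norm (N k) \<le> 1" "N k (d k) = norm (d k)"
proof -
  have "\<exists>\<phi> :: 'e \<Rightarrow>\<^sub>L real. norm \<phi> \<le> 1 \<and> blinfun_apply \<phi> (d k) = norm (d k)" using norming_functional by metis
  from someI_ex[OF this] show "norm (N k) \<le> 1" "N k (d k) = norm (d k)" by (auto simp: N_def)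
qed

lemma E\<^sub>0_closed: "closed E\<^sub>0" by (simp add: E\<^sub>0_def)

lemma E\<^sub>0_subspace: "subspace E\<^sub>0"
  unfolding E\<^sub>0_def by (rule subspace_closure_normed[OF subspace_span])

lemma a_in: "a i \<in> E\<^sub>0"
  unfolding E\<^sub>0_def by (rule subsetD[OF closure_subset], rule span_base) simp

lemma d_in: "d k \<in> E\<^sub>0"
  unfolding d_def rat_combination_def
  by (rule subspace_sum[OF E\<^sub>0_subspace], rule subspace_scale[OF E\<^sub>0_subspace], rule a_in)

lemma d_dense:
  assumes e: "e \<in> E\<^sub>0" and r: "r > 0"
  obtains k where "norm (e - d k) < r"
proof -
  have "\<exists>y\<in>span (range a). dist y e < r / 2"
    using e half_gt_zero[OF r] unfolding E\<^sub>0_def closure_approachable by (elim allE impE)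
  then obtain y where y: "y \<in> span (range a)" "norm (e - y) < r / 2"
    by (auto simp: dist_norm norm_minus_commute)
  have sn: "seminorm (norm :: 'e \<Rightarrow> real)" by (simp add: seminorm_def norm_triangle_ineq)
  obtain l where l: "norm (y - rat_combination a l) < r / 2"
    using rat_combination_dense[OF sn y(1), of "r / 2"] r by auto
  have "norm (e - d (to_nat l)) < r"
    using norm_triangle_ineq[of "e - y" "y - d (to_nat l)"] y l by (simp add: d_def)
  then show thesis by (rule that)
qed

lemma norm_approx:
  assumes "e \<in> E\<^sub>0" "r > 0"
  obtains k where "norm e \<le> N k e + r"
proof -
  obtain k where k: "norm (e - d k) < r / 2" using d_dense[OF assms(1), of "r / 2"] assms(2) by auto
  have "N k (d k) - N k e \<le> norm (d k - e)"
    using blinfun_le_norm[OF N(1), of k "d k - e"] by (simp add: blinfun.diff_right)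
  moreover have "norm e \<le> norm (d k) + norm (e - d k)" using norm_triangle_sub[of e "d k"] by simp
  ultimately have "norm e \<le> N k e + r" using k by (simp add: N(2) norm_minus_commute)
  then show thesis by (rule that)
qed

lemma eqI_norming:
  assumes "u \<in> E\<^sub>0" "v \<in> E\<^sub>0" "\<And>k. N k u = N k v"
  shows "u = v"
proof -
  have "u - v \<in> E\<^sub>0" using assms subspace_diff[OF E\<^sub>0_subspace] by blast
  have "norm (u - v) \<le> 0"
  proof (rule field_le_epsilon)
    fix r :: real assume "r > 0"
    then obtain k where "norm (u - v) \<le> N k (u - v) + r" using norm_approx[OF \<open>u - v \<in> E\<^sub>0\<close>] by blast
    then show "norm (u - v) \<le> 0 + r" by (simp add: blinfun.diff_right assms(3))
  qed
  then show ?thesis by simp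
qed

text \<open>Convergence against the \<open>N k\<close> does not by itself give convergence against
  all functionals. Reflexivity supplies a weak cluster point, lying in \<open>E\<^sub>0\<close>, for
  every filter on the sequence. For filters finer than \<open>sequentially\<close> the
  \<open>N k\<close> force these points to coincide, so the whole sequence converges.\<close>

lemma weak_limit_sequence:
  assumes refl: "reflexive_space TYPE('e)"
    and e: "\<And>n. e n \<in> E\<^sub>0" "\<And>n. norm (e n) \<le> B" "\<And>k. convergent (\<lambda>n. N k (e n))"
  obtains u where "u \<in> E\<^sub>0" "\<And>\<phi> :: 'e \<Rightarrow>\<^sub>L real. (\<lambda>n. \<phi> (e n)) \<longlonglongrightarrow> \<phi> u"
proof -
  have cluster: "\<exists>v\<in>E\<^sub>0. \<exists>F'\<le>F. F' \<noteq> bot \<and> (\<forall>\<phi> :: 'e \<Rightarrow>\<^sub>L real. ((\<lambda>n. \<phi> (e n)) \<longlongrightarrow> \<phi> v) F')"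
    if F: "F \<noteq> bot" for F
  proof -
    have "eventually (\<lambda>n. norm (e n) \<le> B) F" using e(2) by simp
    from reflexive_weak_limit[OF refl F this] obtain F' v
      where F': "F' \<le> F" "F' \<noteq> bot" "\<And>\<phi> :: 'e \<Rightarrow>\<^sub>L real. ((\<lambda>n. \<phi> (e n)) \<longlongrightarrow> \<phi> v) F'" by blast
    have "v \<in> E\<^sub>0"
      by (rule closed_convex_weak_limit[OF E\<^sub>0_closed subspace_imp_convex[OF E\<^sub>0_subspace] F'(2) _ F'(3)])
         (use e(1) in simp)
    then show ?thesis using F' by blast
  qed
  obtain u F\<^sub>1 where u: "u \<in> E\<^sub>0" and F1: "F\<^sub>1 \<le> sequentially" "F\<^sub>1 \<noteq> bot"
    and limu: "\<And>\<phi> :: 'e \<Rightarrow>\<^sub>L real. ((\<lambda>n. \<phi> (e n)) \<longlongrightarrow> \<phi> u) F\<^sub>1"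
    using cluster[OF sequentially_bot] by blast
  have Nu: "(\<lambda>n. N k (e n)) \<longlonglongrightarrow> N k u" for k
  proof -
    obtain l where l: "(\<lambda>n. N k (e n)) \<longlonglongrightarrow> l" using e(3)[of k] by (auto simp: convergent_def)
    have "N k u = l" by (rule tendsto_unique[OF F1(2) limu tendsto_mono[OF F1(1) l]])
    then show ?thesis using l by simp
  qed
  have "(\<lambda>n. \<phi> (e n)) \<longlonglongrightarrow> \<phi> u" for \<phi> :: "'e \<Rightarrow>\<^sub>L real"
  proof (rule ccontr)
    assume "\<not> (\<lambda>n. \<phi> (e n)) \<longlonglongrightarrow> \<phi> u"
    then obtain r where r: "r > 0" "\<not> eventually (\<lambda>n. dist (\<phi> (e n)) (\<phi> u) < r) sequentially"
      by (auto simp: tendsto_iff)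
    \<comment> \<open>A finer filter on which \<open>\<phi>\<close> stays away from its value at
      \<open>u\<close>; it has a cluster point too, and this must again be \<open>u\<close>.\<close>
    define F where "F = inf sequentially (principal {n. \<not> dist (\<phi> (e n)) (\<phi> u) < r})"
    have "F \<noteq> bot" using r(2) unfolding F_def trivial_limit_def eventually_inf_principal by simp
    then obtain v F' where v: "v \<in> E\<^sub>0" and F': "F' \<le> F" "F' \<noteq> bot"
      and limv: "\<And>\<phi> :: 'e \<Rightarrow>\<^sub>L real. ((\<lambda>n. \<phi> (e n)) \<longlongrightarrow> \<phi> v) F'"
      using cluster by blast
    have "F' \<le> sequentially" using F'(1) unfolding F_def by simp
    then have "N k u = N k v" for k
      using tendsto_unique[OF F'(2) tendsto_mono[OF _ Nu[of k]] limv] by blast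
    then have "u = v" by (rule eqI_norming[OF u v])
    then have "eventually (\<lambda>n. dist (\<phi> (e n)) (\<phi> u) < r) F'" using limv[of \<phi>] r(1) tendstoD by blast
    moreover have "eventually (\<lambda>n. \<not> dist (\<phi> (e n)) (\<phi> u) < r) F"
      unfolding F_def eventually_inf_principal by (simp add: always_eventually)
    then have "eventually (\<lambda>n. \<not> dist (\<phi> (e n)) (\<phi> u) < r) F'" using F'(1) by (rule filter_leD[rotated])
    ultimately have "eventually (\<lambda>_. False) F'" by eventually_elim simp
    then show False using F'(2) by (simp add: trivial_limit_def)
  qed
  then show thesis by (rule that[OF u])
qed

end

section \<open>Operator valued densities for functionals on integrable functions\<close>

context finite_measure begin

text \<open>The averages of \<open>\<Lambda>\<close> over the partitions generated by \<open>y 0, \<dots>, y (n - 1)\<close> represent \<open>\<Lambda>\<close> on these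
  functions; \<open>\<Gamma>\<close> is a limit of convex combinations of them.\<close>

lemma functional_representation:
  fixes y :: "nat \<Rightarrow> 'a \<Rightarrow> 'e::banach" and \<Lambda> :: "('a \<Rightarrow> 'e) \<Rightarrow> real"
  assumes y: "\<And>i. simple_function M (y i)"
    and lin: "linear \<Lambda>" and le: "\<And>f. Bochner_integrable M f \<Longrightarrow> \<bar>\<Lambda> f\<bar> \<le> (\<integral>x. norm (f x) \<partial>M)"
  obtains \<Gamma> :: "'a \<Rightarrow> 'e \<Rightarrow>\<^sub>L real" where "\<And>x. norm (\<Gamma> x) \<le> 1"
    "\<And>i. (\<lambda>x. \<Gamma> x (y i x)) \<in> borel_measurable M" "\<And>i. \<Lambda> (y i) = (\<integral>x. \<Gamma> x (y i x) \<partial>M)"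
proof -
  \<comment> \<open>The list of the first \<open>n\<close> values; its level sets are the atoms of
    the partition.\<close>
  define h where "h n x = map (\<lambda>i. y i x) [0..<n]" for n x
  have h: "simple_function M (h n)" for n
  proof (induction n)
    case 0 then show ?case by (simp add: h_def)
  next
    case (Suc n)
    have "h (Suc n) = (\<lambda>x. h n x @ [y n x])" by (rule ext) (simp add: h_def)
    then show ?case using simple_function_compose2[OF Suc y[of n], of "\<lambda>l v. l @ [v]"] by simp
  qed
  define A where "A n v = h n -` {v} \<inter> space M" for n v
  have A: "A n v \<in> sets M" for n v unfolding A_def using simple_functionD(2)[OF h] by blast
  have simpA: "simple_function M (\<lambda>z. indicat_real (A n v) z *\<^sub>R e)" for n v and e :: 'e
    by (rule simple_function_compose1[OF simple_function_indicator[OF A], of "\<lambda>c. c *\<^sub>R e"])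
  have \<Lambda>A: "\<bar>\<Lambda> (\<lambda>z. indicat_real (A n v) z *\<^sub>R e)\<bar> \<le> measure M (A n v) * norm e" for n v e
    using le[OF Bochner_integrable_simple[OF simpA[of n v e]]] A[of n v] by simp
  \<comment> \<open>On a null atom the quotient is \<open>0\<close> by convention; this is
    consistent because \<open>\<Lambda>A\<close> makes \<open>\<Lambda>\<close> vanish
    there.\<close>
  define g where "g n v e = \<Lambda> (\<lambda>z. indicat_real (A n v) z *\<^sub>R e) / measure M (A n v)" for n v e
  have g_le: "\<bar>g n v e\<bar> \<le> norm e" for n v e
    using \<Lambda>A[of n v e] by (cases "measure M (A n v) = 0") (auto simp: g_def divide_le_eq mult.commute zero_less_measure_iff)
  have g_lin: "bounded_linear (g n v)" for n v
  proof (rule bounded_linear_intro[where K = 1])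
    fix e e' :: 'e and r :: real
    have "(\<lambda>z. indicat_real (A n v) z *\<^sub>R (e + e')) = (\<lambda>z. indicat_real (A n v) z *\<^sub>R e) + (\<lambda>z. indicat_real (A n v) z *\<^sub>R e')"
      by (rule ext) (simp add: scaleR_add_right)
    then show "g n v (e + e') = g n v e + g n v e'"
      unfolding g_def by (simp only: linear_add[OF lin] add_divide_distrib)
    have "(\<lambda>z. indicat_real (A n v) z *\<^sub>R (r *\<^sub>R e)) = r *\<^sub>R (\<lambda>z. indicat_real (A n v) z *\<^sub>R e)"
      by (rule ext) simp
    then show "g n v (r *\<^sub>R e) = r *\<^sub>R g n v e"
      unfolding g_def by (simp only: linear_scale[OF lin] real_scaleR_def times_divide_eq_right)
    show "norm (g n v e) \<le> norm e * 1" using g_le by simp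
  qed
  define G where "G n x = Blinfun (g n (h n x))" for n x
  have G_apply: "G n x e = g n (h n x) e" for n x e
    by (simp add: G_def bounded_linear_Blinfun_apply[OF g_lin])
  have G_norm: "norm (G n x) \<le> 1" for n x
    by (rule norm_blinfun_bound) (use g_le in \<open>auto simp: G_apply\<close>)
  \<comment> \<open>\<open>\<Lambda>\<close> acts on functions defined on the whole type, but by
    \<open>le\<close> it sees only their values on \<open>space M\<close>.\<close>
  have \<Lambda>_cong: "\<Lambda> f = \<Lambda> f'" if "Bochner_integrable M f" "Bochner_integrable M f'" "\<And>x. x \<in> space M \<Longrightarrow> f x = f' x" for f f'
  proof -
    have "f - f' = (\<lambda>x. f x - f' x)" by (rule ext) simp
    then have "\<bar>\<Lambda> (f - f')\<bar> \<le> (\<integral>x. norm (f x - f' x) \<partial>M)"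
      using le[OF Bochner_integrable_diff[OF that(1,2)]] by simp
    also have "\<dots> = (\<integral>x. 0 \<partial>M)" by (rule Bochner_Integration.integral_cong) (use that(3) in auto)
    finally show ?thesis by (simp add: linear_diff[OF lin])
  qed
  \<comment> \<open>For \<open>i < n\<close> the function \<open>y i\<close> has the constant value
    \<open>v ! i\<close> on the atom of \<open>v\<close>, so the averages reproduce
    \<open>\<Lambda> (y i)\<close> exactly.\<close>
  have rep: "\<Lambda> (y i) = (\<integral>x. G n x (y i x) \<partial>M)" and Gy_simple: "simple_function M (\<lambda>x. G n x (y i x))" if i: "i < n" for i n
  proof -
    define V where "V = h n ` space M"
    have V: "finite V" using h[of n] by (simp add: V_def simple_function_def)
    have yi: "y i x = h n x ! i" for x using i by (simp add: h_def)
    have in_A: "z \<in> A n v \<longleftrightarrow> v = h n z" if "z \<in> space M" for z v using that by (auto simp: A_def)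
    have Gy: "G n x (y i x) = g n (h n x) (h n x ! i)" for x by (simp add: G_apply yi)
    show "simple_function M (\<lambda>x. G n x (y i x))"
      unfolding Gy by (rule simple_function_compose1[OF h])
    have sum_eq: "(\<Sum>v\<in>V. indicat_real (A n v) z *\<^sub>R c v) = c (h n z)" if z: "z \<in> space M" for z and c :: "'e list \<Rightarrow> 'z::real_vector"
    proof -
      have "(\<Sum>v\<in>V. indicat_real (A n v) z *\<^sub>R c v) = (\<Sum>v\<in>V. if v = h n z then c v else 0)"
        by (rule sum.cong) (auto simp: in_A[OF z] indicator_def)
      then show ?thesis using V z by (simp add: V_def)
    qed
    define f where "f = (\<Sum>v\<in>V. (\<lambda>z. indicat_real (A n v) z *\<^sub>R (v ! i)))"
    have f_apply: "f z = (\<Sum>v\<in>V. indicat_real (A n v) z *\<^sub>R (v ! i))" for z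
      unfolding f_def sum_fun_apply ..
    have f_eq: "f z = y i z" if "z \<in> space M" for z unfolding f_apply sum_eq[OF that] yi ..
    have "simple_function M f"
      using y[of i] by (rule simple_function_cong[THEN iffD2, rotated]) (rule f_eq)
    then have "\<Lambda> (y i) = \<Lambda> f"
      by (intro \<Lambda>_cong Bochner_integrable_simple y) (auto simp: f_eq)
    also have "\<dots> = (\<Sum>v\<in>V. \<Lambda> (\<lambda>z. indicat_real (A n v) z *\<^sub>R (v ! i)))"
      unfolding f_def by (rule linear_sum[OF lin])
    also have "\<dots> = (\<Sum>v\<in>V. measure M (A n v) * g n v (v ! i))"
    proof (rule sum.cong[OF refl])
      fix v
      show "\<Lambda> (\<lambda>z. indicat_real (A n v) z *\<^sub>R (v ! i)) = measure M (A n v) * g n v (v ! i)"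
        using \<Lambda>A[of n v "v ! i"] by (cases "measure M (A n v) = 0") (auto simp: g_def)
    qed
    also have "\<dots> = (\<Sum>v\<in>V. \<integral>x. indicat_real (A n v) x *\<^sub>R g n v (v ! i) \<partial>M)"
      using A by simp
    also have "\<dots> = (\<integral>x. (\<Sum>v\<in>V. indicat_real (A n v) x *\<^sub>R g n v (v ! i)) \<partial>M)"
      by (intro Bochner_Integration.integral_sum[symmetric] integrable_scaleR_left integrable_real_indicator A)
        (simp add: less_top[symmetric])
    also have "\<dots> = (\<integral>x. G n x (y i x) \<partial>M)"
      by (rule Bochner_Integration.integral_cong[OF refl]) (simp only: sum_eq Gy)
    finally show "\<Lambda> (y i) = (\<integral>x. G n x (y i x) \<partial>M)" .
  qed
  define S where "S = insert 0 (\<Union>i. y i ` space M)"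
  have "countable S" unfolding S_def using y by (simp add: simple_function_def countable_finite)
  then have S: "range (from_nat_into S) = S" by (intro range_from_nat_into) (auto simp: S_def)
  \<comment> \<open>Convergence of the averages is demanded only at the countably many values of the
    \<open>y i\<close>.\<close>
  define T where "T k (H :: 'a \<Rightarrow> 'e \<Rightarrow>\<^sub>L real) x = H x (from_nat_into S k)" for k H x
  obtain H where H: "\<And>n. H n \<in> convex hull (G ` {n..})" and conv: "\<And>k. AE x in M. convergent (\<lambda>n. T k (H n) x)"
  proof (rule convex_combinations_AE_convergent[of T G "\<lambda>k. measure M (space M) * norm (from_nat_into S k)"])
    show "linear (T k)" for k
      by (rule linearI) (auto simp: T_def fun_eq_iff blinfun.add_left blinfun.scaleR_left)
    have T_le: "\<bar>T k (G n) x\<bar> \<le> norm (from_nat_into S k)" for k n x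
      unfolding T_def by (rule blinfun_le_norm[OF G_norm])
    have "simple_function M (T k (G n))" for k n
      using simple_function_compose1[OF h[of n], of "\<lambda>v. g n v (from_nat_into S k)"] unfolding T_def G_apply by simp
    then have meas: "T k (G n) \<in> borel_measurable M" for k n by (rule borel_measurable_simple_function)
    show int: "integrable M (T k (G n))" for k n
      by (rule integrable_const_bound[of _ "norm (from_nat_into S k)"]) (use T_le meas in auto)
    show "(\<integral>x. \<bar>T k (G n) x\<bar> \<partial>M) \<le> measure M (space M) * norm (from_nat_into S k)" for k n
      using integral_mono[of M "\<lambda>x. \<bar>T k (G n) x\<bar>" "\<lambda>_. norm (from_nat_into S k)"] int T_le by simp
  qed blast
  have H_norm: "norm (H n x) \<le> 1" for n x
  proof -
    have "convex {K :: 'a \<Rightarrow> 'e \<Rightarrow>\<^sub>L real. \<forall>x. norm (K x) \<le> 1}"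
    proof (rule convexI, clarsimp)
      fix K K' :: "'a \<Rightarrow> 'e \<Rightarrow>\<^sub>L real" and u v x
      assume *: "\<forall>x. norm (K x) \<le> 1" "\<forall>x. norm (K' x) \<le> 1" "0 \<le> u" "0 \<le> v" "u + v = (1::real)"
      have "norm (u *\<^sub>R K x + v *\<^sub>R K' x) \<le> u * norm (K x) + v * norm (K' x)"
        using norm_triangle_ineq[of "u *\<^sub>R K x" "v *\<^sub>R K' x"] * by simp
      also have "\<dots> \<le> u * 1 + v * 1" using * by (intro add_mono mult_left_mono) auto
      finally show "norm (u *\<^sub>R K x + v *\<^sub>R K' x) \<le> 1" using * by simp
    qed
    then have "convex hull (G ` {n..}) \<subseteq> {K. \<forall>x. norm (K x) \<le> 1}"
      using G_norm by (intro hull_minimal) auto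
    then show ?thesis using H[of n] by blast
  qed
  \<comment> \<open>All \<open>G m\<close> with \<open>m \<ge> n > i\<close> represent
    \<open>\<Lambda>\<close> on \<open>y i\<close>, and convex combinations preserve the
    representation.\<close>
  have H_rep: "integrable M (\<lambda>x. H n x (y i x)) \<and> (\<integral>x. H n x (y i x) \<partial>M) = \<Lambda> (y i)" if i: "i < n" for i n
  proof -
    let ?C = "{K. integrable M (\<lambda>x. blinfun_apply (K x) (y i x)) \<and> (\<integral>x. blinfun_apply (K x) (y i x) \<partial>M) = \<Lambda> (y i)}"
    have "convex ?C"
    proof (rule convexI, clarsimp simp: blinfun.add_left blinfun.scaleR_left)
      fix u v :: real assume "u + v = 1"
      then show "u * \<Lambda> (y i) + v * \<Lambda> (y i) = \<Lambda> (y i)" by (simp flip: distrib_right)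
    qed
    moreover have "G m \<in> ?C" if "m \<ge> n" for m
    proof -
      have "i < m" using i that by simp
      have "Bochner_integrable M (\<lambda>x. G m x (y i x))"
        by (rule Bochner_integrable_simple[OF Gy_simple[OF \<open>i < m\<close>]])
      then have "integrable M (\<lambda>x. norm (G m x (y i x)))" by (simp only: Bochner_integrable_iff)
      then have "integrable M (\<lambda>x. G m x (y i x))"
        by (rule integrable_norm_cancel[OF _ borel_measurable_simple_function[OF Gy_simple[OF \<open>i < m\<close>]]])
      then show ?thesis using rep[OF \<open>i < m\<close>] by simp
    qed
    ultimately have "convex hull (G ` {n..}) \<subseteq> ?C" by (intro hull_minimal) auto
    then show ?thesis using H[of n] by blast
  qed
  have "AE x in M. \<forall>k. convergent (\<lambda>n. T k (H n) x)" using conv by (simp add: AE_all_countable)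
  then obtain Z where Z: "Z \<in> null_sets M" "{x \<in> space M. \<not> (\<forall>k. convergent (\<lambda>n. T k (H n) x))} \<subseteq> Z"
    by (auto elim: AE_E simp: null_sets_def)
  \<comment> \<open>A limit along a finer filter exists at every vector and is linear and bounded,
    which gives an operator on the whole space; at the vectors in \<open>S\<close> it is the limit
    of the sequence itself, so measurability survives.\<close>
  have "\<exists>K :: 'e \<Rightarrow>\<^sub>L real. norm K \<le> 1 \<and> (\<forall>s\<in>S. (\<lambda>n. H n x s) \<longlonglongrightarrow> blinfun_apply K s)" if x: "x \<in> space M - Z" for x
  proof -
    have "eventually (\<lambda>n. \<bar>H n x e\<bar> \<le> norm e) sequentially" for e
      by (intro always_eventually allI blinfun_le_norm H_norm)
    then obtain F' and L :: "'e \<Rightarrow> real"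
      where F': "F' \<le> sequentially" "F' \<noteq> bot" and L: "\<And>e. ((\<lambda>n. H n x e) \<longlongrightarrow> L e) F'"
      using simultaneous_filter_limit[OF sequentially_bot, where h = "\<lambda>n. blinfun_apply (H n x)" and B = norm] by blast
    have L_le: "norm (L e) \<le> norm e" for e
      by (rule tendsto_upperbound[OF tendsto_norm[OF L] _ F'(2)])
         (use blinfun_le_norm[OF H_norm] in \<open>auto intro: always_eventually\<close>)
    have "bounded_linear L"
    proof (rule bounded_linear_intro[where K = 1])
      fix u v :: 'e and r :: real
      show "L (u + v) = L u + L v"
        using tendsto_unique[OF F'(2) L[of "u + v"]] tendsto_add[OF L[of u] L[of v]] by (simp add: blinfun.add_right)
      show "L (r *\<^sub>R u) = r *\<^sub>R L u"
        using tendsto_unique[OF F'(2) L[of "r *\<^sub>R u"]] tendsto_scaleR[OF tendsto_const[of r] L[of u]]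
        by (simp add: blinfun.scaleR_right)
      show "norm (L u) \<le> norm u * 1" using L_le by simp
    qed
    note L_apply = bounded_linear_Blinfun_apply[OF this]
    have "(\<lambda>n. H n x s) \<longlonglongrightarrow> L s" if "s \<in> S" for s
    proof -
      have "s \<in> range (from_nat_into S)" using \<open>s \<in> S\<close> unfolding S .
      then obtain k where k: "s = from_nat_into S k" by (rule rangeE)
      have "\<forall>k. convergent (\<lambda>n. T k (H n) x)" using Z(2) x by blast
      then have "convergent (\<lambda>n. H n x s)" unfolding T_def k by (rule spec)
      then obtain l where l: "(\<lambda>n. H n x s) \<longlonglongrightarrow> l" by (auto simp: convergent_def)
      have "L s = l" by (rule tendsto_unique[OF F'(2) L tendsto_mono[OF F'(1) l]])
      then show ?thesis using l by simp
    qed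
    moreover have "norm (Blinfun L) \<le> 1"
      by (rule norm_blinfun_bound) (use L_le in \<open>auto simp: L_apply\<close>)
    ultimately show ?thesis by (intro exI[of _ "Blinfun L"]) (simp add: L_apply)
  qed
  then obtain K where K: "\<And>x. x \<in> space M - Z \<Longrightarrow> norm (K x :: 'e \<Rightarrow>\<^sub>L real) \<le> 1"
      "\<And>x s. x \<in> space M - Z \<Longrightarrow> s \<in> S \<Longrightarrow> (\<lambda>n. H n x s) \<longlonglongrightarrow> blinfun_apply (K x) s"
    by metis
  define \<Gamma> where "\<Gamma> x = (if x \<in> space M - Z then K x else 0)" for x
  have Zs: "Z \<in> sets M" using Z(1) by auto
  have lim: "(\<lambda>n. indicat_real (space M - Z) x * H n x (y i x)) \<longlonglongrightarrow> \<Gamma> x (y i x)" if "x \<in> space M" for x i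
    using that K(2)[of x "y i x"] by (auto simp: \<Gamma>_def S_def indicator_def)
  \<comment> \<open>The shift by \<open>Suc i\<close> starts the sequence where \<open>H\<close>
    represents \<open>\<Lambda>\<close> on \<open>y i\<close> and is known to be integrable against
    it.\<close>
  have meas: "(\<lambda>x. \<Gamma> x (y i x)) \<in> borel_measurable M" for i
  proof (rule borel_measurable_LIMSEQ_real)
    show "(\<lambda>n. indicat_real (space M - Z) x * H (n + Suc i) x (y i x)) \<longlonglongrightarrow> \<Gamma> x (y i x)" if "x \<in> space M" for x
      by (rule LIMSEQ_ignore_initial_segment[OF lim[OF that]])
    show "(\<lambda>x. indicat_real (space M - Z) x * H (n + Suc i) x (y i x)) \<in> borel_measurable M" for n
      using H_rep[of i "n + Suc i"] Zs by (intro borel_measurable_times) auto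
  qed
  show thesis
  proof (rule that[of \<Gamma>])
    show "norm (\<Gamma> x) \<le> 1" for x using K(1) by (simp add: \<Gamma>_def)
    show "(\<lambda>x. \<Gamma> x (y i x)) \<in> borel_measurable M" for i by (rule meas)
    fix i
    have "(\<lambda>n. \<integral>x. H (n + Suc i) x (y i x) \<partial>M) \<longlonglongrightarrow> (\<integral>x. \<Gamma> x (y i x) \<partial>M)"
    proof (rule integral_dominated_convergence[where w = "\<lambda>x. norm (y i x)"])
      show "integrable M (\<lambda>x. norm (y i x))"
        using Bochner_integrable_simple[OF y[of i]] by (simp add: Bochner_integrable_iff)
      show "AE x in M. (\<lambda>n. H (n + Suc i) x (y i x)) \<longlonglongrightarrow> \<Gamma> x (y i x)"
        using AE_not_in[OF Z(1)] AE_space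
      proof eventually_elim
        case (elim x)
        then show ?case
          using LIMSEQ_ignore_initial_segment[OF lim[of x i], of "Suc i"] by simp
      qed
      show "AE x in M. norm (H (n + Suc i) x (y i x)) \<le> norm (y i x)" for n
        using blinfun_le_norm[OF H_norm] by simp
      show "(\<lambda>x. H (n + Suc i) x (y i x)) \<in> borel_measurable M" for n
        using H_rep[of i "n + Suc i"] by auto
    qed (rule meas)
    moreover have "(\<integral>x. H (n + Suc i) x (y i x) \<partial>M) = \<Lambda> (y i)" for n
      using H_rep[of i "n + Suc i"] by auto
    ultimately show "\<Lambda> (y i) = (\<integral>x. \<Gamma> x (y i x) \<partial>M)"
      by (simp add: LIMSEQ_const_iff)
  qed
qed

end

lemma minus_fun_eq: "f - g = (\<lambda>x. f x - g x)" for f g :: "'a \<Rightarrow> 'b::ab_group_add"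
  by (rule ext) simp

section \<open>Estimates of Vitali type and limits in mean of convex combinations\<close>

context finite_measure begin

lemma integral_norm_triangle:
  fixes f g :: "'a \<Rightarrow> 'e::banach"
  assumes f: "Bochner_integrable M f" and g: "Bochner_integrable M g"
  shows "(\<integral>x. norm (f x + g x) \<partial>M) \<le> (\<integral>x. norm (f x) \<partial>M) + (\<integral>x. norm (g x) \<partial>M)"
proof -
  have "(\<integral>x. norm (f x + g x) \<partial>M) \<le> (\<integral>x. norm (f x) + norm (g x) \<partial>M)"
    using f g Bochner_integrable_add[OF f g] norm_triangle_ineq
    by (intro integral_mono) (auto simp: Bochner_integrable_iff)
  then show ?thesis using f g by (simp add: Bochner_integrable_iff)
qed

lemma integral_norm_diff_triangle:
  fixes f g h :: "'a \<Rightarrow> 'e::banach"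
  assumes "Bochner_integrable M f" "Bochner_integrable M g" "Bochner_integrable M h"
  shows "(\<integral>x. norm (f x - h x) \<partial>M) \<le> (\<integral>x. norm (f x - g x) \<partial>M) + (\<integral>x. norm (g x - h x) \<partial>M)"
  using integral_norm_triangle[OF Bochner_integrable_diff[OF assms(1,2)] Bochner_integrable_diff[OF assms(2,3)]]
  by simp

lemma subspace_Bochner_integrable: "subspace {f :: 'a \<Rightarrow> 'e::banach. Bochner_integrable M f}"
  unfolding subspace_def plus_fun_def scaleR_fun_def zero_fun_def
  using Bochner_integrable_add Bochner_integrable_scaleR Bochner_integrable_simple[of "\<lambda>_. 0"] by auto

lemma set_integrable_of_integrable:
  fixes h :: "'a \<Rightarrow> real"
  assumes "integrable M h" "A \<in> sets M"
  shows "set_integrable M A h"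
  using assms unfolding set_integrable_def by (rule integrable_mult_indicator[rotated])

lemma set_integral_le_integral:
  fixes h :: "'a \<Rightarrow> real"
  assumes "integrable M h" "\<And>x. 0 \<le> h x"
  shows "(LINT x:A|M. h x) \<le> (\<integral>x. h x \<partial>M)"
  unfolding set_lebesgue_integral_def
  by (rule integral_mono'[OF assms(1)]) (use assms(2) in \<open>auto simp: indicator_def\<close>)

lemma set_integral_mono_real:
  fixes h k :: "'a \<Rightarrow> real"
  assumes "integrable M h" "integrable M k" "A \<in> sets M" "\<And>x. x \<in> space M \<Longrightarrow> h x \<le> k x"
  shows "(LINT x:A|M. h x) \<le> (LINT x:A|M. k x)"
  unfolding set_lebesgue_integral_def
proof (rule integral_mono)
  show "integrable M (\<lambda>x. indicat_real A x *\<^sub>R h x)" "integrable M (\<lambda>x. indicat_real A x *\<^sub>R k x)"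
    by (rule integrable_mult_indicator[OF assms(3,1)], rule integrable_mult_indicator[OF assms(3,2)])
  show "indicat_real A x *\<^sub>R h x \<le> indicat_real A x *\<^sub>R k x" if "x \<in> space M" for x
    using assms(4)[OF that] by (simp add: indicator_def)
qed

text \<open>Vitali's argument in the form used below: off the set where \<open>h\<close> exceeds
  \<open>c\<close> the integrand is at most \<open>c\<close>, and on that set the smallness
  hypothesis applies.\<close>

lemma integral_le_of_small_sets:
  fixes h :: "'a \<Rightarrow> real"
  assumes h: "integrable M h" "\<And>x. 0 \<le> h x" and c: "0 \<le> c"
    and small: "\<And>A. A \<in> sets M \<Longrightarrow> measure M A \<le> \<delta> \<Longrightarrow> (LINT x:A|M. h x) \<le> \<epsilon>"
    and le: "measure M {x \<in> space M. c < h x} \<le> \<delta>"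
  shows "(\<integral>x. h x \<partial>M) \<le> c * measure M (space M) + \<epsilon>"
proof -
  define A where "A = {x \<in> space M. c < h x}"
  have [measurable]: "h \<in> borel_measurable M" using h(1) by auto
  have A: "A \<in> sets M" unfolding A_def by measurable
  have iA: "integrable M (\<lambda>x. indicat_real A x *\<^sub>R h x)" using h(1) A by (intro integrable_mult_indicator)
  have "(\<integral>x. h x \<partial>M) \<le> (\<integral>x. c + indicat_real A x *\<^sub>R h x \<partial>M)"
    using h iA c by (intro integral_mono) (auto simp: A_def indicator_def)
  also have "\<dots> = c * measure M (space M) + (LINT x:A|M. h x)"
    using iA unfolding set_lebesgue_integral_def by simp
  finally show ?thesis using small[OF A] le unfolding A_def by simp
qed

lemma measure_gt_tendsto_zero:
  fixes h :: "nat \<Rightarrow> 'a \<Rightarrow> real"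
  assumes [measurable]: "\<And>n. h n \<in> borel_measurable M" and lim: "AE x in M. (\<lambda>n. h n x) \<longlonglongrightarrow> 0" and c: "0 < c"
  shows "(\<lambda>n. measure M {x \<in> space M. c < h n x}) \<longlonglongrightarrow> 0"
proof -
  have "(\<lambda>n. \<integral>x. indicat_real {x \<in> space M. c < h n x} x \<partial>M) \<longlonglongrightarrow> (\<integral>x. 0 \<partial>M)"
  proof (rule integral_dominated_convergence[where w = "\<lambda>_. 1"])
    show "AE x in M. (\<lambda>n. indicat_real {x \<in> space M. c < h n x} x) \<longlonglongrightarrow> 0"
      using lim
    proof eventually_elim
      case (elim x)
      have "eventually (\<lambda>n. h n x < c) sequentially" by (rule order_tendstoD(2)[OF elim c])
      then have "eventually (\<lambda>n. indicat_real {x \<in> space M. c < h n x} x = 0) sequentially"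
        by eventually_elim auto
      then show ?case by (rule tendsto_eventually)
    qed
  qed (auto simp: indicator_def)
  then show ?thesis by simp
qed

lemma integral_small_on_small_sets:
  fixes h :: "'a \<Rightarrow> real"
  assumes h: "integrable M h" "\<And>x. 0 \<le> h x" and e: "0 < \<epsilon>"
  obtains \<delta> where "0 < \<delta>" "\<And>A. A \<in> sets M \<Longrightarrow> measure M A \<le> \<delta> \<Longrightarrow> (LINT x:A|M. h x) \<le> \<epsilon>"
proof -
  have [measurable]: "h \<in> borel_measurable M" using h(1) by auto
  have "(\<lambda>n. \<integral>x. h x - min (h x) (real n) \<partial>M) \<longlonglongrightarrow> (\<integral>x. 0 \<partial>M)"
  proof (rule integral_dominated_convergence[where w = h])
    show "AE x in M. (\<lambda>n. h x - min (h x) (real n)) \<longlonglongrightarrow> 0"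
    proof (rule AE_I2, rule tendsto_eventually)
      fix x
      obtain n0 where "h x \<le> real n0" using real_arch_simple by blast
      then have "h x - min (h x) (real n) = 0" if "n \<ge> n0" for n using that by (simp add: min_absorb1 order_trans)
      then show "eventually (\<lambda>n. h x - min (h x) (real n) = 0) sequentially"
        unfolding eventually_sequentially by blast
    qed
    show "AE x in M. norm (h x - min (h x) (real n)) \<le> h x" for n
    proof (rule AE_I2)
      fix x show "norm (h x - min (h x) (real n)) \<le> h x" using h(2)[of x] by (simp add: min_def)
    qed
  qed (use h in auto)
  then have "(\<lambda>n. \<integral>x. h x - min (h x) (real n) \<partial>M) \<longlonglongrightarrow> 0" by simp
  then have "eventually (\<lambda>n. (\<integral>x. h x - min (h x) (real n) \<partial>M) < \<epsilon> / 2) sequentially"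
    by (rule order_tendstoD(2)) (use e in simp)
  then obtain n where n: "(\<integral>x. h x - min (h x) (real n) \<partial>M) < \<epsilon> / 2" by (auto simp: eventually_sequentially)
  have i1: "integrable M (\<lambda>x. min (h x) (real n))"
    by (rule Bochner_Integration.integrable_bound[OF h(1)]) (use h(2) in \<open>auto intro!: AE_I2 simp: min_def\<close>)
  then have i2: "integrable M (\<lambda>x. h x - min (h x) (real n))" using h(1) by simp
  \<comment> \<open>Truncation at height \<open>n\<close> costs \<open>\<epsilon> / 2\<close>; below
    that height a set contributes at most \<open>n\<close> times its measure. With
    \<open>n + 1\<close> the quotient makes sense also for \<open>n = 0\<close>.\<close>
  show thesis
  proof (rule that[of "\<epsilon> / (2 * (real n + 1))"])
    show "0 < \<epsilon> / (2 * (real n + 1))" using e by simp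
    fix A assume A: "A \<in> sets M" "measure M A \<le> \<epsilon> / (2 * (real n + 1))"
    have "(LINT x:A|M. h x) = (LINT x:A|M. (h x - min (h x) (real n)) + min (h x) (real n))" by simp
    moreover have "\<dots> = (LINT x:A|M. h x - min (h x) (real n)) + (LINT x:A|M. min (h x) (real n))"
      by (intro set_integral_add set_integrable_of_integrable i1 i2 A)
    moreover have "(LINT x:A|M. h x - min (h x) (real n)) \<le> (\<integral>x. h x - min (h x) (real n) \<partial>M)"
      by (rule set_integral_le_integral[OF i2]) (simp add: min_def)
    moreover have "(LINT x:A|M. min (h x) (real n)) \<le> (LINT x:A|M. real n)"
      by (rule set_integral_mono_real[OF i1 _ A(1)]) simp_all
    moreover have "(LINT x:A|M. real n) = measure M A * real n"
      using A(1) by (simp add: set_lebesgue_integral_def)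
    moreover have "\<dots> \<le> \<epsilon> / (2 * (real n + 1)) * real n" using A(2) by (intro mult_right_mono) auto
    moreover have "\<dots> \<le> \<epsilon> / 2" using e by (simp add: field_simps)
    ultimately show "(LINT x:A|M. h x) \<le> \<epsilon>" using n by argo
  qed
qed

text \<open>The combinations \<open>g n\<close> converge to \<open>u\<close> only weakly at almost
  every point, and it is not claimed that they converge in mean. Weak convergence is enough against
  a density: at each point \<open>\<Gamma> x\<close> is one fixed functional, so
  \<open>\<Gamma> x (g n x)\<close> does converge. Simple functions have countably many values
  altogether, which places the \<open>g n\<close> in one separable subspace.\<close>

lemma uniformly_integrable_L1_limit_simple:
  fixes f :: "nat \<Rightarrow> 'a \<Rightarrow> 'e::banach"
  assumes refl: "reflexive_space TYPE('e)"
    and f: "\<And>n. simple_function M (f n)"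
    and B: "\<And>n. (\<integral>x. norm (f n x) \<partial>M) \<le> B"
    and ui: "\<And>\<epsilon>. \<epsilon> > 0 \<Longrightarrow> \<exists>\<delta>>0. \<forall>n. \<forall>A\<in>sets M. measure M A \<le> \<delta> \<longrightarrow> (LINT x:A|M. norm (f n x)) \<le> \<epsilon>"
  obtains u where "Bochner_integrable M u"
    "\<And>N \<epsilon>. \<epsilon> > 0 \<Longrightarrow> \<exists>g\<in>convex hull (f ` {N..}). (\<integral>x. norm (g x - u x) \<partial>M) < \<epsilon>"
proof -
  define S where "S = insert 0 (\<Union>n. f n ` space M)"
  have "countable S" unfolding S_def using f by (simp add: simple_function_def countable_finite)
  then have S: "range (from_nat_into S) = S" by (intro range_from_nat_into) (auto simp: S_def)
  interpret separable_norming "from_nat_into S" .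
  have S_in: "s \<in> E\<^sub>0" if "s \<in> S" for s
  proof -
    have "s \<in> range (from_nat_into S)" using that unfolding S .
    then obtain k where "s = from_nat_into S k" by (rule rangeE)
    then show ?thesis using a_in by simp
  qed
  \<comment> \<open>Pairing \<open>f n\<close> with its norm applies the same convex coefficients to
    both: \<open>w n\<close> dominates the norm of \<open>g n\<close> and inherits the bounds in
    mean and on small sets. Test \<open>0\<close> of \<open>T\<close> is this dominating function,
    test \<open>Suc k\<close> is \<open>N k\<close> applied to the values.\<close>
  define F where "F n = (f n, \<lambda>x. norm (f n x))" for n
  define T :: "nat \<Rightarrow> ('a \<Rightarrow> 'e) \<times> ('a \<Rightarrow> real) \<Rightarrow> 'a \<Rightarrow> real"
    where "T k z = (case k of 0 \<Rightarrow> snd z | Suc k \<Rightarrow> (\<lambda>x. N k (fst z x)))" for k z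
  have fB: "Bochner_integrable M (f n)" for n by (rule Bochner_integrable_simple[OF f])
  have fn: "integrable M (\<lambda>x. norm (f n x))" for n using fB[of n] by (simp add: Bochner_integrable_iff)
  obtain G where G: "\<And>n. G n \<in> convex hull (F ` {n..})" and conv: "\<And>k. AE x in M. convergent (\<lambda>n. T k (G n) x)"
  proof (rule convex_combinations_AE_convergent[of T F "\<lambda>_. B"])
    show "linear (T k)" for k
      by (rule linearI) (auto simp: T_def fun_eq_iff blinfun.add_right blinfun.scaleR_right split: nat.splits)
    show "integrable M (T k (F n))" for k n
      using fn[of n] integrable_blinfun[OF fB[of n]] by (auto simp: T_def F_def split: nat.splits)
    show "(\<integral>x. \<bar>T k (F n) x\<bar> \<partial>M) \<le> B" for k n
    proof (cases k)
      case 0 then show ?thesis using B[of n] by (simp add: T_def F_def)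
    next
      case (Suc k')
      have "(\<integral>x. \<bar>N k' (f n x)\<bar> \<partial>M) \<le> (\<integral>x. norm (f n x) \<partial>M)"
        using fn[of n] integrable_blinfun[OF fB[of n], of "N k'"] blinfun_le_norm[OF N(1)] by (intro integral_mono) auto
      then show ?thesis using B[of n] by (simp add: T_def F_def Suc)
    qed
  qed blast
  define g where "g n = fst (G n)" for n
  define w where "w n = snd (G n)" for n
  have T0: "T 0 (G n) = w n" and TSuc: "T (Suc k) (G n) = (\<lambda>x. N k (g n x))" for n k
    by (simp_all add: T_def g_def w_def)
  have g_hull: "g n \<in> convex hull (f ` {n..})" for n
  proof -
    have "fst ` (convex hull (F ` {n..})) = convex hull (fst ` F ` {n..})"
      by (rule convex_hull_linear_image) (rule linear_fst)
    also have "fst ` F ` {n..} = f ` {n..}" by (simp add: F_def image_image)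
    finally show ?thesis using G[of n] unfolding g_def by blast
  qed
  have hull_prop: "G n \<in> C" if "convex C" "\<And>k. F k \<in> C" for C n
    using hull_minimal[of "F ` {n..}" C convex] that G[of n] by blast
  have g_simple: "simple_function M (g n)" for n
  proof -
    have "G n \<in> {z. simple_function M (fst z)}"
    proof (rule hull_prop)
      show "convex {z :: ('a \<Rightarrow> 'e) \<times> ('a \<Rightarrow> real). simple_function M (fst z)}"
        by (rule convexI)
           (auto simp: plus_fun_def scaleR_fun_def intro: simple_function_compose2[where h = "\<lambda>a b. _ *\<^sub>R a + _ *\<^sub>R b"])
    qed (simp add: F_def f)
    then show ?thesis by (simp add: g_def)
  qed
  have g_E0: "g n x \<in> E\<^sub>0" if x: "x \<in> space M" for n x
  proof -
    have "G n \<in> {z. fst z x \<in> E\<^sub>0}"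
    proof (rule hull_prop)
      show "convex {z :: ('a \<Rightarrow> 'e) \<times> ('a \<Rightarrow> real). fst z x \<in> E\<^sub>0}"
        by (rule convexI) (auto intro: subspace_add[OF E\<^sub>0_subspace] subspace_scale[OF E\<^sub>0_subspace])
      show "F k \<in> {z. fst z x \<in> E\<^sub>0}" for k
      proof -
        have "f k x \<in> S" using x unfolding S_def by blast
        then show ?thesis using S_in by (simp add: F_def)
      qed
    qed
    then show ?thesis by (simp add: g_def)
  qed
  have gw: "norm (g n x) \<le> w n x" for n x
  proof -
    have "G n \<in> {z. norm (fst z x) \<le> snd z x}"
    proof (rule hull_prop)
      show "convex {z :: ('a \<Rightarrow> 'e) \<times> ('a \<Rightarrow> real). norm (fst z x) \<le> snd z x}"
      proof (rule convexI, clarsimp)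
        fix p q :: "'a \<Rightarrow> 'e" and v v' :: "'a \<Rightarrow> real" and r s :: real
        assume "norm (p x) \<le> v x" "norm (q x) \<le> v' x" "0 \<le> r" "0 \<le> s"
        then show "norm (r *\<^sub>R p x + s *\<^sub>R q x) \<le> r * v x + s * v' x"
          by (intro order_trans[OF norm_triangle_ineq] add_mono) (auto intro: mult_left_mono)
      qed
    qed (simp add: F_def)
    then show ?thesis by (simp add: g_def w_def)
  qed
  have w_int: "integrable M (w n)" for n
  proof -
    have "G n \<in> {z. integrable M (snd z)}"
    proof (rule hull_prop)
      show "convex {z :: ('a \<Rightarrow> 'e) \<times> ('a \<Rightarrow> real). integrable M (snd z)}"
        by (rule convexI) (auto simp: plus_fun_def scaleR_fun_def)
    qed (simp add: F_def fn)
    then show ?thesis by (simp add: w_def)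
  qed
  have w_set: "(LINT x:A|M. w n x) \<le> c" if A: "A \<in> sets M" and c: "\<And>k. (LINT x:A|M. norm (f k x)) \<le> c" for A c n
  proof -
    have "G n \<in> {z. integrable M (snd z) \<and> (LINT x:A|M. snd z x) \<le> c}"
    proof (rule hull_prop)
      show "convex {z :: ('a \<Rightarrow> 'e) \<times> ('a \<Rightarrow> real). integrable M (snd z) \<and> (LINT x:A|M. snd z x) \<le> c}"
      proof (rule convexI, clarsimp simp: plus_fun_def scaleR_fun_def)
        fix v v' :: "'a \<Rightarrow> real" and r s :: real
        assume *: "integrable M v" "integrable M v'" "(LINT x:A|M. v x) \<le> c" "(LINT x:A|M. v' x) \<le> c"
          and rs: "0 \<le> r" "0 \<le> s" "r + s = 1"
        have "(LINT x:A|M. r * v x + s * v' x) = r * (LINT x:A|M. v x) + s * (LINT x:A|M. v' x)"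
          using * A by (subst set_integral_add) (auto intro!: set_integrable_of_integrable)
        also have "\<dots> \<le> r * c + s * c" using * rs by (intro add_mono mult_left_mono) auto
        also have "\<dots> = c" using rs(3) by (simp flip: distrib_right)
        finally show "(LINT x:A|M. r * v x + s * v' x) \<le> c" .
      qed
    qed (use c fn in \<open>simp add: F_def\<close>)
    then show ?thesis by (simp add: w_def)
  qed
  have w0: "0 \<le> w n x" for n x using gw[of n x] norm_ge_zero order_trans by blast
  have gB: "Bochner_integrable M (g n)" for n by (rule Bochner_integrable_simple[OF g_simple])
  have "AE x in M. \<forall>k. convergent (\<lambda>n. T k (G n) x)" using conv by (simp add: AE_all_countable)
  then obtain Z where Z: "Z \<in> null_sets M" "{x \<in> space M. \<not> (\<forall>k. convergent (\<lambda>n. T k (G n) x))} \<subseteq> Z"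
    by (auto elim: AE_E simp: null_sets_def)
  have w_conv: "convergent (\<lambda>n. w n x)" and Ng_conv: "convergent (\<lambda>n. N k (g n x))" if "x \<in> space M - Z" for x k
  proof -
    have *: "\<forall>k. convergent (\<lambda>n. T k (G n) x)" using Z(2) that by blast
    show "convergent (\<lambda>n. w n x)" using spec[OF *, of 0] by (simp only: T0)
    show "convergent (\<lambda>n. N k (g n x))" using spec[OF *, of "Suc k"] by (simp only: TSuc)
  qed
  have "\<exists>v\<in>E\<^sub>0. \<forall>\<phi> :: 'e \<Rightarrow>\<^sub>L real. (\<lambda>n. blinfun_apply \<phi> (g n x)) \<longlonglongrightarrow> blinfun_apply \<phi> v" if x: "x \<in> space M - Z" for x
  proof -
    obtain b where b: "\<And>n. norm (w n x) \<le> b"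
      using convergent_imp_Bseq[OF w_conv[OF x]] unfolding Bseq_def by blast
    have "norm (g n x) \<le> b" for n using gw[of n x] b[of n] by simp
    then obtain v where "v \<in> E\<^sub>0" "\<And>\<phi> :: 'e \<Rightarrow>\<^sub>L real. (\<lambda>n. \<phi> (g n x)) \<longlonglongrightarrow> \<phi> v"
      using weak_limit_sequence[OF refl, of "\<lambda>n. g n x" b] g_E0 Ng_conv[OF x] x by blast
    then show ?thesis by blast
  qed
  then obtain u\<^sub>0 where u0: "\<And>x. x \<in> space M - Z \<Longrightarrow> u\<^sub>0 x \<in> E\<^sub>0"
    "\<And>x (\<phi> :: 'e \<Rightarrow>\<^sub>L real). x \<in> space M - Z \<Longrightarrow> (\<lambda>n. \<phi> (g n x)) \<longlonglongrightarrow> \<phi> (u\<^sub>0 x)" by metis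
  define u where "u x = (if x \<in> space M - Z then u\<^sub>0 x else 0)" for x
  have u_E0: "u x \<in> E\<^sub>0" for x using u0(1) subspace_0[OF E\<^sub>0_subspace] by (simp add: u_def)
  have Zs: "Z \<in> sets M" using Z(1) by auto
  have u_lim: "(\<lambda>n. \<phi> (g n x)) \<longlonglongrightarrow> \<phi> (u x)" if "x \<in> space M - Z" for x and \<phi> :: "'e \<Rightarrow>\<^sub>L real"
    using u0(2)[OF that] that by (simp add: u_def)
  have Nu_meas [measurable]: "(\<lambda>x. N k (u x)) \<in> borel_measurable M" for k
  proof (rule borel_measurable_LIMSEQ_real)
    show "(\<lambda>n. indicat_real (space M - Z) x * N k (g n x)) \<longlonglongrightarrow> N k (u x)" if "x \<in> space M" for x
      using u_lim[of x "N k"] that by (cases "x \<in> Z") (auto simp: u_def)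
    show "(\<lambda>x. indicat_real (space M - Z) x * N k (g n x)) \<in> borel_measurable M" for n
      using Zs strongly_measurable_blinfun[OF strongly_measurable_simple[OF g_simple]] by (intro borel_measurable_times) auto
  qed
  have norm_sup: "norm v = (SUP k. N k v)" and bdd: "bdd_above (range (\<lambda>k. N k v))" if v: "v \<in> E\<^sub>0" for v
  proof -
    have le: "N k v \<le> norm v" for k using blinfun_le_norm[OF N(1), of k v] by simp
    then show bdd: "bdd_above (range (\<lambda>k. N k v))" by (intro bdd_aboveI2)
    show "norm v = (SUP k. N k v)"
    proof (rule antisym)
      show "(SUP k. N k v) \<le> norm v" using le by (intro cSUP_least) auto
      show "norm v \<le> (SUP k. N k v)"
      proof (rule field_le_epsilon)
        fix r :: real assume "r > 0"
        then obtain k where "norm v \<le> N k v + r" using norm_approx[OF v] by blast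
        moreover have "N k v \<le> (SUP k. N k v)" by (rule cSUP_upper[OF _ bdd]) simp
        ultimately show "norm v \<le> (SUP k. N k v) + r" by simp
      qed
    qed
  qed
  \<comment> \<open>Measurability is read off from the scalar functions \<open>N k (u x)\<close>: on
    \<open>E\<^sub>0\<close> the norm is the supremum of the \<open>N k\<close>, so all distances
    \<open>dist (u x) (d j)\<close> are measurable.\<close>
  have u_sm: "strongly_measurable M u"
  proof (rule strongly_measurableI_dist[where d = d])
    show "u x \<in> closure (range d)" for x
      unfolding closure_approachable
    proof (intro allI impI)
      fix r :: real assume "r > 0"
      then obtain k where "norm (u x - d k) < r" using d_dense[OF u_E0] by blast
      then show "\<exists>y\<in>range d. dist y (u x) < r" by (auto simp: dist_norm norm_minus_commute)
    qed
    fix j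
    have in_E0: "u x - d j \<in> E\<^sub>0" for x by (rule subspace_diff[OF E\<^sub>0_subspace u_E0 d_in])
    have "(\<lambda>x. dist (u x) (d j)) = (\<lambda>x. SUP k. N k (u x - d j))"
      by (rule ext) (simp only: dist_norm norm_sup[OF in_E0])
    moreover have "(\<lambda>x. SUP k. N k (u x - d j)) \<in> borel_measurable M"
    proof (rule borel_measurable_cSUP)
      show "(\<lambda>x. N k (u x - d j)) \<in> borel_measurable M" for k
        unfolding blinfun.diff_right by measurable
    qed (use bdd[OF in_E0] in auto)
    ultimately show "(\<lambda>x. dist (u x) (d j)) \<in> borel_measurable M" by simp
  qed
  \<comment> \<open>The dominating functions converge off \<open>Z\<close> whereas the norms of the
    \<open>g n\<close> need not, so Fatou's lemma is applied to the former.\<close>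
  have u_le: "ennreal (norm (u x)) \<le> liminf (\<lambda>n. ennreal (w n x))" if x: "x \<in> space M" for x
  proof (cases "x \<in> Z")
    case False
    then have x': "x \<in> space M - Z" using x by simp
    obtain l where l: "(\<lambda>n. w n x) \<longlonglongrightarrow> l" using w_conv[OF x'] by (auto simp: convergent_def)
    have "N k (u x) \<le> l" for k
    proof (rule tendsto_le[OF _ l u_lim[OF x']])
      have "N k (g n x) \<le> w n x" for n
        using blinfun_le_norm[OF N(1), of k "g n x"] gw[of n x] by simp
      then show "eventually (\<lambda>n. N k (g n x) \<le> w n x) sequentially" by simp
    qed simp
    then have "norm (u x) \<le> l" unfolding norm_sup[OF u_E0] by (intro cSUP_least) auto
    moreover have "liminf (\<lambda>n. ennreal (w n x)) = ennreal l"
      by (rule lim_imp_Liminf) (auto intro: tendsto_ennrealI l)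
    ultimately show ?thesis by (simp add: ennreal_leI)
  qed (simp add: u_def)
  have uB: "Bochner_integrable M u"
  proof -
    have "(\<integral>\<^sup>+x. ennreal (norm (u x)) \<partial>M) \<le> (\<integral>\<^sup>+x. liminf (\<lambda>n. ennreal (w n x)) \<partial>M)"
      by (rule nn_integral_mono) (rule u_le)
    also have "\<dots> \<le> liminf (\<lambda>n. \<integral>\<^sup>+x. ennreal (w n x) \<partial>M)"
      using w_int by (intro nn_integral_liminf) auto
    also have "\<dots> \<le> ennreal B"
    proof (rule Liminf_le)
      have "(\<integral>\<^sup>+x. ennreal (w n x) \<partial>M) = ennreal (\<integral>x. w n x \<partial>M)" for n
        by (rule nn_integral_eq_integral[OF w_int]) (simp add: w0)
      moreover have "(\<integral>x. w n x \<partial>M) \<le> B" for n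
        using w_set[of "space M" B n] B by (simp add: set_integral_space w_int fn)
      ultimately show "eventually (\<lambda>n. (\<integral>\<^sup>+x. ennreal (w n x) \<partial>M) \<le> ennreal B) sequentially"
        by (simp add: ennreal_leI)
    qed simp
    also have "\<dots> < \<infinity>" by simp
    finally have "(\<integral>\<^sup>+x. ennreal (norm (u x)) \<partial>M) < \<infinity>" .
    then show ?thesis
      unfolding Bochner_integrable_iff using u_sm strongly_measurable_norm[OF u_sm]
      by (auto intro!: integrableI_bounded)
  qed
  show thesis
  proof (rule that[OF uB], rule ccontr)
    fix n\<^sub>0 and \<epsilon> :: real
    assume \<epsilon>: "\<epsilon> > 0" and neg: "\<not> (\<exists>g\<in>convex hull (f ` {n\<^sub>0..}). (\<integral>x. norm (g x - u x) \<partial>M) < \<epsilon>)"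
    have far: "\<epsilon> \<le> (\<integral>x. norm (h x - u x) \<partial>M)" if h: "h \<in> convex hull (f ` {n\<^sub>0..})" for h
    proof (rule leI, rule notI)
      assume "(\<integral>x. norm (h x - u x) \<partial>M) < \<epsilon>"
      with neg h show False by (elim notE) (rule bexI)
    qed
    define V where "V = {f :: 'a \<Rightarrow> 'e. Bochner_integrable M f}"
    have subV: "subspace V" unfolding V_def by (rule subspace_Bochner_integrable)
    obtain P where P: "linear P" "range P \<subseteq> V" "\<And>v. v \<in> V \<Longrightarrow> P v = v"
      by (rule subspace_projection[OF subV]) (rule that)
    define p where "p v = (\<integral>x. norm (P v x) \<partial>M)" for v
    have p: "seminorm p" unfolding p_def
    proof (rule seminorm_comp_linear[OF P(1), where p = "\<lambda>v. \<integral>x. norm (v x) \<partial>M"])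
      fix v v' assume "v \<in> range P" "v' \<in> range P"
      then have "v \<in> V" "v' \<in> V" using P(2) by auto
      then show "(\<integral>x. norm ((v + v') x) \<partial>M) \<le> (\<integral>x. norm (v x) \<partial>M) + (\<integral>x. norm (v' x) \<partial>M)"
        unfolding V_def plus_fun_apply by (auto intro: integral_norm_triangle)
    qed simp
    have pV: "p v = (\<integral>x. norm (v x) \<partial>M)" if "v \<in> V" for v using P(3)[OF that] by (simp add: p_def)
    define Q where "Q = (\<lambda>h. h - u) ` (convex hull (f ` {n\<^sub>0..}))"
    have hull_V: "convex hull (f ` {n\<^sub>0..}) \<subseteq> V"
      using fB subspace_imp_convex[OF subspace_Bochner_integrable] by (intro hull_minimal) (auto simp: V_def)
    have diffV: "h - h' \<in> V" if "h \<in> V" "h' \<in> V" for h h'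
      using subspace_diff[OF subspace_Bochner_integrable] that unfolding V_def by blast
    have uV: "u \<in> V" using uB by (simp add: V_def)
    have convQ: "convex Q"
    proof -
      have "Q = (\<lambda>h. - u + h) ` (convex hull (f ` {n\<^sub>0..}))" unfolding Q_def by (rule image_cong) auto
      then show ?thesis by (simp only:) (rule convex_translation[OF convex_convex_hull])
    qed
    have neQ: "Q \<noteq> {}" by (simp add: Q_def)
    have farQ: "\<epsilon> \<le> p v" if v: "v \<in> Q" for v
    proof -
      obtain h where h: "h \<in> convex hull (f ` {n\<^sub>0..})" "v = h - u" using v by (auto simp: Q_def)
      have "v \<in> V" using h hull_V uV diffV by blast
      then show ?thesis using far[OF h(1)] by (simp add: pV h(2))
    qed
    obtain \<Lambda> where \<Lambda>: "linear \<Lambda>" "\<And>v. \<bar>\<Lambda> v\<bar> \<le> p v" "\<And>v. v \<in> Q \<Longrightarrow> \<epsilon> \<le> \<Lambda> v"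
      by (rule hahn_banach_convex[OF p convQ neQ farQ], assumption) (rule that)
    have \<Lambda>le: "\<bar>\<Lambda> v\<bar> \<le> (\<integral>x. norm (v x) \<partial>M)" if "Bochner_integrable M v" for v
      using \<Lambda>(2)[of v] pV[of v] that by (simp add: V_def)
    obtain s where s: "\<And>i::nat. simple_function M (s i)" "\<And>x. x \<in> space M \<Longrightarrow> (\<lambda>i. s i x) \<longlonglongrightarrow> u x"
      and sle: "\<And>i x. norm (s i x) \<le> 2 * norm (u x)"
      by (rule strongly_measurable_dominated_simple[OF u_sm]) blast
    \<comment> \<open>Interleaving the \<open>g i\<close> with simple approximants
      \<open>s i\<close> of \<open>u\<close> yields one density for both; through the
      \<open>s i\<close> the representation extends to \<open>u\<close>, which need not be
      simple.\<close>
    define y where "y i = (if even i then g (i div 2) else s (i div 2))" for i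
    have y: "simple_function M (y i)" for i using g_simple s(1) by (simp add: y_def)
    obtain \<Gamma> :: "'a \<Rightarrow> 'e \<Rightarrow>\<^sub>L real" where \<Gamma>: "\<And>x. norm (\<Gamma> x) \<le> 1"
      and \<Gamma>y: "\<And>i. (\<lambda>x. \<Gamma> x (y i x)) \<in> borel_measurable M" "\<And>i. \<Lambda> (y i) = (\<integral>x. \<Gamma> x (y i x) \<partial>M)"
      by (rule functional_representation[OF y \<Lambda>(1) \<Lambda>le], assumption) (rule that)
    have \<Gamma>g: "(\<lambda>x. \<Gamma> x (g i x)) \<in> borel_measurable M" "\<Lambda> (g i) = (\<integral>x. \<Gamma> x (g i x) \<partial>M)"
      and \<Gamma>s: "(\<lambda>x. \<Gamma> x (s i x)) \<in> borel_measurable M" "\<Lambda> (s i) = (\<integral>x. \<Gamma> x (s i x) \<partial>M)" for i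
      using \<Gamma>y[of "2 * i"] \<Gamma>y[of "Suc (2 * i)"] by (simp_all add: y_def)
    have un: "integrable M (\<lambda>x. norm (u x))" using uB by (simp add: Bochner_integrable_iff)
    have \<Gamma>s_lim: "(\<lambda>i. \<Gamma> x (s i x)) \<longlonglongrightarrow> \<Gamma> x (u x)" if "x \<in> space M" for x
      by (rule blinfun.tendsto[OF tendsto_const s(2)[OF that]])
    have \<Gamma>u_meas: "(\<lambda>x. \<Gamma> x (u x)) \<in> borel_measurable M"
      by (rule borel_measurable_LIMSEQ_real[OF \<Gamma>s_lim \<Gamma>s(1)])
    have bound: "\<bar>\<Gamma> x (s i x)\<bar> \<le> 2 * norm (u x)" for i x
      using blinfun_le_norm[OF \<Gamma>, of x "s i x"] sle[of i x] by simp
    have "(\<lambda>i. \<Lambda> (s i)) \<longlonglongrightarrow> (\<integral>x. \<Gamma> x (u x) \<partial>M)"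
      unfolding \<Gamma>s(2)
      by (rule integral_dominated_convergence[where w = "\<lambda>x. 2 * norm (u x)"])
         (use \<Gamma>u_meas \<Gamma>s(1) un \<Gamma>s_lim bound in auto)
    moreover have "(\<lambda>i. \<Lambda> (s i)) \<longlonglongrightarrow> \<Lambda> u"
    proof -
      have sB: "Bochner_integrable M (\<lambda>x. s i x - u x)" for i
        by (rule Bochner_integrable_diff[OF Bochner_integrable_simple[OF s(1)] uB])
      have "(\<lambda>i. \<integral>x. norm (s i x - u x) \<partial>M) \<longlonglongrightarrow> (\<integral>x. 0 \<partial>M)"
      proof (rule integral_dominated_convergence[where w = "\<lambda>x. 3 * norm (u x)"])
        show "AE x in M. (\<lambda>i. norm (s i x - u x)) \<longlonglongrightarrow> 0"
        proof (rule AE_I2)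
          fix x assume "x \<in> space M"
          from tendsto_norm[OF tendsto_diff[OF s(2)[OF this] tendsto_const, of "u x"]]
          show "(\<lambda>i. norm (s i x - u x)) \<longlonglongrightarrow> 0" by simp
        qed
        show "(\<lambda>x. norm (s i x - u x)) \<in> borel_measurable M" for i
          by (rule strongly_measurable_norm[OF conjunct1[OF iffD1[OF Bochner_integrable_iff sB]]])
        show "AE x in M. norm (norm (s i x - u x)) \<le> 3 * norm (u x)" for i
        proof (rule AE_I2)
          fix x
          show "norm (norm (s i x - u x)) \<le> 3 * norm (u x)"
            using norm_triangle_ineq4[of "s i x" "u x"] sle[of i x] by simp
        qed
      qed (use un in auto)
      then have L0: "(\<lambda>i. \<integral>x. norm (s i x - u x) \<partial>M) \<longlonglongrightarrow> 0" by simp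
      have "(\<lambda>i. \<Lambda> (s i) - \<Lambda> u) \<longlonglongrightarrow> 0"
      proof (rule Lim_null_comparison[OF always_eventually L0], rule allI)
        fix i
        have "\<Lambda> (s i) - \<Lambda> u = \<Lambda> (\<lambda>x. s i x - u x)"
          unfolding linear_diff[OF \<Lambda>(1), symmetric] minus_fun_eq ..
        then show "norm (\<Lambda> (s i) - \<Lambda> u) \<le> (\<integral>x. norm (s i x - u x) \<partial>M)"
          using \<Lambda>le[OF sB[of i]] by simp
      qed
      then show ?thesis by (rule LIM_zero_cancel)
    qed
    ultimately have \<Lambda>u: "\<Lambda> u = (\<integral>x. \<Gamma> x (u x) \<partial>M)" by (rule LIMSEQ_unique[rotated])
    define h where "h n x = \<bar>\<Gamma> x (g n x) - \<Gamma> x (u x)\<bar>" for n x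
    have h_meas: "h n \<in> borel_measurable M" for n unfolding h_def using \<Gamma>g(1) \<Gamma>u_meas by measurable
    have h0: "0 \<le> h n x" for n x by (simp add: h_def)
    have h_le: "h n x \<le> w n x + norm (u x)" for n x
      using blinfun_le_norm[OF \<Gamma>, of x "g n x"] blinfun_le_norm[OF \<Gamma>, of x "u x"] gw[of n x] by (simp add: h_def)
    have h_int: "integrable M (h n)" for n
      by (rule Bochner_Integration.integrable_bound[of _ "\<lambda>x. w n x + norm (u x)"])
         (use w_int un h_meas h_le h0 w0 in \<open>auto\<close>)
    have h_lim: "AE x in M. (\<lambda>n. h n x) \<longlonglongrightarrow> 0"
      using AE_not_in[OF Z(1)] AE_space
    proof eventually_elim
      case (elim x)
      then have "(\<lambda>n. \<Gamma> x (g n x) - \<Gamma> x (u x)) \<longlonglongrightarrow> \<Gamma> x (u x) - \<Gamma> x (u x)"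
        by (intro tendsto_diff u_lim tendsto_const) simp
      then show ?case unfolding h_def by (intro tendsto_rabs_zero) simp
    qed
    define m where "m = measure M (space M)"
    have m: "0 \<le> m" by (simp add: m_def)
    \<comment> \<open>Budget: \<open>c * m \<le> \<epsilon> / 4\<close> where \<open>h n\<close> is
      small, and on the exceptional set \<open>\<epsilon> / 4\<close> each from \<open>w n\<close>
      and from \<open>u\<close>; in total less than \<open>\<epsilon>\<close>.\<close>
    define c where "c = \<epsilon> / (4 * (m + 1))"
    have c: "c > 0" using \<epsilon> m by (simp add: c_def)
    have cm: "c * m \<le> \<epsilon> / 4" using \<epsilon> m by (simp add: c_def field_simps)
    obtain \<delta>\<^sub>1 where d1: "\<delta>\<^sub>1 > 0" "\<And>n A. A \<in> sets M \<Longrightarrow> measure M A \<le> \<delta>\<^sub>1 \<Longrightarrow> (LINT x:A|M. norm (f n x)) \<le> \<epsilon> / 4"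
      using ui[of "\<epsilon> / 4"] \<epsilon> by auto
    obtain \<delta>\<^sub>2 where d2: "\<delta>\<^sub>2 > 0" "\<And>A. A \<in> sets M \<Longrightarrow> measure M A \<le> \<delta>\<^sub>2 \<Longrightarrow> (LINT x:A|M. norm (u x)) \<le> \<epsilon> / 4"
      using integral_small_on_small_sets[OF un, of "\<epsilon> / 4"] \<epsilon> by auto
    define \<delta> where "\<delta> = min \<delta>\<^sub>1 \<delta>\<^sub>2"
    have small: "(LINT x:A|M. h n x) \<le> \<epsilon> / 2" if A: "A \<in> sets M" "measure M A \<le> \<delta>" for A n
    proof -
      have "(LINT x:A|M. h n x) \<le> (LINT x:A|M. w n x + norm (u x))"
        using h_int w_int un A h_le by (intro set_integral_mono_real) auto
      also have "\<dots> = (LINT x:A|M. w n x) + (LINT x:A|M. norm (u x))"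
        using w_int un A by (intro set_integral_add set_integrable_of_integrable) auto
      also have "\<dots> \<le> \<epsilon> / 4 + \<epsilon> / 4"
        using A d1(2)[OF A(1)] d2(2)[OF A(1)] by (intro add_mono w_set) (auto simp: \<delta>_def)
      finally show ?thesis by simp
    qed
    have "\<delta> > 0" using d1(1) d2(1) by (simp add: \<delta>_def)
    then have "eventually (\<lambda>n. measure M {x \<in> space M. c < h n x} < \<delta>) sequentially"
      by (rule order_tendstoD(2)[OF measure_gt_tendsto_zero[OF h_meas h_lim c]])
    then have "eventually (\<lambda>n. measure M {x \<in> space M. c < h n x} < \<delta> \<and> n\<^sub>0 \<le> n) sequentially"
      using eventually_ge_at_top[of n\<^sub>0] by eventually_elim simp
    then obtain n where "measure M {x \<in> space M. c < h n x} < \<delta> \<and> n\<^sub>0 \<le> n"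
      using eventually_happens'[OF sequentially_bot] by blast
    then have n: "measure M {x \<in> space M. c < h n x} \<le> \<delta>" "n\<^sub>0 \<le> n" by simp_all
    have "g n \<in> convex hull (f ` {n\<^sub>0..})" using g_hull[of n] convex_hull_image_atLeast_mono[OF n(2)] by blast
    then have "\<epsilon> \<le> \<Lambda> (g n - u)" by (intro \<Lambda>(3)) (auto simp: Q_def)
    also have "\<dots> = (\<integral>x. \<Gamma> x (g n x) \<partial>M) - (\<integral>x. \<Gamma> x (u x) \<partial>M)"
      by (simp add: linear_diff[OF \<Lambda>(1)] \<Gamma>g(2) \<Lambda>u)
    also have "\<dots> = (\<integral>x. \<Gamma> x (g n x) - \<Gamma> x (u x) \<partial>M)"
    proof (rule Bochner_Integration.integral_diff[symmetric])
      have *: "norm (\<Gamma> x (g n x)) \<le> norm (w n x)" for x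
        using blinfun_le_norm[OF \<Gamma>, of x "g n x"] gw[of n x] by simp
      show "integrable M (\<lambda>x. \<Gamma> x (g n x))"
        by (rule Bochner_Integration.integrable_bound[OF w_int[of n] \<Gamma>g(1)[of n]]) (rule AE_I2, rule *)
      have **: "norm (\<Gamma> x (u x)) \<le> norm (norm (u x))" for x
        using blinfun_le_norm[OF \<Gamma>, of x "u x"] by simp
      show "integrable M (\<lambda>x. \<Gamma> x (u x))"
        by (rule Bochner_Integration.integrable_bound[OF un \<Gamma>u_meas]) (rule AE_I2, rule **)
    qed
    also have "\<dots> \<le> (\<integral>x. h n x \<partial>M)" using integral_abs_bound unfolding h_def by (rule order_trans[OF abs_ge_self])
    also have "\<dots> \<le> c * m + \<epsilon> / 2"
      unfolding m_def by (rule integral_le_of_small_sets[OF h_int h0 less_imp_le[OF c] small n(1)])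
    also have "\<dots> \<le> \<epsilon> / 4 + \<epsilon> / 2" using cm by simp
    finally show False using \<epsilon> by simp
  qed
qed

lemma Bochner_integrable_approx_simple:
  fixes f :: "'a \<Rightarrow> 'e::banach"
  assumes f: "Bochner_integrable M f" and e: "0 < \<epsilon>"
  obtains s where "simple_function M s" "\<And>x. norm (s x) \<le> 2 * norm (f x)" "(\<integral>x. norm (s x - f x) \<partial>M) < \<epsilon>"
proof -
  have fm: "strongly_measurable M f" and fn: "integrable M (\<lambda>x. norm (f x))"
    using f by (simp_all add: Bochner_integrable_iff)
  obtain s where s: "\<And>i::nat. simple_function M (s i)" "\<And>x. x \<in> space M \<Longrightarrow> (\<lambda>i. s i x) \<longlonglongrightarrow> f x"
    and sle: "\<And>i x. norm (s i x) \<le> 2 * norm (f x)"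
    by (rule strongly_measurable_dominated_simple[OF fm]) blast
  have "(\<lambda>i. \<integral>x. norm (s i x - f x) \<partial>M) \<longlonglongrightarrow> (\<integral>x. 0 \<partial>M)"
  proof (rule integral_dominated_convergence[where w = "\<lambda>x. 3 * norm (f x)"])
    show "AE x in M. (\<lambda>i. norm (s i x - f x)) \<longlonglongrightarrow> 0"
    proof (rule AE_I2)
      fix x assume "x \<in> space M"
      from tendsto_norm[OF tendsto_diff[OF s(2)[OF this] tendsto_const, of "f x"]]
      show "(\<lambda>i. norm (s i x - f x)) \<longlonglongrightarrow> 0" by simp
    qed
    show "(\<lambda>x. norm (s i x - f x)) \<in> borel_measurable M" for i
      by (rule strongly_measurable_norm[OF strongly_measurable_diff[OF strongly_measurable_simple[OF s(1)] fm]])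
    show "AE x in M. norm (norm (s i x - f x)) \<le> 3 * norm (f x)" for i
    proof (rule AE_I2)
      fix x
      show "norm (norm (s i x - f x)) \<le> 3 * norm (f x)"
        using norm_triangle_ineq4[of "s i x" "f x"] sle[of i x] by simp
    qed
  qed (use fn in auto)
  then have "(\<lambda>i. \<integral>x. norm (s i x - f x) \<partial>M) \<longlonglongrightarrow> 0" by simp
  from eventually_happens'[OF sequentially_bot order_tendstoD(2)[OF this e]]
  obtain i where "(\<integral>x. norm (s i x - f x) \<partial>M) < \<epsilon>" by blast
  then show thesis by (rule that[OF s(1) sle])
qed

text \<open>Simple functions at distance below \<open>1 / (n + 1)\<close> from \<open>f n\<close>
  inherit the bounds up to a factor \<open>2\<close>; the convex combinations found for them are
  copied to the \<open>f n\<close> with the same coefficients.\<close>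

lemma uniformly_integrable_L1_limit:
  fixes f :: "nat \<Rightarrow> 'a \<Rightarrow> 'e::banach"
  assumes refl: "reflexive_space TYPE('e)"
    and f: "\<And>n. Bochner_integrable M (f n)"
    and B: "\<And>n. (\<integral>x. norm (f n x) \<partial>M) \<le> B"
    and ui: "\<And>\<epsilon>. \<epsilon> > 0 \<Longrightarrow> \<exists>\<delta>>0. \<forall>n. \<forall>A\<in>sets M. measure M A \<le> \<delta> \<longrightarrow> (LINT x:A|M. norm (f n x)) \<le> \<epsilon>"
  obtains u where "Bochner_integrable M u"
    "\<And>N \<epsilon>. \<epsilon> > 0 \<Longrightarrow> \<exists>g\<in>convex hull (f ` {N..}). (\<integral>x. norm (g x - u x) \<partial>M) < \<epsilon>"
proof -
  have "\<exists>s. simple_function M s \<and> (\<forall>x. norm (s x) \<le> 2 * norm (f n x)) \<and> (\<integral>x. norm (s x - f n x) \<partial>M) < inverse (Suc n)" for n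
  proof -
    obtain s where "simple_function M s" "\<And>x. norm (s x) \<le> 2 * norm (f n x)"
      "(\<integral>x. norm (s x - f n x) \<partial>M) < inverse (Suc n)"
      by (rule Bochner_integrable_approx_simple[OF f[of n], of "inverse (Suc n)"]) auto
    then show ?thesis by blast
  qed
  then obtain s where s: "\<And>n. simple_function M (s n)" and sle: "\<And>n x. norm (s n x) \<le> 2 * norm (f n x)"
    and sf: "\<And>n. (\<integral>x. norm (s n x - f n x) \<partial>M) < inverse (Suc n)" by metis
  have sB: "Bochner_integrable M (s n)" for n by (rule Bochner_integrable_simple[OF s])
  have fn: "integrable M (\<lambda>x. norm (f n x))" and sn: "integrable M (\<lambda>x. norm (s n x))" for n
    using f[of n] sB[of n] by (simp_all add: Bochner_integrable_iff)
  have set_le: "(LINT x:A|M. norm (s n x)) \<le> 2 * (LINT x:A|M. norm (f n x))" if A: "A \<in> sets M" for A n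
    using set_integral_mono_real[OF sn[of n] integrable_mult_right[OF fn[of n], of 2] A] sle[of n] by simp
  obtain u where u: "Bochner_integrable M u"
    and lim: "\<And>N \<epsilon>. \<epsilon> > 0 \<Longrightarrow> \<exists>g\<in>convex hull (s ` {N..}). (\<integral>x. norm (g x - u x) \<partial>M) < \<epsilon>"
  proof (rule uniformly_integrable_L1_limit_simple[OF refl s])
    show "(\<integral>x. norm (s n x) \<partial>M) \<le> 2 * B" for n
    proof -
      have "(\<integral>x. norm (s n x) \<partial>M) \<le> (\<integral>x. 2 * norm (f n x) \<partial>M)"
        using sn[of n] fn[of n] sle[of n] by (intro integral_mono) auto
      then show ?thesis using B[of n] by simp
    qed
    fix \<epsilon> :: real assume "\<epsilon> > 0"
    then obtain \<delta> where d: "\<delta> > 0" "\<And>n A. A \<in> sets M \<Longrightarrow> measure M A \<le> \<delta> \<Longrightarrow> (LINT x:A|M. norm (f n x)) \<le> \<epsilon> / 2"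
      using ui[of "\<epsilon> / 2"] by auto
    have "(LINT x:A|M. norm (s n x)) \<le> \<epsilon>" if "A \<in> sets M" "measure M A \<le> \<delta>" for n A
      using d(2)[OF that, of n] set_le[OF that(1), of n] by simp
    then show "\<exists>\<delta>>0. \<forall>n. \<forall>A\<in>sets M. measure M A \<le> \<delta> \<longrightarrow> (LINT x:A|M. norm (s n x)) \<le> \<epsilon>"
      using d(1) by blast
  qed blast
  have "\<exists>g\<in>convex hull (f ` {N..}). (\<integral>x. norm (g x - u x) \<partial>M) < \<epsilon>" if e: "\<epsilon> > 0" for N \<epsilon>
  proof -
    obtain m where m: "N \<le> m" "inverse (real (Suc m)) < \<epsilon> / 2"
    proof -
      obtain k where k: "inverse (real (Suc k)) < \<epsilon> / 2" using reals_Archimedean[of "\<epsilon> / 2"] e by auto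
      have "inverse (real (Suc (max N k))) \<le> inverse (real (Suc k))" by simp
      then have "inverse (real (Suc (max N k))) < \<epsilon> / 2" using k by (rule order_le_less_trans)
      then show thesis by (rule that[rotated]) simp
    qed
    obtain g where g: "g \<in> convex hull (s ` {m..})" "(\<integral>x. norm (g x - u x) \<partial>M) < \<epsilon> / 2"
      using lim[OF half_gt_zero[OF e], of m] by blast
    \<comment> \<open>The hull of the pairs transports coefficients from the \<open>s n\<close> to
      the \<open>f n\<close>; from index \<open>m\<close> on the two differ by at most
      \<open>1 / (m + 1)\<close> in mean, and so do their combinations.\<close>
    define F where "F n = (s n, f n)" for n
    have "fst ` (convex hull (F ` {m..})) = convex hull (fst ` F ` {m..})"
      by (rule convex_hull_linear_image[OF linear_fst])
    also have "fst ` F ` {m..} = s ` {m..}" by (simp add: F_def image_image)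
    finally have "g \<in> fst ` (convex hull (F ` {m..}))" using g(1) by (simp only:)
    then obtain z where z: "z \<in> convex hull (F ` {m..})" "g = fst z" by (rule imageE)
    have "snd z \<in> snd ` (convex hull (F ` {m..}))" using z(1) by (rule imageI)
    also have "\<dots> = convex hull (snd ` F ` {m..})"
      by (rule convex_hull_linear_image[OF linear_snd])
    also have "snd ` F ` {m..} = f ` {m..}" by (simp add: F_def image_image)
    finally have snd_z: "snd z \<in> convex hull (f ` {m..})" .
    let ?C = "{z :: ('a \<Rightarrow> 'e) \<times> ('a \<Rightarrow> 'e). Bochner_integrable M (fst z) \<and> Bochner_integrable M (snd z) \<and> (\<integral>x. norm (fst z x - snd z x) \<partial>M) \<le> inverse (Suc m)}"
    have "convex ?C"
    proof (rule convexI)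
      fix p q and a b :: real
      assume p: "p \<in> ?C" and q: "q \<in> ?C" and ab: "0 \<le> a" "0 \<le> b" "a + b = 1"
      have bp: "Bochner_integrable M (\<lambda>x. a *\<^sub>R (fst p x - snd p x))" and bq: "Bochner_integrable M (\<lambda>x. b *\<^sub>R (fst q x - snd q x))"
        using p q by (auto intro!: Bochner_integrable_scaleR Bochner_integrable_diff)
      have "(\<integral>x. norm (fst (a *\<^sub>R p + b *\<^sub>R q) x - snd (a *\<^sub>R p + b *\<^sub>R q) x) \<partial>M)
          = (\<integral>x. norm (a *\<^sub>R (fst p x - snd p x) + b *\<^sub>R (fst q x - snd q x)) \<partial>M)"
        by (simp add: scaleR_diff_right add_diff_add)
      also have "\<dots> \<le> (\<integral>x. norm (a *\<^sub>R (fst p x - snd p x)) \<partial>M) + (\<integral>x. norm (b *\<^sub>R (fst q x - snd q x)) \<partial>M)"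
        by (rule integral_norm_triangle[OF bp bq])
      also have "\<dots> = a * (\<integral>x. norm (fst p x - snd p x) \<partial>M) + b * (\<integral>x. norm (fst q x - snd q x) \<partial>M)"
        using ab by simp
      also have "\<dots> \<le> a * inverse (Suc m) + b * inverse (Suc m)"
        using p q ab by (intro add_mono mult_left_mono) auto
      also have "\<dots> = inverse (Suc m)" using ab(3) by (simp flip: distrib_right)
      finally have "(\<integral>x. norm (fst (a *\<^sub>R p + b *\<^sub>R q) x - snd (a *\<^sub>R p + b *\<^sub>R q) x) \<partial>M) \<le> inverse (Suc m)" .
      moreover have "Bochner_integrable M (fst (a *\<^sub>R p + b *\<^sub>R q))" "Bochner_integrable M (snd (a *\<^sub>R p + b *\<^sub>R q))"
        using p q by (auto simp: plus_fun_def scaleR_fun_def intro!: Bochner_integrable_add Bochner_integrable_scaleR)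
      ultimately show "a *\<^sub>R p + b *\<^sub>R q \<in> ?C" by blast
    qed
    moreover have "F n \<in> ?C" if "m \<le> n" for n
    proof -
      have "inverse (real (Suc n)) \<le> inverse (real (Suc m))" using that by simp
      then have "(\<integral>x. norm (s n x - f n x) \<partial>M) \<le> inverse (real (Suc m))" using sf[of n] by linarith
      then show ?thesis using f[of n] sB[of n] by (simp add: F_def)
    qed
    ultimately have "convex hull (F ` {m..}) \<subseteq> ?C" by (intro hull_minimal image_subsetI) simp_all
    then have zC: "Bochner_integrable M g" "Bochner_integrable M (snd z)" "(\<integral>x. norm (g x - snd z x) \<partial>M) \<le> inverse (Suc m)"
      using z(1) unfolding z(2) by blast+
    have "(\<integral>x. norm (snd z x - u x) \<partial>M) \<le> (\<integral>x. norm (snd z x - g x) \<partial>M) + (\<integral>x. norm (g x - u x) \<partial>M)"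
      by (rule integral_norm_diff_triangle[OF zC(2,1) u])
    moreover have "(\<integral>x. norm (snd z x - g x) \<partial>M) = (\<integral>x. norm (g x - snd z x) \<partial>M)"
      by (simp add: norm_minus_commute)
    ultimately have "(\<integral>x. norm (snd z x - u x) \<partial>M) < \<epsilon>" using zC(3) g(2) m(2) by linarith
    moreover have "snd z \<in> convex hull (f ` {N..})"
      using snd_z convex_hull_image_atLeast_mono[OF m(1)] by blast
    ultimately show ?thesis by blast
  qed
  then show thesis by (rule that[OF u])
qed

end

section \<open>Maximal functions and terminal values\<close>

text \<open>Running suprema at positive times lose nothing: each \<open>t \<ge> 0\<close> is seen by
  the one at \<open>t + 1\<close>.\<close>

lemma maximal_function_eq_SUP: "maximal_function Y x = (SUP t\<in>{0..}. ennreal (norm (Y t x)))"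
proof (rule antisym)
  show "maximal_function Y x \<le> (SUP t\<in>{0..}. ennreal (norm (Y t x)))"
    unfolding maximal_function_def running_sup_def
    by (intro SUP_least) (rule SUP_upper, simp)
  show "(SUP t\<in>{0..}. ennreal (norm (Y t x))) \<le> maximal_function Y x"
  proof (rule SUP_least)
    fix t :: real assume "t \<in> {0..}"
    then have "ennreal (norm (Y t x)) \<le> running_sup Y (t + 1) x"
      unfolding running_sup_def by (intro SUP_upper) auto
    also have "\<dots> \<le> maximal_function Y x"
      unfolding maximal_function_def using \<open>t \<in> {0..}\<close> by (intro SUP_upper) auto
    finally show "ennreal (norm (Y t x)) \<le> maximal_function Y x" .
  qed
qed

lemma norm_le_maximal_function: "0 \<le> t \<Longrightarrow> ennreal (norm (Y t x)) \<le> maximal_function Y x"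
  unfolding maximal_function_eq_SUP by (rule SUP_upper) simp

lemma maximal_function_leI:
  "(\<And>t. 0 \<le> t \<Longrightarrow> ennreal (norm (Y t x)) \<le> c) \<Longrightarrow> maximal_function Y x \<le> c"
  unfolding maximal_function_eq_SUP by (rule SUP_least) simp

lemma maximal_function_add: "maximal_function (Y + Z) x \<le> maximal_function Y x + maximal_function Z x"
proof (rule maximal_function_leI)
  fix t :: real assume t: "0 \<le> t"
  have "ennreal (norm ((Y + Z) t x)) \<le> ennreal (norm (Y t x) + norm (Z t x))"
    by (rule ennreal_leI) (simp add: norm_triangle_ineq)
  also have "\<dots> = ennreal (norm (Y t x)) + ennreal (norm (Z t x))" by (rule ennreal_plus) simp_all
  also have "\<dots> \<le> maximal_function Y x + maximal_function Z x"
    by (intro add_mono norm_le_maximal_function t)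
  finally show "ennreal (norm ((Y + Z) t x)) \<le> maximal_function Y x + maximal_function Z x" .
qed

lemma maximal_function_scaleR: "maximal_function (c *\<^sub>R Y) x = ennreal \<bar>c\<bar> * maximal_function Y x"
  unfolding maximal_function_eq_SUP SUP_mult_left_ennreal by (simp add: ennreal_mult)

text \<open>Right continuity reduces the supremum to a countable one, which gives measurability and
  allows Doob's inequality to be proved with finitely many times.\<close>

lemma cadlag_maximal_function_rat:
  assumes Y: "cadlag M Y" and x: "x \<in> space M"
  shows "maximal_function Y x = (SUP q\<in>{q::rat. 0 \<le> q}. ennreal (norm (Y (of_rat q) x)))"
proof (rule antisym)
  show "(SUP q\<in>{q::rat. 0 \<le> q}. ennreal (norm (Y (of_rat q) x))) \<le> maximal_function Y x"
    by (intro SUP_least norm_le_maximal_function) simp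
  show "maximal_function Y x \<le> (SUP q\<in>{q::rat. 0 \<le> q}. ennreal (norm (Y (of_rat q) x)))"
  proof (rule maximal_function_leI)
    fix t :: real assume t: "0 \<le> t"
    let ?S = "SUP q\<in>{q::rat. 0 \<le> q}. ennreal (norm (Y (of_rat q) x))"
    have right: "((\<lambda>s. Y s x) \<longlongrightarrow> Y t x) (at_right t)" using Y x t unfolding cadlag_def by blast
    show "ennreal (norm (Y t x)) \<le> ?S"
    proof (rule ccontr)
      assume "\<not> ennreal (norm (Y t x)) \<le> ?S"
      then have lt: "?S < ennreal (norm (Y t x))" by simp
      have "((\<lambda>s. ennreal (norm (Y s x))) \<longlongrightarrow> ennreal (norm (Y t x))) (at_right t)"
        by (intro tendsto_ennrealI tendsto_norm right)
      from order_tendstoD(1)[OF this lt] obtain b where b: "b > t" "\<And>s. t < s \<Longrightarrow> s < b \<Longrightarrow> ?S < ennreal (norm (Y s x))"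
        unfolding eventually_at_right_field by blast
      obtain q :: rat where q: "t < of_rat q" "of_rat q < b" using of_rat_dense[OF b(1)] by blast
      have "0 \<le> (of_rat q :: real)" using q(1) t by linarith
      then have "0 \<le> q" by simp
      then have "ennreal (norm (Y (of_rat q) x)) \<le> ?S" by (intro SUP_upper) simp
      with b(2)[OF q] show False by simp
    qed
  qed
qed

lemma cadlag_add:
  assumes "cadlag M Y" "cadlag M Z"
  shows "cadlag M (Y + Z)"
  unfolding cadlag_def
proof (intro ballI conjI allI impI)
  fix x t assume x: "x \<in> space M"
  { assume "0 \<le> (t::real)"
    then show "((\<lambda>s. (Y + Z) s x) \<longlongrightarrow> (Y + Z) t x) (at_right t)"
      using assms x unfolding cadlag_def plus_fun_apply by (intro tendsto_add) blast+ }
  { assume "0 < (t::real)"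
    then obtain l l' where "((\<lambda>s. Y s x) \<longlongrightarrow> l) (at_left t)" "((\<lambda>s. Z s x) \<longlongrightarrow> l') (at_left t)"
      using assms x unfolding cadlag_def by blast
    then have "((\<lambda>s. (Y + Z) s x) \<longlongrightarrow> l + l') (at_left t)" unfolding plus_fun_apply by (rule tendsto_add)
    then show "\<exists>l. ((\<lambda>s. (Y + Z) s x) \<longlongrightarrow> l) (at_left t)" by (rule exI) }
qed

lemma cadlag_scaleR:
  assumes "cadlag M Y"
  shows "cadlag M (c *\<^sub>R Y)"
  unfolding cadlag_def
proof (intro ballI conjI allI impI)
  fix x t assume x: "x \<in> space M"
  { assume "0 \<le> (t::real)"
    then show "((\<lambda>s. (c *\<^sub>R Y) s x) \<longlongrightarrow> (c *\<^sub>R Y) t x) (at_right t)"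
      using assms x unfolding cadlag_def scaleR_fun_apply by (intro tendsto_scaleR tendsto_const) blast+ }
  { assume "0 < (t::real)"
    then obtain l where "((\<lambda>s. Y s x) \<longlongrightarrow> l) (at_left t)"
      using assms x unfolding cadlag_def by blast
    then have "((\<lambda>s. (c *\<^sub>R Y) s x) \<longlongrightarrow> c *\<^sub>R l) (at_left t)"
      unfolding scaleR_fun_apply by (rule tendsto_scaleR[OF tendsto_const])
    then show "\<exists>l. ((\<lambda>s. (c *\<^sub>R Y) s x) \<longlongrightarrow> l) (at_left t)" by (rule exI) }
qed

text \<open>The value infinity becomes \<open>0\<close>, so domination of the norms and
  subadditivity hold only where the maximal function is finite; for members of
  \<open>H1_processes\<close> this is almost everywhere.\<close>

definition max_real :: "('x, 'e::real_normed_vector) process \<Rightarrow> 'x \<Rightarrow> real" where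
  "max_real Y x = enn2real (maximal_function Y x)"

lemma max_real_nonneg: "0 \<le> max_real Y x" by (simp add: max_real_def)

lemma max_real_scaleR: "max_real (c *\<^sub>R Y) x = \<bar>c\<bar> * max_real Y x"
  by (simp add: max_real_def maximal_function_scaleR enn2real_mult)

lemma max_real_add:
  assumes "maximal_function Y x < \<infinity>" "maximal_function Z x < \<infinity>"
  shows "max_real (Y + Z) x \<le> max_real Y x + max_real Z x"
proof -
  have "enn2real (maximal_function (Y + Z) x) \<le> enn2real (maximal_function Y x + maximal_function Z x)"
    using assms by (intro enn2real_mono maximal_function_add) auto
  then show ?thesis using assms by (simp add: max_real_def enn2real_plus)
qed

lemma norm_le_max_real:
  assumes "maximal_function Y x < \<infinity>" "0 \<le> t"
  shows "norm (Y t x) \<le> max_real Y x"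
proof -
  have "ennreal (norm (Y t x)) \<le> ennreal (max_real Y x)"
    using norm_le_maximal_function[OF assms(2), of Y x] assms(1) by (simp add: max_real_def)
  then show ?thesis by (simp add: max_real_nonneg)
qed

context finite_measure begin

text \<open>Convergence in mean passes to the scalar integrals that characterise conditional
  expectations; this is how terminal values are carried to a limit.\<close>

lemma set_integral_blinfun_tendsto:
  fixes f :: "nat \<Rightarrow> 'a \<Rightarrow> 'e::banach" and \<phi> :: "'e \<Rightarrow>\<^sub>L real"
  assumes f: "\<And>n. Bochner_integrable M (f n)" and g: "Bochner_integrable M g" and A: "A \<in> sets M"
    and lim: "(\<lambda>n. \<integral>x. norm (f n x - g x) \<partial>M) \<longlonglongrightarrow> 0"
  shows "(\<lambda>n. LINT x:A|M. \<phi> (f n x)) \<longlonglongrightarrow> (LINT x:A|M. \<phi> (g x))"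
proof (rule LIM_zero_cancel, rule Lim_null_comparison[OF always_eventually], rule allI)
  have lim0: "(\<lambda>n. norm \<phi> * (\<integral>x. norm (f n x - g x) \<partial>M)) \<longlonglongrightarrow> norm \<phi> * 0"
    by (rule tendsto_mult[OF tendsto_const lim])
  then show "(\<lambda>n. norm \<phi> * (\<integral>x. norm (f n x - g x) \<partial>M)) \<longlonglongrightarrow> 0" by simp
  fix n
  have si: "set_integrable M A (\<lambda>x. \<phi> (f n x))" "set_integrable M A (\<lambda>x. \<phi> (g x))"
    by (rule set_integrable_of_integrable[OF integrable_blinfun[OF f] A],
        rule set_integrable_of_integrable[OF integrable_blinfun[OF g] A])
  have d: "Bochner_integrable M (\<lambda>x. f n x - g x)" by (rule Bochner_integrable_diff[OF f g])
  have "(LINT x:A|M. \<phi> (f n x)) - (LINT x:A|M. \<phi> (g x)) = (LINT x:A|M. \<phi> (f n x) - \<phi> (g x))"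
    by (rule set_integral_diff(2)[OF si, symmetric])
  also have "\<dots> = (\<integral>x. indicat_real A x *\<^sub>R \<phi> (f n x - g x) \<partial>M)"
    unfolding set_lebesgue_integral_def blinfun.diff_right ..
  finally have eq: "(LINT x:A|M. \<phi> (f n x)) - (LINT x:A|M. \<phi> (g x)) = (\<integral>x. indicat_real A x *\<^sub>R \<phi> (f n x - g x) \<partial>M)" .
  have "norm (\<integral>x. indicat_real A x *\<^sub>R \<phi> (f n x - g x) \<partial>M) \<le> (\<integral>x. norm \<phi> * norm (f n x - g x) \<partial>M)"
  proof (rule order_trans[OF integral_norm_bound], rule integral_mono)
    show "integrable M (\<lambda>x. norm (indicat_real A x *\<^sub>R \<phi> (f n x - g x)))"
      by (rule integrable_norm[OF integrable_mult_indicator[OF A integrable_blinfun[OF d]]])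
    show "integrable M (\<lambda>x. norm \<phi> * norm (f n x - g x))"
      by (rule integrable_mult_right) (use d in \<open>simp add: Bochner_integrable_iff\<close>)
    fix x
    have "norm (indicat_real A x *\<^sub>R \<phi> (f n x - g x)) \<le> norm (\<phi> (f n x - g x))" by (simp add: indicator_def)
    also have "\<dots> \<le> norm \<phi> * norm (f n x - g x)" by (rule norm_blinfun)
    finally show "norm (indicat_real A x *\<^sub>R \<phi> (f n x - g x)) \<le> norm \<phi> * norm (f n x - g x)" .
  qed
  then show "norm ((LINT x:A|M. \<phi> (f n x)) - (LINT x:A|M. \<phi> (g x))) \<le> norm \<phi> * (\<integral>x. norm (f n x - g x) \<partial>M)"
    unfolding eq by simp
qed

end

section \<open>Martingales with terminal values: Doob's inequality and completeness\<close>

context stochastic_basis begin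

lemma sets_F_subset: "0 \<le> t \<Longrightarrow> sets (F t) \<subseteq> sets M"
  using subalgebra_F[of t] by (simp add: subalgebra_def)

lemma space_F: "0 \<le> t \<Longrightarrow> space (F t) = space M"
  using subalgebra_F[of t] by (simp add: subalgebra_def)

text \<open>This allows processes to be modified on null sets without losing adaptedness.\<close>

lemma null_set_in_F:
  assumes "N \<in> null_sets M" "0 \<le> t"
  shows "N \<in> sets (F t)"
proof -
  have "N \<in> sets (F 0)" unfolding F_zero using assms(1) by (rule sigma_sets.Basic)
  then show ?thesis using F_mono[of 0 t] assms(2) by auto
qed

text \<open>Such an \<open>f\<close> is not determined by \<open>Y\<close>, since it need not be
  measurable for the \<sigma>-algebra generated by the filtration;
  \<open>H1_terminal_bounded\<close> later produces a good one.\<close>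

definition terminal :: "('x, 'e::banach) process \<Rightarrow> ('x \<Rightarrow> 'e) \<Rightarrow> bool" where
  "terminal Y f \<longleftrightarrow> Bochner_integrable M f \<and> (\<forall>t\<ge>0. is_cond_exp M (F t) f (Y t))"

lemma terminal_iff:
  "terminal Y f \<longleftrightarrow> Bochner_integrable M f \<and>
    (\<forall>t\<ge>0. Bochner_integrable M (Y t) \<and> strongly_measurable (F t) (Y t) \<and>
      (\<forall>A\<in>sets (F t). \<forall>\<phi> :: 'e::banach \<Rightarrow>\<^sub>L real. (LINT x:A|M. \<phi> (f x)) = (LINT x:A|M. \<phi> (Y t x))))"
proof -
  have eq: "is_cond_exp M (F t) f (Y t) \<longleftrightarrow> Bochner_integrable M f \<and> Bochner_integrable M (Y t) \<and> strongly_measurable (F t) (Y t) \<and>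
      (\<forall>A\<in>sets (F t). \<forall>\<phi> :: 'e \<Rightarrow>\<^sub>L real. (LINT x:A|M. \<phi> (f x)) = (LINT x:A|M. \<phi> (Y t x)))" if "0 \<le> t" for t
    by (rule is_cond_exp_iff[OF sets_F_subset[OF that]])
  show ?thesis unfolding terminal_def by (rule iffI; elim conjE; intro conjI allI impI; simp add: eq)
qed

lemma terminalD:
  fixes Y :: "('x, 'e::banach) process" and \<phi> :: "'e \<Rightarrow>\<^sub>L real"
  assumes "terminal Y f" "0 \<le> t"
  shows "Bochner_integrable M f" "Bochner_integrable M (Y t)" "strongly_measurable (F t) (Y t)"
    "strongly_measurable M (Y t)" "A \<in> sets (F t) \<Longrightarrow> (LINT x:A|M. \<phi> (f x)) = (LINT x:A|M. \<phi> (Y t x))"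
  using assms unfolding terminal_iff by (simp_all add: Bochner_integrable_iff)

lemma terminal_is_cond_exp:
  fixes Y :: "('x, 'e::banach) process"
  assumes f: "terminal Y f" and st: "0 \<le> s" "s \<le> t"
  shows "is_cond_exp M (F s) (Y t) (Y s)"
proof -
  have t: "0 \<le> t" using st by simp
  have "(LINT x:A|M. \<phi> (Y t x)) = (LINT x:A|M. \<phi> (Y s x))" if A: "A \<in> sets (F s)" for A and \<phi> :: "'e \<Rightarrow>\<^sub>L real"
  proof -
    have "A \<in> sets (F t)" using A F_mono[OF st] by blast
    then show ?thesis using terminalD(5)[OF f st(1) A] terminalD(5)[OF f t] by metis
  qed
  then show ?thesis
    unfolding is_cond_exp_iff[OF sets_F_subset[OF st(1)]]
    using terminalD(2,3)[OF f st(1)] terminalD(2)[OF f t] by blast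
qed

lemma maximal_function_measurable:
  fixes Y :: "('x, 'e::banach) process"
  assumes Y: "cadlag M Y" and m: "\<And>t. 0 \<le> t \<Longrightarrow> strongly_measurable M (Y t)"
  shows "maximal_function Y \<in> borel_measurable M"
proof -
  have "(\<lambda>x. SUP q\<in>{q::rat. 0 \<le> q}. ennreal (norm (Y (of_rat q) x))) \<in> borel_measurable M"
  proof (rule borel_measurable_SUP)
    show "(\<lambda>x. ennreal (norm (Y (of_rat q) x))) \<in> borel_measurable M" if "q \<in> {q::rat. 0 \<le> q}" for q
      by (rule measurable_compose[OF strongly_measurable_norm[OF m] measurable_ennreal]) (use that in simp)
  qed simp
  then show ?thesis
    by (rule measurable_cong[THEN iffD2, rotated]) (rule cadlag_maximal_function_rat[OF Y])
qed

text \<open>The martingale property is the tower property of a terminal value, and the maximal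
  function is measurable by regularity of the paths; three conditions remain to be checked in
  applications.\<close>

lemma H1_processes_iff:
  fixes Y :: "('x, 'e::banach) process"
  shows "Y \<in> H1_processes M F \<longleftrightarrow> cadlag M Y \<and> (\<exists>f. terminal Y f) \<and> (\<integral>\<^sup>+x. maximal_function Y x \<partial>M) < \<infinity>"
proof
  assume "Y \<in> H1_processes M F"
  then show "cadlag M Y \<and> (\<exists>f. terminal Y f) \<and> (\<integral>\<^sup>+x. maximal_function Y x \<partial>M) < \<infinity>"
    unfolding H1_processes_def terminal_def by blast
next
  assume *: "cadlag M Y \<and> (\<exists>f. terminal Y f) \<and> (\<integral>\<^sup>+x. maximal_function Y x \<partial>M) < \<infinity>"
  then obtain f where f: "terminal Y f" by blast
  have "martingale M F Y"
    unfolding martingale_def using terminalD(2,3)[OF f] terminal_is_cond_exp[OF f] by blast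
  moreover have "maximal_function Y \<in> borel_measurable M"
    using * terminalD(4)[OF f] by (intro maximal_function_measurable) auto
  ultimately show "Y \<in> H1_processes M F"
    unfolding H1_processes_def using * unfolding terminal_def by blast
qed

lemma terminal_add:
  fixes Y Z :: "('x, 'e::banach) process"
  assumes f: "terminal Y f" and g: "terminal Z g"
  shows "terminal (Y + Z) (f + g)"
  unfolding terminal_iff plus_fun_def
proof (intro conjI allI impI ballI)
  show "Bochner_integrable M (\<lambda>x. f x + g x)"
    using f g unfolding terminal_def by (intro Bochner_integrable_add) auto
  fix t :: real assume t: "0 \<le> t"
  show "Bochner_integrable M (\<lambda>x. Y t x + Z t x)"
    by (rule Bochner_integrable_add[OF terminalD(2)[OF f t] terminalD(2)[OF g t]])
  show "strongly_measurable (F t) (\<lambda>x. Y t x + Z t x)"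
    by (rule strongly_measurable_add[OF terminalD(3)[OF f t] terminalD(3)[OF g t]])
  fix A and \<phi> :: "'e \<Rightarrow>\<^sub>L real" assume A: "A \<in> sets (F t)"
  then have AM: "A \<in> sets M" using sets_F_subset[OF t] by blast
  have si: "set_integrable M A (\<lambda>x. \<phi> (h x))" if "Bochner_integrable M h" for h
    by (rule set_integrable_of_integrable[OF integrable_blinfun[OF that] AM])
  show "(LINT x:A|M. \<phi> (f x + g x)) = (LINT x:A|M. \<phi> (Y t x + Z t x))"
    unfolding blinfun.add_right
      set_integral_add(2)[OF si[OF terminalD(1)[OF f t]] si[OF terminalD(1)[OF g t]]]
      set_integral_add(2)[OF si[OF terminalD(2)[OF f t]] si[OF terminalD(2)[OF g t]]]
      terminalD(5)[OF f t A] terminalD(5)[OF g t A] ..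
qed

lemma terminal_scaleR:
  fixes Y :: "('x, 'e::banach) process"
  assumes f: "terminal Y f"
  shows "terminal (c *\<^sub>R Y) (c *\<^sub>R f)"
  unfolding terminal_iff scaleR_fun_def
proof (intro conjI allI impI ballI)
  show "Bochner_integrable M (\<lambda>x. c *\<^sub>R f x)"
    using f unfolding terminal_def by (intro Bochner_integrable_scaleR) auto
  fix t :: real assume t: "0 \<le> t"
  show "Bochner_integrable M (\<lambda>x. c *\<^sub>R Y t x)" by (rule Bochner_integrable_scaleR[OF terminalD(2)[OF f t]])
  show "strongly_measurable (F t) (\<lambda>x. c *\<^sub>R Y t x)" by (rule strongly_measurable_scaleR_const[OF terminalD(3)[OF f t]])
  fix A and \<phi> :: "'e \<Rightarrow>\<^sub>L real" assume A: "A \<in> sets (F t)"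
  show "(LINT x:A|M. \<phi> (c *\<^sub>R f x)) = (LINT x:A|M. \<phi> (c *\<^sub>R Y t x))"
    unfolding blinfun.scaleR_right using terminalD(5)[OF f t A, of \<phi>] by simp
qed

lemma subspace_H1_processes: "subspace (H1_processes M F :: ('x, 'e::banach) process set)"
  unfolding subspace_def
proof (intro conjI ballI allI)
  have "terminal (0 :: ('x, 'e) process) 0"
    unfolding terminal_iff zero_fun_def
    by (auto intro: Bochner_integrable_simple strongly_measurable_simple)
  moreover have "cadlag M (0 :: ('x, 'e) process)" unfolding cadlag_def by auto
  moreover have "maximal_function (0 :: ('x, 'e) process) = (\<lambda>_. 0)"
    by (rule ext) (simp add: maximal_function_eq_SUP)
  then have "(\<integral>\<^sup>+x. maximal_function (0 :: ('x, 'e) process) x \<partial>M) < \<infinity>" by simp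
  ultimately show "(0 :: ('x, 'e) process) \<in> H1_processes M F" unfolding H1_processes_iff by blast
  fix Y :: "('x, 'e) process" assume Y: "Y \<in> H1_processes M F"
  then obtain f where f: "terminal Y f" unfolding H1_processes_iff by blast
  have Ym: "maximal_function Y \<in> borel_measurable M" using Y unfolding H1_processes_def by blast
  show "c *\<^sub>R Y \<in> H1_processes M F" for c
  proof -
    have "(\<integral>\<^sup>+x. maximal_function (c *\<^sub>R Y) x \<partial>M) = ennreal \<bar>c\<bar> * (\<integral>\<^sup>+x. maximal_function Y x \<partial>M)"
      unfolding maximal_function_scaleR by (rule nn_integral_cmult[OF Ym])
    also have "\<dots> < \<infinity>" using Y unfolding H1_processes_iff by (simp add: ennreal_mult_less_top)
    finally show ?thesis
      using Y terminal_scaleR[OF f] cadlag_scaleR unfolding H1_processes_iff by blast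
  qed
  fix Z :: "('x, 'e) process" assume Z: "Z \<in> H1_processes M F"
  then obtain g where g: "terminal Z g" unfolding H1_processes_iff by blast
  have Zm: "maximal_function Z \<in> borel_measurable M" using Z unfolding H1_processes_def by blast
  have "(\<integral>\<^sup>+x. maximal_function (Y + Z) x \<partial>M) \<le> (\<integral>\<^sup>+x. maximal_function Y x + maximal_function Z x \<partial>M)"
    by (rule nn_integral_mono) (rule maximal_function_add)
  also have "\<dots> = (\<integral>\<^sup>+x. maximal_function Y x \<partial>M) + (\<integral>\<^sup>+x. maximal_function Z x \<partial>M)"
    by (rule nn_integral_add[OF Ym Zm])
  also have "\<dots> < \<infinity>" using Y Z unfolding H1_processes_iff by simp
  finally show "Y + Z \<in> H1_processes M F"
    using Y Z terminal_add[OF f g] cadlag_add unfolding H1_processes_iff by blast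
qed

lemma H1_AE_finite:
  fixes Y :: "('x, 'e::banach) process"
  assumes "Y \<in> H1_processes M F"
  shows "AE x in M. maximal_function Y x < \<infinity>"
proof -
  have "AE x in M. maximal_function Y x \<noteq> \<infinity>"
    using assms unfolding H1_processes_def by (intro nn_integral_PInf_AE) auto
  then show ?thesis by eventually_elim (simp add: top.not_eq_extremum)
qed

lemma H1_max_real_measurable:
  fixes Y :: "('x, 'e::banach) process"
  assumes "Y \<in> H1_processes M F"
  shows "max_real Y \<in> borel_measurable M"
proof -
  have [measurable]: "maximal_function Y \<in> borel_measurable M" using assms unfolding H1_processes_def by blast
  show ?thesis unfolding max_real_def by measurable
qed

lemma H1_nn_integral_max_real:
  fixes Y :: "('x, 'e::banach) process"
  assumes Y: "Y \<in> H1_processes M F"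
  shows "(\<integral>\<^sup>+x. ennreal (max_real Y x) \<partial>M) = (\<integral>\<^sup>+x. maximal_function Y x \<partial>M)"
proof (rule nn_integral_cong_AE)
  show "AE x in M. ennreal (max_real Y x) = maximal_function Y x"
    using H1_AE_finite[OF Y] by eventually_elim (simp add: max_real_def)
qed

lemma H1_max_real_integrable:
  fixes Y :: "('x, 'e::banach) process"
  assumes Y: "Y \<in> H1_processes M F"
  shows "integrable M (max_real Y)"
proof (rule integrableI_bounded[OF H1_max_real_measurable[OF Y]])
  show "(\<integral>\<^sup>+x. ennreal (norm (max_real Y x)) \<partial>M) < \<infinity>"
    using Y H1_nn_integral_max_real[OF Y] unfolding H1_processes_iff by (simp add: max_real_nonneg)
qed

lemma H1_integral_max_real:
  fixes Y :: "('x, 'e::banach) process"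
  assumes Y: "Y \<in> H1_processes M F"
  shows "(\<integral>x. max_real Y x \<partial>M) = enn2real (\<integral>\<^sup>+x. maximal_function Y x \<partial>M)"
  unfolding H1_nn_integral_max_real[OF Y, symmetric]
  by (rule integral_eq_nn_integral[OF H1_max_real_measurable[OF Y] AE_I2[OF max_real_nonneg]])

text \<open>The norm localised to an event. On small events it measures uniform integrability, and
  on prescribed events it dominates functionals concentrated there.\<close>

definition set_norm :: "'x set \<Rightarrow> ('x, 'e::banach) process \<Rightarrow> real" where
  "set_norm A Y = (LINT x:A|M. max_real Y x)"

definition pnorm :: "('x, 'e::banach) process \<Rightarrow> real" where
  "pnorm Y = (\<integral>x. max_real Y x \<partial>M)"

lemma set_norm_le_of_AE:
  assumes "integrable M h" "integrable M k" "A \<in> sets M" "AE x in M. h x \<le> (k x :: real)"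
  shows "(LINT x:A|M. h x) \<le> (LINT x:A|M. k x)"
  unfolding set_lebesgue_integral_def
proof (rule integral_mono_AE)
  show "integrable M (\<lambda>x. indicat_real A x *\<^sub>R h x)" "integrable M (\<lambda>x. indicat_real A x *\<^sub>R k x)"
    by (rule integrable_mult_indicator[OF assms(3,1)], rule integrable_mult_indicator[OF assms(3,2)])
  show "AE x in M. indicat_real A x *\<^sub>R h x \<le> indicat_real A x *\<^sub>R k x"
    using assms(4) by eventually_elim (simp add: indicator_def)
qed

lemma set_norm_triangle:
  fixes Y Z :: "('x, 'e::banach) process"
  assumes Y: "Y \<in> H1_processes M F" and Z: "Z \<in> H1_processes M F" and A: "A \<in> sets M"
  shows "set_norm A (Y + Z) \<le> set_norm A Y + set_norm A Z"
proof -
  have YZ: "Y + Z \<in> H1_processes M F" by (rule subspace_add[OF subspace_H1_processes Y Z])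
  have "AE x in M. max_real (Y + Z) x \<le> max_real Y x + max_real Z x"
    using H1_AE_finite[OF Y] H1_AE_finite[OF Z] by eventually_elim (rule max_real_add)
  then have "set_norm A (Y + Z) \<le> (LINT x:A|M. max_real Y x + max_real Z x)"
    unfolding set_norm_def
    by (rule set_norm_le_of_AE[OF H1_max_real_integrable[OF YZ]
          Bochner_Integration.integrable_add[OF H1_max_real_integrable[OF Y] H1_max_real_integrable[OF Z]] A])
  also have "\<dots> = set_norm A Y + set_norm A Z"
    unfolding set_norm_def
    by (rule set_integral_add(2)[OF set_integrable_of_integrable[OF H1_max_real_integrable[OF Y] A]
          set_integrable_of_integrable[OF H1_max_real_integrable[OF Z] A]])
  finally show ?thesis .
qed

lemma set_norm_scaleR: "set_norm A (c *\<^sub>R Y) = \<bar>c\<bar> * set_norm A Y"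
  unfolding set_norm_def max_real_scaleR by simp

lemma set_norm_nonneg: "0 \<le> set_norm A Y"
  unfolding set_norm_def set_lebesgue_integral_def
  by (rule Bochner_Integration.integral_nonneg) (simp add: max_real_nonneg)

lemma set_norm_le_pnorm:
  fixes Y :: "('x, 'e::banach) process"
  assumes "Y \<in> H1_processes M F"
  shows "set_norm A Y \<le> pnorm Y"
  unfolding set_norm_def pnorm_def
  by (rule set_integral_le_integral[OF H1_max_real_integrable[OF assms] max_real_nonneg])

lemma pnorm_eq_set_norm:
  fixes Y :: "('x, 'e::banach) process"
  assumes "Y \<in> H1_processes M F"
  shows "pnorm Y = set_norm (space M) Y"
  unfolding set_norm_def pnorm_def
  by (rule set_integral_space[OF H1_max_real_integrable[OF assms], symmetric])

text \<open>Decomposition by the first passage above \<open>c\<close>, for finitely many times. The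
  event of first passage at \<open>t\<close> belongs to \<open>F t\<close>, so
  \<open>cond_exp_norm_le\<close> compares the norms of \<open>Y t\<close> and of \<open>f\<close>
  on it. Rational times then exhaust the event in question.\<close>

lemma doob_maximal_inequality:
  fixes Y :: "('x, 'e::banach) process"
  assumes Y: "cadlag M Y" and f: "terminal Y f" and c: "0 < c"
  shows "c * measure M {x \<in> space M. ennreal c < maximal_function Y x} \<le> (\<integral>x. norm (f x) \<partial>M)"
proof -
  have fn: "integrable M (\<lambda>x. norm (f x))" using f unfolding terminal_def Bochner_integrable_iff by blast
  define D where "D I = {x \<in> space M. \<exists>t\<in>I. c < norm (Y t x)}" for I
  have finite_case: "D I \<in> sets M \<and> c * measure M (D I) \<le> (\<integral>x. norm (f x) \<partial>M)" if I: "finite I" "I \<subseteq> {0..}" for I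
  proof -
    define A where "A t = {x \<in> space M. c < norm (Y t x) \<and> (\<forall>s\<in>{s\<in>I. s < t}. \<not> c < norm (Y s x))}" for t
    have AF: "A t \<in> sets (F t)" if t: "t \<in> I" for t
    proof -
      have t0: "0 \<le> t" using t I by auto
      have meas: "{x \<in> space (F t). c < norm (Y s x)} \<in> sets (F t)" if s: "s \<in> I" "s \<le> t" for s
      proof -
        have s0: "0 \<le> s" using s I by auto
        have "(\<lambda>x. norm (Y s x)) \<in> borel_measurable (F t)"
          by (rule strongly_measurable_norm[OF strongly_measurable_mono[OF terminalD(3)[OF f s0] F_mono[OF s0 s(2)]]])
             (simp add: space_F s0 t0)
        then show ?thesis by measurable
      qed
      have "A t = {x \<in> space (F t). c < norm (Y t x)} - (\<Union>s\<in>{s\<in>I. s < t}. {x \<in> space (F t). c < norm (Y s x)})"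
        unfolding A_def space_F[OF t0] by blast
      also have "\<dots> \<in> sets (F t)"
      proof (rule sets.Diff)
        show "{x \<in> space (F t). c < norm (Y t x)} \<in> sets (F t)" by (rule meas) (use t in auto)
        show "(\<Union>s\<in>{s\<in>I. s < t}. {x \<in> space (F t). c < norm (Y s x)}) \<in> sets (F t)"
          by (rule sets.finite_UN) (use I meas in auto)
      qed
      finally show ?thesis .
    qed
    have AM: "A t \<in> sets M" if "t \<in> I" for t
      using AF[OF that] sets_F_subset[of t] that I by auto
    have D_eq: "D I = (\<Union>t\<in>I. A t)"
    proof (intro equalityI subsetI)
      fix x assume "x \<in> D I"
      then have x: "x \<in> space M" and ne: "{t\<in>I. c < norm (Y t x)} \<noteq> {}" unfolding D_def by auto
      have fin: "finite {t\<in>I. c < norm (Y t x)}" using I by simp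
      let ?t = "Min {t\<in>I. c < norm (Y t x)}"
      have "?t \<in> {t\<in>I. c < norm (Y t x)}" by (rule Min_in[OF fin ne])
      moreover have "\<not> c < norm (Y s x)" if "s \<in> I" "s < ?t" for s
      proof
        assume "c < norm (Y s x)"
        then have "?t \<le> s" using that(1) by (intro Min_le[OF fin]) simp
        then show False using that(2) by simp
      qed
      ultimately show "x \<in> (\<Union>t\<in>I. A t)" using x unfolding A_def by blast
    next
      fix x assume "x \<in> (\<Union>t\<in>I. A t)"
      then show "x \<in> D I" unfolding A_def D_def by blast
    qed
    have disj: "disjoint_family_on A I"
      unfolding disjoint_family_on_def
    proof (intro ballI impI)
      fix s t assume st: "s \<in> I" "t \<in> I" "s \<noteq> t"
      show "A s \<inter> A t = {}"
        using st by (cases "s < t") (auto simp: A_def)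
    qed
    have "D I \<in> sets M" unfolding D_eq using I AM by auto
    moreover have "c * measure M (D I) \<le> (\<integral>x. norm (f x) \<partial>M)"
    proof -
      have "measure M (D I) = (\<Sum>t\<in>I. measure M (A t))"
        unfolding D_eq by (rule finite_measure_finite_Union[OF I(1) _ disj]) (use AM in auto)
      then have "c * measure M (D I) = (\<Sum>t\<in>I. c * measure M (A t))" by (simp add: sum_distrib_left)
      also have "\<dots> \<le> (\<Sum>t\<in>I. LINT x:A t|M. norm (f x))"
      proof (rule sum_mono)
        fix t assume t: "t \<in> I"
        have t0: "0 \<le> t" using t I by auto
        have Yn: "integrable M (\<lambda>x. norm (Y t x))"
          using terminalD(2)[OF f t0] unfolding Bochner_integrable_iff by blast
        have "c * measure M (A t) = (LINT x:A t|M. c)"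
          using AM[OF t] by (simp add: set_lebesgue_integral_def mult.commute)
        also have "\<dots> \<le> (LINT x:A t|M. norm (Y t x))"
        proof (rule set_integral_mono)
          show "set_integrable M (A t) (\<lambda>x. c)" by (rule set_integrable_of_integrable[OF _ AM[OF t]]) simp
          show "set_integrable M (A t) (\<lambda>x. norm (Y t x))" by (rule set_integrable_of_integrable[OF Yn AM[OF t]])
          show "c \<le> norm (Y t x)" if "x \<in> A t" for x using that unfolding A_def by simp
        qed
        also have "\<dots> \<le> (LINT x:A t|M. norm (f x))"
          by (rule cond_exp_norm_le[OF sets_F_subset[OF t0] space_F[OF t0] _ AF[OF t]])
             (use f t0 in \<open>simp add: terminal_def\<close>)
        finally show "c * measure M (A t) \<le> (LINT x:A t|M. norm (f x))" .
      qed
      also have "\<dots> = (LINT x:(\<Union>t\<in>I. A t)|M. norm (f x))"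
        by (rule set_integral_finite_Union[symmetric, OF I(1) disj])
           (use AM in \<open>auto intro: set_integrable_of_integrable[OF fn]\<close>)
      also have "\<dots> \<le> (\<integral>x. norm (f x) \<partial>M)" by (rule set_integral_le_integral[OF fn]) simp
      finally show ?thesis .
    qed
    ultimately show ?thesis by blast
  qed
  \<comment> \<open>An enumeration of the nonnegative rationals; the events for its finite initial
    segments increase, so the bound passes to their union.\<close>
  define q :: "nat \<Rightarrow> real" where "q n = of_rat (from_nat_into {q::rat. 0 \<le> q} n)" for n
  have rq: "range (from_nat_into {q::rat. 0 \<le> q}) = {q::rat. 0 \<le> q}" by (rule range_from_nat_into) auto
  have q0: "0 \<le> q n" for n
  proof -
    have "from_nat_into {q::rat. 0 \<le> q} n \<in> {q::rat. 0 \<le> q}" by (rule from_nat_into) auto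
    then show ?thesis by (simp add: q_def)
  qed
  define E where "E n = D (q ` {..n})" for n
  have En: "E n \<in> sets M" "c * measure M (E n) \<le> (\<integral>x. norm (f x) \<partial>M)" for n
    using finite_case[of "q ` {..n}"] q0 unfolding E_def by auto
  have UE: "(\<Union>n. E n) = {x \<in> space M. ennreal c < maximal_function Y x}"
  proof (intro equalityI subsetI)
    fix x assume "x \<in> (\<Union>n. E n)"
    then obtain n where x: "x \<in> space M" "c < norm (Y (q n) x)" unfolding E_def D_def by blast
    then have "ennreal c < ennreal (norm (Y (q n) x))" using c by (intro ennreal_lessI) auto
    also have "\<dots> \<le> maximal_function Y x" by (rule norm_le_maximal_function[OF q0])
    finally show "x \<in> {x \<in> space M. ennreal c < maximal_function Y x}" using x(1) by simp
  next
    fix x assume "x \<in> {x \<in> space M. ennreal c < maximal_function Y x}"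
    then have x: "x \<in> space M" and lt: "ennreal c < (SUP r\<in>{q::rat. 0 \<le> q}. ennreal (norm (Y (of_rat r) x)))"
      using cadlag_maximal_function_rat[OF Y] by auto
    then obtain r :: rat where r: "0 \<le> r" "ennreal c < ennreal (norm (Y (of_rat r) x))"
      unfolding less_SUP_iff by blast
    have "r \<in> range (from_nat_into {q::rat. 0 \<le> q})" unfolding rq using r(1) by simp
    then obtain n where n: "r = from_nat_into {q::rat. 0 \<le> q} n" by (rule rangeE)
    have "c < norm (Y (q n) x)" using r(2) c unfolding n q_def by (simp add: ennreal_less_iff)
    then have "x \<in> E n" using x unfolding E_def D_def by blast
    then show "x \<in> (\<Union>n. E n)" by blast
  qed
  have "incseq E" unfolding incseq_def E_def D_def by (auto intro: order_trans)
  then have "(\<lambda>n. measure M (E n)) \<longlonglongrightarrow> measure M (\<Union>n. E n)"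
    using En(1) by (intro finite_Lim_measure_incseq) auto
  then have "(\<lambda>n. c * measure M (E n)) \<longlonglongrightarrow> c * measure M {x \<in> space M. ennreal c < maximal_function Y x}"
    unfolding UE by (intro tendsto_mult tendsto_const)
  then show ?thesis by (rule LIMSEQ_le_const2) (use En(2) in blast)
qed

lemma diff_eq_add_scaleR: "Y - Z = Y + (-1) *\<^sub>R Z" for Y Z :: "'w::real_vector"
  by simp

lemma terminal_diff:
  fixes Y Z :: "('x, 'e::banach) process"
  assumes "terminal Y f" "terminal Z g"
  shows "terminal (Y - Z) (f - g)"
  unfolding diff_eq_add_scaleR[of Y] diff_eq_add_scaleR[of f]
  by (rule terminal_add[OF assms(1) terminal_scaleR[OF assms(2)]])

lemma H1_diff:
  fixes Y Z :: "('x, 'e::banach) process"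
  shows "Y \<in> H1_processes M F \<Longrightarrow> Z \<in> H1_processes M F \<Longrightarrow> Y - Z \<in> H1_processes M F"
  by (rule subspace_diff[OF subspace_H1_processes])

text \<open>The rate \<open>(1 / 2) ^ n\<close> is summable, so off a null set the paths converge
  uniformly in time and the limit keeps their regularity. Its terminal value is the limit
  \<open>u\<close> prescribed for the terminal values.\<close>

lemma H1_complete:
  fixes Z :: "nat \<Rightarrow> ('x, 'e::banach) process"
  assumes Z: "\<And>n. Z n \<in> H1_processes M F" and g: "\<And>n. terminal (Z n) (g n)"
    and u: "Bochner_integrable M u" and gu: "(\<lambda>n. \<integral>x. norm (g n x - u x) \<partial>M) \<longlonglongrightarrow> 0"
    and fast: "\<And>n. pnorm (Z n - Z (Suc n)) \<le> (1 / 2) ^ n"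
  obtains N where "N \<in> H1_processes M F" "terminal N u" "\<And>n. pnorm (Z n - N) \<le> 2 * (1 / 2) ^ n"
proof -
  define h where "h n = max_real (Z n - Z (Suc n))" for n
  have dV: "Z n - Z (Suc n) \<in> H1_processes M F" for n by (rule H1_diff[OF Z Z])
  have h_int: "integrable M (h n)" for n unfolding h_def by (rule H1_max_real_integrable[OF dV])
  have h0: "0 \<le> h n x" for n x by (simp add: h_def max_real_nonneg)
  have hI: "(\<integral>x. h n x \<partial>M) \<le> (1 / 2) ^ n" for n using fast[of n] by (simp add: h_def pnorm_def)
  have "AE x in M. summable (\<lambda>n. h n x)"
  proof (rule AE_summable_of_integrals[OF h_int h0])
    show "summable (\<lambda>n. \<integral>x. h n x \<partial>M)"
    proof (rule summable_comparison_test')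
      show "summable (\<lambda>n. (1 / 2 :: real) ^ n)" by (rule summable_geometric) simp
      show "norm (\<integral>x. h n x \<partial>M) \<le> (1 / 2) ^ n" for n
        using hI[of n] h0 by (simp add: Bochner_Integration.integral_nonneg)
    qed
  qed
  moreover have "AE x in M. \<forall>n. maximal_function (Z n - Z (Suc n)) x < \<infinity>"
    unfolding AE_all_countable by (rule allI, rule H1_AE_finite[OF dV])
  ultimately have "AE x in M. summable (\<lambda>n. h n x) \<and> (\<forall>n. maximal_function (Z n - Z (Suc n)) x < \<infinity>)"
    by eventually_elim simp
  then obtain B where B: "{x \<in> space M. \<not> (summable (\<lambda>n. h n x) \<and> (\<forall>n. maximal_function (Z n - Z (Suc n)) x < \<infinity>))} \<subseteq> B"
      "emeasure M B = 0" "B \<in> sets M"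
    by (rule AE_E) (rule that)
  have Bnull: "B \<in> null_sets M" using B by (simp add: null_sets_def)
  have good: "summable (\<lambda>n. h n x)" "maximal_function (Z n - Z (Suc n)) x < \<infinity>" if "x \<in> space M - B" for x n
    using B(1) that by blast+
  \<comment> \<open>The tail series dominates, uniformly in time, the distance from
    \<open>Z n\<close> to all later terms and hence to the limit.\<close>
  define r where "r n x = (\<Sum>k. h (k + n) x)" for n x
  have step: "norm (Z n t x - Z (Suc n) t x) \<le> h n x" if "x \<in> space M - B" "0 \<le> t" for n t x
    using norm_le_max_real[OF good(2)[OF that(1)] that(2), of n] by (simp add: h_def)
  have summ: "summable (\<lambda>k. h (k + n) x)" if "x \<in> space M - B" for n x
    by (rule summable_ignore_initial_segment[OF good(1)[OF that]])
  have partial: "norm (Z n t x - Z (n + m) t x) \<le> r n x" if x: "x \<in> space M - B" and t: "0 \<le> t" for n m t x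
  proof -
    have "norm (Z n t x - Z (n + m) t x) \<le> (\<Sum>k<m. h (k + n) x)"
    proof (induction m)
      case (Suc m)
      have "norm (Z n t x - Z (n + Suc m) t x) \<le> norm (Z n t x - Z (n + m) t x) + norm (Z (n + m) t x - Z (Suc (n + m)) t x)"
        using norm_triangle_ineq[of "Z n t x - Z (n + m) t x" "Z (n + m) t x - Z (Suc (n + m)) t x"] by simp
      also have "\<dots> \<le> (\<Sum>k<m. h (k + n) x) + h (n + m) x"
        using Suc step[OF x t, of "n + m"] by (rule add_mono)
      finally show ?case by (simp add: add.commute)
    qed simp
    also have "\<dots> \<le> r n x" unfolding r_def by (rule sum_le_suminf[OF summ[OF x]]) (use h0 in auto)
    finally show ?thesis .
  qed
  have r_lim: "(\<lambda>n. r n x) \<longlonglongrightarrow> 0" if x: "x \<in> space M - B" for x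
    unfolding r_def by (rule suminf_exist_split2[OF good(1)[OF x]])
  have conv: "convergent (\<lambda>n. Z n t x)" if x: "x \<in> space M - B" and t: "0 \<le> t" for t x
  proof (rule Cauchy_convergent, rule metric_CauchyI)
    fix e :: real assume "e > 0"
    then have "0 < e / 2" by simp
    from eventually_happens'[OF sequentially_bot order_tendstoD(2)[OF r_lim[OF x] this]]
    obtain n where n: "r n x < e / 2" by blast
    have near: "dist (Z n t x) (Z k t x) < e / 2" if "k \<ge> n" for k
      using partial[OF x t, of n "k - n"] n that by (simp add: dist_norm)
    have "dist (Z k t x) (Z l t x) < e" if "k \<ge> n" "l \<ge> n" for k l
      using dist_triangle_half_r[OF near[OF that(1)] near[OF that(2)]] .
    then show "\<exists>M. \<forall>m\<ge>M. \<forall>n\<ge>M. dist (Z m t x) (Z n t x) < e" by blast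
  qed
  define N where "N t x = (if x \<in> space M - B then lim (\<lambda>n. Z n t x) else 0)" for t x
  have lim: "(\<lambda>n. Z n t x) \<longlonglongrightarrow> N t x" if "x \<in> space M - B" "0 \<le> t" for t x
    using conv[OF that] that(1) by (simp add: N_def convergent_LIMSEQ_iff)
  have near: "norm (Z n t x - N t x) \<le> r n x" if x: "x \<in> space M - B" and t: "0 \<le> t" for n t x
  proof (rule tendsto_upperbound[where F = sequentially])
    show "(\<lambda>m. norm (Z n t x - Z (n + m) t x)) \<longlonglongrightarrow> norm (Z n t x - N t x)"
      using LIMSEQ_ignore_initial_segment[OF lim[OF x t], of n]
      by (intro tendsto_norm tendsto_diff tendsto_const) (simp add: add.commute)
    show "eventually (\<lambda>m. norm (Z n t x - Z (n + m) t x) \<le> r n x) sequentially"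
      using partial[OF x t] by simp
  qed simp
  have unif: "uniform_limit {0..} (\<lambda>n t. Z n t x) (\<lambda>t. N t x) sequentially" if x: "x \<in> space M - B" for x
  proof (rule uniform_limitI)
    fix e :: real assume "e > 0"
    from order_tendstoD(2)[OF r_lim[OF x] this]
    show "eventually (\<lambda>n. \<forall>t\<in>{0..}. dist (Z n t x) (N t x) < e) sequentially"
    proof eventually_elim
      case (elim n)
      show ?case
      proof
        fix t :: real assume "t \<in> {0..}"
        then show "dist (Z n t x) (N t x) < e" using near[OF x, of t n] elim by (simp add: dist_norm)
      qed
    qed
  qed
  have Zcad: "cadlag M (Z n)" for n using Z[of n] unfolding H1_processes_iff by blast
  have cad: "cadlag M N"
    unfolding cadlag_def
  proof (intro ballI conjI allI impI)
    fix x t assume x: "x \<in> space M"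
    { assume t: "0 \<le> (t::real)"
      show "((\<lambda>s. N s x) \<longlongrightarrow> N t x) (at_right t)"
      proof (cases "x \<in> B")
        case True then show ?thesis by (simp add: N_def)
      next
        case False
        then have x': "x \<in> space M - B" using x by simp
        show ?thesis
        proof (rule swap_uniform_limit'[OF _ lim[OF x' t] unif[OF x']])
          show "\<forall>\<^sub>F n in sequentially. ((\<lambda>s. Z n s x) \<longlongrightarrow> Z n t x) (at_right t)"
            using Zcad x t unfolding cadlag_def by (intro always_eventually) blast
          show "\<forall>\<^sub>F s in at_right t. s \<in> {0..}"
            using eventually_at_right_less[of t] by eventually_elim (use t in auto)
        qed simp
      qed }
    { assume t: "0 < (t::real)"
      show "\<exists>l. ((\<lambda>s. N s x) \<longlongrightarrow> l) (at_left t)"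
      proof (cases "x \<in> B")
        case True then have "((\<lambda>s. N s x) \<longlongrightarrow> 0) (at_left t)" by (simp add: N_def)
        then show ?thesis by (rule exI)
      next
        case False
        then have x': "x \<in> space M - B" using x by simp
        have pos: "\<forall>\<^sub>F s in at_left t. s \<in> {0..}"
          using eventually_at_left_real[OF t] by eventually_elim auto
        have "\<forall>n. \<exists>l. ((\<lambda>s. Z n s x) \<longlongrightarrow> l) (at_left t)" using Zcad x t unfolding cadlag_def by blast
        from choice[OF this] obtain l where "\<forall>n. ((\<lambda>s. Z n s x) \<longlongrightarrow> l n) (at_left t)" by (rule exE)
        then have l: "((\<lambda>s. Z n s x) \<longlongrightarrow> l n) (at_left t)" for n by (rule spec)
        \<comment> \<open>The same tail bound makes the left limits of the approximants a Cauchy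
          sequence, so that the limits in \<open>n\<close> and in \<open>s\<close> may be
          interchanged.\<close>
        have l_le: "norm (l n - l (n + m)) \<le> r n x" for n m
        proof (rule tendsto_upperbound[OF tendsto_norm[OF tendsto_diff[OF l l]]])
          show "\<forall>\<^sub>F s in at_left t. norm (Z n s x - Z (n + m) s x) \<le> r n x"
            using pos by eventually_elim (use partial[OF x'] in simp)
        qed simp
        have "Cauchy l"
        proof (rule metric_CauchyI)
          fix e :: real assume "e > 0"
          then have "0 < e / 2" by simp
          from eventually_happens'[OF sequentially_bot order_tendstoD(2)[OF r_lim[OF x'] this]]
          obtain n where n: "r n x < e / 2" by blast
          have nr: "dist (l n) (l k) < e / 2" if "k \<ge> n" for k
            using l_le[of n "k - n"] n that by (simp add: dist_norm)
          have "dist (l k) (l j) < e" if "k \<ge> n" "j \<ge> n" for k j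
            using dist_triangle_half_r[OF nr[OF that(1)] nr[OF that(2)]] .
          then show "\<exists>M. \<forall>m\<ge>M. \<forall>n\<ge>M. dist (l m) (l n) < e" by blast
        qed
        then obtain L where L: "l \<longlonglongrightarrow> L" using Cauchy_convergent by (auto simp: convergent_def)
        have "((\<lambda>s. N s x) \<longlongrightarrow> L) (at_left t)"
        proof (rule swap_uniform_limit'[OF _ L unif[OF x'] pos])
          show "\<forall>\<^sub>F n in sequentially. ((\<lambda>s. Z n s x) \<longlongrightarrow> l n) (at_left t)" using l by simp
        qed simp
        then show ?thesis by (rule exI)
      qed }
  qed
  have r_int: "(\<integral>\<^sup>+x. ennreal (r n x) \<partial>M) \<le> ennreal (2 * (1 / 2) ^ n)" for n
  proof -
    have "(\<integral>\<^sup>+x. ennreal (r n x) \<partial>M) = (\<integral>\<^sup>+x. (\<Sum>k. ennreal (h (k + n) x)) \<partial>M)"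
    proof (rule nn_integral_cong_AE)
      show "AE x in M. ennreal (r n x) = (\<Sum>k. ennreal (h (k + n) x))"
        using AE_not_in[OF Bnull] AE_space
      proof eventually_elim
        case (elim x)
        then have "x \<in> space M - B" by simp
        from suminf_ennreal2[OF h0 summ[OF this]] show ?case by (simp add: r_def)
      qed
    qed
    also have "\<dots> = (\<Sum>k. \<integral>\<^sup>+x. ennreal (h (k + n) x) \<partial>M)"
      by (rule nn_integral_suminf) (use h_int in auto)
    also have "\<dots> \<le> (\<Sum>k. ennreal ((1 / 2) ^ (k + n)))"
    proof (rule suminf_le)
      show "(\<integral>\<^sup>+x. ennreal (h (k + n) x) \<partial>M) \<le> ennreal ((1 / 2) ^ (k + n))" for k
        by (subst nn_integral_eq_integral[OF h_int]) (use h0 hI[of "k + n"] in \<open>auto intro: ennreal_leI\<close>)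
    qed simp_all
    also have "\<dots> = ennreal (\<Sum>k. (1 / 2) ^ (k + n))"
      by (rule suminf_ennreal2) (auto intro!: summable_geometric summable_mult2 simp: power_add)
    also have "(\<Sum>k. (1 / 2 :: real) ^ (k + n)) = 2 * (1 / 2) ^ n"
      unfolding power_add by (subst suminf_mult2[symmetric]) (auto simp: suminf_geometric)
    finally show ?thesis .
  qed
  have max_le: "AE x in M. maximal_function (Z n - N) x \<le> ennreal (r n x)" for n
    using AE_not_in[OF Bnull] AE_space
  proof eventually_elim
    case (elim x)
    then have x: "x \<in> space M - B" by simp
    show ?case
      by (rule maximal_function_leI) (use near[OF x] in \<open>auto intro: ennreal_leI\<close>)
  qed
  have N_strong: "strongly_measurable (F t) (N t)" if t: "0 \<le> t" for t
  proof (rule strongly_measurable_LIMSEQ)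
    \<comment> \<open>Cutting off the null set \<open>B\<close> preserves adaptedness because
      \<open>F t\<close> contains all null sets.\<close>
    have BF: "space M - B \<in> sets (F t)"
      using sets.compl_sets[OF null_set_in_F[OF Bnull t]] space_F[OF t] by simp
    show "strongly_measurable (F t) (\<lambda>x. indicat_real (space M - B) x *\<^sub>R Z n t x)" for n
      by (rule strongly_measurable_indicator[OF terminalD(3)[OF g t] BF])
    show "(\<lambda>n. indicat_real (space M - B) x *\<^sub>R Z n t x) \<longlonglongrightarrow> N t x" if "x \<in> space (F t)" for x
    proof (cases "x \<in> B")
      case True then show ?thesis by (simp add: N_def)
    next
      case False
      then have "x \<in> space M - B" using that space_F[OF t] by simp
      then show ?thesis using lim[of x t] t by simp
    qed
  qed
  have N_strongM: "strongly_measurable M (N t)" if t: "0 \<le> t" for t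
    by (rule strongly_measurable_mono[OF N_strong[OF t] sets_F_subset[OF t] space_F[OF t]])
  have diff_nn: "(\<integral>\<^sup>+x. ennreal (norm (Z n t x - N t x)) \<partial>M) \<le> ennreal (2 * (1 / 2) ^ n)" if t: "0 \<le> t" for n t
  proof -
    have "(\<integral>\<^sup>+x. ennreal (norm (Z n t x - N t x)) \<partial>M) \<le> (\<integral>\<^sup>+x. ennreal (r n x) \<partial>M)"
    proof (rule nn_integral_mono_AE)
      show "AE x in M. ennreal (norm (Z n t x - N t x)) \<le> ennreal (r n x)"
        using AE_not_in[OF Bnull] AE_space
      proof eventually_elim
        case (elim x)
        then have x: "x \<in> space M - B" by simp
        show ?case by (rule ennreal_leI[OF near[OF x t]])
      qed
    qed
    also note r_int
    finally show ?thesis .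
  qed
  have diff_strong: "strongly_measurable M (\<lambda>x. Z n t x - N t x)" if t: "0 \<le> t" for n t
    by (rule strongly_measurable_diff[OF terminalD(4)[OF g t] N_strongM[OF t]])
  have diffB: "Bochner_integrable M (\<lambda>x. Z n t x - N t x)" if t: "0 \<le> t" for n t
    unfolding Bochner_integrable_iff
  proof (intro conjI diff_strong[OF t] integrableI_bounded)
    show "(\<lambda>x. norm (Z n t x - N t x)) \<in> borel_measurable M" by (rule strongly_measurable_norm[OF diff_strong[OF t]])
    have "(\<integral>\<^sup>+x. ennreal (norm (Z n t x - N t x)) \<partial>M) < \<infinity>"
      by (rule order_le_less_trans[OF diff_nn[OF t]]) simp
    then show "(\<integral>\<^sup>+x. ennreal (norm (norm (Z n t x - N t x))) \<partial>M) < \<infinity>" by simp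
  qed
  have diff_int: "(\<integral>x. norm (Z n t x - N t x) \<partial>M) \<le> 2 * (1 / 2) ^ n" if t: "0 \<le> t" for n t
  proof -
    have "ennreal (\<integral>x. norm (Z n t x - N t x) \<partial>M) \<le> ennreal (2 * (1 / 2) ^ n)"
      using diff_nn[OF t, of n] diffB[OF t, of n]
      by (subst nn_integral_eq_integral[symmetric]) (auto simp: Bochner_integrable_iff)
    then show ?thesis by simp
  qed
  have NB: "Bochner_integrable M (N t)" if t: "0 \<le> t" for t
    using Bochner_integrable_diff[OF terminalD(2)[OF g[of 0] t] diffB[OF t, of 0]] by simp
  have pow_lim: "(\<lambda>n. 2 * (1 / 2 :: real) ^ n) \<longlonglongrightarrow> 0"
    using tendsto_mult[OF tendsto_const[of 2] LIMSEQ_realpow_zero[of "1 / 2 :: real"]] by simp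
  have trm: "terminal N u"
    unfolding terminal_iff
  proof (intro conjI allI impI ballI)
    show "Bochner_integrable M u" by (rule u)
    fix t :: real assume t: "0 \<le> t"
    show "Bochner_integrable M (N t)" by (rule NB[OF t])
    show "strongly_measurable (F t) (N t)" by (rule N_strong[OF t])
    fix A and \<phi> :: "'e \<Rightarrow>\<^sub>L real" assume A: "A \<in> sets (F t)"
    then have AM: "A \<in> sets M" using sets_F_subset[OF t] by blast
    have 1: "(\<lambda>n. LINT x:A|M. \<phi> (g n x)) \<longlonglongrightarrow> (LINT x:A|M. \<phi> (u x))"
      by (rule set_integral_blinfun_tendsto[OF terminalD(1)[OF g t] u AM gu])
    have "(\<lambda>n. \<integral>x. norm (Z n t x - N t x) \<partial>M) \<longlonglongrightarrow> 0"
    proof (rule tendsto_sandwich[OF _ _ tendsto_const pow_lim])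
      show "\<forall>\<^sub>F n in sequentially. 0 \<le> (\<integral>x. norm (Z n t x - N t x) \<partial>M)" by simp
      show "\<forall>\<^sub>F n in sequentially. (\<integral>x. norm (Z n t x - N t x) \<partial>M) \<le> 2 * (1 / 2) ^ n"
        by (rule always_eventually, rule allI, rule diff_int[OF t])
    qed
    then have 2: "(\<lambda>n. LINT x:A|M. \<phi> (Z n t x)) \<longlonglongrightarrow> (LINT x:A|M. \<phi> (N t x))"
      by (rule set_integral_blinfun_tendsto[OF terminalD(2)[OF g t] NB[OF t] AM])
    show "(LINT x:A|M. \<phi> (u x)) = (LINT x:A|M. \<phi> (N t x))"
      by (rule LIMSEQ_unique[OF 1]) (use 2 in \<open>simp only: terminalD(5)[OF g t A]\<close>)
  qed
  have max_int: "(\<integral>\<^sup>+x. maximal_function (Z n - N) x \<partial>M) \<le> ennreal (2 * (1 / 2) ^ n)" for n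
    by (rule order_trans[OF nn_integral_mono_AE[OF max_le] r_int])
  have diffV: "Z n - N \<in> H1_processes M F" for n
    unfolding H1_processes_iff
  proof (intro conjI exI)
    show "cadlag M (Z n - N)"
      unfolding diff_eq_add_scaleR by (rule cadlag_add[OF Zcad cadlag_scaleR[OF cad]])
    show "terminal (Z n - N) (g n - u)" by (rule terminal_diff[OF g trm])
    show "(\<integral>\<^sup>+x. maximal_function (Z n - N) x \<partial>M) < \<infinity>"
      by (rule order_le_less_trans[OF max_int]) simp
  qed
  show thesis
  proof (rule that[of N])
    have "Z 0 - (Z 0 - N) \<in> H1_processes M F" by (rule H1_diff[OF Z diffV])
    then show "N \<in> H1_processes M F" by simp
    show "terminal N u" by (rule trm)
    show "pnorm (Z n - N) \<le> 2 * (1 / 2) ^ n" for n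
    proof -
      have "enn2real (\<integral>\<^sup>+x. maximal_function (Z n - N) x \<partial>M) \<le> enn2real (ennreal (2 * (1 / 2) ^ n))"
        by (rule enn2real_mono[OF max_int]) simp
      then show ?thesis unfolding pnorm_def H1_integral_max_real[OF diffV] by simp
    qed
  qed
qed

text \<open>The pairs \<open>(Y n, f n)\<close> carry one set of coefficients through both hulls,
  and terminal values are compatible with linear combinations.\<close>

lemma convex_hull_terminal:
  fixes Y :: "nat \<Rightarrow> ('x, 'e::banach) process"
  assumes f: "\<And>n. terminal (Y n) (f n)" and g: "g \<in> convex hull (f ` S)"
  obtains Z where "Z \<in> convex hull (Y ` S)" "terminal Z g"
proof -
  define H where "H n = (Y n, f n)" for n
  have "snd ` (convex hull (H ` S)) = convex hull (snd ` H ` S)"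
    by (rule convex_hull_linear_image[OF linear_snd])
  also have "snd ` H ` S = f ` S" by (simp add: H_def image_image)
  finally have "g \<in> snd ` (convex hull (H ` S))" using g by (simp only:)
  then obtain z where z': "g = snd z" "z \<in> convex hull (H ` S)" by (rule imageE)
  note z = z'(2) z'(1)
  have "fst z \<in> fst ` (convex hull (H ` S))" using z(1) by (rule imageI)
  also have "\<dots> = convex hull (fst ` H ` S)" by (rule convex_hull_linear_image[OF linear_fst])
  also have "fst ` H ` S = Y ` S" by (simp add: H_def image_image)
  finally have 1: "fst z \<in> convex hull (Y ` S)" .
  let ?C = "{z :: ('x, 'e) process \<times> ('x \<Rightarrow> 'e). terminal (fst z) (snd z)}"
  have "convex ?C"
    by (rule convexI) (simp add: terminal_add terminal_scaleR)
  then have "convex hull (H ` S) \<subseteq> ?C"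
    by (intro hull_minimal image_subsetI) (simp_all add: H_def f)
  then have "terminal (fst z) g" using z by blast
  with 1 show thesis by (rule that)
qed

text \<open>A given terminal value may be large on sets of \<open>M\<close> that the filtration does
  not see, and then its norm is not controlled by the maximal function there. A new one is built as
  a limit in mean of convex combinations of the \<open>Y n\<close>, whose norms the maximal function
  does dominate.\<close>

lemma H1_terminal_bounded:
  fixes Y :: "('x, 'e::banach) process"
  assumes refl: "reflexive_space TYPE('e)" and Y: "Y \<in> H1_processes M F"
  obtains u where "terminal Y u" "\<And>A. A \<in> sets M \<Longrightarrow> (LINT x:A|M. norm (u x)) \<le> set_norm A Y"
proof -
  obtain f0 where f0: "terminal Y f0" using Y unfolding H1_processes_iff by blast
  define f where "f n = Y (real n)" for n :: nat
  have fB: "Bochner_integrable M (f n)" for n unfolding f_def by (rule terminalD(2)[OF f0]) simp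
  have fn: "integrable M (\<lambda>x. norm (f n x))" for n using fB[of n] by (simp add: Bochner_integrable_iff)
  have mY: "integrable M (max_real Y)" by (rule H1_max_real_integrable[OF Y])
  \<comment> \<open>One integrable function dominates the whole sequence, which makes it uniformly
    integrable.\<close>
  have le: "AE x in M. norm (f n x) \<le> max_real Y x" for n
    using H1_AE_finite[OF Y] by eventually_elim (simp add: f_def norm_le_max_real)
  have set_le: "(LINT x:A|M. norm (f n x)) \<le> set_norm A Y" if "A \<in> sets M" for A n
    unfolding set_norm_def by (rule set_norm_le_of_AE[OF fn mY that le])
  obtain u where u: "Bochner_integrable M u"
    and lim: "\<And>N \<epsilon>. \<epsilon> > 0 \<Longrightarrow> \<exists>g\<in>convex hull (f ` {N..}). (\<integral>x. norm (g x - u x) \<partial>M) < \<epsilon>"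
  proof (rule uniformly_integrable_L1_limit[OF refl fB])
    show "(\<integral>x. norm (f n x) \<partial>M) \<le> pnorm Y" for n
      unfolding pnorm_def by (rule integral_mono_AE[OF fn mY le])
    fix \<epsilon> :: real assume "\<epsilon> > 0"
    then obtain \<delta> where d: "\<delta> > 0" "\<And>A. A \<in> sets M \<Longrightarrow> measure M A \<le> \<delta> \<Longrightarrow> (LINT x:A|M. max_real Y x) \<le> \<epsilon>"
      by (rule integral_small_on_small_sets[OF mY max_real_nonneg]) (rule that)
    have "(LINT x:A|M. norm (f n x)) \<le> \<epsilon>" if "A \<in> sets M" "measure M A \<le> \<delta>" for n A
      using set_le[OF that(1), of n] d(2)[OF that] unfolding set_norm_def by linarith
    then show "\<exists>\<delta>>0. \<forall>n. \<forall>A\<in>sets M. measure M A \<le> \<delta> \<longrightarrow> (LINT x:A|M. norm (f n x)) \<le> \<epsilon>"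
      using d(1) by (intro exI[of _ \<delta>]) simp
  qed (rule that)
  have hull_set: "Bochner_integrable M g \<and> (LINT x:A|M. norm (g x)) \<le> set_norm A Y"
    if A: "A \<in> sets M" and g: "g \<in> convex hull (f ` {N..})" for A g N
  proof -
    let ?C = "{g :: 'x \<Rightarrow> 'e. Bochner_integrable M g \<and> (LINT x:A|M. norm (g x)) \<le> set_norm A Y}"
    have "convex ?C"
    proof (rule convexI)
      fix p q :: "'x \<Rightarrow> 'e" and a b :: real assume p: "p \<in> ?C" and q: "q \<in> ?C" and ab: "0 \<le> a" "0 \<le> b" "a + b = 1"
      have B: "Bochner_integrable M (a *\<^sub>R p + b *\<^sub>R q)"
        unfolding plus_fun_def scaleR_fun_def using p q by (intro Bochner_integrable_add Bochner_integrable_scaleR) auto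
      have pn: "integrable M (\<lambda>x. norm (p x))" and qn: "integrable M (\<lambda>x. norm (q x))"
        and sn: "integrable M (\<lambda>x. norm ((a *\<^sub>R p + b *\<^sub>R q) x))"
        using p q B by (auto simp: Bochner_integrable_iff)
      have "(LINT x:A|M. norm ((a *\<^sub>R p + b *\<^sub>R q) x)) \<le> (LINT x:A|M. a * norm (p x) + b * norm (q x))"
      proof (rule set_integral_mono_real[OF sn _ A])
        show "integrable M (\<lambda>x. a * norm (p x) + b * norm (q x))" using pn qn by simp
        show "norm ((a *\<^sub>R p + b *\<^sub>R q) x) \<le> a * norm (p x) + b * norm (q x)" for x
          using norm_triangle_ineq[of "a *\<^sub>R p x" "b *\<^sub>R q x"] ab by simp
      qed
      also have "\<dots> = a * (LINT x:A|M. norm (p x)) + b * (LINT x:A|M. norm (q x))"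
        using pn qn A by (subst set_integral_add(2)) (auto intro!: set_integrable_of_integrable)
      also have "\<dots> \<le> a * set_norm A Y + b * set_norm A Y"
        using p q ab by (intro add_mono mult_left_mono) auto
      also have "\<dots> = set_norm A Y" using ab(3) by (simp flip: distrib_right)
      finally show "a *\<^sub>R p + b *\<^sub>R q \<in> ?C" using B by blast
    qed
    then have "convex hull (f ` {N..}) \<subseteq> ?C"
      using fB set_le[OF A] by (intro hull_minimal image_subsetI) simp_all
    then show ?thesis using g by blast
  qed
  \<comment> \<open>From an index \<open>N \<ge> t\<close> on, all \<open>Y n\<close> have the same
    integrals over events of \<open>F t\<close> as \<open>Y t\<close>, and so have their convex
    combinations; in the limit \<open>u\<close> becomes a terminal value.\<close>
  have hull_cond: "(LINT x:A|M. \<phi> (g x)) = (LINT x:A|M. \<phi> (Y t x))"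
    if t: "0 \<le> t" "t \<le> real N" and A: "A \<in> sets (F t)" and g: "g \<in> convex hull (f ` {N..})" for A g N t and \<phi> :: "'e \<Rightarrow>\<^sub>L real"
  proof -
    have AM: "A \<in> sets M" using A sets_F_subset[OF t(1)] by blast
    let ?C = "{g :: 'x \<Rightarrow> 'e. Bochner_integrable M g \<and> (LINT x:A|M. blinfun_apply \<phi> (g x)) = (LINT x:A|M. blinfun_apply \<phi> (Y t x))}"
    have "convex ?C"
    proof (rule convexI)
      fix p q :: "'x \<Rightarrow> 'e" and a b :: real assume p: "p \<in> ?C" and q: "q \<in> ?C" and ab: "0 \<le> a" "0 \<le> b" "a + b = 1"
      have B: "Bochner_integrable M (a *\<^sub>R p + b *\<^sub>R q)"
        unfolding plus_fun_def scaleR_fun_def using p q by (intro Bochner_integrable_add Bochner_integrable_scaleR) auto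
      have si: "set_integrable M A (\<lambda>x. a * \<phi> (p x))" "set_integrable M A (\<lambda>x. b * \<phi> (q x))"
        using p q by (auto intro!: set_integrable_of_integrable[OF _ AM] integrable_mult_right integrable_blinfun)
      have "(LINT x:A|M. \<phi> ((a *\<^sub>R p + b *\<^sub>R q) x)) = (LINT x:A|M. a * \<phi> (p x) + b * \<phi> (q x))"
        by (simp add: blinfun.add_right blinfun.scaleR_right)
      also have "\<dots> = a * (LINT x:A|M. \<phi> (p x)) + b * (LINT x:A|M. \<phi> (q x))"
        by (subst set_integral_add(2)[OF si]) simp
      also have "\<dots> = (LINT x:A|M. \<phi> (Y t x))" using p q ab(3) by (simp flip: distrib_right)
      finally show "a *\<^sub>R p + b *\<^sub>R q \<in> ?C" using B by blast
    qed
    moreover have "f n \<in> ?C" if "n \<in> {N..}" for n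
    proof -
      have tn: "t \<le> real n" using t(2) that by (simp add: order_trans[of _ "real N"])
      have "(LINT x:A|M. \<phi> (f0 x)) = (LINT x:A|M. \<phi> (f n x))"
        unfolding f_def using A F_mono[OF t(1) tn] by (intro terminalD(5)[OF f0]) auto
      then show ?thesis using fB[of n] terminalD(5)[OF f0 t(1) A, of \<phi>] by simp
    qed
    ultimately have "convex hull (f ` {N..}) \<subseteq> ?C" by (intro hull_minimal image_subsetI)
    then show ?thesis using g by blast
  qed
  have "\<exists>g. g \<in> convex hull (f ` {N..}) \<and> (\<integral>x. norm (g x - u x) \<partial>M) < inverse (real (Suc N))" for N
  proof -
    have "0 < inverse (real (Suc N))" by simp
    from lim[OF this, of N] show ?thesis unfolding Bex_def .
  qed
  from choice[OF allI, OF this] obtain g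
    where "\<forall>N. g N \<in> convex hull (f ` {N..}) \<and> (\<integral>x. norm (g N x - u x) \<partial>M) < inverse (real (Suc N))" by (rule exE)
  then have g: "g N \<in> convex hull (f ` {N..})" and gu: "(\<integral>x. norm (g N x - u x) \<partial>M) < inverse (real (Suc N))" for N
    by blast+
  have gB: "Bochner_integrable M (g N)" for N using hull_set[OF sets.top g] by blast
  have g_lim: "(\<lambda>N. \<integral>x. norm (g N x - u x) \<partial>M) \<longlonglongrightarrow> 0"
  proof (rule tendsto_sandwich[OF _ _ tendsto_const LIMSEQ_inverse_real_of_nat])
    show "\<forall>\<^sub>F N in sequentially. 0 \<le> (\<integral>x. norm (g N x - u x) \<partial>M)" by simp
    show "\<forall>\<^sub>F N in sequentially. (\<integral>x. norm (g N x - u x) \<partial>M) \<le> inverse (real (Suc N))"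
      by (rule always_eventually, rule allI, rule less_imp_le[OF gu])
  qed
  show thesis
  proof (rule that[of u])
    show "terminal Y u"
      unfolding terminal_iff
    proof (intro conjI allI impI ballI)
      show "Bochner_integrable M u" by (rule u)
      fix t :: real assume t: "0 \<le> t"
      show "Bochner_integrable M (Y t)" "strongly_measurable (F t) (Y t)"
        by (rule terminalD(2)[OF f0 t], rule terminalD(3)[OF f0 t])
      fix A and \<phi> :: "'e \<Rightarrow>\<^sub>L real" assume A: "A \<in> sets (F t)"
      have AM: "A \<in> sets M" using A sets_F_subset[OF t] by blast
      obtain k :: nat where k: "t \<le> real k" using real_arch_simple by blast
      have "(\<lambda>N. LINT x:A|M. \<phi> (g N x)) \<longlonglongrightarrow> (LINT x:A|M. \<phi> (u x))"
        by (rule set_integral_blinfun_tendsto[OF gB u AM g_lim])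
      moreover have "(\<lambda>N. LINT x:A|M. \<phi> (g N x)) \<longlonglongrightarrow> (LINT x:A|M. \<phi> (Y t x))"
      proof (rule tendsto_eventually)
        show "\<forall>\<^sub>F N in sequentially. (LINT x:A|M. \<phi> (g N x)) = (LINT x:A|M. \<phi> (Y t x))"
          using eventually_ge_at_top[of k]
        proof eventually_elim
          case (elim N)
          then have "t \<le> real N" using k by (simp add: order_trans[of _ "real k"])
          from hull_cond[OF t this A g] show ?case .
        qed
      qed
      ultimately show "(LINT x:A|M. \<phi> (u x)) = (LINT x:A|M. \<phi> (Y t x))" by (rule LIMSEQ_unique)
    qed
    fix A assume A: "A \<in> sets M"
    have un: "integrable M (\<lambda>x. norm (u x))" using u by (simp add: Bochner_integrable_iff)
    have "(LINT x:A|M. norm (u x)) \<le> set_norm A Y + (\<integral>x. norm (g N x - u x) \<partial>M)" for N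
    proof -
      have gn: "integrable M (\<lambda>x. norm (g N x))" and dn: "integrable M (\<lambda>x. norm (g N x - u x))"
        using gB[of N] Bochner_integrable_diff[OF gB[of N] u] by (simp_all add: Bochner_integrable_iff)
      have "(LINT x:A|M. norm (u x)) \<le> (LINT x:A|M. norm (g N x) + norm (g N x - u x))"
      proof (rule set_integral_mono_real[OF un Bochner_Integration.integrable_add[OF gn dn] A])
        show "norm (u x) \<le> norm (g N x) + norm (g N x - u x)" for x
          using norm_triangle_sub[of "u x" "g N x"] by (simp add: norm_minus_commute)
      qed
      moreover have "\<dots> = (LINT x:A|M. norm (g N x)) + (LINT x:A|M. norm (g N x - u x))"
        by (rule set_integral_add(2)[OF set_integrable_of_integrable[OF gn A] set_integrable_of_integrable[OF dn A]])
      moreover have "(LINT x:A|M. norm (g N x - u x)) \<le> (\<integral>x. norm (g N x - u x) \<partial>M)"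
        by (rule set_integral_le_integral[OF dn]) simp
      moreover have "(LINT x:A|M. norm (g N x)) \<le> set_norm A Y" using hull_set[OF A g] by blast
      ultimately show ?thesis by linarith
    qed
    then have le_N: "\<exists>K. \<forall>N\<ge>K. (LINT x:A|M. norm (u x)) \<le> set_norm A Y + (\<integral>x. norm (g N x - u x) \<partial>M)" by blast
    have "(\<lambda>N. set_norm A Y + (\<integral>x. norm (g N x - u x) \<partial>M)) \<longlonglongrightarrow> set_norm A Y"
      using tendsto_add[OF tendsto_const g_lim, of "set_norm A Y"] by simp
    then show "(LINT x:A|M. norm (u x)) \<le> set_norm A Y" by (rule LIMSEQ_le_const[OF _ le_N])
  qed
qed

text \<open>\<open>\<delta> k\<close> is a modulus of uniform integrability for the tolerance
  \<open>1 / (k + 1)\<close>. Fixing the bound and the moduli gives a convex and closed set, which a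
  uniformly integrable family itself need not be.\<close>

definition ui_ball :: "real \<Rightarrow> (nat \<Rightarrow> real) \<Rightarrow> ('x, 'e::banach) process set" where
  "ui_ball B \<delta> = {Y \<in> H1_processes M F. pnorm Y \<le> B \<and>
     (\<forall>k. \<forall>A\<in>sets M. measure M A \<le> \<delta> k \<longrightarrow> set_norm A Y \<le> inverse (Suc k))}"

lemma convex_ui_ball: "convex (ui_ball B \<delta> :: ('x, 'e::banach) process set)"
proof (rule convexI)
  fix Y Z :: "('x, 'e) process" and a b :: real
  assume Y: "Y \<in> ui_ball B \<delta>" and Z: "Z \<in> ui_ball B \<delta>" and ab: "0 \<le> a" "0 \<le> b" "a + b = 1"
  have YV: "Y \<in> H1_processes M F" and ZV: "Z \<in> H1_processes M F" using Y Z by (auto simp: ui_ball_def)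
  have aV: "a *\<^sub>R Y \<in> H1_processes M F" and bV: "b *\<^sub>R Z \<in> H1_processes M F"
    by (rule subspace_scale[OF subspace_H1_processes YV], rule subspace_scale[OF subspace_H1_processes ZV])
  have le: "set_norm A (a *\<^sub>R Y + b *\<^sub>R Z) \<le> c" if A: "A \<in> sets M" "set_norm A Y \<le> c" "set_norm A Z \<le> c" for A c
  proof -
    have "set_norm A (a *\<^sub>R Y + b *\<^sub>R Z) \<le> a * set_norm A Y + b * set_norm A Z"
      using set_norm_triangle[OF aV bV A(1)] ab by (simp add: set_norm_scaleR)
    also have "\<dots> \<le> a * c + b * c" using A ab by (intro add_mono mult_left_mono)
    also have "\<dots> = c" using ab(3) by (simp flip: distrib_right)
    finally show ?thesis .
  qed
  have V: "a *\<^sub>R Y + b *\<^sub>R Z \<in> H1_processes M F" by (rule subspace_add[OF subspace_H1_processes aV bV])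
  have "pnorm (a *\<^sub>R Y + b *\<^sub>R Z) \<le> B"
    unfolding pnorm_eq_set_norm[OF V]
    by (rule le) (use Y Z pnorm_eq_set_norm[OF YV] pnorm_eq_set_norm[OF ZV] in \<open>auto simp: ui_ball_def\<close>)
  moreover have "set_norm A (a *\<^sub>R Y + b *\<^sub>R Z) \<le> inverse (Suc k)" if "A \<in> sets M" "measure M A \<le> \<delta> k" for A k
    by (rule le[OF that(1)]) (use Y Z that in \<open>simp_all add: ui_ball_def\<close>)
  ultimately show "a *\<^sub>R Y + b *\<^sub>R Z \<in> ui_ball B \<delta>" using V unfolding ui_ball_def by blast
qed

lemma set_norm_diff_le:
  fixes Y Z :: "('x, 'e::banach) process"
  assumes "Y \<in> H1_processes M F" "Z \<in> H1_processes M F" "A \<in> sets M"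
  shows "set_norm A (Y - Z) \<le> set_norm A Y + set_norm A Z"
  unfolding diff_eq_add_scaleR[of Y]
  using set_norm_triangle[OF assms(1) subspace_scale[OF subspace_H1_processes assms(2)] assms(3), of "-1"]
    set_norm_scaleR[of A "-1" Z] by simp

text \<open>An approximation in \<open>pnorm\<close> controls all events at once, because
  \<open>set_norm A\<close> is at most \<open>pnorm\<close>.\<close>

lemma ui_ball_closed:
  fixes N :: "('x, 'e::banach) process"
  assumes N: "N \<in> H1_processes M F"
    and approx: "\<And>e. 0 < e \<Longrightarrow> \<exists>Z\<in>ui_ball B \<delta>. pnorm (Z - N) < e"
  shows "N \<in> ui_ball B \<delta>"
proof -
  have le: "set_norm A N \<le> c" if A: "A \<in> sets M" and c: "\<And>Z :: ('x, 'e) process. Z \<in> ui_ball B \<delta> \<Longrightarrow> set_norm A Z \<le> c" for A c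
  proof (rule field_le_epsilon)
    fix e :: real assume "0 < e"
    then obtain Z where Z: "Z \<in> ui_ball B \<delta>" "pnorm (Z - N) < e" using approx by blast
    have ZV: "Z \<in> H1_processes M F" using Z(1) by (simp add: ui_ball_def)
    have "set_norm A (Z - (Z - N)) \<le> set_norm A Z + set_norm A (Z - N)"
      by (rule set_norm_diff_le[OF ZV H1_diff[OF ZV N] A])
    moreover have "set_norm A (Z - N) \<le> pnorm (Z - N)" by (rule set_norm_le_pnorm[OF H1_diff[OF ZV N]])
    moreover have "Z - (Z - N) = N" by simp
    ultimately show "set_norm A N \<le> c + e" using c[OF Z(1)] Z(2) by simp
  qed
  have "pnorm N \<le> B"
    unfolding pnorm_eq_set_norm[OF N]
  proof (rule le[OF sets.top])
    fix Z :: "('x, 'e) process" assume "Z \<in> ui_ball B \<delta>"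
    then show "set_norm (space M) Z \<le> B" using pnorm_eq_set_norm[of Z] by (simp add: ui_ball_def)
  qed
  moreover have "set_norm A N \<le> inverse (Suc k)" if "A \<in> sets M" "measure M A \<le> \<delta> k" for A k
    by (rule le[OF that(1)]) (use that in \<open>simp add: ui_ball_def\<close>)
  ultimately show ?thesis using N unfolding ui_ball_def by blast
qed

text \<open>On uniformly integrable sets Doob's inequality turns convergence of the terminal values in mean
  into convergence in the norm of the martingale space.\<close>

lemma ui_ball_pnorm_diff:
  fixes Y Z :: "('x, 'e::banach) process"
  assumes Y: "Y \<in> ui_ball B \<delta>" "terminal Y f" and Z: "Z \<in> ui_ball B \<delta>" "terminal Z g"
    and c: "0 < c" and le: "(\<integral>x. norm (f x - g x) \<partial>M) \<le> c * \<delta> k"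
  shows "pnorm (Y - Z) \<le> c + 2 * inverse (Suc k)"
proof -
  have YV: "Y \<in> H1_processes M F" and ZV: "Z \<in> H1_processes M F" using Y Z by (auto simp: ui_ball_def)
  have V: "Y - Z \<in> H1_processes M F" by (rule H1_diff[OF YV ZV])
  then have cad: "cadlag M (Y - Z)" unfolding H1_processes_iff by blast
  have "c * measure M {x \<in> space M. ennreal c < maximal_function (Y - Z) x} \<le> c * \<delta> k"
    using doob_maximal_inequality[OF cad terminal_diff[OF Y(2) Z(2)] c] le by simp
  \<comment> \<open>After division by \<open>c\<close>, Doob's inequality makes the event where the
    difference exceeds \<open>c\<close> small enough for the modulus \<open>\<delta> k\<close>;
    hence the tolerance \<open>c * \<delta> k\<close> for the terminal values.\<close>
  then have d: "measure M {x \<in> space M. ennreal c < maximal_function (Y - Z) x} \<le> \<delta> k" using c by simp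
  have sub: "{x \<in> space M. c < max_real (Y - Z) x} \<subseteq> {x \<in> space M. ennreal c < maximal_function (Y - Z) x}"
  proof clarify
    fix x assume x: "c < max_real (Y - Z) x"
    then have "ennreal c < ennreal (max_real (Y - Z) x)" using c by (intro ennreal_lessI) auto
    also have "\<dots> \<le> maximal_function (Y - Z) x"
      unfolding max_real_def by (cases "maximal_function (Y - Z) x = \<top>") (auto simp: top.not_eq_extremum)
    finally show "ennreal c < maximal_function (Y - Z) x" .
  qed
  have [measurable]: "maximal_function (Y - Z) \<in> borel_measurable M" using V unfolding H1_processes_def by blast
  have "measure M {x \<in> space M. c < max_real (Y - Z) x} \<le> measure M {x \<in> space M. ennreal c < maximal_function (Y - Z) x}"
    by (rule finite_measure_mono[OF sub]) measurable
  then have small: "measure M {x \<in> space M. c < max_real (Y - Z) x} \<le> \<delta> k" using d by linarith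
  have "(\<integral>x. max_real (Y - Z) x \<partial>M) \<le> c * measure M (space M) + 2 * inverse (Suc k)"
  proof (rule integral_le_of_small_sets[OF H1_max_real_integrable[OF V] max_real_nonneg less_imp_le[OF c] _ small])
    fix A assume A: "A \<in> sets M" "measure M A \<le> \<delta> k"
    have "set_norm A Y \<le> inverse (Suc k)" "set_norm A Z \<le> inverse (Suc k)"
      using Y(1) Z(1) A by (simp_all add: ui_ball_def)
    then show "(LINT x:A|M. max_real (Y - Z) x) \<le> 2 * inverse (Suc k)"
      using set_norm_diff_le[OF YV ZV A(1)] unfolding set_norm_def by linarith
  qed
  then show ?thesis by (simp add: pnorm_def prob_space)
qed

text \<open>Terminal values dominated by the maximal functions are uniformly integrable, so convex
  combinations of them converge in mean. The speed is fixed in advance, so that the corresponding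
  martingales form a fast Cauchy sequence.\<close>

lemma ui_ball_tails:
  fixes Y :: "nat \<Rightarrow> ('x, 'e::banach) process"
  assumes refl: "reflexive_space TYPE('e)" and \<delta>: "\<And>k. 0 < \<delta> k" and Y: "\<And>n. Y n \<in> ui_ball B \<delta>"
  obtains N where "N \<in> ui_ball B \<delta>" "\<And>n e. 0 < e \<Longrightarrow> \<exists>Z\<in>convex hull (Y ` {n..}). pnorm (Z - N) < e"
proof -
  have YV: "Y n \<in> H1_processes M F" for n using Y[of n] by (simp add: ui_ball_def)
  have "\<exists>f. terminal (Y n) f \<and> (\<forall>A\<in>sets M. (LINT x:A|M. norm (f x)) \<le> set_norm A (Y n))" for n
  proof -
    obtain f where "terminal (Y n) f" "\<And>A. A \<in> sets M \<Longrightarrow> (LINT x:A|M. norm (f x)) \<le> set_norm A (Y n)"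
      by (rule H1_terminal_bounded[OF refl YV[of n]]) (rule that)
    then show ?thesis by blast
  qed
  from choice[OF allI, OF this] obtain f
    where "\<forall>n. terminal (Y n) (f n) \<and> (\<forall>A\<in>sets M. (LINT x:A|M. norm (f n x)) \<le> set_norm A (Y n))" by (rule exE)
  then have f: "terminal (Y n) (f n)" and fle: "A \<in> sets M \<Longrightarrow> (LINT x:A|M. norm (f n x)) \<le> set_norm A (Y n)" for n A
    by blast+
  have fB: "Bochner_integrable M (f n)" for n using f[of n] by (simp add: terminal_def)
  have fn: "integrable M (\<lambda>x. norm (f n x))" for n using fB[of n] by (simp add: Bochner_integrable_iff)
  obtain u where u: "Bochner_integrable M u"
    and lim: "\<And>N \<epsilon>. \<epsilon> > 0 \<Longrightarrow> \<exists>g\<in>convex hull (f ` {N..}). (\<integral>x. norm (g x - u x) \<partial>M) < \<epsilon>"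
  proof (rule uniformly_integrable_L1_limit[OF refl fB])
    show "(\<integral>x. norm (f n x) \<partial>M) \<le> B" for n
    proof -
      have "(\<integral>x. norm (f n x) \<partial>M) = (LINT x:space M|M. norm (f n x))"
        by (rule set_integral_space[OF fn, symmetric])
      also have "\<dots> \<le> pnorm (Y n)" unfolding pnorm_eq_set_norm[OF YV] by (rule fle[OF sets.top])
      also have "\<dots> \<le> B" using Y[of n] by (simp add: ui_ball_def)
      finally show ?thesis .
    qed
    fix \<epsilon> :: real assume "\<epsilon> > 0"
    then obtain k where k: "inverse (real (Suc k)) < \<epsilon>" using reals_Archimedean by blast
    have "(LINT x:A|M. norm (f n x)) \<le> \<epsilon>" if A: "A \<in> sets M" "measure M A \<le> \<delta> k" for n A
    proof -
      have "set_norm A (Y n) \<le> inverse (real (Suc k))" using Y[of n] A by (simp add: ui_ball_def)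
      then show ?thesis using fle[OF A(1), of n] k by linarith
    qed
    then show "\<exists>\<delta>>0. \<forall>n. \<forall>A\<in>sets M. measure M A \<le> \<delta> \<longrightarrow> (LINT x:A|M. norm (f n x)) \<le> \<epsilon>"
      using \<delta>[of k] by (intro exI[of _ "\<delta> k"]) simp
  qed (rule that)
  \<comment> \<open>Two halves of \<open>(1 / 2) ^ i\<close>: the norm of a difference will be at
    most \<open>c i + 2 / (k i + 1)\<close>, and \<open>k i\<close> is chosen so that the second
    term is below \<open>c i\<close>.\<close>
  define c :: "nat \<Rightarrow> real" where "c i = (1 / 2) ^ i / 2" for i
  have c: "0 < c i" for i by (simp add: c_def)
  have "\<exists>k. inverse (real (Suc k)) < c i / 2" for i using reals_Archimedean[of "c i / 2"] c[of i] by simp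
  from choice[OF allI, OF this] obtain k where "\<forall>i. inverse (real (Suc (k i))) < c i / 2" by (rule exE)
  then have k: "inverse (real (Suc (k i))) < c i / 2" for i by blast
  \<comment> \<open>\<open>c i * \<delta> (k i)\<close> is the distance in mean that Doob's
    inequality allows; the minimum with \<open>1\<close> also makes \<open>\<kappa> i\<close> tend
    to \<open>0\<close>, so that the terminal values converge.\<close>
  define \<kappa> where "\<kappa> i = c i * min (\<delta> (k i)) 1" for i
  have \<kappa>: "0 < \<kappa> i" for i using c \<delta> by (simp add: \<kappa>_def)
  \<comment> \<open>The minimum over all earlier indices puts both \<open>g i\<close> and
    \<open>g (Suc i)\<close> within \<open>\<kappa> i / 2\<close> of \<open>u\<close>.\<close>
  define \<eta> where "\<eta> i = Min (\<kappa> ` {..i}) / 2" for i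
  have \<eta>: "0 < \<eta> i" for i
  proof -
    have "Min (\<kappa> ` {..i}) \<in> \<kappa> ` {..i}" by (rule Min_in) auto
    then show ?thesis using \<kappa> by (auto simp: \<eta>_def)
  qed
  have \<eta>_le: "\<eta> j \<le> \<kappa> i / 2" if "i \<le> j" for i j
    unfolding \<eta>_def using that by (intro divide_right_mono Min_le) auto
  have "\<exists>g. g \<in> convex hull (f ` {i..}) \<and> (\<integral>x. norm (g x - u x) \<partial>M) < \<eta> i" for i
    using lim[OF \<eta>, of i i] unfolding Bex_def .
  from choice[OF allI, OF this] obtain g
    where "\<forall>i. g i \<in> convex hull (f ` {i..}) \<and> (\<integral>x. norm (g i x - u x) \<partial>M) < \<eta> i" by (rule exE)
  then have g: "g i \<in> convex hull (f ` {i..})" and gu: "(\<integral>x. norm (g i x - u x) \<partial>M) < \<eta> i" for i by blast+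
  have "\<exists>Z. Z \<in> convex hull (Y ` {i..}) \<and> terminal Z (g i)" for i
  proof -
    obtain Z where "Z \<in> convex hull (Y ` {i..})" "terminal Z (g i)"
      by (rule convex_hull_terminal[of Y f, OF f g[of i]]) (rule that)
    then show ?thesis by blast
  qed
  from choice[OF allI, OF this] obtain Z
    where "\<forall>i. Z i \<in> convex hull (Y ` {i..}) \<and> terminal (Z i) (g i)" by (rule exE)
  then have Zh: "Z i \<in> convex hull (Y ` {i..})" and Zt: "terminal (Z i) (g i)" for i by blast+
  have ZC: "Z i \<in> ui_ball B \<delta>" for i
    using hull_minimal[of "Y ` {i..}" "ui_ball B \<delta>" convex] convex_ui_ball Y Zh[of i] by blast
  have ZV: "Z i \<in> H1_processes M F" for i using ZC[of i] by (simp add: ui_ball_def)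
  have gB: "Bochner_integrable M (g i)" for i using Zt[of i] by (simp add: terminal_def)
  have fast: "pnorm (Z i - Z (Suc i)) \<le> (1 / 2) ^ i" for i
  proof -
    have "(\<integral>x. norm (g i x - g (Suc i) x) \<partial>M) \<le> (\<integral>x. norm (g i x - u x) \<partial>M) + (\<integral>x. norm (u x - g (Suc i) x) \<partial>M)"
      by (rule integral_norm_diff_triangle[OF gB u gB])
    moreover have "(\<integral>x. norm (u x - g (Suc i) x) \<partial>M) = (\<integral>x. norm (g (Suc i) x - u x) \<partial>M)"
      by (simp only: norm_minus_commute)
    moreover have "\<eta> i \<le> \<kappa> i / 2" "\<eta> (Suc i) \<le> \<kappa> i / 2" by (rule \<eta>_le, simp)+
    ultimately have "(\<integral>x. norm (g i x - g (Suc i) x) \<partial>M) \<le> \<kappa> i" using gu[of i] gu[of "Suc i"] by argo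
    also have "\<dots> \<le> c i * \<delta> (k i)" unfolding \<kappa>_def using c[of i] by (intro mult_left_mono) auto
    finally have "pnorm (Z i - Z (Suc i)) \<le> c i + 2 * inverse (real (Suc (k i)))"
      by (rule ui_ball_pnorm_diff[OF ZC Zt ZC Zt c])
    then show ?thesis using k[of i] unfolding c_def by argo
  qed
  have "(\<lambda>i. \<integral>x. norm (g i x - u x) \<partial>M) \<longlonglongrightarrow> 0"
  proof (rule tendsto_sandwich[OF _ _ tendsto_const LIMSEQ_realpow_zero[of "1 / 2 :: real"]])
    show "\<forall>\<^sub>F i in sequentially. 0 \<le> (\<integral>x. norm (g i x - u x) \<partial>M)" by simp
    have "(\<integral>x. norm (g i x - u x) \<partial>M) \<le> (1 / 2) ^ i" for i
    proof -
      have "\<kappa> i \<le> c i * 1" unfolding \<kappa>_def using c[of i] by (intro mult_left_mono) auto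
      then have "\<eta> i \<le> (1 / 2) ^ i"
        using \<eta>_le[OF order_refl, of i] \<kappa>[of i] zero_le_power[of "1 / 2 :: real" i] unfolding c_def by argo
      then show ?thesis using gu[of i] by linarith
    qed
    then show "\<forall>\<^sub>F i in sequentially. (\<integral>x. norm (g i x - u x) \<partial>M) \<le> (1 / 2) ^ i"
      by (intro always_eventually allI)
  qed simp_all
  then obtain N where N: "N \<in> H1_processes M F" and ZN: "\<And>n. pnorm (Z n - N) \<le> 2 * (1 / 2) ^ n"
    by (rule H1_complete[of Z g u, OF ZV Zt u _ fast]) (rule that)
  have near: "\<exists>i\<ge>n. pnorm (Z i - N) < e" if e: "0 < e" for n e
  proof -
    have "(\<lambda>n. 2 * (1 / 2 :: real) ^ n) \<longlonglongrightarrow> 0"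
      using tendsto_mult[OF tendsto_const[of 2] LIMSEQ_realpow_zero[of "1 / 2 :: real"]] by simp
    from order_tendstoD(2)[OF this e] eventually_ge_at_top[of n]
    have "eventually (\<lambda>i. 2 * (1 / 2) ^ i < e \<and> n \<le> i) sequentially" by eventually_elim simp
    from eventually_happens'[OF sequentially_bot this] obtain i where "2 * (1 / 2) ^ i < e" "n \<le> i" by blast
    then show ?thesis using ZN[of i] by (intro exI[of _ i]) simp
  qed
  show thesis
  proof (rule that[of N])
    show "N \<in> ui_ball B \<delta>"
    proof (rule ui_ball_closed[OF N])
      show "\<exists>Z\<in>ui_ball B \<delta>. pnorm (Z - N) < e" if "0 < e" for e
        using near[OF that, of 0] ZC by blast
    qed
    show "\<exists>Z\<in>convex hull (Y ` {n..}). pnorm (Z - N) < e" if e0: "0 < e" for n and e :: real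
    proof -
      obtain i where i: "n \<le> i" "pnorm (Z i - N) < e" using near[OF e0, of n] by blast
      have "Z i \<in> convex hull (Y ` {n..})" using Zh[of i] convex_hull_image_atLeast_mono[OF i(1)] by blast
      then show ?thesis using i(2) by blast
    qed
  qed
qed

end

section \<open>Weak compactness\<close>

text \<open>Convergence to \<open>c0\<close> along a filter needs to be tested only on the subbasis,
  which for the weak topology consists of preimages under single functionals.\<close>

lemma generate_topology_on_eventually:
  assumes "generate_topology_on S U" "c0 \<in> U" "\<And>V. V \<in> S \<Longrightarrow> c0 \<in> V \<Longrightarrow> eventually (\<lambda>w. g w \<in> V) F"
  shows "eventually (\<lambda>w. g w \<in> U) F"
  using assms(1,2)
proof (induction rule: generate_topology_on.induct)
  case (Int a b)
  then have "eventually (\<lambda>w. g w \<in> a) F" "eventually (\<lambda>w. g w \<in> b) F" by auto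
  then show ?case by eventually_elim simp
next
  case (UN K)
  then obtain k where k: "k \<in> K" "c0 \<in> k" by blast
  then have "eventually (\<lambda>w. g w \<in> k) F" using UN by blast
  then show ?case by eventually_elim (use k(1) in blast)
next
  case (Basis s)
  then show ?case using assms(3) by blast
qed simp

section \<open>The quotient by indistinguishability, its dual and its weak topology\<close>

context stochastic_basis begin

abbreviation cls :: "('x, 'e::banach) process \<Rightarrow> ('x, 'e) process set" where
  "cls Y \<equiv> H1_rel M F `` {Y}"

lemma cls_in_H1: "Y \<in> H1_processes M F \<Longrightarrow> cls Y \<in> H1 M F"
  unfolding H1_def by (rule quotientI)

lemma self_in_cls: "Y \<in> H1_processes M F \<Longrightarrow> Y \<in> cls Y"
  by (rule equiv_class_self[OF equiv_H1_rel])

lemma cls_eqI: "(Y, Z) \<in> H1_rel M F \<Longrightarrow> cls Y = cls Z"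
  by (rule equiv_class_eq[OF equiv_H1_rel])

lemma in_cls_D: "Z \<in> cls Y \<Longrightarrow> (Y, Z) \<in> H1_rel M F" by simp

lemma H1_member:
  assumes "C \<in> H1 M F" "Y \<in> C"
  shows "Y \<in> H1_processes M F" "C = cls Y"
proof -
  obtain Z where Z: "C = cls Z" "Z \<in> H1_processes M F" using assms(1) unfolding H1_def by (rule quotientE)
  then have "(Z, Y) \<in> H1_rel M F" using assms(2) by simp
  then show "Y \<in> H1_processes M F" "C = cls Y" using cls_eqI[of Z Y] Z(1) by (simp_all add: H1_rel_def)
qed

lemma H1_cases:
  assumes "C \<in> H1 M F"
  obtains Y where "Y \<in> H1_processes M F" "C = cls Y"
  using assms unfolding H1_def by (auto elim: quotientE)

lemma H1_norm_cls:
  fixes Y :: "('x, 'e::banach) process"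
  assumes "Y \<in> H1_processes M F"
  shows "H1_norm M (cls Y) = pnorm Y"
  unfolding pnorm_def H1_integral_max_real[OF assms]
  by (rule H1_norm_class[OF self_in_cls[OF assms] cls_in_H1[OF assms]])

lemma H1_rel_add:
  fixes Y :: "('x, 'e::banach) process"
  assumes "(Y, Y') \<in> H1_rel M F" "(Z, Z') \<in> H1_rel M F"
  shows "(Y + Z, Y' + Z') \<in> H1_rel M F"
proof -
  have "{x \<in> space M. \<exists>t\<ge>0. Y t x \<noteq> Y' t x} \<union> {x \<in> space M. \<exists>t\<ge>0. Z t x \<noteq> Z' t x} \<in> null_sets M"
    using assms unfolding H1_rel_def indistinguishable_iff by blast
  then have "{x \<in> space M. \<exists>t\<ge>0. (Y + Z) t x \<noteq> (Y' + Z') t x} \<in> null_sets M"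
    by (rule complete2[rotated]) auto
  then show ?thesis
    using assms subspace_add[OF subspace_H1_processes] unfolding H1_rel_def indistinguishable_iff by blast
qed

lemma H1_rel_scaleR:
  fixes Y :: "('x, 'e::banach) process"
  assumes "(Y, Y') \<in> H1_rel M F"
  shows "(c *\<^sub>R Y, c *\<^sub>R Y') \<in> H1_rel M F"
proof -
  have "{x \<in> space M. \<exists>t\<ge>0. Y t x \<noteq> Y' t x} \<in> null_sets M"
    using assms unfolding H1_rel_def indistinguishable_iff by blast
  then have "{x \<in> space M. \<exists>t\<ge>0. (c *\<^sub>R Y) t x \<noteq> (c *\<^sub>R Y') t x} \<in> null_sets M"
    by (rule complete2[rotated]) auto
  then show ?thesis
    using assms subspace_scale[OF subspace_H1_processes] unfolding H1_rel_def indistinguishable_iff by blast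
qed

lemma H1_add_cls:
  fixes Y Z :: "('x, 'e::banach) process"
  assumes Y: "Y \<in> H1_processes M F" and Z: "Z \<in> H1_processes M F"
  shows "H1_add M F (cls Y) (cls Z) = cls (Y + Z)"
proof -
  have "cls (\<lambda>t x. Y' t x + Z' t x) = cls (Y + Z)" if "Y' \<in> cls Y" "Z' \<in> cls Z" for Y' Z'
  proof -
    have "cls (Y + Z) = cls (Y' + Z')"
      by (rule cls_eqI[OF H1_rel_add[OF in_cls_D[OF that(1)] in_cls_D[OF that(2)]]])
    then show ?thesis by (simp add: plus_fun_def)
  qed
  then show ?thesis unfolding H1_add_def using self_in_cls[OF Y] self_in_cls[OF Z] by blast
qed

lemma H1_scale_cls:
  fixes Y :: "('x, 'e::banach) process"
  assumes Y: "Y \<in> H1_processes M F"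
  shows "H1_scale M F c (cls Y) = cls (c *\<^sub>R Y)"
proof -
  have "cls (\<lambda>t x. c *\<^sub>R Y' t x) = cls (c *\<^sub>R Y)" if "Y' \<in> cls Y" for Y'
  proof -
    have "cls (c *\<^sub>R Y) = cls (c *\<^sub>R Y')" by (rule cls_eqI[OF H1_rel_scaleR[OF in_cls_D[OF that]]])
    then show ?thesis by (simp add: scaleR_fun_def)
  qed
  then show ?thesis unfolding H1_scale_def using self_in_cls[OF Y] by blast
qed

lemma pnorm_diff_rel:
  fixes Y Z :: "('x, 'e::banach) process"
  assumes "(Y, Z) \<in> H1_rel M F"
  shows "pnorm (Y - Z) = 0"
proof -
  have "indistinguishable M Y Z" using assms by (simp add: H1_rel_def)
  then have "indistinguishable M (Y - Z) (0 :: ('x, 'e) process)" unfolding indistinguishable_iff by simp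
  then have "AE x in M. maximal_function (Y - Z) x = maximal_function (0 :: ('x, 'e) process) x" by (rule maximal_function_AE_cong)
  then have "AE x in M. max_real (Y - Z) x = 0"
    by eventually_elim (simp add: max_real_def maximal_function_eq_SUP)
  then show ?thesis unfolding pnorm_def by (rule integral_eq_zero_AE)
qed

text \<open>The dual at the level of representatives: linear on the full type of processes, where
  Hahn-Banach functionals live, but bounded only on \<open>H1_processes\<close>.\<close>

definition dual_functionals :: "(('x, 'e::banach) process \<Rightarrow> real) set" where
  "dual_functionals = {\<psi>. linear \<psi> \<and> (\<exists>K. \<forall>Y\<in>H1_processes M F. \<bar>\<psi> Y\<bar> \<le> K * pnorm Y)}"

text \<open>Indistinguishable processes differ by a process of norm \<open>0\<close>, so boundedness
  makes the value independent of the representative picked by \<open>SOME\<close>.\<close>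

lemma dual_functional_descends:
  fixes \<psi> :: "('x, 'e::banach) process \<Rightarrow> real"
  assumes \<psi>: "\<psi> \<in> dual_functionals"
  obtains \<phi> where "\<phi> \<in> H1_dual M F" "\<And>Y. Y \<in> H1_processes M F \<Longrightarrow> \<phi> (cls Y) = \<psi> Y"
proof -
  obtain K where lin: "linear \<psi>" and K: "\<And>Y. Y \<in> H1_processes M F \<Longrightarrow> \<bar>\<psi> Y\<bar> \<le> K * pnorm Y"
    using \<psi> unfolding dual_functionals_def by blast
  define \<phi> where "\<phi> C = \<psi> (SOME Y. Y \<in> C)" for C
  have \<phi>: "\<phi> (cls Y) = \<psi> Y" if Y: "Y \<in> H1_processes M F" for Y
  proof -
    define Z where "Z = (SOME Z. Z \<in> cls Y)"
    have "Z \<in> cls Y" unfolding Z_def by (rule someI[where P = "\<lambda>Z. Z \<in> cls Y", OF self_in_cls[OF Y]])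
    then have rel: "(Y, Z) \<in> H1_rel M F" by (rule in_cls_D)
    then have "Z \<in> H1_processes M F" by (simp add: H1_rel_def)
    from K[OF H1_diff[OF Y this]] have "\<psi> (Y - Z) = 0" by (simp add: pnorm_diff_rel[OF rel])
    then have "\<psi> Z = \<psi> Y" by (simp add: linear_diff[OF lin])
    then show ?thesis unfolding \<phi>_def Z_def .
  qed
  have "\<phi> \<in> H1_dual M F"
    unfolding H1_dual_def
  proof (intro CollectI conjI ballI allI exI)
    fix C D :: "('x, 'e) process set" and c :: real assume C: "C \<in> H1 M F"
    obtain Y where Y: "Y \<in> H1_processes M F" "C = cls Y" by (rule H1_cases[OF C])
    show "\<phi> (H1_scale M F c C) = c * \<phi> C"
      unfolding Y(2) H1_scale_cls[OF Y(1)] \<phi>[OF Y(1)] \<phi>[OF subspace_scale[OF subspace_H1_processes Y(1)]]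
      by (simp add: linear_scale[OF lin])
    show "\<bar>\<phi> C\<bar> \<le> K * H1_norm M C"
      unfolding Y(2) H1_norm_cls[OF Y(1)] \<phi>[OF Y(1)] by (rule K[OF Y(1)])
    assume D: "D \<in> H1 M F"
    obtain Z where Z: "Z \<in> H1_processes M F" "D = cls Z" by (rule H1_cases[OF D])
    show "\<phi> (H1_add M F C D) = \<phi> C + \<phi> D"
      unfolding Y(2) Z(2) H1_add_cls[OF Y(1) Z(1)] \<phi>[OF Y(1)] \<phi>[OF Z(1)] \<phi>[OF subspace_add[OF subspace_H1_processes Y(1) Z(1)]]
      by (rule linear_add[OF lin])
  qed
  then show thesis by (rule that) (rule \<phi>)
qed

lemma H1_projection:
  obtains P :: "('x, 'e::banach) process \<Rightarrow> ('x, 'e) process"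
  where "linear P" "\<And>Y. P Y \<in> H1_processes M F" "\<And>Y. Y \<in> H1_processes M F \<Longrightarrow> P Y = Y"
proof -
  obtain P :: "('x, 'e) process \<Rightarrow> ('x, 'e) process"
    where P: "linear P" "range P \<subseteq> H1_processes M F" "\<And>Y. Y \<in> H1_processes M F \<Longrightarrow> P Y = Y"
    by (rule subspace_projection[OF subspace_H1_processes]) (rule that)
  have "P Y \<in> H1_processes M F" for Y using P(2) by blast
  with P show thesis by (intro that[of P])
qed

lemma seminorm_set_norm:
  fixes P :: "('x, 'e::banach) process \<Rightarrow> ('x, 'e) process"
  assumes P: "linear P" "\<And>Y. P Y \<in> H1_processes M F" and A: "A \<in> sets M"
  shows "seminorm (\<lambda>Y. set_norm A (P Y))"
proof (rule seminorm_comp_linear[OF P(1)])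
  fix Y Z assume "Y \<in> range P" "Z \<in> range P"
  then have "Y \<in> H1_processes M F" "Z \<in> H1_processes M F" using P(2) by auto
  then show "set_norm A (Y + Z) \<le> set_norm A Y + set_norm A Z" by (rule set_norm_triangle[OF _ _ A])
qed (rule set_norm_scaleR)

lemma seminorm_pnorm:
  fixes P :: "('x, 'e::banach) process \<Rightarrow> ('x, 'e) process"
  assumes P: "linear P" "\<And>Y. P Y \<in> H1_processes M F"
  shows "seminorm (\<lambda>Y. pnorm (P Y))"
  unfolding pnorm_eq_set_norm[OF P(2)] by (rule seminorm_set_norm[OF P sets.top])

lemma pnorm_nonneg: "0 \<le> pnorm Y"
  unfolding pnorm_def by (rule Bochner_Integration.integral_nonneg) (rule max_real_nonneg)

text \<open>If an open cover has no finite subcover, the complements of its members generate a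
  proper filter on the ball. The class of a weak limit lies in some member of the cover, which the
  filter would have to enter eventually and yet avoids.\<close>

lemma compactin_ui_ball:
  assumes refl: "reflexive_space TYPE('e::banach)" and \<delta>: "\<And>k. 0 < \<delta> k"
  shows "compactin (H1_weak_topology M F) (cls ` (ui_ball B \<delta> :: ('x, 'e) process set))"
proof -
  let ?C = "ui_ball B \<delta> :: ('x, 'e) process set"
  let ?T = "H1_weak_topology M F :: ('x, 'e) process set topology"
  have CV: "Y \<in> H1_processes M F" if "Y \<in> ?C" for Y using that by (simp add: ui_ball_def)
  obtain P :: "('x, 'e) process \<Rightarrow> ('x, 'e) process"
    where P: "linear P" "\<And>Y. P Y \<in> H1_processes M F" "\<And>Y. Y \<in> H1_processes M F \<Longrightarrow> P Y = Y"
    by (rule H1_projection) (rule that)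
  define q where "q Y = pnorm (P Y)" for Y
  have q: "seminorm q" unfolding q_def by (rule seminorm_pnorm[OF P(1,2)])
  show ?thesis
    unfolding compactin_def
  proof (intro conjI allI impI)
    show "cls ` ?C \<subseteq> topspace ?T"
      unfolding topspace_H1_weak_topology using CV cls_in_H1 by blast
    fix \<U> assume \<U>: "Ball \<U> (openin ?T) \<and> cls ` ?C \<subseteq> \<Union>\<U>"
    show "\<exists>\<F>. finite \<F> \<and> \<F> \<subseteq> \<U> \<and> cls ` ?C \<subseteq> \<Union>\<F>"
    proof (rule ccontr)
      assume neg: "\<not> (\<exists>\<F>. finite \<F> \<and> \<F> \<subseteq> \<U> \<and> cls ` ?C \<subseteq> \<Union>\<F>)"
      define G where "G U = principal {Y \<in> ?C. cls Y \<notin> U}" for U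
      \<comment> \<open>The inserted empty set contributes the condition of membership in the ball,
        so the filter lives there even if the cover is empty.\<close>
      define FF where "FF = (INF U\<in>insert {} \<U>. G U)"
      have "FF \<noteq> bot"
        unfolding FF_def
      proof (rule INF_filter_not_bot)
        fix X assume X: "X \<subseteq> insert {} \<U>" "finite X"
        have "finite (X - {{}})" "X - {{}} \<subseteq> \<U>" using X by auto
        then have "\<not> cls ` ?C \<subseteq> \<Union>(X - {{}})" using neg by blast
        then obtain Y where Y: "Y \<in> ?C" "cls Y \<notin> \<Union>(X - {{}})" by blast
        have "(INF U\<in>X. G U) = principal (\<Inter>U\<in>X. {Y \<in> ?C. cls Y \<notin> U})"
          unfolding G_def by (rule INF_principal_finite[OF X(2)])
        moreover have "Y \<in> (\<Inter>U\<in>X. {Y \<in> ?C. cls Y \<notin> U})" using Y by blast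
        ultimately show "(INF U\<in>X. G U) \<noteq> bot" by (auto simp: principal_eq_bot_iff)
      qed
      have FG: "FF \<le> G U" if "U \<in> insert {} \<U>" for U unfolding FF_def by (rule INF_lower[OF that])
      have "eventually (\<lambda>Y. Y \<in> {Y \<in> ?C. cls Y \<notin> {}}) FF"
        using FG[of "{}"] unfolding G_def le_principal by simp
      then have evC: "eventually (\<lambda>Y. Y \<in> ?C) FF" by eventually_elim simp
      obtain Y0 F' where Y0: "Y0 \<in> ?C" and F': "F' \<le> FF" "F' \<noteq> bot"
        and lim: "\<And>f. linear f \<Longrightarrow> (\<And>w. \<bar>f w\<bar> \<le> q w) \<Longrightarrow> (f \<longlongrightarrow> f Y0) F'"
      proof (rule weak_limit_in_set[OF q _ \<open>FF \<noteq> bot\<close> evC])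
        show "q Y \<le> B" if "Y \<in> ?C" for Y
          using that P(3)[OF CV[OF that]] by (simp add: q_def ui_ball_def)
        fix a :: "nat \<Rightarrow> ('x, 'e) process" assume a: "range a \<subseteq> ?C"
        then have aC: "a n \<in> ?C" for n by blast
        obtain N where N: "N \<in> ?C" "\<And>n e. 0 < e \<Longrightarrow> \<exists>Z\<in>convex hull (a ` {n..}). pnorm (Z - N) < e"
          by (rule ui_ball_tails[where Y = a and \<delta> = \<delta> and B = B, OF refl \<delta> aC]) (rule that)
        show "\<exists>x\<in>?C. \<forall>n. \<forall>e>0. \<exists>y\<in>convex hull (a ` {n..}). q (x - y) < e"
        proof (rule bexI[OF _ N(1)], intro allI impI)
          fix n and e :: real assume "0 < e"
          then obtain Z where Z: "Z \<in> convex hull (a ` {n..})" "pnorm (Z - N) < e" using N(2)[of e n] by blast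
          have "convex hull (a ` {n..}) \<subseteq> ?C"
            using aC by (intro hull_minimal convex_ui_ball) auto
          then have "Z \<in> ?C" using Z(1) by blast
          then have "q (Z - N) < e" using Z(2) P(3)[OF H1_diff[OF CV CV[OF N(1)]]] by (simp add: q_def)
          then have "q (N - Z) < e" using seminorm_minus_commute[OF q, of N Z] by simp
          then show "\<exists>y\<in>convex hull (a ` {n..}). q (N - y) < e" using Z(1) by blast
        qed
      qed (rule that, assumption, assumption, assumption, blast)
      have ev': "eventually (\<lambda>Y. Y \<in> ?C) F'" by (rule filter_leD[OF F'(1) evC])
      have lim_dual: "((\<lambda>Y. \<phi> (cls Y)) \<longlongrightarrow> \<phi> (cls Y0)) F'" if \<phi>: "\<phi> \<in> H1_dual M F" for \<phi> :: "('x, 'e) process set \<Rightarrow> real"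
      proof -
        have add: "\<phi> (H1_add M F C D) = \<phi> C + \<phi> D" if "C \<in> H1 M F" "D \<in> H1 M F" for C D
          using \<phi> that unfolding H1_dual_def by simp
        have scale: "\<phi> (H1_scale M F c C) = c * \<phi> C" if "C \<in> H1 M F" for c C
          using \<phi> that unfolding H1_dual_def by simp
        have "\<exists>K. \<forall>C\<in>H1 M F. \<bar>\<phi> C\<bar> \<le> K * H1_norm M C" using \<phi> unfolding H1_dual_def by simp
        then obtain K where K: "\<And>C. C \<in> H1 M F \<Longrightarrow> \<bar>\<phi> C\<bar> \<le> K * H1_norm M C" by blast
        \<comment> \<open>Division by \<open>K'\<close> brings the functional below the seminorm
          \<open>q\<close>; the summand \<open>1\<close> keeps the divisor positive.\<close>
        define K' where "K' = \<bar>K\<bar> + 1"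
        define f where "f Y = \<phi> (cls (P Y)) / K'" for Y
        have K': "0 < K'" by (simp add: K'_def)
        have "linear f"
        proof (rule linearI)
          fix Y Z c
          show "f (Y + Z) = f Y + f Z"
            unfolding f_def linear_add[OF P(1)] H1_add_cls[OF P(2) P(2), symmetric]
              add[OF cls_in_H1[OF P(2)] cls_in_H1[OF P(2)]] by (rule add_divide_distrib)
          show "f (c *\<^sub>R Y) = c *\<^sub>R f Y"
            unfolding f_def linear_scale[OF P(1)] H1_scale_cls[OF P(2), symmetric] scale[OF cls_in_H1[OF P(2)]] by simp
        qed
        moreover have "\<bar>f w\<bar> \<le> q w" for w
        proof -
          have "\<bar>\<phi> (cls (P w))\<bar> \<le> K * pnorm (P w)"
            using K[OF cls_in_H1[OF P(2)], of w] by (simp only: H1_norm_cls[OF P(2)])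
          also have "\<dots> \<le> K' * pnorm (P w)" by (rule mult_right_mono[OF _ pnorm_nonneg]) (simp add: K'_def)
          finally show ?thesis using K' by (simp add: f_def q_def pos_divide_le_eq mult.commute)
        qed
        ultimately have "(f \<longlongrightarrow> f Y0) F'" by (rule lim)
        then have "((\<lambda>Y. K' * f Y) \<longlongrightarrow> K' * f Y0) F'" by (rule tendsto_mult[OF tendsto_const])
        moreover have "K' * f Y0 = \<phi> (cls Y0)" using K' by (simp add: f_def P(3)[OF CV[OF Y0]])
        moreover have "eventually (\<lambda>Y. K' * f Y = \<phi> (cls Y)) F'"
          using ev' by eventually_elim (use K' P(3)[OF CV] in \<open>simp add: f_def\<close>)
        ultimately show ?thesis by (simp add: tendsto_cong)
      qed
      obtain U where U: "U \<in> \<U>" "cls Y0 \<in> U" using \<U> Y0 by blast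
      have "generate_topology_on {{C \<in> H1 M F. \<phi> C \<in> W} |\<phi> W. \<phi> \<in> H1_dual M F \<and> open W} U"
        using \<U> U(1) unfolding H1_weak_topology_def openin_topology_generated_by_iff by blast
      then have "eventually (\<lambda>Y. cls Y \<in> U) F'"
      proof (rule generate_topology_on_eventually[OF _ U(2)])
        fix V :: "('x, 'e) process set set"
        assume V: "V \<in> {{C \<in> H1 M F. \<phi> C \<in> W} |\<phi> W. \<phi> \<in> H1_dual M F \<and> open W}" and Y0V: "cls Y0 \<in> V"
        then obtain \<phi> W where \<phi>: "\<phi> \<in> H1_dual M F" "open W" "V = {C \<in> H1 M F. \<phi> C \<in> W}" by blast
        have "\<phi> (cls Y0) \<in> W" using Y0V \<phi>(3) by blast
        from topological_tendstoD[OF lim_dual[OF \<phi>(1)] \<phi>(2) this] ev'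
        show "eventually (\<lambda>Y. cls Y \<in> V) F'"
          by eventually_elim (use \<phi>(3) CV cls_in_H1 in blast)
      qed
      moreover have "eventually (\<lambda>Y. Y \<in> {Y \<in> ?C. cls Y \<notin> U}) FF"
        using FG[of U] U(1) unfolding G_def le_principal by simp
      then have "eventually (\<lambda>Y. Y \<in> {Y \<in> ?C. cls Y \<notin> U}) F'" by (rule filter_leD[OF F'(1)])
      ultimately have "eventually (\<lambda>_. False) F'" by eventually_elim simp
      then show False using F'(2) by (simp add: trivial_limit_def)
    qed
  qed
qed

lemma openin_weak_subbasic:
  assumes "\<phi> \<in> H1_dual M F" "open W"
  shows "openin (H1_weak_topology M F) {C \<in> H1 M F. \<phi> C \<in> W}"
  unfolding H1_weak_topology_def by (rule topology_generated_by_Basis) (use assms in blast)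

lemma closedin_ui_ball:
  shows "closedin (H1_weak_topology M F) (cls ` (ui_ball B \<delta> :: ('x, 'e::banach) process set))"
proof -
  let ?C = "ui_ball B \<delta> :: ('x, 'e) process set"
  let ?T = "H1_weak_topology M F :: ('x, 'e) process set topology"
  have CV: "Y \<in> H1_processes M F" if "Y \<in> ?C" for Y using that by (simp add: ui_ball_def)
  obtain P :: "('x, 'e) process \<Rightarrow> ('x, 'e) process"
    where P: "linear P" "\<And>Y. P Y \<in> H1_processes M F" "\<And>Y. Y \<in> H1_processes M F \<Longrightarrow> P Y = Y"
    by (rule H1_projection) (rule that)
  show ?thesis
    unfolding closedin_def topspace_H1_weak_topology
  proof (intro conjI)
    show "cls ` ?C \<subseteq> H1 M F" using CV cls_in_H1 by blast
    show "openin ?T (H1 M F - cls ` ?C)"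
    proof (subst openin_subopen, rule ballI)
      fix D assume D: "D \<in> H1 M F - cls ` ?C"
      then obtain Y where Y: "Y \<in> H1_processes M F" "D = cls Y" by (auto elim: H1_cases)
      have YC: "Y \<notin> ?C" using D Y(2) by blast
      have "\<exists>e>0. \<forall>Z\<in>?C. \<not> pnorm (Z - Y) < e" using ui_ball_closed[OF Y(1)] YC by blast
      then obtain e where e: "0 < e" "\<And>Z. Z \<in> ?C \<Longrightarrow> e \<le> pnorm (Z - Y)" by (auto simp: not_less)
      show "\<exists>U. openin ?T U \<and> D \<in> U \<and> U \<subseteq> H1 M F - cls ` ?C"
      proof (cases "?C = {}")
        case True
        have "openin ?T (topspace ?T)" by (rule openin_topspace)
        then have "openin ?T (H1 M F)" by (simp only: topspace_H1_weak_topology)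
        then show ?thesis using D True by (intro exI[of _ "H1 M F"]) auto
      next
        case False
        define Q where "Q = (\<lambda>Z. - Y + Z) ` ?C"
        have "convex Q" unfolding Q_def by (rule convex_translation[OF convex_ui_ball])
        have "Q \<noteq> {}" using False by (simp add: Q_def)
        have far: "e \<le> pnorm (P x)" if x: "x \<in> Q" for x
        proof -
          obtain Z where Z: "x = - Y + Z" "Z \<in> ?C" using x unfolding Q_def by (rule imageE)
          have "x = Z - Y" by (simp add: Z(1))
          then show ?thesis using e(2)[OF Z(2)] P(3)[OF H1_diff[OF CV[OF Z(2)] Y(1)]] by simp
        qed
        obtain f where f: "linear f" "\<And>x. \<bar>f x\<bar> \<le> pnorm (P x)" "\<And>x. x \<in> Q \<Longrightarrow> e \<le> f x"
          by (rule hahn_banach_convex[OF seminorm_pnorm[OF P(1,2)] \<open>convex Q\<close> \<open>Q \<noteq> {}\<close> far], assumption) (rule that)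
        have "\<bar>f Z\<bar> \<le> 1 * pnorm Z" if "Z \<in> H1_processes M F" for Z using f(2)[of Z] P(3)[OF that] by simp
        then have "f \<in> dual_functionals" unfolding dual_functionals_def using f(1) by blast
        then obtain \<phi> where \<phi>: "\<phi> \<in> H1_dual M F" "\<And>Y. Y \<in> H1_processes M F \<Longrightarrow> \<phi> (cls Y) = f Y"
          by (rule dual_functional_descends) (rule that)
        \<comment> \<open>On the ball the separating functional is at least \<open>f Y + e\<close>,
          so this open half space contains the class of \<open>Y\<close> and misses the
          ball.\<close>
        let ?U = "{C \<in> H1 M F. \<phi> C \<in> {..<f Y + e}}"
        have "openin ?T ?U" by (rule openin_weak_subbasic[OF \<phi>(1)]) simp
        moreover have "D \<in> ?U" using D e(1) \<phi>(2)[OF Y(1)] Y(2) by simp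
        moreover have "cls Z \<notin> ?U" if Z: "Z \<in> ?C" for Z
        proof -
          have "e \<le> f (- Y + Z)" by (rule f(3)) (use Z in \<open>auto simp: Q_def\<close>)
          then show ?thesis using \<phi>(2)[OF CV[OF Z]] by (simp add: linear_diff[OF f(1)])
        qed
        then have "?U \<subseteq> H1 M F - cls ` ?C" by blast
        ultimately show ?thesis by blast
      qed
    qed
  qed
qed

lemma uniformly_integrable_imp_weakly_compact:
  fixes K :: "('x, 'e::banach) process set set"
  assumes refl: "reflexive_space TYPE('e)" and K: "K \<subseteq> H1 M F"
    and ui: "uniformly_integrable M (maximal_functions K)"
  shows "relatively_weakly_compact_H1 M F K"
proof -
  have mf: "max_real Y \<in> maximal_functions K" if "Y \<in> \<Union>K" for Y
    using that unfolding maximal_functions_def max_real_def by blast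
  obtain B where B: "\<And>\<xi>. \<xi> \<in> maximal_functions K \<Longrightarrow> (\<integral>x. \<bar>\<xi> x\<bar> \<partial>M) \<le> B"
    using ui unfolding uniformly_integrable_def by blast
  \<comment> \<open>A modulus is extracted for each tolerance \<open>1 / (k + 1)\<close>. Together
    with \<open>B\<close> these place \<open>K\<close> inside the classes of one
    \<open>ui_ball\<close>, a weakly closed set, which therefore also contains the closure.\<close>
  have "\<exists>\<delta>>0. \<forall>\<xi>\<in>maximal_functions K. \<forall>A\<in>sets M. measure M A \<le> \<delta> \<longrightarrow> (LINT x:A|M. \<bar>\<xi> x\<bar>) \<le> inverse (real (Suc k))" for k
  proof -
    have "0 < inverse (real (Suc k))" by simp
    then show ?thesis using ui unfolding uniformly_integrable_def by blast
  qed
  then have "\<forall>k. \<exists>\<delta>. 0 < \<delta> \<and> (\<forall>\<xi>\<in>maximal_functions K. \<forall>A\<in>sets M. measure M A \<le> \<delta> \<longrightarrow> (LINT x:A|M. \<bar>\<xi> x\<bar>) \<le> inverse (real (Suc k)))"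
    by blast
  from choice[OF this] obtain \<delta> where "\<forall>k. 0 < \<delta> k \<and> (\<forall>\<xi>\<in>maximal_functions K. \<forall>A\<in>sets M. measure M A \<le> \<delta> k \<longrightarrow> (LINT x:A|M. \<bar>\<xi> x\<bar>) \<le> inverse (real (Suc k)))"
    by (rule exE)
  then have \<delta>: "0 < \<delta> k" and d: "\<xi> \<in> maximal_functions K \<Longrightarrow> A \<in> sets M \<Longrightarrow> measure M A \<le> \<delta> k \<Longrightarrow> (LINT x:A|M. \<bar>\<xi> x\<bar>) \<le> inverse (real (Suc k))" for k \<xi> A
    by blast+
  have abs_eq: "\<bar>max_real Y x\<bar> = max_real Y x" for Y :: "('x, 'e) process" and x by (simp add: max_real_nonneg)
  have "C \<in> cls ` ui_ball B \<delta>" if C: "C \<in> K" for C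
  proof -
    obtain Y where Y: "Y \<in> H1_processes M F" "C = cls Y" by (rule H1_cases[OF subsetD[OF K C]])
    have "Y \<in> \<Union>K" using C Y self_in_cls[OF Y(1)] by blast
    note mfY = mf[OF this]
    have "pnorm Y \<le> B" using B[OF mfY] unfolding abs_eq pnorm_def .
    moreover have "set_norm A Y \<le> inverse (real (Suc k))" if "A \<in> sets M" "measure M A \<le> \<delta> k" for A k
      using d[OF mfY that] unfolding abs_eq set_norm_def .
    ultimately have "Y \<in> ui_ball B \<delta>" using Y(1) unfolding ui_ball_def by blast
    then show ?thesis using Y(2) by blast
  qed
  then have "K \<subseteq> cls ` ui_ball B \<delta>" by blast
  then have "H1_weak_topology M F closure_of K \<subseteq> cls ` ui_ball B \<delta>"
    by (rule closure_of_minimal[OF _ closedin_ui_ball])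
  then show ?thesis
    unfolding relatively_weakly_compact_H1_def
    by (rule closed_compactin[OF compactin_ui_ball[OF refl \<delta>] _ closedin_closure_of])
qed

section \<open>Weak compactness forces uniform integrability\<close>

lemma weak_cluster_point:
  fixes K :: "('x, 'e::banach) process set set" and Y :: "nat \<Rightarrow> ('x, 'e) process"
  assumes K: "K \<subseteq> H1 M F" and comp: "relatively_weakly_compact_H1 M F K" and Y: "\<And>n. Y n \<in> \<Union>K"
  obtains N where "N \<in> H1_processes M F"
    "\<And>\<Psi> e m. finite \<Psi> \<Longrightarrow> \<Psi> \<subseteq> dual_functionals \<Longrightarrow> 0 < e \<Longrightarrow> \<exists>n\<ge>m. \<forall>\<psi>\<in>\<Psi>. \<bar>\<psi> (Y n) - \<psi> N\<bar> < e"
proof (rule ccontr)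
  assume neg: "\<not> thesis"
  note thesisI = that
  let ?T = "H1_weak_topology M F :: ('x, 'e) process set topology"
  let ?S = "?T closure_of K"
  have YH: "Y n \<in> H1_processes M F" and clsY: "cls (Y n) \<in> K" for n
  proof -
    obtain C where C: "C \<in> K" "Y n \<in> C" using Y[of n] by (rule UnionE)
    show "Y n \<in> H1_processes M F" by (rule H1_member(1)[OF subsetD[OF K C(1)] C(2)])
    show "cls (Y n) \<in> K" using H1_member(2)[OF subsetD[OF K C(1)] C(2)] C(1) by simp
  qed
  \<comment> \<open>If no class were a cluster point, each would have a weak neighbourhood that the
    sequence eventually leaves for good; finitely many of them would cover the closure of
    \<open>K\<close>, and with it the sequence.\<close>
  define \<U> where "\<U> = {U. openin ?T U \<and> eventually (\<lambda>n. cls (Y n) \<notin> U) sequentially}"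
  have nbhd: "C \<in> \<Union>\<U>" if C: "C \<in> H1 M F" for C
  proof -
    obtain N where N: "N \<in> H1_processes M F" "C = cls N" by (rule H1_cases[OF C])
    define good where "good \<Psi> e m \<longleftrightarrow> (\<exists>n\<ge>m. \<forall>\<psi>\<in>\<Psi>. \<bar>\<psi> (Y n) - \<psi> N\<bar> < e)"
      for \<Psi> :: "(('x, 'e) process \<Rightarrow> real) set" and e m
    have "\<exists>\<Psi> e m. finite \<Psi> \<and> \<Psi> \<subseteq> dual_functionals \<and> 0 < e \<and> \<not> good \<Psi> e m"
    proof (rule ccontr)
      assume *: "\<not> (\<exists>\<Psi> e m. finite \<Psi> \<and> \<Psi> \<subseteq> dual_functionals \<and> 0 < e \<and> \<not> good \<Psi> e m)"
      have "good \<Psi> e m" if "finite \<Psi>" "\<Psi> \<subseteq> dual_functionals" "0 < e" for \<Psi> e m using * that by blast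
      then have thesis unfolding good_def by (rule thesisI[OF N(1)])
      with neg show False by contradiction
    qed
    then obtain \<Psi> e m where \<Psi>: "finite \<Psi>" "\<Psi> \<subseteq> dual_functionals" "0 < e" "\<not> good \<Psi> e m" by blast
    have "\<exists>\<phi>. \<phi> \<in> H1_dual M F \<and> (\<forall>Y\<in>H1_processes M F. \<phi> (cls Y) = \<psi> Y)" if \<psi>: "\<psi> \<in> \<Psi>" for \<psi>
    proof -
      obtain \<phi> where "\<phi> \<in> H1_dual M F" "\<And>Y. Y \<in> H1_processes M F \<Longrightarrow> \<phi> (cls Y) = \<psi> Y"
        by (rule dual_functional_descends[OF subsetD[OF \<Psi>(2) \<psi>]]) (rule that)
      then show ?thesis by (intro exI[of _ \<phi>]) simp
    qed
    then have "\<forall>\<psi>\<in>\<Psi>. \<exists>\<phi>. \<phi> \<in> H1_dual M F \<and> (\<forall>Y\<in>H1_processes M F. \<phi> (cls Y) = \<psi> Y)" by (rule ballI)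
    from bchoice[OF this] obtain g
      where g: "\<forall>\<psi>\<in>\<Psi>. g \<psi> \<in> H1_dual M F \<and> (\<forall>Y\<in>H1_processes M F. g \<psi> (cls Y) = \<psi> Y)" by (rule exE)
    \<comment> \<open>The intersection with the whole space takes care of an empty family of
      functionals.\<close>
    define U where "U = (\<Inter>\<psi>\<in>\<Psi>. {C \<in> H1 M F. g \<psi> C \<in> ball (\<psi> N) e}) \<inter> topspace ?T"
    have "openin ?T U"
      unfolding U_def
    proof (rule openin_INT[OF \<Psi>(1)])
      fix \<psi> assume "\<psi> \<in> \<Psi>"
      then have "g \<psi> \<in> H1_dual M F" using g by blast
      then show "openin ?T {C \<in> H1 M F. g \<psi> C \<in> ball (\<psi> N) e}" by (rule openin_weak_subbasic) simp
    qed
    moreover have "C \<in> U" using C g N \<Psi>(3) by (auto simp: U_def topspace_H1_weak_topology)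
    moreover have "cls (Y n) \<notin> U" if mn: "m \<le> n" for n
    proof
      assume *: "cls (Y n) \<in> U"
      have "\<bar>\<psi> (Y n) - \<psi> N\<bar> < e" if \<psi>: "\<psi> \<in> \<Psi>" for \<psi>
      proof -
        have "g \<psi> (cls (Y n)) \<in> ball (\<psi> N) e" using * \<psi> unfolding U_def by simp
        moreover have "g \<psi> (cls (Y n)) = \<psi> (Y n)" using g \<psi> YH by blast
        ultimately show ?thesis by (simp add: dist_real_def abs_minus_commute)
      qed
      then show False using \<Psi>(4) mn unfolding good_def by blast
    qed
    then have "eventually (\<lambda>n. cls (Y n) \<notin> U) sequentially" by (rule eventually_sequentiallyI)
    ultimately show ?thesis unfolding \<U>_def by blast
  qed
  have comp': "compactin ?T ?S" using comp unfolding relatively_weakly_compact_H1_def .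
  have "?S \<subseteq> H1 M F" using closure_of_subset_topspace[of ?T K] by (simp only: topspace_H1_weak_topology)
  then have "?S \<subseteq> \<Union>\<U>" using nbhd by blast
  then obtain \<F> where \<F>: "finite \<F>" "\<F> \<subseteq> \<U>" "?S \<subseteq> \<Union>\<F>"
    using compactinD[OF comp', of \<U>] unfolding \<U>_def by blast
  have "eventually (\<lambda>n. \<forall>U\<in>\<F>. cls (Y n) \<notin> U) sequentially"
    by (rule eventually_ball_finite[OF \<F>(1)]) (use \<F>(2) in \<open>auto simp: \<U>_def\<close>)
  then obtain n where n: "\<forall>U\<in>\<F>. cls (Y n) \<notin> U" by (auto simp: eventually_sequentially)
  have "K \<subseteq> ?S" by (rule closure_of_subset) (use K in \<open>simp add: topspace_H1_weak_topology\<close>)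
  then have "cls (Y n) \<in> \<Union>\<F>" using clsY \<F>(3) by blast
  then show False using n by blast
qed

text \<open>Absolute convergence is asked for at every \<open>Z\<close> of the type, also outside
  \<open>H1_processes\<close>, because members of \<open>dual_functionals\<close> are linear
  everywhere.\<close>

lemma suminf_dual_functional:
  fixes \<psi> :: "nat \<Rightarrow> ('x, 'e::banach) process \<Rightarrow> real"
  assumes lin: "\<And>n. linear (\<psi> n)" and summable: "\<And>Z. summable (\<lambda>n. \<bar>\<psi> n Z\<bar>)"
    and bound: "\<And>Z. Z \<in> H1_processes M F \<Longrightarrow> (\<Sum>n. \<bar>\<psi> n Z\<bar>) \<le> C * pnorm Z"
  shows "(\<lambda>Z. \<Sum>n. \<psi> n Z) \<in> dual_functionals"
proof -
  have s: "summable (\<lambda>n. \<psi> n Z)" for Z by (rule summable_rabs_cancel[OF summable])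
  have "linear (\<lambda>Z. \<Sum>n. \<psi> n Z)"
    by (rule linearI) (simp_all add: linear_add[OF lin] linear_scale[OF lin] suminf_add[OF s s] suminf_mult[OF s])
  moreover have "\<bar>\<Sum>n. \<psi> n Z\<bar> \<le> C * pnorm Z" if "Z \<in> H1_processes M F" for Z
    using summable_rabs[OF summable[of Z]] bound[OF that] by linarith
  ultimately show ?thesis unfolding dual_functionals_def by blast
qed

lemma Union_subset_H1_processes:
  fixes K :: "('x, 'e::banach) process set set"
  assumes "K \<subseteq> H1 M F" "Y \<in> \<Union>K"
  shows "Y \<in> H1_processes M F"
proof -
  obtain C where C: "C \<in> K" "Y \<in> C" using assms(2) by (rule UnionE)
  show ?thesis by (rule H1_member(1)[OF subsetD[OF assms(1) C(1)] C(2)])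
qed

text \<open>The localised norm as majorant in the Hahn-Banach theorem produces functionals
  concentrated on the \<open>A n\<close>; for disjoint events they can be summed without loss of
  boundedness.\<close>

lemma norming_functionals:
  fixes Y :: "nat \<Rightarrow> ('x, 'e::banach) process"
  assumes Y: "\<And>n. Y n \<in> H1_processes M F" and A: "\<And>n. A n \<in> sets M"
  obtains P \<psi> where "\<And>Z. P Z \<in> H1_processes M F" "\<And>Z. Z \<in> H1_processes M F \<Longrightarrow> P Z = Z"
    "\<And>n. linear (\<psi> n)" "\<And>n Z. \<bar>\<psi> n Z\<bar> \<le> set_norm (A n) (P Z)" "\<And>n. \<psi> n (Y n) = set_norm (A n) (Y n)"
proof -
  obtain P :: "('x, 'e) process \<Rightarrow> ('x, 'e) process"
    where P: "linear P" "\<And>Y. P Y \<in> H1_processes M F" "\<And>Y. Y \<in> H1_processes M F \<Longrightarrow> P Y = Y"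
    by (rule H1_projection) (rule that)
  have "\<exists>f. linear f \<and> (\<forall>Z. \<bar>f Z\<bar> \<le> set_norm (A n) (P Z)) \<and> f (Y n) = set_norm (A n) (Y n)" for n
  proof -
    obtain f where "linear f" "\<And>Z. \<bar>f Z\<bar> \<le> set_norm (A n) (P Z)" "f (Y n) = set_norm (A n) (P (Y n))"
      by (rule hahn_banach_norming[OF seminorm_set_norm[OF P(1,2) A[of n]], where z = "Y n"]) (rule that)
    then show ?thesis by (intro exI[of _ f]) (simp add: P(3)[OF Y])
  qed
  from choice[OF allI, OF this] obtain \<psi> where
    \<psi>: "\<forall>n. linear (\<psi> n) \<and> (\<forall>Z. \<bar>\<psi> n Z\<bar> \<le> set_norm (A n) (P Z)) \<and> \<psi> n (Y n) = set_norm (A n) (Y n)"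
    by (rule exE)
  show thesis by (rule that[of P \<psi>]) (use P \<psi> in blast)+
qed

text \<open>A gliding hump: the signs \<open>s\<close> prevent cancellation among the first terms, and the weights
  \<open>(1/3)^n\<close> make each term dominate all later ones.\<close>

lemma weakly_compact_imp_bounded:
  fixes K :: "('x, 'e::banach) process set set"
  assumes K: "K \<subseteq> H1 M F" and comp: "relatively_weakly_compact_H1 M F K"
  obtains B where "\<And>Y. Y \<in> \<Union>K \<Longrightarrow> pnorm Y \<le> B"
proof (rule ccontr)
  assume neg: "\<not> thesis"
  note thesisI = that
  \<comment> \<open>The threshold is tuned to the weights: after multiplication by
    \<open>(1/3)^n\<close> and the loss of one half, the remainder still exceeds
    \<open>n\<close>.\<close>
  have "\<exists>Y. Y \<in> \<Union>K \<and> 2 * real n * 3 ^ n < pnorm Y" for n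
  proof (rule ccontr)
    assume *: "\<not> (\<exists>Y. Y \<in> \<Union>K \<and> 2 * real n * 3 ^ n < pnorm Y)"
    have "pnorm Y \<le> 2 * real n * 3 ^ n" if "Y \<in> \<Union>K" for Y using * that not_less by blast
    then have thesis by (rule thesisI)
    with neg show False by contradiction
  qed
  from choice[OF allI, OF this] obtain Y where Y: "\<forall>n. Y n \<in> \<Union>K \<and> 2 * real n * 3 ^ n < pnorm (Y n)" by (rule exE)
  then have YK: "Y n \<in> \<Union>K" and big: "2 * real n * 3 ^ n < pnorm (Y n)" for n by simp_all
  have YH: "Y n \<in> H1_processes M F" for n by (rule Union_subset_H1_processes[OF K YK])
  obtain P \<psi> where P: "\<And>Z. P Z \<in> H1_processes M F" "\<And>Z. Z \<in> H1_processes M F \<Longrightarrow> P Z = Z"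
    and lin: "\<And>n. linear (\<psi> n)" and le: "\<And>n Z. \<bar>\<psi> n Z\<bar> \<le> set_norm (space M) (P Z)"
    and at: "\<And>n. \<psi> n (Y n) = set_norm (space M) (Y n)"
    by (rule norming_functionals[of Y "\<lambda>_. space M", OF YH sets.top]) (rule that)
  have le: "\<bar>\<psi> n Z\<bar> \<le> pnorm (P Z)" for n Z using le[of n Z] pnorm_eq_set_norm[OF P(1)[of Z]] by simp
  have at: "\<psi> n (Y n) = pnorm (Y n)" for n using at[of n] pnorm_eq_set_norm[OF YH[of n]] by simp
  define S where "S s n = (\<Sum>j<n. s j * (1/3)^j * \<psi> j (Y n))" for s :: "nat \<Rightarrow> real" and n
  \<comment> \<open>The new sign follows that of the earlier terms evaluated at \<open>Y n\<close>,
    so the partial sum is in absolute value at least the new term.\<close>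
  have "\<exists>s. \<forall>n. \<bar>s n\<bar> = 1 \<and> (1/3)^n * pnorm (Y n) \<le> \<bar>S s n + s n * (1/3)^n * pnorm (Y n)\<bar>"
  proof (rule dependent_wellorder_choice[where P = "\<lambda>s n r. \<bar>r\<bar> = (1::real) \<and> (1/3)^n * pnorm (Y n) \<le> \<bar>S s n + r * (1/3)^n * pnorm (Y n)\<bar>"])
    fix r :: real and f g :: "nat \<Rightarrow> real" and n :: nat assume "\<And>y. y < n \<Longrightarrow> f y = g y"
    then have "S f n = S g n" unfolding S_def by (intro sum.cong) auto
    then show "(\<bar>r\<bar> = 1 \<and> (1/3)^n * pnorm (Y n) \<le> \<bar>S f n + r * (1/3)^n * pnorm (Y n)\<bar>)
      = (\<bar>r\<bar> = 1 \<and> (1/3)^n * pnorm (Y n) \<le> \<bar>S g n + r * (1/3)^n * pnorm (Y n)\<bar>)" by simp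
  next
    fix n and f :: "nat \<Rightarrow> real"
    have nn: "0 \<le> (1/3)^n * pnorm (Y n)" by (simp add: pnorm_nonneg)
    show "\<exists>r. \<bar>r\<bar> = 1 \<and> (1/3)^n * pnorm (Y n) \<le> \<bar>S f n + r * (1/3)^n * pnorm (Y n)\<bar>"
    proof (cases "0 \<le> S f n")
      case True then show ?thesis using nn by (intro exI[of _ 1]) auto
    next
      case False then show ?thesis using nn by (intro exI[of _ "-1"]) auto
    qed
  qed
  then obtain s where s: "\<And>n. \<bar>s n\<bar> = 1" "\<And>n. (1/3)^n * pnorm (Y n) \<le> \<bar>S s n + s n * (1/3)^n * pnorm (Y n)\<bar>"
    by blast
  define \<phi> where "\<phi> n Z = s n * (1/3)^n * \<psi> n Z" for n Z
  define \<Phi> where "\<Phi> Z = (\<Sum>n. \<phi> n Z)" for Z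
  have \<phi>_le: "\<bar>\<phi> n Z\<bar> \<le> (1/3)^n * pnorm (P Z)" for n Z
    using mult_left_mono[OF le[of n Z], of "(1/3)^n"] by (simp add: \<phi>_def abs_mult s(1))
  have geo: "summable (\<lambda>n. (1/3::real)^n)" by (rule summable_geometric) simp
  have geo': "summable (\<lambda>n. (1/3)^n * pnorm (P Z))" for Z by (rule summable_mult2[OF geo])
  have geo_sum: "(\<Sum>n. (1/3::real)^n) = 3/2" using suminf_geometric[of "1/3::real"] by simp
  have sm: "summable (\<lambda>n. \<bar>\<phi> n Z\<bar>)" for Z
    by (rule summable_comparison_test'[OF geo'[of Z], of 0]) (use \<phi>_le in simp)
  have "\<Phi> \<in> dual_functionals"
    unfolding \<Phi>_def
  proof (rule suminf_dual_functional[where C = "3/2"])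
    show "linear (\<phi> n)" for n
      by (rule linearI) (simp_all add: \<phi>_def linear_add[OF lin] linear_scale[OF lin] algebra_simps)
    fix Z :: "('x, 'e) process" assume Z: "Z \<in> H1_processes M F"
    have "(\<Sum>n. \<bar>\<phi> n Z\<bar>) \<le> (\<Sum>n. (1/3)^n * pnorm (P Z))" by (rule suminf_le[OF \<phi>_le sm geo'])
    also have "\<dots> = 3/2 * pnorm Z" using suminf_mult2[OF geo, of "pnorm (P Z)"] geo_sum P(2)[OF Z] by simp
    finally show "(\<Sum>n. \<bar>\<phi> n Z\<bar>) \<le> 3/2 * pnorm Z" .
  qed (rule sm)
  have large: "real n \<le> \<bar>\<Phi> (Y n)\<bar>" for n
  proof -
    have PY: "P (Y n) = Y n" by (rule P(2)[OF YH])
    have "\<Phi> (Y n) = (\<Sum>j. \<phi> (j + Suc n) (Y n)) + (\<Sum>j<Suc n. \<phi> j (Y n))"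
      unfolding \<Phi>_def by (rule suminf_split_initial_segment[OF summable_rabs_cancel[OF sm]])
    moreover have "(\<Sum>j<Suc n. \<phi> j (Y n)) = S s n + s n * (1/3)^n * pnorm (Y n)"
      by (simp add: S_def \<phi>_def at)
    \<comment> \<open>The weights after \<open>n\<close> add up to \<open>3/2 * (1/3)^Suc n\<close>,
      one half of \<open>(1/3)^n\<close>, so the tail cancels at most half of the new term.\<close>
    moreover have "\<bar>\<Sum>j. \<phi> (j + Suc n) (Y n)\<bar> \<le> 1/2 * ((1/3)^n * pnorm (Y n))"
    proof -
      have sm': "summable (\<lambda>j. \<bar>\<phi> (j + Suc n) (Y n)\<bar>)" by (rule summable_ignore_initial_segment[OF sm])
      have "\<bar>\<Sum>j. \<phi> (j + Suc n) (Y n)\<bar> \<le> (\<Sum>j. \<bar>\<phi> (j + Suc n) (Y n)\<bar>)" by (rule summable_rabs[OF sm'])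
      also have "\<dots> \<le> (\<Sum>j. (1/3)^j * ((1/3)^Suc n * pnorm (Y n)))"
        by (rule suminf_le[OF _ sm' summable_mult2[OF geo]])
           (use \<phi>_le[of "_ + Suc n" "Y n"] in \<open>simp add: PY power_add mult_ac\<close>)
      also have "\<dots> = 3/2 * ((1/3)^Suc n * pnorm (Y n))" by (simp only: suminf_mult2[OF geo, symmetric] geo_sum)
      also have "\<dots> = 1/2 * ((1/3)^n * pnorm (Y n))" by simp
      finally show ?thesis .
    qed
    moreover have "real n \<le> 1/2 * ((1/3)^n * pnorm (Y n))"
      using big[of n] by (simp add: power_one_over field_simps)
    ultimately show ?thesis using s(2)[of n] by argo
  qed
  \<comment> \<open>The values \<open>\<Phi> (Y n)\<close> grow beyond all bounds, whereas a weak
    cluster point keeps infinitely many of them near \<open>\<Phi> N\<close>.\<close>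
  obtain N where "N \<in> H1_processes M F"
    and N: "\<And>\<Psi> e m. finite \<Psi> \<Longrightarrow> \<Psi> \<subseteq> dual_functionals \<Longrightarrow> 0 < e \<Longrightarrow> \<exists>n\<ge>m. \<forall>\<psi>\<in>\<Psi>. \<bar>\<psi> (Y n) - \<psi> N\<bar> < e"
    by (rule weak_cluster_point[OF K comp YK]) (rule that)
  obtain m :: nat where m: "\<bar>\<Phi> N\<bar> + 1 < real m" by (rule exE[OF reals_Archimedean2])
  have "\<exists>n\<ge>m. \<forall>\<psi>\<in>{\<Phi>}. \<bar>\<psi> (Y n) - \<psi> N\<bar> < 1" by (rule N) (simp_all add: \<open>\<Phi> \<in> dual_functionals\<close>)
  then obtain n where n: "m \<le> n" "\<bar>\<Phi> (Y n) - \<Phi> N\<bar> < 1" by (auto simp del: One_nat_def)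
  show False using large[of n] n m by linarith
qed

lemma set_norm_mono:
  fixes Y :: "('x, 'e::banach) process"
  assumes Y: "Y \<in> H1_processes M F" and AB: "A \<in> sets M" "B \<in> sets M" "A \<subseteq> B"
  shows "set_norm A Y \<le> set_norm B Y"
  unfolding set_norm_def set_lebesgue_integral_def
proof (rule integral_mono)
  show "integrable M (\<lambda>x. indicat_real A x *\<^sub>R max_real Y x)" "integrable M (\<lambda>x. indicat_real B x *\<^sub>R max_real Y x)"
    by (rule integrable_mult_indicator[OF _ H1_max_real_integrable[OF Y]], fact)+
  show "indicat_real A x *\<^sub>R max_real Y x \<le> indicat_real B x *\<^sub>R max_real Y x" for x
    using AB(3) by (auto simp: indicator_def max_real_nonneg)
qed

lemma set_norm_Un_le:
  fixes Y :: "('x, 'e::banach) process"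
  assumes Y: "Y \<in> H1_processes M F" and AB: "A \<in> sets M" "B \<in> sets M" "C \<in> sets M" "C \<subseteq> A \<union> B"
  shows "set_norm C Y \<le> set_norm A Y + set_norm B Y"
proof -
  have int: "integrable M (\<lambda>x. indicat_real S x *\<^sub>R max_real Y x)" if "S \<in> sets M" for S
    by (rule integrable_mult_indicator[OF that H1_max_real_integrable[OF Y]])
  have "set_norm C Y \<le> (\<integral>x. indicat_real A x *\<^sub>R max_real Y x + indicat_real B x *\<^sub>R max_real Y x \<partial>M)"
    unfolding set_norm_def set_lebesgue_integral_def
  proof (rule integral_mono[OF int[OF AB(3)] Bochner_Integration.integrable_add[OF int[OF AB(1)] int[OF AB(2)]]])
    show "indicat_real C x *\<^sub>R max_real Y x \<le> indicat_real A x *\<^sub>R max_real Y x + indicat_real B x *\<^sub>R max_real Y x" for x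
      using AB(4) by (auto simp: indicator_def max_real_nonneg)
  qed
  also have "\<dots> = set_norm A Y + set_norm B Y"
    unfolding set_norm_def set_lebesgue_integral_def
    by (rule Bochner_Integration.integral_add[OF int[OF AB(1)] int[OF AB(2)]])
  finally show ?thesis .
qed

lemma set_norm_disjoint:
  fixes Y :: "('x, 'e::banach) process" and B :: "nat \<Rightarrow> 'x set"
  assumes Y: "Y \<in> H1_processes M F" and B: "\<And>n. B n \<in> sets M" "disjoint_family B"
    and C: "C \<in> sets M" "\<And>n. B n \<subseteq> C"
  shows "summable (\<lambda>n. set_norm (B n) Y)" "(\<Sum>n. set_norm (B n) Y) \<le> set_norm C Y"
proof -
  have part: "(\<Sum>i<n. set_norm (B i) Y) \<le> set_norm C Y" for n
  proof -
    have "(\<Sum>i<n. set_norm (B i) Y) = set_norm (\<Union>i<n. B i) Y"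
      unfolding set_norm_def
    proof (rule set_integral_finite_Union[symmetric])
      show "disjoint_family_on B {..<n}" by (rule disjoint_family_on_mono[OF subset_UNIV B(2)])
      show "set_integrable M (B i) (max_real Y)" for i
        by (rule set_integrable_of_integrable[OF H1_max_real_integrable[OF Y] B(1)])
    qed (use B(1) in auto)
    also have "\<dots> \<le> set_norm C Y" by (rule set_norm_mono[OF Y _ C(1)]) (use B(1) C(2) in auto)
    finally show ?thesis .
  qed
  show s: "summable (\<lambda>n. set_norm (B n) Y)" by (rule summableI_nonneg_bounded[OF set_norm_nonneg part])
  show "(\<Sum>n. set_norm (B n) Y) \<le> set_norm C Y" by (rule suminf_le_const[OF s part])
qed

text \<open>Each step fixes \<open>d n\<close> so that events of measure at most \<open>d n\<close>
  carry at most \<open>\<epsilon> / 8\<close> of the maximal function of \<open>Y n\<close>. Later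
  sets \<open>A m\<close> are so small that their union \<open>R n\<close> has measure at most
  \<open>d n\<close>; removing it from \<open>A n\<close> will make the sets disjoint at little
  cost.\<close>

lemma not_uniform_imp_almost_disjoint:
  fixes S :: "('x, 'e::banach) process set"
  assumes S: "S \<subseteq> H1_processes M F" and e: "0 < \<epsilon>"
    and neg: "\<And>\<delta>. 0 < \<delta> \<Longrightarrow> \<exists>Y\<in>S. \<exists>A\<in>sets M. measure M A \<le> \<delta> \<and> \<epsilon> < set_norm A Y"
  obtains Y :: "nat \<Rightarrow> ('x, 'e) process" and A R where "\<And>n. Y n \<in> S" "\<And>n. A n \<in> sets M" "\<And>n. R n \<in> sets M"
    "\<And>n. \<epsilon> < set_norm (A n) (Y n)" "\<And>n. set_norm (R n) (Y n) \<le> \<epsilon> / 8"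
    "\<And>m n. n < m \<Longrightarrow> A m \<subseteq> R n" "\<And>\<eta>. 0 < \<eta> \<Longrightarrow> \<exists>n. measure M (R n) \<le> \<eta>"
proof -
  \<comment> \<open>The state consists of the process, its large event and the tolerance that limits
    the measure of the next event.\<close>
  define good where "good x \<longleftrightarrow> (case x of (Y, A, d) \<Rightarrow> Y \<in> S \<and> A \<in> sets M \<and> \<epsilon> < set_norm A Y \<and> 0 < d \<and>
      (\<forall>A'\<in>sets M. measure M A' \<le> d \<longrightarrow> set_norm A' Y \<le> \<epsilon> / 8))" for x :: "('x, 'e) process \<times> 'x set \<times> real"
  have step: "\<exists>y. good y \<and> measure M (fst (snd y)) \<le> d / 2 \<and> snd (snd y) \<le> d / 2" if "0 < d" for d
  proof -
    have "0 < d / 2" using that by simp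
    then obtain Y A where YA: "Y \<in> S" "A \<in> sets M" "measure M A \<le> d / 2" "\<epsilon> < set_norm A Y" using neg by blast
    have YH: "Y \<in> H1_processes M F" using YA(1) S by blast
    have "0 < \<epsilon> / 8" using e by simp
    obtain d' where d'_pos: "0 < d'" and d': "\<And>A. A \<in> sets M \<Longrightarrow> measure M A \<le> d' \<Longrightarrow> (LINT x:A|M. max_real Y x) \<le> \<epsilon> / 8"
      by (rule integral_small_on_small_sets[OF H1_max_real_integrable[OF YH] max_real_nonneg \<open>0 < \<epsilon> / 8\<close>]) (rule that)
    have "good (Y, A, min d' (d / 2))" using YA d'_pos d'[folded set_norm_def] that unfolding good_def by simp
    then show ?thesis using YA(3) by (intro exI[of _ "(Y, A, min d' (d / 2))"]) simp
  qed
  have "\<exists>z. \<forall>n. good (z n) \<and> (measure M (fst (snd (z (Suc n)))) \<le> snd (snd (z n)) / 2 \<and> snd (snd (z (Suc n))) \<le> snd (snd (z n)) / 2)"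
  proof (rule dependent_nat_choice[where P = "\<lambda>_. good" and
      Q = "\<lambda>_ x y. measure M (fst (snd y)) \<le> snd (snd x) / 2 \<and> snd (snd y) \<le> snd (snd x) / 2"])
    show "\<exists>x. good x" using step[of 1] by auto
    fix x :: "('x, 'e) process \<times> 'x set \<times> real" assume "good x"
    then have "0 < snd (snd x)" by (auto simp: good_def split: prod.splits)
    from step[OF this]
    show "\<exists>y. good y \<and> measure M (fst (snd y)) \<le> snd (snd x) / 2 \<and> snd (snd y) \<le> snd (snd x) / 2" .
  qed
  then obtain z where zz: "\<forall>n. good (z n) \<and> (measure M (fst (snd (z (Suc n)))) \<le> snd (snd (z n)) / 2 \<and> snd (snd (z (Suc n))) \<le> snd (snd (z n)) / 2)"
    by (rule exE)
  have z: "good (z n)" and z2: "measure M (fst (snd (z (Suc n)))) \<le> snd (snd (z n)) / 2"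
      "snd (snd (z (Suc n))) \<le> snd (snd (z n)) / 2" for n
    using spec[OF zz, of n] by simp_all
  define Y where "Y n = fst (z n)" for n
  define A where "A n = fst (snd (z n))" for n
  define d where "d n = snd (snd (z n))" for n
  define R where "R n = (\<Union>k. A (Suc n + k))" for n
  have zn: "Y n \<in> S \<and> A n \<in> sets M \<and> \<epsilon> < set_norm (A n) (Y n) \<and> 0 < d n \<and>
      (\<forall>A'\<in>sets M. measure M A' \<le> d n \<longrightarrow> set_norm A' (Y n) \<le> \<epsilon> / 8)" for n
    using z[of n] unfolding good_def Y_def A_def d_def by (simp add: case_prod_beta)
  have R: "R n \<in> sets M" for n unfolding R_def using zn by auto
  have dk: "d (n + k) \<le> d n * (1/2)^k" for n k
  proof (induction k)
    case (Suc k)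
    have "d (n + Suc k) \<le> d (n + k) / 2" using z2(2)[of "n + k"] by (simp add: d_def)
    then show ?case using Suc by simp
  qed simp
  have mA: "measure M (A (Suc n + k)) \<le> d n * (1/2)^Suc k" for n k
    using z2(1)[of "n + k"] dk[of n k] by (simp add: A_def d_def)
  \<comment> \<open>The tolerances at least halve in each step, so the measures of the events after
    \<open>n\<close> add up to at most \<open>d n\<close>.\<close>
  have half: "(\<lambda>k. d n * (1/2)^Suc k) sums d n" for n
    using sums_mult[OF power_half_series, of "d n"] by simp
  have mR: "measure M (R n) \<le> d n" for n
  proof -
    have sm: "summable (\<lambda>k. measure M (A (Suc n + k)))"
      by (rule summable_comparison_test'[OF sums_summable[OF half[of n]], of 0]) (use mA[of n] in simp)
    have "measure M (R n) \<le> (\<Sum>k. measure M (A (Suc n + k)))"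
      unfolding R_def by (rule finite_measure_subadditive_countably) (use zn sm in auto)
    also have "\<dots> \<le> d n"
      using suminf_le[OF mA[of n] sm sums_summable[OF half]] sums_unique[OF half[of n]] by simp
    finally show ?thesis .
  qed
  show thesis
  proof (rule that[of Y A R])
    show "set_norm (R n) (Y n) \<le> \<epsilon> / 8" for n using zn[of n] R[of n] mR[of n] by blast
    show "A m \<subseteq> R n" if "n < m" for m n
    proof -
      have "m = Suc n + (m - Suc n)" using that by simp
      then show ?thesis unfolding R_def by (metis UNIV_I UN_upper)
    qed
    show "\<exists>n. measure M (R n) \<le> \<eta>" if \<eta>: "0 < \<eta>" for \<eta>
    proof -
      have d0: "0 < d 0" using zn by blast
      obtain n where n: "(1/2::real)^n < \<eta> / d 0" using real_arch_pow_inv[of "\<eta> / d 0" "1/2"] \<eta> d0 by auto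
      have "measure M (R n) \<le> d 0 * (1/2)^n" using mR[of n] dk[of 0 n] by simp
      also have "\<dots> \<le> \<eta>" using n d0 by (simp add: field_simps)
      finally show ?thesis by blast
    qed
  qed (use zn R in blast)+
qed

text \<open>Two cluster points are needed. The subsequence \<open>\<kappa>\<close> is selected with
  reference to a cluster point \<open>N\<close> of the whole sequence, but need not accumulate at
  \<open>N\<close>. Its own cluster point \<open>N'\<close> has the same values under all
  \<open>l (\<kappa> j)\<close>, so \<open>\<Lambda>\<close> cannot tell \<open>N'\<close> from
  \<open>N\<close>, although it stays \<open>\<epsilon> / 2\<close> above \<open>\<Lambda> N\<close>
  along the subsequence.\<close>

lemma weakly_compact_imp_uniform:
  fixes K :: "('x, 'e::banach) process set set"
  assumes K: "K \<subseteq> H1 M F" and comp: "relatively_weakly_compact_H1 M F K" and e: "0 < \<epsilon>"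
  shows "\<exists>\<delta>>0. \<forall>Y\<in>\<Union>K. \<forall>A\<in>sets M. measure M A \<le> \<delta> \<longrightarrow> set_norm A Y \<le> \<epsilon>"
proof (rule ccontr)
  assume neg: "\<not> (\<exists>\<delta>>0. \<forall>Y\<in>\<Union>K. \<forall>A\<in>sets M. measure M A \<le> \<delta> \<longrightarrow> set_norm A Y \<le> \<epsilon>)"
  have neg': "\<exists>Y\<in>\<Union>K. \<exists>A\<in>sets M. measure M A \<le> \<delta> \<and> \<epsilon> < set_norm A Y" if "0 < \<delta>" for \<delta>
    using neg that not_less by blast
  have sub: "\<Union>K \<subseteq> H1_processes M F" using Union_subset_H1_processes[OF K] by (rule subsetI)
  obtain Y :: "nat \<Rightarrow> ('x, 'e) process" and A R
    where YK: "\<And>n. Y n \<in> \<Union>K" and A: "\<And>n. A n \<in> sets M" and R: "\<And>n. R n \<in> sets M"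
      and big: "\<And>n. \<epsilon> < set_norm (A n) (Y n)" and small: "\<And>n. set_norm (R n) (Y n) \<le> \<epsilon> / 8"
      and AR: "\<And>m n. n < m \<Longrightarrow> A m \<subseteq> R n" and R0: "\<And>\<eta>. 0 < \<eta> \<Longrightarrow> \<exists>n. measure M (R n) \<le> \<eta>"
    by (rule not_uniform_imp_almost_disjoint[OF sub e neg'], assumption) (rule that)
  have YH: "Y n \<in> H1_processes M F" for n using YK sub by blast
  \<comment> \<open>For the maximal function of \<open>Y n\<close>, passing from \<open>A n\<close>
    to \<open>B n\<close> loses at most \<open>\<epsilon> / 8\<close>, and \<open>B n\<close> is
    disjoint from all later sets, since these lie in \<open>R n\<close>.\<close>
  define B where "B n = A n - R n" for n
  have B: "B n \<in> sets M" for n unfolding B_def using A R by blast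
  have BR: "B m \<subseteq> R n" if "n < m" for m n using AR[OF that] unfolding B_def by blast
  have Bdisj: "B m \<inter> B n = {}" if "m \<noteq> n" for m n
  proof (cases "m < n")
    case True then show ?thesis using BR[OF True] unfolding B_def by blast
  next
    case False
    then have "n < m" using that by simp
    then show ?thesis using BR[of n m] unfolding B_def by blast
  qed
  have bigB: "7 / 8 * \<epsilon> < set_norm (B n) (Y n)" for n
  proof -
    have "set_norm (A n) (Y n) \<le> set_norm (B n) (Y n) + set_norm (R n) (Y n)"
      by (rule set_norm_Un_le[OF YH B R A]) (auto simp: B_def)
    then show ?thesis using big[of n] small[of n] by argo
  qed
  obtain P l where P: "\<And>Z. P Z \<in> H1_processes M F" "\<And>Z. Z \<in> H1_processes M F \<Longrightarrow> P Z = Z"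
    and lin: "\<And>n. linear (l n)" and le: "\<And>n Z. \<bar>l n Z\<bar> \<le> set_norm (B n) (P Z)"
    and at: "\<And>n. l n (Y n) = set_norm (B n) (Y n)"
    by (rule norming_functionals[of Y B, OF YH B]) (rule that)
  have le': "\<bar>l n Z\<bar> \<le> set_norm (B n) Z" if "Z \<in> H1_processes M F" for n Z using le[of n Z] P(2)[OF that] by simp
  have l_dual: "l n \<in> dual_functionals" for n
  proof -
    have "\<bar>l n Z\<bar> \<le> 1 * pnorm Z" if "Z \<in> H1_processes M F" for Z
      using le'[OF that, of n] set_norm_le_pnorm[OF that, of "B n"] by simp
    then show ?thesis unfolding dual_functionals_def using lin by blast
  qed
  obtain N where N: "N \<in> H1_processes M F"
    and clN: "\<And>\<Psi> e m. finite \<Psi> \<Longrightarrow> \<Psi> \<subseteq> dual_functionals \<Longrightarrow> 0 < e \<Longrightarrow> \<exists>n\<ge>m. \<forall>\<psi>\<in>\<Psi>. \<bar>\<psi> (Y n) - \<psi> N\<bar> < e"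
    by (rule weak_cluster_point[OF K comp YK]) (rule that)
  have e8: "0 < \<epsilon> / 8" using e by simp
  obtain \<eta> where \<eta>: "0 < \<eta>" "\<And>A. A \<in> sets M \<Longrightarrow> measure M A \<le> \<eta> \<Longrightarrow> (LINT x:A|M. max_real N x) \<le> \<epsilon> / 8"
    by (rule integral_small_on_small_sets[OF H1_max_real_integrable[OF N] max_real_nonneg e8]) (rule that)
  obtain n0 where "measure M (R n0) \<le> \<eta>" using R0[OF \<eta>(1)] by blast
  from \<eta>(2)[OF R this] have n0: "set_norm (R n0) N \<le> \<epsilon> / 8" unfolding set_norm_def .
  \<comment> \<open>Two demands: \<open>n0 < \<kappa> k\<close> puts all selected sets into
    \<open>R n0\<close>, where \<open>N\<close> has mass at most \<open>\<epsilon> / 8\<close>, and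
    the tolerance keeps the \<open>k\<close> earlier differences together below
    \<open>\<epsilon> / 8\<close>.\<close>
  define Pr where "Pr \<kappa> k r \<longleftrightarrow> n0 < r \<and> (\<forall>j<k. \<kappa> j < r \<and> \<bar>l (\<kappa> j) (Y r) - l (\<kappa> j) N\<bar> < \<epsilon> / (8 * real (Suc k)))"
    for \<kappa> :: "nat \<Rightarrow> nat" and k r
  have "\<exists>\<kappa>. \<forall>k. Pr \<kappa> k (\<kappa> k)"
  proof (rule dependent_wellorder_choice)
    fix r k :: nat and f g :: "nat \<Rightarrow> nat" assume "\<And>y. y < k \<Longrightarrow> f y = g y"
    then show "Pr f k r = Pr g k r" unfolding Pr_def by auto
  next
    fix k :: nat and \<kappa> :: "nat \<Rightarrow> nat"
    have "\<exists>n\<ge>n0 + Suc (\<Sum>j<k. \<kappa> j). \<forall>\<psi>\<in>(\<lambda>j. l (\<kappa> j)) ` {..<k}. \<bar>\<psi> (Y n) - \<psi> N\<bar> < \<epsilon> / (8 * real (Suc k))"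
      by (rule clN) (use l_dual e in auto)
    then obtain r where r: "n0 + Suc (\<Sum>j<k. \<kappa> j) \<le> r" "\<And>j. j < k \<Longrightarrow> \<bar>l (\<kappa> j) (Y r) - l (\<kappa> j) N\<bar> < \<epsilon> / (8 * real (Suc k))"
      by blast
    have "\<kappa> j < r" if "j < k" for j
    proof -
      have "\<kappa> j \<le> (\<Sum>j<k. \<kappa> j)" by (rule member_le_sum) (use that in auto)
      then show ?thesis using r(1) by linarith
    qed
    then show "\<exists>r. Pr \<kappa> k r" unfolding Pr_def using r by (intro exI[of _ r]) auto
  qed
  then obtain \<kappa> where \<kappa>: "\<And>k. Pr \<kappa> k (\<kappa> k)" by blast
  have \<kappa>_n0: "n0 < \<kappa> k" and \<kappa>_less: "j < k \<Longrightarrow> \<kappa> j < \<kappa> k"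
    and close: "j < k \<Longrightarrow> \<bar>l (\<kappa> j) (Y (\<kappa> k)) - l (\<kappa> j) N\<bar> < \<epsilon> / (8 * real (Suc k))" for j k
    using \<kappa>[of k] unfolding Pr_def by blast+
  have \<kappa>_neq: "\<kappa> i \<noteq> \<kappa> j" if "i \<noteq> j" for i j
    using \<kappa>_less[of i j] \<kappa>_less[of j i] that by (cases "i < j") auto
  have disj: "disjoint_family (\<lambda>j. B (\<kappa> (j + i)))" for i
    unfolding disjoint_family_on_def using Bdisj \<kappa>_neq by simp
  \<comment> \<open>Disjointness bounds a whole series of functionals by the mass on any event
    containing their sets: some \<open>R n\<close> for the tails, the whole space for
    boundedness.\<close>
  have sums: "summable (\<lambda>j. \<bar>l (\<kappa> (j + i)) Z\<bar>)" "\<bar>\<Sum>j. l (\<kappa> (j + i)) Z\<bar> \<le> set_norm C Z"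
      "(\<Sum>j. \<bar>l (\<kappa> (j + i)) Z\<bar>) \<le> set_norm C Z"
    if Z: "Z \<in> H1_processes M F" and C: "C \<in> sets M" "\<And>j. B (\<kappa> (j + i)) \<subseteq> C" for i Z C
  proof -
    have d: "summable (\<lambda>j. set_norm (B (\<kappa> (j + i))) Z)" "(\<Sum>j. set_norm (B (\<kappa> (j + i))) Z) \<le> set_norm C Z"
      by (rule set_norm_disjoint[OF Z B disj C])+
    show s: "summable (\<lambda>j. \<bar>l (\<kappa> (j + i)) Z\<bar>)"
      by (rule summable_comparison_test'[OF d(1), of 0]) (use le'[OF Z] in simp)
    show b: "(\<Sum>j. \<bar>l (\<kappa> (j + i)) Z\<bar>) \<le> set_norm C Z"
      using suminf_le[OF le'[OF Z] s d(1)] d(2) by simp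
    show "\<bar>\<Sum>j. l (\<kappa> (j + i)) Z\<bar> \<le> set_norm C Z" using summable_rabs[OF s] b by simp
  qed
  define \<Lambda> where "\<Lambda> Z = (\<Sum>j. l (\<kappa> j) Z)" for Z
  have \<Lambda>_dual: "\<Lambda> \<in> dual_functionals"
    unfolding \<Lambda>_def
  proof (rule suminf_dual_functional[where C = 1])
    show "summable (\<lambda>j. \<bar>l (\<kappa> j) Z\<bar>)" for Z
    proof (rule summable_comparison_test'[of _ 0])
      show "summable (\<lambda>j. set_norm (B (\<kappa> j)) (P Z))"
        using set_norm_disjoint(1)[OF P(1) B disj[of 0] sets.top sets.sets_into_space[OF B]] by simp
    qed (use le in simp)
    fix Z :: "('x, 'e) process" assume Z: "Z \<in> H1_processes M F"
    have "(\<Sum>j. \<bar>l (\<kappa> (j + 0)) Z\<bar>) \<le> set_norm (space M) Z"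
      by (rule sums(3)[OF Z sets.top sets.sets_into_space[OF B]])
    then show "(\<Sum>j. \<bar>l (\<kappa> j) Z\<bar>) \<le> 1 * pnorm Z" by (simp add: pnorm_eq_set_norm[OF Z])
  qed (rule lin)
  have split: "\<Lambda> Z = (\<Sum>j. l (\<kappa> (j + i)) Z) + (\<Sum>j<i. l (\<kappa> j) Z)" if Z: "Z \<in> H1_processes M F" for Z i
  proof -
    have "summable (\<lambda>j. \<bar>l (\<kappa> (j + 0)) Z\<bar>)" by (rule sums(1)[OF Z sets.top sets.sets_into_space[OF B]])
    then have "summable (\<lambda>j. \<bar>l (\<kappa> j) Z\<bar>)" by simp
    from suminf_split_initial_segment[OF summable_rabs_cancel[OF this], of i] show ?thesis unfolding \<Lambda>_def .
  qed
  \<comment> \<open>The main term exceeds \<open>7 / 8 * \<epsilon>\<close>; the earlier terms, the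
    tail at \<open>Y (\<kappa> k)\<close> after \<open>k\<close>, and the tail at \<open>N\<close>
    with its \<open>k\<close>-th term included cost at most \<open>\<epsilon> / 8\<close>
    each.\<close>
  have gap: "\<epsilon> / 2 \<le> \<Lambda> (Y (\<kappa> k)) - \<Lambda> N" for k
  proof -
    let ?Y = "Y (\<kappa> k)"
    have "(\<Sum>j<k. l (\<kappa> j) N) - (\<Sum>j<k. l (\<kappa> j) ?Y) \<le> (\<Sum>j<k. \<epsilon> / (8 * real (Suc k)))"
      unfolding sum_subtractf[symmetric]
    proof (rule sum_mono)
      fix j assume "j \<in> {..<k}"
      then show "l (\<kappa> j) N - l (\<kappa> j) ?Y \<le> \<epsilon> / (8 * real (Suc k))" using close[of j k] by (simp add: abs_less_iff)
    qed
    moreover have "(\<Sum>j<k. \<epsilon> / (8 * real (Suc k))) \<le> \<epsilon> / 8"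
      using e by (simp add: field_simps)
    moreover have "\<bar>\<Sum>j. l (\<kappa> (j + Suc k)) ?Y\<bar> \<le> \<epsilon> / 8"
      by (rule order_trans[OF sums(2)[OF YH R] small]) (rule BR[OF \<kappa>_less], simp)
    moreover have "\<bar>\<Sum>j. l (\<kappa> (j + k)) N\<bar> \<le> \<epsilon> / 8"
      by (rule order_trans[OF sums(2)[OF N R] n0]) (rule BR[OF \<kappa>_n0])
    moreover have "7 / 8 * \<epsilon> < l (\<kappa> k) ?Y" using bigB at by simp
    moreover have "\<Lambda> ?Y = (\<Sum>j. l (\<kappa> (j + Suc k)) ?Y) + ((\<Sum>j<k. l (\<kappa> j) ?Y) + l (\<kappa> k) ?Y)"
      using split[OF YH, of "\<kappa> k" "Suc k"] by simp
    moreover have "\<Lambda> N = (\<Sum>j. l (\<kappa> (j + k)) N) + (\<Sum>j<k. l (\<kappa> j) N)" by (rule split[OF N])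
    ultimately show ?thesis unfolding abs_le_iff by linarith
  qed
  obtain N' where N': "N' \<in> H1_processes M F"
    and clN': "\<And>\<Psi> e m. finite \<Psi> \<Longrightarrow> \<Psi> \<subseteq> dual_functionals \<Longrightarrow> 0 < e \<Longrightarrow> \<exists>k\<ge>m. \<forall>\<psi>\<in>\<Psi>. \<bar>\<psi> (Y (\<kappa> k)) - \<psi> N'\<bar> < e"
    by (rule weak_cluster_point[where Y = "\<lambda>k. Y (\<kappa> k)", OF K comp YK]) (rule that)
  \<comment> \<open>Along the subsequence the values of \<open>l (\<kappa> j)\<close> converge to
    the one at \<open>N\<close>, with error below \<open>\<epsilon> / (8 * (k + 1))\<close>, while
    they accumulate at the one at \<open>N'\<close>.\<close>
  have "l (\<kappa> j) N' = l (\<kappa> j) N" for j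
  proof (rule ccontr)
    assume ne: "l (\<kappa> j) N' \<noteq> l (\<kappa> j) N"
    define t where "t = \<bar>l (\<kappa> j) N' - l (\<kappa> j) N\<bar> / 2"
    have t: "0 < t" using ne by (simp add: t_def)
    obtain m where m: "\<epsilon> / (8 * t) < real m" by (rule exE[OF reals_Archimedean2])
    have "\<exists>k\<ge>m + Suc j. \<forall>\<psi>\<in>{l (\<kappa> j)}. \<bar>\<psi> (Y (\<kappa> k)) - \<psi> N'\<bar> < t" by (rule clN') (use l_dual t in auto)
    then obtain k where k: "m + Suc j \<le> k" "\<bar>l (\<kappa> j) (Y (\<kappa> k)) - l (\<kappa> j) N'\<bar> < t" by auto
    have "\<epsilon> / (8 * t) < real (Suc k)" using m k(1) by linarith
    then have "\<epsilon> / (8 * real (Suc k)) < t" using t by (simp add: field_simps)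
    moreover have "\<bar>l (\<kappa> j) (Y (\<kappa> k)) - l (\<kappa> j) N\<bar> < \<epsilon> / (8 * real (Suc k))" by (rule close) (use k(1) in simp)
    ultimately show False using k(2) unfolding t_def by argo
  qed
  then have eq: "\<Lambda> N' = \<Lambda> N" by (simp add: \<Lambda>_def)
  have "\<exists>k\<ge>0. \<forall>\<psi>\<in>{\<Lambda>}. \<bar>\<psi> (Y (\<kappa> k)) - \<psi> N'\<bar> < \<epsilon> / 2" by (rule clN') (use \<Lambda>_dual e in auto)
  then obtain k where "\<bar>\<Lambda> (Y (\<kappa> k)) - \<Lambda> N'\<bar> < \<epsilon> / 2" by auto
  then show False using gap[of k] eq by linarith
qed

lemma weakly_compact_imp_uniformly_integrable:
  fixes K :: "('x, 'e::banach) process set set"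
  assumes K: "K \<subseteq> H1 M F" and comp: "relatively_weakly_compact_H1 M F K"
  shows "uniformly_integrable M (maximal_functions K)"
proof -
  obtain B where B: "\<And>Y. Y \<in> \<Union>K \<Longrightarrow> pnorm Y \<le> B" by (rule weakly_compact_imp_bounded[OF K comp]) (rule that)
  have mf: "maximal_functions K = max_real ` (\<Union>K)" unfolding maximal_functions_def max_real_def by blast
  have abs_eq: "\<bar>max_real Y x\<bar> = max_real Y x" for Y :: "('x, 'e) process" and x by (simp add: max_real_nonneg)
  have img: "(\<forall>\<xi>\<in>max_real ` S. Q \<xi>) \<longleftrightarrow> (\<forall>Y\<in>S. Q (max_real Y))" for S :: "('x, 'e) process set" and Q by simp
  show ?thesis
    unfolding uniformly_integrable_def mf img abs_eq set_norm_def[symmetric] pnorm_def[symmetric]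
  proof (intro conjI ballI allI impI)
    show "integrable M (max_real Y)" if "Y \<in> \<Union>K" for Y
      by (rule H1_max_real_integrable[OF Union_subset_H1_processes[OF K that]])
    show "\<exists>B. \<forall>Y\<in>\<Union>K. pnorm Y \<le> B" using B by blast
    show "\<exists>\<delta>>0. \<forall>Y\<in>\<Union>K. \<forall>A\<in>sets M. measure M A \<le> \<delta> \<longrightarrow> set_norm A Y \<le> \<epsilon>" if "0 < \<epsilon>" for \<epsilon>
      by (rule weakly_compact_imp_uniform[OF K comp that])
  qed
qed

end

theorem proposition1:
  fixes M :: "'x measure" and F :: "real \<Rightarrow> 'x measure"
    and K :: "('x, 'e::banach) process set set"
  assumes "stochastic_basis M F"
    and "reflexive_space TYPE('e)"
    and "K \<subseteq> H1 M F"
  shows "relatively_weakly_compact_H1 M F K \<longleftrightarrow> uniformly_integrable M (maximal_functions K)"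
  using stochastic_basis.weakly_compact_imp_uniformly_integrable[OF assms(1,3)]
    stochastic_basis.uniformly_integrable_imp_weakly_compact[OF assms] by blast

end
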